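(* Let $\partial\Omega$ be a surface and $\Psi=(\Psi^{\partial\Omega},\tilde\Psi^{\partial\Omega})$ a wavelet basis on it as described in the context, where $\tilde d\in\mathbb N$ denotes the order of vanishing moments of the dual system. Let $k\in\{1,2,\ldots,\tilde d\}$, $\rho\in(0,k)$, and let $(s,p,p)$ be an admissible tuple of parameters with $s>0$. Let $S$ be an operator and $g:\partial\Omega\to\mathbb C$ a right-hand side, and let $u:\partial\Omega\to\mathbb C$ be a solution of $S(u)=g$ on $\partial\Omega$. If $u$ is contained in $B^s_{\Psi,p}(L_p(\partial\Omega))\cap X^k_\rho(\partial\Omega)$, then $u$ also belongs to $B^\alpha_{\Psi,\tau}(L_\tau(\partial\Omega))$ for all tuples $(\alpha,\tau,\tau)$ with $$\frac1\tau=\frac\alpha2+\frac12\quad\text{and}\quad0\le\alpha<2\alpha^*,\quad\text{where}\quad\alpha^*=\min\left\{\rho,\;k-\rho,\;s-\left(\frac1p-\frac12\right)\right\}.$$ Moreover, for every $0\le s'<\min\{3/2,s_{\partial\Omega}\}$ satisfying $$s-s'\ge2\left(\frac1p-\frac12\right)$$ we have $\sigma_n(u;\Psi^{\partial\Omega},H^{s'}(\partial\Omega))\lesssim n^{-\gamma/2}$, as $n\to\infty$, for all $\gamma<\gamma^*$, where $$\gamma^*:=s-s'+\Theta\cdot(2\alpha^*-s)\ge0\quad\text{and}\quad\Theta:=1-\frac{s'}{s-2(1/p-1/2)}\in[0,1],$$ with the convention $0/0:=0$.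
   Context: Notation: $a\lesssim b$ means $a\le c\,b$ with a constant $c>0$ independent of the context-dependent parameters (here: of $n$); $a\sim b$ means $a\lesssim b$ and $b\lesssim a$. $\mathrm{dist}(M_1,M_2)$ is the shortest distance between the sets $M_1,M_2$ along their common superset ($\partial\Omega$ or an affine plane). Surface. $\Omega\subset\mathbb R^3$ is a bounded, simply connected, closed polyhedron with finitely many flat quadrilateral sides and straight edges, and $\partial\Omega$ is Lipschitz. Write $\partial\Omega=\bigcup_{i=1}^I\overline{F_i}$, where each open patch $F_i$ is a subset of an affine plane, bounded by a closed polygonal chain connecting exactly four vertices of $\Omega$ (not necessarily convex); $\overline{F_i}\cap\overline{F_\ell}$, $i\ne\ell$, is empty, a common edge, or a common vertex. There are sufficiently smooth diffeomorphic parametrizations $\kappa_i:[0,1]^2\to\overline{F_i}$. $C^\infty_{\mathrm{pw}}(\partial\Omega)$ is the set of globally continuous $u:\partial\Omega\to\mathbb C$ with $u|_{\overline{F_i}}\in C^\infty(\overline{F_i})$ for all $i$. Let $\nu_1,\dots,\nu_N$ be the vertices of $\Omega$. The tangent cone $\mathcal C_n$ consists of $\nu_n$ and all $x\in\mathbb R^3$ such that $\{\nu_n+\gamma(x-\nu_n):\gamma\in[0,c)\}\subset\Omega$ for some $c>0$. Its boundary is the essentially disjoint union $\partial\mathcal C_n=\bigcup_{t=1}^{T_n}\overline{\Gamma^{n,t}}$ of closures of open plane sectors (faces) $\Gamma^{n,t}$. $i(n,t)$ is the unique patch index with $\nu_n\in\overline{F_{i(n,t)}}$ and $F_{i(n,t)}\cap\Gamma^{n,t}\neq\emptyset$.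 With $\gamma_{n,t}$ the opening angle, let $\tilde\Gamma^{n,t}=\{(r\cos\phi,r\sin\phi):r\in(0,\infty),\phi\in(0,\gamma_{n,t})\}\subset\mathbb R^2$ and let $R_{n,t}$ be the distance-preserving map of the closure of $\tilde\Gamma^{n,t}$ onto $\overline{\Gamma^{n,t}}$ taking $0$ to $\nu_n$. For $f_n:\partial\mathcal C_n\to\mathbb C$ put $f_{n,t}:=f_n|_{\overline{\Gamma^{n,t}}}\circ R_{n,t}$. $C^\infty_{0,\mathrm{fw}}(\partial\mathcal C_n)$ is the set of continuous compactly supported $f_n$ with every $f_{n,t}$ being $C^\infty$ on the closure of $\tilde\Gamma^{n,t}$. Resolution of unity. Fixed are non-negative $\varphi_1,\dots,\varphi_N\in C^\infty_{\mathrm{pw}}(\partial\Omega)$ with $\sum_n\varphi_n=1$ on $\partial\Omega$ and open neighborhoods $\nu_n\in\mathcal U_{n,0}\subsetneq\mathcal U_{n,1}\subsetneq\partial\Omega$ with $\varphi_n=1$ on $\mathcal U_{n,0}$, $\varphi_n=0$ on $\partial\Omega\setminus\mathcal U_{n,1}$, such that for some small constant $C_1>0$: $\mathrm{dist}(\mathcal U_{n,1},F_\ell)\ge C_1$ for all $\ell$ with $\nu_n\notin\overline{F_\ell}$, and $\min_t\mathrm{dist}(\mathcal U_{n,1}\cap\Gamma^{n,t},F_{i(n,t)}\setminus\Gamma^{n,t})\ge C_1$. Weighted Sobolev spaces. With $q(\phi):=\min\{\phi,\gamma_{n,t}-\phi\}$, for compactly supported $f_n$ let $$\|f_n\mid X^k_\rho(\partial\mathcal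 C_n)\|:=\|f_n\mid L_2(\partial\mathcal C_n)\|+\sum_{t=1}^{T_n}\sum_{\substack{\beta=(\beta_r,\beta_\phi)\in\mathbb N_0^2\\1\le|\beta|\le k}}\left\|r^{-\rho}(1+r)^\rho(qr)^{\beta_r}\left(\tfrac{\partial}{\partial r}\right)^{\beta_r}q^{\beta_\phi-\rho}\left(\tfrac{\partial}{\partial\phi}\right)^{\beta_\phi}f_{n,t}\ \Big|\ L_2(\tilde\Gamma^{n,t})\right\|$$ ($f_{n,t}$ in polar coordinates); $X^k_\rho(\partial\mathcal C_n)$ is the closure of $C^\infty_{0,\mathrm{fw}}(\partial\mathcal C_n)$ in this norm. For $k\in\mathbb N$, $0\le\rho\le k$, $X^k_\rho(\partial\Omega)$ is the closure of $C^\infty_{\mathrm{pw}}(\partial\Omega)$ in the norm $\|u\mid X^k_\rho(\partial\Omega)\|:=\sum_{n=1}^N\|\varphi_nu\mid X^k_\rho(\partial\mathcal C_n)\|$. Wavelet basis. $\langle u,v\rangle:=\sum_{i=1}^I\langle u\circ\kappa_i,v\circ\kappa_i\rangle_\square$, with $\langle\cdot,\cdot\rangle_\square$ the $L_2([0,1]^2)$ inner product; the induced norm is equivalent to that of $L_2(\partial\Omega)$. $\Psi=(\Psi^{\partial\Omega},\tilde\Psi^{\partial\Omega})$ is a fixed pair of $\langle\cdot,\cdot\rangle$-biorthogonal Riesz bases of $L_2(\partial\Omega)$, consisting of finitely many generators on the coarsest level $j^*-1$ and of wavelets $\psi^{\partial\Omega}_{j,\xi}$ resp. $\tilde\psi^{\partial\Omega}_{j,\xi}$,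 $j\ge j^*$, $\xi\in\nabla_j^{\partial\Omega}$; every $u\in L_2(\partial\Omega)$ has the unique expansion $u=P_{j^*-1}(u)+\sum_{j\ge j^*}\sum_{\xi\in\nabla_j^{\partial\Omega}}\langle u,\tilde\psi_{j,\xi}^{\partial\Omega}\rangle\psi_{j,\xi}^{\partial\Omega}$, where $P_{j^*-1}$ is the biorthogonal projector onto the span of the primal generators, and $\|u\mid L_2(\partial\Omega)\|\sim\|P_{j^*-1}(u)\mid L_2(\partial\Omega)\|+(\sum_{j,\xi}|\langle u,\tilde\psi_{j,\xi}^{\partial\Omega}\rangle|^2)^{1/2}$. Assumed are: (I) the index sets consist of grid points on $\partial\Omega$, $\nabla_j^{\partial\Omega}=\bigcup_{i=1}^I\nabla_j^{F_i}$ with $\#\nabla_j^{F_i}\sim2^{2j}$ (grid points belonging to $\overline{F_i}$); (II) $\|\tilde\psi_{j,\xi}^{\partial\Omega}\mid L_2(\partial\Omega)\|\sim1$; (III) $\tilde\psi_{j,\xi}^{\partial\Omega}$ has compact support containing $\xi$ with $|\mathrm{supp}\,\tilde\psi_{j,\xi}^{\partial\Omega}|\sim2^{-2j}$; (IV) vanishing moments of order $\tilde d\in\mathbb N$: $\langle\mathcal P,\tilde\psi_{j,\xi}^{\partial\Omega}\circ\kappa_i\rangle_\square=0$ for all polynomials $\mathcal P$ on $[0,1]^2$ of total degree $<\tilde d$ whenever $\tilde\psi_{j,\xi}^{\partial\Omega}$ is completely supported in the interior of a patch $F_i$; (V) $\#\{\xi\in\nabla_j^{\partial\Omega}:0<\mathrm{dist}(\mathrm{supp}\,\tilde\psi_{j,\xi}^{\partial\Omega},\bigcup_i\partial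 F_i)\lesssim2^{-j}\}\sim2^j$ and $\#\{\xi\in\nabla_j^{\partial\Omega}:\mathrm{supp}\,\tilde\psi_{j,\xi}^{\partial\Omega}\cap\bigcup_i\partial F_i\ne\emptyset\}\lesssim2^j$; (VI) $\#\{\xi\in\nabla_j^{\partial\Omega}:x\in\mathrm{supp}\,\tilde\psi_{j,\xi}^{\partial\Omega}\}\lesssim1$ for all $j\ge j^*$, $x\in\partial\Omega$; (VII) for $-\frac12<s<\min\{\frac32,s_{\partial\Omega}\}$, where $s_{\partial\Omega}\ge1$ depends only on the angles between patches, $\|u\mid H^s(\partial\Omega)\|\sim\|P_{j^*-1}(u)\mid L_2(\partial\Omega)\|+(\sum_{j\ge j^*}\sum_{\xi\in\nabla_j^{\partial\Omega}}2^{2sj}|\langle u,\tilde\psi_{j,\xi}^{\partial\Omega}\rangle|^2)^{1/2}$ ($H^s$ for negative $s$ defined by duality). Besov-type spaces. A tuple of real parameters $(\alpha,p,q)$ is admissible if $\frac12\le\frac1p\le\frac\alpha2+\frac12$ and $0<q\le2$ if $1/p=\alpha/2+1/2$, $0<q\le\infty$ otherwise. For admissible $(\alpha,p,q)$, $B^\alpha_{\Psi,q}(L_p(\partial\Omega))$ is the set of $u\in L_2(\partial\Omega)$ with $$\|u\mid B^\alpha_{\Psi,q}(L_p(\partial\Omega))\|:=\|P_{j^*-1}(u)\mid L_p(\partial\Omega)\|+\left(\sum_{j\ge j^*}2^{j(\alpha+2[\frac12-\frac1p])q}\left[\sum_{\xi\in\nabla_j^{\partial\Omega}}|\langle u,\tilde\psi_{j,\xi}^{\partial\Omega}\rangle|^p\right]^{q/p}\right)^{1/q}<\infty$$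 (supremum over $j$ if $q=\infty$). Best $n$-term approximation. For a (quasi-)normed space $G$, a countable subset $\mathcal B=\{f_1,f_2,\dots\}\subset G$ and $f\in G$, $\sigma_n(f;\mathcal B,G):=\inf_{i_1,\dots,i_n\in\mathbb N}\inf_{c_1,\dots,c_n\in\mathbb C}\|f-\sum_{m=1}^nc_mf_{i_m}\mid G\|$. As dictionary, $\Psi^{\partial\Omega}$ denotes the system of all primal generators and primal wavelets.
   Formalization: Assumption (III) is strengthened: besides area ~2^{-2j}, the support of each dual wavelet is assumed to have diameter at most a constant times 2^{-j}; with the area condition alone, scattered supports make the claim false. *)

theory Defs
  imports "HOL-Analysis.Analysis"
begin

section \<open>Smoothness up to the boundary\<close>

text \<open>\<open>Ck_on m U f\<close> is meant for open \<open>U\<close>.\<close>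

primrec Ck_on :: "nat \<Rightarrow> 'a::euclidean_space set \<Rightarrow> ('a \<Rightarrow> 'b::real_normed_vector) \<Rightarrow> bool" where
  "Ck_on 0 U f \<longleftrightarrow> continuous_on U f"
| "Ck_on (Suc m) U f \<longleftrightarrow>
     (\<exists>D. (\<forall>x\<in>U. (f has_derivative D x) (at x)) \<and> (\<forall>b\<in>Basis. Ck_on m U (\<lambda>x. D x b)))"

text \<open>On a set that is not open, such as a closed patch of a plane in space, regularity means that
  the function is the restriction of a regular function on an open neighbourhood.\<close>

definition Ck_up_to :: "nat \<Rightarrow> 'a::euclidean_space set \<Rightarrow> ('a \<Rightarrow> 'b::real_normed_vector) \<Rightarrow> bool" where
  "Ck_up_to m A f \<longleftrightarrow> (\<exists>U g. open U \<and> A \<subseteq> U \<and> Ck_on m U g \<and> (\<forall>x\<in>A. g x = f x))"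

definition smooth_up_to :: "'a::euclidean_space set \<Rightarrow> ('a \<Rightarrow> 'b::real_normed_vector) \<Rightarrow> bool" where
  "smooth_up_to A f \<longleftrightarrow> (\<exists>U g. open U \<and> A \<subseteq> U \<and> (\<forall>m. Ck_on m U g) \<and> (\<forall>x\<in>A. g x = f x))"

definition Ck_diffeo :: "nat \<Rightarrow> 'a::euclidean_space set \<Rightarrow> 'b::euclidean_space set \<Rightarrow> ('a \<Rightarrow> 'b) \<Rightarrow> bool" where
  "Ck_diffeo m A B f \<longleftrightarrow> bij_betw f A B \<and> Ck_up_to m A f \<and> Ck_up_to m B (inv_into A f)"


section \<open>Extended norms and intrinsic distances\<close>

text \<open>All norms take values in \<open>[0,\<infinity>]\<close>, the value \<open>\<infinity>\<close> marking functions outside the space.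
  Only exponents \<open>a > 0\<close> are used.\<close>

definition epowr :: "ennreal \<Rightarrow> real \<Rightarrow> ennreal" where
  "epowr x a = (if x = \<infinity> then \<infinity> else ennreal (enn2real x powr a))"

definition Lp_norm :: "'a measure \<Rightarrow> real \<Rightarrow> ('a \<Rightarrow> 'b::real_normed_vector) \<Rightarrow> ennreal" where
  "Lp_norm M p f = epowr (\<integral>\<^sup>+ x. ennreal (norm (f x) powr p) \<partial>M) (1 / p)"

definition slobodeckij_seminorm ::
    "'a::metric_space measure \<Rightarrow> real \<Rightarrow> ('a \<Rightarrow> 'b::real_normed_vector) \<Rightarrow> ennreal" where
  \<comment> \<open>for two-dimensional domains: the exponent is \<open>dimension + 2s\<close>\<close>
  "slobodeckij_seminorm M s f =
     epowr (\<integral>\<^sup>+ x. (\<integral>\<^sup>+ y. ennreal ((norm (f x - f y))\<^sup>2 / dist x y powr (2 + 2 * s)) \<partial>M) \<partial>M) (1 / 2)"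

definition curve_length :: "(real \<Rightarrow> 'a::metric_space) \<Rightarrow> ennreal" where
  "curve_length g =
     (SUP ts\<in>{ts. sorted ts \<and> set ts \<subseteq> {0..1}}.
        \<Sum>i<length ts - 1. ennreal (dist (g (ts ! i)) (g (ts ! Suc i))))"

text \<open>The shortest distance along a common superset \<open>X\<close>. It is \<open>\<infinity>\<close> if one of the sets is empty or
  if they lie in different components of \<open>X\<close>.\<close>

definition dist_along ::
    "'a::real_normed_vector set \<Rightarrow> 'a set \<Rightarrow> 'a set \<Rightarrow> ennreal" where
  "dist_along X A B =
     (INF g\<in>{g. path g \<and> path_image g \<subseteq> X \<and> pathstart g \<in> A \<and> pathfinish g \<in> B}. curve_length g)"


section \<open>Polyhedral surfaces\<close>

type_synonym point = "real ^ 3"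

text \<open>A patchwise flat surface. Indices \<open>i\<close> of patches, \<open>n\<close> of vertices, \<open>t\<close> of faces of the tangent
  cone at the \<open>n\<close>-th vertex, and \<open>a\<close> of the four corners of a patch all start with \<open>0\<close>.\<close>

record surface =
  Omega :: "point set"
  num_patches :: nat
  patch :: "nat \<Rightarrow> point set"
  corner :: "nat \<Rightarrow> nat \<Rightarrow> point"
  kappa :: "nat \<Rightarrow> real \<times> real \<Rightarrow> point"
  num_vertices :: nat
  vertex :: "nat \<Rightarrow> point"
  num_faces :: "nat \<Rightarrow> nat"
  opening_angle :: "nat \<Rightarrow> nat \<Rightarrow> real"
  face_chart :: "nat \<Rightarrow> nat \<Rightarrow> real \<times> real \<Rightarrow> point"

abbreviation bd :: "surface \<Rightarrow> point set" where
  "bd S \<equiv> frontier (Omega S)"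

abbreviation unit_square :: "(real \<times> real) set" where
  "unit_square \<equiv> {0..1} \<times> {0..1}"

text \<open>Locally, and up to a rigid motion, the closed set \<open>D\<close> is the epigraph of a Lipschitz function
  on the plane orthogonal to a unit vector \<open>e\<close>.\<close>

definition lipschitz_boundary :: "point set \<Rightarrow> bool" where
  "lipschitz_boundary D \<longleftrightarrow>
     (\<forall>x\<in>frontier D. \<exists>e r h L. \<exists>g :: point \<Rightarrow> real.
        norm e = 1 \<and> r > 0 \<and> h > 0 \<and> L-lipschitz_on {y. y \<bullet> e = 0} g \<and>
        (\<forall>y t. y \<bullet> e = 0 \<and> norm y < r \<and> \<bar>t\<bar> < h \<longrightarrow>
           (x + y + t *\<^sub>R e \<in> D \<longleftrightarrow> g y \<le> t)))"

definition edge :: "(nat \<Rightarrow> point) \<Rightarrow> nat \<Rightarrow> point set" where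
  "edge c a = closed_segment (c a) (c (Suc a mod 4))"

text \<open>A bounded, relatively open subset of a plane whose relative boundary is a simple closed polygonal
  chain with four corners; by the Jordan curve theorem it is the region enclosed by the chain.\<close>

definition open_quadrilateral :: "point set \<Rightarrow> (nat \<Rightarrow> point) \<Rightarrow> bool" where
  "open_quadrilateral F c \<longleftrightarrow>
     (\<exists>A. affine A \<and> aff_dim A = 2 \<and> openin (top_of_set A) F) \<and>
     F \<noteq> {} \<and> bounded F \<and>
     simple_path (linepath (c 0) (c 1) +++ linepath (c 1) (c 2) +++
                  linepath (c 2) (c 3) +++ linepath (c 3) (c 0)) \<and>
     closure F - F = (\<Union>a<4. edge c a)"

definition tangent_cone :: "point set \<Rightarrow> point \<Rightarrow> point set" where
  "tangent_cone D v =
     insert v {x. \<exists>c>0. (\<lambda>g. v + g *\<^sub>R (x - v)) ` {0..<c} \<subseteq> D}"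

definition sector :: "real \<Rightarrow> (real \<times> real) set" where
  "sector \<omega> = {(r * cos \<phi>, r * sin \<phi>) | r \<phi>. 0 < r \<and> 0 < \<phi> \<and> \<phi> < \<omega>}"

definition face :: "surface \<Rightarrow> nat \<Rightarrow> nat \<Rightarrow> point set" where
  "face S n t = face_chart S n t ` sector (opening_angle S n t)"

abbreviation meets_face :: "surface \<Rightarrow> nat \<Rightarrow> nat \<Rightarrow> nat \<Rightarrow> bool" where
  "meets_face S n t i \<equiv>
     i < num_patches S \<and> vertex S n \<in> closure (patch S i) \<and> patch S i \<inter> face S n t \<noteq> {}"

definition patch_of_face :: "surface \<Rightarrow> nat \<Rightarrow> nat \<Rightarrow> nat" where
  "patch_of_face S n t = (THE i. meets_face S n t i)"

text \<open>The parameter \<open>m\<close> is the order of smoothness of the parametrizations of the patches.\<close>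

definition polyhedral_surface :: "nat \<Rightarrow> surface \<Rightarrow> bool" where
  "polyhedral_surface m S \<longleftrightarrow>
     Omega S \<noteq> {} \<and> compact (Omega S) \<and> simply_connected (Omega S) \<and> lipschitz_boundary (Omega S) \<and>
     bd S = (\<Union>i<num_patches S. closure (patch S i)) \<and>
     (\<forall>i<num_patches S.
        open_quadrilateral (patch S i) (corner S i) \<and>
        Ck_diffeo m unit_square (closure (patch S i)) (kappa S i)) \<and>
     (\<forall>i<num_patches S. \<forall>l<num_patches S. i \<noteq> l \<longrightarrow>
        (let J = closure (patch S i) \<inter> closure (patch S l) in
           J = {} \<or>
           (\<exists>a<4. \<exists>b<4. J = edge (corner S i) a \<and> J = edge (corner S l) b) \<or>
           (\<exists>a<4. \<exists>b<4. J = {corner S i a} \<and> J = {corner S l b}))) \<and>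
     bij_betw (vertex S) {..<num_vertices S} {corner S i a | i a. i < num_patches S \<and> a < 4} \<and>
     (\<forall>n<num_vertices S.
        (\<forall>t<num_faces S n.
           0 < opening_angle S n t \<and> opening_angle S n t < 2 * pi \<and>
           (\<forall>x\<in>closure (sector (opening_angle S n t)).
              \<forall>y\<in>closure (sector (opening_angle S n t)).
                dist (face_chart S n t x) (face_chart S n t y) = dist x y) \<and>
           face_chart S n t (0, 0) = vertex S n \<and>
           (\<exists>!i. meets_face S n t i)) \<and>
        disjoint_family_on (face S n) {..<num_faces S n} \<and>
        frontier (tangent_cone (Omega S) (vertex S n)) = (\<Union>t<num_faces S n. closure (face S n t)))"

text \<open>Functions on the surface are represented by functions on the whole space, whose values off the
  surface are irrelevant.\<close>

definition C_pw :: "surface \<Rightarrow> (point \<Rightarrow> complex) set" where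
  "C_pw S = {u. continuous_on (bd S) u \<and> (\<forall>i<num_patches S. smooth_up_to (closure (patch S i)) u)}"


subsection \<open>Surface measure\<close>

definition plane_chart :: "point set \<Rightarrow> real \<times> real \<Rightarrow> point" where
  "plane_chart F = (SOME E. (\<forall>x y. dist (E x) (E y) = dist x y) \<and> F \<subseteq> range E)"

text \<open>The area measure on the Borel subsets of the surface: on each patch, planar Lebesgue measure
  transported by an isometry; edges are null sets.\<close>

definition surface_measure :: "surface \<Rightarrow> point measure" where
  "surface_measure S =
     measure_of (bd S) {A. A \<in> sets borel \<and> A \<subseteq> bd S}
       (\<lambda>A. \<Sum>i<num_patches S. emeasure lborel (plane_chart (patch S i) -` (A \<inter> patch S i)))"

definition L2_surface :: "surface \<Rightarrow> (point \<Rightarrow> complex) set" where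
  "L2_surface S = {u \<in> borel_measurable (surface_measure S). Lp_norm (surface_measure S) 2 u < \<infinity>}"

definition inner_square :: "(real \<times> real \<Rightarrow> complex) \<Rightarrow> (real \<times> real \<Rightarrow> complex) \<Rightarrow> complex" where
  "inner_square f g = (LINT x:unit_square|lborel. f x * cnj (g x))"

definition inner_surface :: "surface \<Rightarrow> (point \<Rightarrow> complex) \<Rightarrow> (point \<Rightarrow> complex) \<Rightarrow> complex" where
  "inner_surface S u v = (\<Sum>i<num_patches S. inner_square (u \<circ> kappa S i) (v \<circ> kappa S i))"


subsection \<open>Sobolev spaces of order less than 3/2\<close>

definition weak_partial ::
    "(real \<times> real) set \<Rightarrow> real \<times> real \<Rightarrow> (real \<times> real \<Rightarrow> complex) \<Rightarrow> (real \<times> real \<Rightarrow> complex) \<Rightarrow> bool" where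
  "weak_partial D b w g \<longleftrightarrow>
     (\<forall>\<theta> :: real \<times> real \<Rightarrow> real.
        (\<forall>m. Ck_on m UNIV \<theta>) \<and> compact (closure {x. \<theta> x \<noteq> 0}) \<and> closure {x. \<theta> x \<noteq> 0} \<subseteq> D \<longrightarrow>
        (LINT x:D|lborel. frechet_derivative \<theta> (at x) b *\<^sub>R w x) = - (LINT x:D|lborel. \<theta> x *\<^sub>R g x))"

text \<open>The part of the Sobolev norm of order \<open>1 \<le> s < 2\<close> on one patch that involves the gradient. The
  gradient is determined up to null sets; the infimum is \<open>\<infinity>\<close> if there is none.\<close>

definition patch_gradient_norm :: "surface \<Rightarrow> nat \<Rightarrow> real \<Rightarrow> (point \<Rightarrow> complex) \<Rightarrow> ennreal" where
  "patch_gradient_norm S i s u =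
     (let E = plane_chart (patch S i); D = E -` patch S i; M = restrict_space lborel D in
      INF g\<in>{g. \<forall>b\<in>Basis. g b \<in> borel_measurable M \<and> Lp_norm M 2 (g b) < \<infinity> \<and>
                  weak_partial D b (u \<circ> E) (g b)}.
        \<Sum>b\<in>Basis. Lp_norm M 2 (g b) + (if s > 1 then slobodeckij_seminorm M (s - 1) (g b) else 0))"

text \<open>For \<open>1 \<le> s < 3/2\<close> a function belongs to \<open>H\<^sup>s(\<partial>\<Omega>)\<close> iff it does so on each patch and its traces
  from both sides of each edge agree. The latter is enforced by the global seminorm of
  order \<open>1/2\<close>, which is infinite for jumps across edges and is dominated by the norm of
  \<open>H\<^sup>1(\<partial>\<Omega>)\<close> otherwise. Negative orders are defined by duality; only elements of
  \<open>L\<^sub>2(\<partial>\<Omega>)\<close> are considered.\<close>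

definition sobolev_norm_nonneg :: "surface \<Rightarrow> real \<Rightarrow> (point \<Rightarrow> complex) \<Rightarrow> ennreal" where
  "sobolev_norm_nonneg S s u =
     Lp_norm (surface_measure S) 2 u +
     (if s = 0 then 0
      else if s < 1 then slobodeckij_seminorm (surface_measure S) s u
      else slobodeckij_seminorm (surface_measure S) (1 / 2) u +
           (\<Sum>i<num_patches S. patch_gradient_norm S i s u))"

definition sobolev_norm :: "surface \<Rightarrow> real \<Rightarrow> (point \<Rightarrow> complex) \<Rightarrow> ennreal" where
  "sobolev_norm S s u =
     (if 0 \<le> s then sobolev_norm_nonneg S s u
      else (SUP v\<in>{v \<in> L2_surface S. sobolev_norm_nonneg S (- s) v \<le> 1}.
              ennreal (cmod (inner_surface S u v))))"


section \<open>Resolution of unity and weighted Sobolev spaces\<close>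

record resolution =
  phi :: "nat \<Rightarrow> point \<Rightarrow> real"
  inner_nbhd :: "nat \<Rightarrow> point set"
  outer_nbhd :: "nat \<Rightarrow> point set"

definition resolution_of_unity :: "surface \<Rightarrow> resolution \<Rightarrow> bool" where
  "resolution_of_unity S Z \<longleftrightarrow>
     (\<forall>n<num_vertices S.
        (\<forall>x\<in>bd S. 0 \<le> phi Z n x) \<and> (\<lambda>x. complex_of_real (phi Z n x)) \<in> C_pw S \<and>
        openin (top_of_set (bd S)) (inner_nbhd Z n) \<and> openin (top_of_set (bd S)) (outer_nbhd Z n) \<and>
        vertex S n \<in> inner_nbhd Z n \<and> inner_nbhd Z n \<subset> outer_nbhd Z n \<and> outer_nbhd Z n \<subset> bd S \<and>
        (\<forall>x\<in>inner_nbhd Z n. phi Z n x = 1) \<and> (\<forall>x\<in>bd S - outer_nbhd Z n. phi Z n x = 0)) \<and>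
     (\<forall>x\<in>bd S. (\<Sum>n<num_vertices S. phi Z n x) = 1) \<and>
     (\<exists>C1>0. \<forall>n<num_vertices S.
        (\<forall>l<num_patches S. vertex S n \<notin> closure (patch S l) \<longrightarrow>
           ennreal C1 \<le> dist_along (bd S) (outer_nbhd Z n) (patch S l)) \<and>
        (\<forall>t<num_faces S n.
           ennreal C1 \<le> dist_along (affine hull face S n t)
             (outer_nbhd Z n \<inter> face S n t) (patch S (patch_of_face S n t) - face S n t)))"

definition radial_derivative :: "(real \<times> real \<Rightarrow> complex) \<Rightarrow> real \<times> real \<Rightarrow> complex" where
  "radial_derivative h = (\<lambda>(r, \<phi>). vector_derivative (\<lambda>x. h (x, \<phi>)) (at r))"

definition angular_derivative :: "(real \<times> real \<Rightarrow> complex) \<Rightarrow> real \<times> real \<Rightarrow> complex" where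
  "angular_derivative h = (\<lambda>(r, \<phi>). vector_derivative (\<lambda>x. h (r, x)) (at \<phi>))"

text \<open>The term of index \<open>(a, b)\<close> in the norm of \<open>X\<^sup>k\<^sub>\<rho>\<close>, for a function \<open>f\<close> on the sector with opening
  angle \<open>\<omega>\<close>. The factor \<open>r\<close> under the integral is the Jacobian of polar coordinates.\<close>

definition weighted_term :: "real \<Rightarrow> real \<Rightarrow> nat \<Rightarrow> nat \<Rightarrow> (real \<times> real \<Rightarrow> complex) \<Rightarrow> ennreal" where
  "weighted_term \<omega> \<rho> a b f =
     (let F = (\<lambda>(r, \<phi>). f (r * cos \<phi>, r * sin \<phi>));
          q = (\<lambda>\<phi>. min \<phi> (\<omega> - \<phi>));
          h = (radial_derivative ^^ a) ((angular_derivative ^^ b) F)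
      in epowr (\<integral>\<^sup>+ z. (case z of (r, \<phi>) \<Rightarrow>
             ennreal ((r powr (- \<rho>) * (1 + r) powr \<rho> * (q \<phi> * r) ^ a * q \<phi> powr (real b - \<rho>)
                       * cmod (h (r, \<phi>)))\<^sup>2 * r)) * indicator ({0<..} \<times> {0<..<\<omega>}) z \<partial>lborel) (1 / 2))"

definition X_cone_norm :: "surface \<Rightarrow> nat \<Rightarrow> nat \<Rightarrow> real \<Rightarrow> (point \<Rightarrow> complex) \<Rightarrow> ennreal" where
  "X_cone_norm S n k \<rho> f =
     epowr (\<Sum>t<num_faces S n.
       \<integral>\<^sup>+ x. ennreal ((cmod (f (face_chart S n t x)))\<^sup>2) * indicator (sector (opening_angle S n t)) x
         \<partial>lborel) (1 / 2) +
     (\<Sum>t<num_faces S n. \<Sum>(a, b)\<in>{(a, b). 1 \<le> a + b \<and> a + b \<le> k}.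
        weighted_term (opening_angle S n t) \<rho> a b (f \<circ> face_chart S n t))"

text \<open>The localized function \<open>\<phi>\<^sub>n u\<close> is extended by zero to the boundary of the tangent cone.\<close>

definition X_norm :: "surface \<Rightarrow> resolution \<Rightarrow> nat \<Rightarrow> real \<Rightarrow> (point \<Rightarrow> complex) \<Rightarrow> ennreal" where
  "X_norm S Z k \<rho> u =
     (\<Sum>n<num_vertices S.
        X_cone_norm S n k \<rho> (\<lambda>x. if x \<in> bd S then complex_of_real (phi Z n x) * u x else 0))"

text \<open>The closure of \<open>C_pw\<close> is realized inside \<open>L\<^sub>2\<close>, by which the norm is bounded from below: it
  consists of the \<open>L\<^sub>2\<close>-limits of sequences which are Cauchy in the norm. For large \<open>\<rho>\<close> the norm
  is infinite for some elements of \<open>C_pw\<close>, hence the finiteness condition.\<close>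

definition X_space :: "surface \<Rightarrow> resolution \<Rightarrow> nat \<Rightarrow> real \<Rightarrow> (point \<Rightarrow> complex) set" where
  "X_space S Z k \<rho> =
     {u \<in> L2_surface S. \<exists>v :: nat \<Rightarrow> point \<Rightarrow> complex.
        (\<forall>m. v m \<in> C_pw S \<and> X_norm S Z k \<rho> (v m) < \<infinity>) \<and>
        (\<forall>\<epsilon>>0. \<exists>M. \<forall>m\<ge>M. \<forall>l\<ge>M. X_norm S Z k \<rho> (\<lambda>x. v m x - v l x) < \<epsilon>) \<and>
        (\<lambda>m. Lp_norm (surface_measure S) 2 (\<lambda>x. u x - v m x)) \<longlonglongrightarrow> 0}"


section \<open>Wavelet bases\<close>

datatype windex = Generator nat | Wavelet nat point

text \<open>\<open>grid W j i\<close> is the set of grid points of level \<open>j\<close> attributed to the \<open>i\<close>-th patch;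
  the wavelets have levels \<open>j \<ge> coarsest W\<close>.\<close>

record wavelet_system =
  coarsest :: nat
  num_generators :: nat
  grid :: "nat \<Rightarrow> nat \<Rightarrow> point set"
  primal :: "windex \<Rightarrow> point \<Rightarrow> complex"
  dual :: "windex \<Rightarrow> point \<Rightarrow> complex"

definition nabla :: "surface \<Rightarrow> wavelet_system \<Rightarrow> nat \<Rightarrow> point set" where
  "nabla S W j = (\<Union>i<num_patches S. grid W j i)"

definition windices :: "surface \<Rightarrow> wavelet_system \<Rightarrow> windex set" where
  "windices S W =
     Generator ` {..<num_generators W} \<union> {Wavelet j \<xi> | j \<xi>. coarsest W \<le> j \<and> \<xi> \<in> nabla S W j}"

definition coeff_at :: "surface \<Rightarrow> wavelet_system \<Rightarrow> (point \<Rightarrow> complex) \<Rightarrow> nat \<Rightarrow> point \<Rightarrow> complex" where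
  "coeff_at S W u j \<xi> = inner_surface S u (dual W (Wavelet j \<xi>))"

definition coarse_projection ::
    "surface \<Rightarrow> wavelet_system \<Rightarrow> (point \<Rightarrow> complex) \<Rightarrow> point \<Rightarrow> complex" where
  "coarse_projection S W u =
     (\<lambda>x. \<Sum>l<num_generators W. inner_surface S u (dual W (Generator l)) * primal W (Generator l) x)"

definition riesz_basis :: "surface \<Rightarrow> windex set \<Rightarrow> (windex \<Rightarrow> point \<Rightarrow> complex) \<Rightarrow> bool" where
  "riesz_basis S \<Lambda> B \<longleftrightarrow>
     (\<forall>\<eta>\<in>\<Lambda>. B \<eta> \<in> L2_surface S) \<and>
     (\<forall>u\<in>L2_surface S. \<forall>\<epsilon>>0. \<exists>A c. finite A \<and> A \<subseteq> \<Lambda> \<and>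
        Lp_norm (surface_measure S) 2 (\<lambda>x. u x - (\<Sum>\<eta>\<in>A. c \<eta> * B \<eta> x)) < \<epsilon>) \<and>
     (\<exists>C1>0. \<exists>C2>0. \<forall>A. \<forall>c :: windex \<Rightarrow> complex. finite A \<and> A \<subseteq> \<Lambda> \<longrightarrow>
        ennreal (C1 * sqrt (\<Sum>\<eta>\<in>A. (cmod (c \<eta>))\<^sup>2))
          \<le> Lp_norm (surface_measure S) 2 (\<lambda>x. \<Sum>\<eta>\<in>A. c \<eta> * B \<eta> x) \<and>
        Lp_norm (surface_measure S) 2 (\<lambda>x. \<Sum>\<eta>\<in>A. c \<eta> * B \<eta> x)
          \<le> ennreal (C2 * sqrt (\<Sum>\<eta>\<in>A. (cmod (c \<eta>))\<^sup>2)))"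

definition supp_dual :: "surface \<Rightarrow> wavelet_system \<Rightarrow> nat \<Rightarrow> point \<Rightarrow> point set" where
  "supp_dual S W j \<xi> = closure {x \<in> bd S. dual W (Wavelet j \<xi>) x \<noteq> 0}"

definition skeleton :: "surface \<Rightarrow> point set" where
  "skeleton S = (\<Union>i<num_patches S. closure (patch S i) - patch S i)"

definition wavelet_sobolev_norm ::
    "surface \<Rightarrow> wavelet_system \<Rightarrow> real \<Rightarrow> (point \<Rightarrow> complex) \<Rightarrow> ennreal" where
  "wavelet_sobolev_norm S W s u =
     Lp_norm (surface_measure S) 2 (coarse_projection S W u) +
     epowr (\<Sum>i. let j = coarsest W + i in
        ennreal (\<Sum>\<xi>\<in>nabla S W j. 2 powr (2 * s * real j) * (cmod (coeff_at S W u j \<xi>))\<^sup>2)) (1 / 2)"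

definition biorthogonal_system :: "surface \<Rightarrow> wavelet_system \<Rightarrow> bool" where
  "biorthogonal_system S W \<longleftrightarrow>
     riesz_basis S (windices S W) (primal W) \<and> riesz_basis S (windices S W) (dual W) \<and>
     (\<forall>\<eta>\<in>windices S W. \<forall>\<mu>\<in>windices S W.
        inner_surface S (primal W \<eta>) (dual W \<mu>) = (if \<eta> = \<mu> then 1 else 0)) \<and>
     (\<forall>u\<in>L2_surface S.
        (\<lambda>J. Lp_norm (surface_measure S) 2
           (\<lambda>x. u x - coarse_projection S W u x -
              (\<Sum>j=coarsest W..<coarsest W + J. \<Sum>\<xi>\<in>nabla S W j.
                 coeff_at S W u j \<xi> * primal W (Wavelet j \<xi>) x))) \<longlonglongrightarrow> 0)"

definition wavelet_grids :: "surface \<Rightarrow> wavelet_system \<Rightarrow> bool" where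
  "wavelet_grids S W \<longleftrightarrow>
     (\<exists>C1>0. \<exists>C2>0. \<forall>j\<ge>coarsest W. \<forall>i<num_patches S.
        finite (grid W j i) \<and> grid W j i \<subseteq> closure (patch S i) \<and>
        C1 * 2 ^ (2 * j) \<le> real (card (grid W j i)) \<and> real (card (grid W j i)) \<le> C2 * 2 ^ (2 * j))"

definition wavelets_normalized :: "surface \<Rightarrow> wavelet_system \<Rightarrow> bool" where
  "wavelets_normalized S W \<longleftrightarrow>
     (\<exists>C1>0. \<exists>C2>0. \<forall>j\<ge>coarsest W. \<forall>\<xi>\<in>nabla S W j.
        ennreal C1 \<le> Lp_norm (surface_measure S) 2 (dual W (Wavelet j \<xi>)) \<and>
        Lp_norm (surface_measure S) 2 (dual W (Wavelet j \<xi>)) \<le> ennreal C2)"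

text \<open>The bound on the diameter makes explicit that the supports are localized near \<open>\<xi>\<close>, which the
  bound on the area does not imply.\<close>

definition wavelet_supports :: "surface \<Rightarrow> wavelet_system \<Rightarrow> bool" where
  "wavelet_supports S W \<longleftrightarrow>
     (\<exists>C1>0. \<exists>C2>0. \<forall>j\<ge>coarsest W. \<forall>\<xi>\<in>nabla S W j.
        compact (supp_dual S W j \<xi>) \<and> \<xi> \<in> supp_dual S W j \<xi> \<and>
        ennreal (C1 / 2 ^ (2 * j)) \<le> emeasure (surface_measure S) (supp_dual S W j \<xi>) \<and>
        emeasure (surface_measure S) (supp_dual S W j \<xi>) \<le> ennreal (C2 / 2 ^ (2 * j)) \<and>
        diameter (supp_dual S W j \<xi>) \<le> C2 / 2 ^ j)"

definition vanishing_moments :: "surface \<Rightarrow> wavelet_system \<Rightarrow> nat \<Rightarrow> bool" where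
  "vanishing_moments S W d \<longleftrightarrow>
     (\<forall>j\<ge>coarsest W. \<forall>\<xi>\<in>nabla S W j. \<forall>i<num_patches S. supp_dual S W j \<xi> \<subseteq> patch S i \<longrightarrow>
        (\<forall>c :: nat \<times> nat \<Rightarrow> complex.
           inner_square
             (\<lambda>(x, y). \<Sum>(a, b)\<in>{(a, b). a + b < d}. c (a, b) * complex_of_real (x ^ a * y ^ b))
             (dual W (Wavelet j \<xi>) \<circ> kappa S i) = 0))"

definition wavelets_near_interfaces :: "surface \<Rightarrow> wavelet_system \<Rightarrow> bool" where
  "wavelets_near_interfaces S W \<longleftrightarrow>
     (\<exists>c>0. \<exists>C1>0. \<exists>C2>0. \<forall>j\<ge>coarsest W.
        (let near = {\<xi> \<in> nabla S W j. 0 < dist_along (bd S) (supp_dual S W j \<xi>) (skeleton S) \<and>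
                       dist_along (bd S) (supp_dual S W j \<xi>) (skeleton S) \<le> ennreal (c / 2 ^ j)};
             touching = {\<xi> \<in> nabla S W j. supp_dual S W j \<xi> \<inter> skeleton S \<noteq> {}}
         in C1 * 2 ^ j \<le> real (card near) \<and> real (card near) \<le> C2 * 2 ^ j \<and>
            real (card touching) \<le> C2 * 2 ^ j))"

definition finite_overlap :: "surface \<Rightarrow> wavelet_system \<Rightarrow> bool" where
  "finite_overlap S W \<longleftrightarrow>
     (\<exists>C. \<forall>j\<ge>coarsest W. \<forall>x\<in>bd S. card {\<xi> \<in> nabla S W j. x \<in> supp_dual S W j \<xi>} \<le> C)"

definition sobolev_equivalence :: "surface \<Rightarrow> wavelet_system \<Rightarrow> real \<Rightarrow> bool" where
  \<comment> \<open>includes the norm equivalence for \<open>L\<^sub>2\<close> as the case \<open>s = 0\<close>\<close>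
  "sobolev_equivalence S W sS \<longleftrightarrow>
     (\<forall>s. - (1 / 2) < s \<and> s < min (3 / 2) sS \<longrightarrow>
        (\<exists>C1>0. \<exists>C2>0. \<forall>u\<in>L2_surface S.
           ennreal C1 * wavelet_sobolev_norm S W s u \<le> sobolev_norm S s u \<and>
           sobolev_norm S s u \<le> ennreal C2 * wavelet_sobolev_norm S W s u))"

text \<open>\<open>d\<close> is the order of vanishing moments and \<open>sS\<close> the upper limit, given by the geometry, for the
  orders of Sobolev spaces on the surface.\<close>

definition wavelet_basis :: "surface \<Rightarrow> wavelet_system \<Rightarrow> nat \<Rightarrow> real \<Rightarrow> bool" where
  "wavelet_basis S W d sS \<longleftrightarrow>
     1 \<le> d \<and> 1 \<le> sS \<and> biorthogonal_system S W \<and> wavelet_grids S W \<and> wavelets_normalized S W \<and>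
     wavelet_supports S W \<and> vanishing_moments S W d \<and> wavelets_near_interfaces S W \<and>
     finite_overlap S W \<and> sobolev_equivalence S W sS"


section \<open>Besov-type spaces and best n-term approximation\<close>

definition admissible :: "real \<Rightarrow> real \<Rightarrow> ereal \<Rightarrow> bool" where
  "admissible \<alpha> p q \<longleftrightarrow>
     1 / 2 \<le> 1 / p \<and> 1 / p \<le> \<alpha> / 2 + 1 / 2 \<and> 0 < q \<and> (1 / p = \<alpha> / 2 + 1 / 2 \<longrightarrow> q \<le> 2)"

definition besov_norm ::
    "surface \<Rightarrow> wavelet_system \<Rightarrow> real \<Rightarrow> real \<Rightarrow> ereal \<Rightarrow> (point \<Rightarrow> complex) \<Rightarrow> ennreal" where
  "besov_norm S W \<alpha> p q u =
     (let w = (\<lambda>j. 2 powr (real j * (\<alpha> + 2 * (1 / 2 - 1 / p))));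
          A = (\<lambda>j. \<Sum>\<xi>\<in>nabla S W j. cmod (coeff_at S W u j \<xi>) powr p);
          r = real_of_ereal q
      in Lp_norm (surface_measure S) p (coarse_projection S W u) +
         (if q = \<infinity> then (SUP j\<in>{coarsest W..}. ennreal (w j * A j powr (1 / p)))
          else epowr (\<Sum>i. let j = coarsest W + i in ennreal (w j powr r * A j powr (r / p))) (1 / r)))"

definition besov_space ::
    "surface \<Rightarrow> wavelet_system \<Rightarrow> real \<Rightarrow> real \<Rightarrow> ereal \<Rightarrow> (point \<Rightarrow> complex) set" where
  "besov_space S W \<alpha> p q = {u \<in> L2_surface S. besov_norm S W \<alpha> p q u < \<infinity>}"

definition best_nterm_error ::
    "(point \<Rightarrow> complex) \<Rightarrow> (point \<Rightarrow> complex) set \<Rightarrow> ((point \<Rightarrow> complex) \<Rightarrow> ennreal) \<Rightarrow> nat \<Rightarrow> ennreal" where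
  "best_nterm_error f B nrm n =
     (INF b\<in>{b :: nat \<Rightarrow> point \<Rightarrow> complex. \<forall>m<n. b m \<in> B}. INF c :: nat \<Rightarrow> complex.
        nrm (\<lambda>x. f x - (\<Sum>m<n. c m * b m x)))"

end

theory Submission
 imports Defs
begin

text \<open>The terms of \<open>\<alpha>star\<close> have separate origins. Let delta be the
  distance of a grid point to the edges. Away from the edges the weighted norm bounds the sum over
  level j of (2^(kj) delta^(k-rho) |c|)^2; the passage to the exponent tau pairs it with the sum of
  delta^(-b), where b = 2(k-rho)/alpha. At most about 4^j eta wavelets have delta below eta, so for
  b > 1, that is alpha < 2(k-rho), the smallest values delta ~ 2^(-j) dominate, and the result
  decays in j if alpha < 2 rho. At the edges the Besov norm suffices if alpha < 2(s - (1/p - 1/2)).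
  Two obstacles shape the details. Members of \<open>X_space\<close> are mere limits of functions in
  \<open>C_pw\<close>, so the weighted estimates are proved on \<open>C_pw\<close> with constants
  independent of function and level and pass to the limit coefficient by coefficient. Supports are
  small in the distance of space, while cancellation requires them inside one patch; the Lipschitz
  property keeps patches from coming close in space away from the edges.\<close>

abbreviation nn_lborel :: "('a::euclidean_space => ennreal) => ennreal" (binder "NN " 10) where
 "nn_lborel f == integral\<^sup>N lborel f"

text \<open>A dual wavelet at distance \<open>\<delta>\<close> from the edges has vanishing moments as soon as \<open>2\<^sup>j \<delta>\<close> is
large, so a local Taylor expansion bounds its coefficient by \<open>2\<^bsup>-jk\<^esup>\<close> times the \<open>L\<^sub>2\<close> norm of the \<open>k\<close>-th
derivatives near the support; there the weight in the norm of \<open>X\<^sup>k\<^sub>\<rho>\<close> controls \<open>\<delta>\<^bsup>k-\<rho>\<^esup>\<close> times these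
derivatives, because on the face around a vertex \<open>q r\<close> dominates \<open>\<delta>\<close>. The comparison of tangent-cone faces with
patches uses that the patches are convex: near each point a patch is the diffeomorphic image of a
convex set and it is also locally conic, hence locally convex. The remaining
\<open>2\<^sup>j\<close> coefficients of level \<open>j\<close> are controlled by the Besov norm. Hoelder's inequality, over dyadic layers of
\<open>\<delta>\<close> for the first kind, gives the \<open>l\<^sub>\<tau>\<close> summability; the rates follow by interpolation
with the Besov norm and thresholding.\<close>

section \<open>Calculus of functions of class \<open>C\<^sup>k\<close>\<close>

lemma Ck_on_continuous: "Ck_on m U f ==> continuous_on U f"
 by (cases m) (auto intro!: continuous_at_imp_continuous_on intro: has_derivative_continuous)

lemma Ck_on_SucI:
 assumes "!!x. x : U ==> (f has_derivative D x) (at x)"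
  "!!b. b : Basis ==> Ck_on m U (%x. D x b)"
 shows "Ck_on (Suc m) U f"
 using assms by auto

lemma Ck_on_Suc_imp: "Ck_on (Suc m) U f ==> Ck_on m U f"
proof (induction m arbitrary: f)
 case 0
 thus ?case using Ck_on_continuous[of "Suc 0"] by simp
next
 case (Suc m)
 thus ?case by (metis Ck_on.simps(2))
qed

lemma Ck_on_le: "Ck_on m U f ==> l <= m ==> Ck_on l U f"
proof (induction m)
 case (Suc m)
 thus ?case using Ck_on_Suc_imp le_Suc_eq by metis
qed (simp del: Ck_on.simps)

lemma Ck_on_subset: "Ck_on m U f ==> V <= U ==> Ck_on m V f"
proof (induction m arbitrary: f)
 case 0
 thus ?case by (auto intro: continuous_on_subset)
next
 case (Suc m)
 from Suc.prems(1) obtain D where D: "\<forall>x\<in>U. (f has_derivative D x) (at x)"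
  "\<forall>b\<in>Basis. Ck_on m U (%x. D x b)" by auto
 have "\<forall>x\<in>V. (f has_derivative D x) (at x)" using D(1) Suc.prems(2) by blast
 moreover have "\<forall>b\<in>Basis. Ck_on m V (%x. D x b)" using D(2) Suc.IH Suc.prems(2) by blast
 ultimately show ?case by auto
qed

lemma Ck_on_cong:
 assumes "open U" "!!x. x : U ==> f x = g x" "Ck_on m U f"
 shows "Ck_on m U g"
proof (cases m)
 case 0
 thus ?thesis using assms by (auto intro: continuous_on_eq)
next
 case (Suc l)
 with assms(3) obtain D where D: "\<forall>x\<in>U. (f has_derivative D x) (at x)"
  "\<forall>b\<in>Basis. Ck_on l U (%x. D x b)" by auto
 have "\<forall>x\<in>U. (g has_derivative D x) (at x)"
  using D(1) assms(1,2) has_derivative_transform_within_open by blast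
 thus ?thesis using D(2) Suc by auto
qed

lemma Ck_on_const: "Ck_on m U (%x. c)"
proof (induction m arbitrary: c)
 case (Suc m)
 show ?case by (rule Ck_on_SucI[where D = "%x h. 0"]) (simp_all add: Suc)
qed auto

lemma Ck_on_add: "Ck_on m U f ==> Ck_on m U g ==> Ck_on m U (%x. f x + g x)"
proof (induction m arbitrary: f g)
 case 0
 thus ?case by (auto intro: continuous_on_add)
next
 case (Suc m)
 from Suc.prems obtain D E where D: "\<forall>x\<in>U. (f has_derivative D x) (at x)"
  "\<forall>b\<in>Basis. Ck_on m U (%x. D x b)" and E: "\<forall>x\<in>U. (g has_derivative E x) (at x)"
  "\<forall>b\<in>Basis. Ck_on m U (%x. E x b)" by auto
 have "\<forall>x\<in>U. ((%x. f x + g x) has_derivative (%x h. D x h + E x h) x) (at x)"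
  using D E by (auto intro: has_derivative_add)
 moreover have "\<forall>b\<in>Basis. Ck_on m U (%x. (%x h. D x h + E x h) x b)" using D E Suc.IH by simp
 ultimately show ?case by (intro Ck_on_SucI[where D = "%x h. D x h + E x h"]) blast+
qed

lemma Ck_on_sum:
 "finite A ==> (!!a. a : A ==> Ck_on m U (f a)) ==> Ck_on m U (%x. \<Sum>a\<in>A. f a x)"
proof (induction A rule: finite_induct)
 case empty
 thus ?case by (simp only: sum.empty Ck_on_const)
next
 case (insert a A)
 hence "Ck_on m U (%x. f a x + (\<Sum>a\<in>A. f a x))" by (intro Ck_on_add) blast+
 thus ?case using insert(1,2) by simp
qed

lemma (in bounded_linear) Ck_on_compose_linear:
 "Ck_on m U g ==> Ck_on m U (%x. f (g x))"
proof (induction m arbitrary: g)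
 case 0
 thus ?case by (auto intro: continuous_on)
next
 case (Suc m)
 from Suc.prems obtain D where D: "\<forall>x\<in>U. (g has_derivative D x) (at x)"
  "\<forall>b\<in>Basis. Ck_on m U (%x. D x b)" by auto
 show ?case
  by (rule Ck_on_SucI[where D = "%x h. f (D x h)"]) (use D Suc.IH in \<open>auto intro: has_derivative\<close>)
qed

lemma (in bounded_bilinear) Ck_on_bilinear:
 "Ck_on m U f ==> Ck_on m U g ==> Ck_on m U (%x. prod (f x) (g x))"
proof (induction m arbitrary: f g)
 case 0
 thus ?case by (auto intro: continuous_on)
next
 case (Suc m)
 from Suc.prems obtain D E where D: "\<forall>x\<in>U. (f has_derivative D x) (at x)"
  "\<forall>b\<in>Basis. Ck_on m U (%x. D x b)" and E: "\<forall>x\<in>U. (g has_derivative E x) (at x)"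
  "\<forall>b\<in>Basis. Ck_on m U (%x. E x b)" by auto
 have "\<forall>x\<in>U. ((%x. prod (f x) (g x)) has_derivative
     (%x h. prod (f x) (E x h) + prod (D x h) (g x)) x) (at x)"
  using D E by (auto intro: FDERIV)
 moreover have "\<forall>b\<in>Basis. Ck_on m U (%x. (%x h. prod (f x) (E x h) + prod (D x h) (g x)) x b)"
  using D(2) E(2) by (intro ballI Ck_on_add Suc.IH Suc.prems[THEN Ck_on_Suc_imp]) blast+
 ultimately show ?case
  by (intro Ck_on_SucI[where D = "%x h. prod (f x) (E x h) + prod (D x h) (g x)"]) blast+
qed

lemmas Ck_on_scaleR = bounded_bilinear.Ck_on_bilinear[OF bounded_bilinear_scaleR]
lemmas Ck_on_mult = bounded_bilinear.Ck_on_bilinear[OF bounded_bilinear_mult]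

lemma Ck_on_minus: "Ck_on m U f ==> Ck_on m U (%x. - f x)"
 by (rule bounded_linear.Ck_on_compose_linear[OF bounded_linear_minus[OF bounded_linear_ident]])

lemma Ck_on_diff: "Ck_on m U f ==> Ck_on m U g ==> Ck_on m U (%x. f x - g x)"
 using Ck_on_add[of m U f "%x. - g x"] Ck_on_minus by auto

lemma Ck_on_ident: "Ck_on m U (%x. x)"
proof (cases m)
 case (Suc l)
 show ?thesis unfolding Suc by (rule Ck_on_SucI[where D = "%x h. h"]) (simp_all add: Ck_on_const)
qed auto

lemma Ck_on_compose:
 "open U ==> Ck_on m V g ==> Ck_on m U f ==> f ` U <= V ==> Ck_on m U (%x. g (f x))"
proof (induction m arbitrary: g)
 case 0
 thus ?case by (auto intro: continuous_on_compose2)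
next
 case (Suc m)
 from Suc.prems obtain D E where D: "\<forall>x\<in>V. (g has_derivative D x) (at x)"
  "\<forall>b\<in>Basis. Ck_on m V (%x. D x b)" and E: "\<forall>x\<in>U. (f has_derivative E x) (at x)"
  "\<forall>b\<in>Basis. Ck_on m U (%x. E x b)" by auto
 have d: "\<forall>x\<in>U. ((%x. g (f x)) has_derivative (%x h. D (f x) (E x h)) x) (at x)"
  using D(1) E(1) Suc.prems(4) has_derivative_compose by (metis image_subset_iff)
 have "Ck_on m U (%x. D (f x) (E x b))" if b: "b : Basis" for b
 proof -
  \<comment> \<open>\<open>Ck_on\<close> speaks of derivatives in basis directions only, so
    \<open>D (f x)\<close> at the moving vector \<open>E x b\<close> is expanded in the basis; the
    induction hypothesis then applies to each \<open>D (f x) c\<close> separately.\<close>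
  have e: "(\<Sum>c\<in>Basis. (E x b \<bullet> c) *\<^sub>R D (f x) c) = D (f x) (E x b)" if "x : U" for x
  proof -
   have "linear (D (f x))"
    using D(1) Suc.prems(4) that has_derivative_linear image_subset_iff by metis
   thus ?thesis
    by (subst (2) euclidean_representation[of "E x b", symmetric]) (simp add: linear_sum linear_scale)
  qed
  have i: "Ck_on m U (%x. E x b \<bullet> c)" for c
   by (rule bounded_linear.Ck_on_compose_linear[OF bounded_linear_inner_left]) (use E(2) b in blast)
  have j: "Ck_on m U (%x. D (f x) c)" if "c : Basis" for c
   using D(2) that Suc.prems(4) by (intro Suc.IH Suc.prems(1) Suc.prems(3)[THEN Ck_on_Suc_imp]) blast+
  have s: "Ck_on m U (%x. \<Sum>c\<in>Basis. (E x b \<bullet> c) *\<^sub>R D (f x) c)"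
   by (intro Ck_on_sum Ck_on_scaleR i j) auto
  show ?thesis by (rule Ck_on_cong[OF Suc.prems(1) e s])
 qed
 thus ?case using d by (intro Ck_on_SucI[where D = "%x h. D (f x) (E x h)"]) blast+
qed

section \<open>Partial derivatives of functions of two variables and their symmetry\<close>

abbreviation D1 where "D1 \<equiv> radial_derivative"
abbreviation D2 where "D2 \<equiv> angular_derivative"

lemma Basis_plane: "(Basis :: (real \<times> real) set) = {(1, 0), (0, 1)}"
 by (auto simp: Basis_prod_def)

lemma has_derivative_D1:
 fixes f :: "real \<times> real => 'a::real_normed_vector"
 assumes "(f has_derivative D) (at (x, y))"
 shows "((%t. f (t, y)) has_vector_derivative D (1, 0)) (at x)"
proof -
 have "((%t. (t, y)) has_derivative (%h. (h, 0))) (at x)"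
  by (intro has_derivative_Pair has_derivative_ident has_derivative_const)
 from has_derivative_compose[OF this assms]
 have "((%t. f (t, y)) has_derivative (%h. D (h, 0))) (at x)" .
 moreover have "(%h. D (h, 0)) = (%h. h *\<^sub>R D (1, 0))"
  by (intro ext, rule linear_scale[OF has_derivative_linear[OF assms], of _ "(1,0)",
     unfolded scaleR_Pair real_scaleR_def mult_1_right mult_zero_right])
 ultimately show ?thesis by (simp only: has_vector_derivative_def)
qed

lemma has_derivative_D2:
 fixes f :: "real \<times> real => 'a::real_normed_vector"
 assumes "(f has_derivative D) (at (x, y))"
 shows "((%t. f (x, t)) has_vector_derivative D (0, 1)) (at y)"
proof -
 have "((%t. (x, t)) has_derivative (%h. (0, h))) (at y)"
  by (intro has_derivative_Pair has_derivative_ident has_derivative_const)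
 from has_derivative_compose[OF this assms]
 have "((%t. f (x, t)) has_derivative (%h. D (0, h))) (at y)" .
 moreover have "(%h. D (0, h)) = (%h. h *\<^sub>R D (0, 1))"
  by (intro ext, rule linear_scale[OF has_derivative_linear[OF assms], of _ "(0,1)",
     unfolded scaleR_Pair real_scaleR_def mult_1_right mult_zero_right])
 ultimately show ?thesis by (simp only: has_vector_derivative_def)
qed

lemma D1_eq: "(f has_derivative D) (at z) ==> D1 f z = D (1, 0)"
 using has_derivative_D1[of f D "fst z" "snd z"]
 by (auto simp: radial_derivative_def vector_derivative_at split_beta)

lemma D2_eq: "(f has_derivative D) (at z) ==> D2 f z = D (0, 1)"
 using has_derivative_D2[of f D "fst z" "snd z"]
 by (auto simp: angular_derivative_def vector_derivative_at split_beta)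

text \<open>A slice of an open set is a neighbourhood in the line, and the derivative at a point
  depends only on the values nearby.\<close>

lemma D1_cong:
 assumes "open U" "z : U" "!!x. x : U ==> f x = g x"
 shows "D1 f z = D1 g z"
proof -
 obtain x y where z: "z = (x, y)" by fastforce
 have "open ((%t. (t, y)) -` U)" by (intro open_vimage assms(1) continuous_intros)
 from eventually_nhds_in_open[OF this, of x] assms(2) z
 have "eventually (%t. (t, y) : U) (nhds x)" by simp
 hence "eventually (%t. f (t, y) = g (t, y)) (nhds x)"
  by eventually_elim (use assms(3) in auto)
 thus ?thesis unfolding radial_derivative_def z by (auto intro: vector_derivative_cong_eq)
qed

lemma D2_cong:
 assumes "open U" "z : U" "!!x. x : U ==> f x = g x"
 shows "D2 f z = D2 g z"
proof -
 obtain x y where z: "z = (x, y)" by fastforce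
 have "open ((%t. (x, t)) -` U)" by (intro open_vimage assms(1) continuous_intros)
 from eventually_nhds_in_open[OF this, of y] assms(2) z
 have "eventually (%t. (x, t) : U) (nhds y)" by simp
 hence "eventually (%t. f (x, t) = g (x, t)) (nhds y)"
  by eventually_elim (use assms(3) in auto)
 thus ?thesis unfolding angular_derivative_def z by (auto intro: vector_derivative_cong_eq)
qed

lemma Ck_on_has_derivative:
 assumes "Ck_on (Suc m) U f" "z : U"
 shows "(f has_derivative (%h. fst h *\<^sub>R D1 f z + snd h *\<^sub>R D2 f z)) (at z)"
proof -
 obtain D where D: "(f has_derivative D) (at z)" using assms by auto
 interpret linear D using D by (rule has_derivative_linear)
 have "D h = fst h *\<^sub>R D1 f z + snd h *\<^sub>R D2 f z" for h
 proof -
  have "D (fst h *\<^sub>R (1, 0) + snd h *\<^sub>R (0, 1)) = fst h *\<^sub>R D1 f z + snd h *\<^sub>R D2 f z"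
   by (simp only: add scale D1_eq[OF D] D2_eq[OF D])
  thus ?thesis by (cases h) simp
 qed
 hence "D = (%h. fst h *\<^sub>R D1 f z + snd h *\<^sub>R D2 f z)" by (rule ext)
 thus ?thesis using D by (simp only:)
qed

lemma Ck_on_differentiable: "Ck_on (Suc m) U f ==> z : U ==> f differentiable (at z)"
 by (auto simp: differentiable_def)

lemma Ck_on_D1:
 assumes "open U" "Ck_on (Suc m) U f"
 shows "Ck_on m U (D1 f)"
proof -
 obtain D where D: "\<forall>x\<in>U. (f has_derivative D x) (at x)" "\<forall>b\<in>Basis. Ck_on m U (%x. D x b)"
  using assms by auto
 show ?thesis
  by (rule Ck_on_cong[OF assms(1), of "%x. D x (1, 0)"]) (use D in \<open>auto simp: D1_eq Basis_plane\<close>)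
qed

lemma Ck_on_D2:
 assumes "open U" "Ck_on (Suc m) U f"
 shows "Ck_on m U (D2 f)"
proof -
 obtain D where D: "\<forall>x\<in>U. (f has_derivative D x) (at x)" "\<forall>b\<in>Basis. Ck_on m U (%x. D x b)"
  using assms by auto
 show ?thesis
  by (rule Ck_on_cong[OF assms(1), of "%x. D x (0, 1)"]) (use D in \<open>auto simp: D2_eq Basis_plane\<close>)
qed

lemma vector_derivative_bound:
 fixes f :: "real => 'a::real_normed_vector"
 assumes "a <= b" "!!x. x : {a..b} ==> (f has_vector_derivative f' x) (at x)"
  "!!x. x : {a..b} ==> norm (f' x) <= B"
 shows "norm (f b - f a) <= B * (b - a)"
proof -
 have "norm (f b - f a) <= B * norm (b - a)"
 proof (rule differentiable_bound[of "{a..b}" f "%x h. h *\<^sub>R f' x"])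
  show "(f has_derivative (%h. h *\<^sub>R f' x)) (at x within {a..b})" if "x : {a..b}" for x
   using assms(2)[OF that] by (auto simp: has_vector_derivative_def intro: has_derivative_at_withinI)
  show "onorm (%h. h *\<^sub>R f' x) <= B" if "x : {a..b}" for x
   using assms(3)[OF that] by (intro onorm_le) (simp add: mult.commute[of B] mult_left_mono)
 qed (use assms in auto)
 thus ?thesis using assms(1) by simp
qed

text \<open>Two applications of the mean value inequality, first in x and then in y, compare the
  second difference over a square of side h with h^2 times the mixed derivative. The argument treats
  the variables differently, but the second difference is symmetric in them.\<close>

lemma mixed_difference_bound:
 assumes U: "open U" "(a, b) : U" and f: "Ck_on 2 U f" and e: "e > 0"
 shows "\<exists>d>0. \<forall>h. 0 < h & h < d -->
  norm (f (a + h, b + h) - f (a + h, b) - f (a, b + h) + f (a, b) - h\<^sup>2 *\<^sub>R D2 (D1 f) (a, b)) <= e * h\<^sup>2"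
proof -
 have f2: "Ck_on (Suc (Suc 0)) U f" using f by (simp add: numeral_2_eq_2)
 have f1: "Ck_on (Suc 0) U (D1 f)" by (rule Ck_on_D1[OF U(1) f2])
 let ?c = "D2 (D1 f) (a, b)"
 have "continuous_on U (D2 (D1 f))" by (rule Ck_on_continuous[OF Ck_on_D2[OF U(1) f1]])
 hence "isCont (D2 (D1 f)) (a, b)" using U continuous_on_eq_continuous_at by blast
 then obtain d1 where d1: "d1 > 0" "!!z. dist z (a, b) < d1 ==> dist (D2 (D1 f) z) ?c < e"
  using e unfolding continuous_at_eps_delta by blast
 obtain d2 where d2: "d2 > 0" "ball (a, b) d2 <= U" using U open_contains_ball by blast
 define d where "d = min d1 d2 / 2"
 have near: "(x, y) : U & norm (D2 (D1 f) (x, y) - ?c) <= e"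
  if "x : {a..a + h}" "y : {b..b + h}" "0 < h" "h < d" for x y h
 proof -
  have "dist (x, y) (a, b) <= \<bar>x - a\<bar> + \<bar>y - b\<bar>"
   using sqrt_sum_squares_le_sum_abs[of "x - a" "y - b"] by (simp add: dist_Pair_Pair dist_real_def)
  also have "... < min d1 d2" using that d_def by auto
  finally have "dist (x, y) (a, b) < min d1 d2" .
  hence "dist (x, y) (a, b) < d1" "(x, y) : ball (a, b) d2" by (auto simp: dist_commute)
  with d1(2) d2(2) show ?thesis by (force simp: dist_norm)
 qed
 have "norm (f (a + h, b + h) - f (a + h, b) - f (a, b + h) + f (a, b) - h\<^sup>2 *\<^sub>R ?c) <= e * h\<^sup>2"
  if h: "0 < h" "h < d" for h
 proof -
  \<comment> \<open>The subtracted linear term makes the increment of this function over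
    \<open>{a..a + h}\<close> exactly the quantity to be bounded.\<close>
  let ?p = "%x. f (x, b + h) - f (x, b) - (x - a) *\<^sub>R (h *\<^sub>R ?c)"
  have n: "norm (?p (a + h) - ?p a) <= (e * h) * (a + h - a)"
  proof (rule vector_derivative_bound[of _ _ _ "%x. D1 f (x, b + h) - D1 f (x, b) - h *\<^sub>R ?c"])
   fix x assume x: "x : {a..a + h}"
   have "((%t. f (t, y)) has_vector_derivative D1 f (x, y)) (at x)" if "y : {b..b + h}" for y
    using has_derivative_D1[OF Ck_on_has_derivative[OF f2]] near[OF x that h] by fastforce
   thus "(?p has_vector_derivative D1 f (x, b + h) - D1 f (x, b) - h *\<^sub>R ?c) (at x)"
    using h by (auto intro!: derivative_eq_intros)
   let ?q = "%y. D1 f (x, y) - (y - b) *\<^sub>R ?c"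
   have "norm (?q (b + h) - ?q b) <= e * (b + h - b)"
   proof (rule vector_derivative_bound[of _ _ _ "%y. D2 (D1 f) (x, y) - ?c"])
    fix y assume y: "y : {b..b + h}"
    have "((%t. D1 f (x, t)) has_vector_derivative D2 (D1 f) (x, y)) (at y)"
     using has_derivative_D2[OF Ck_on_has_derivative[OF f1]] near[OF x y h] by fastforce
    thus "(?q has_vector_derivative D2 (D1 f) (x, y) - ?c) (at y)"
     by (auto intro!: derivative_eq_intros)
    show "norm (D2 (D1 f) (x, y) - ?c) <= e" using near[OF x y h] by blast
   qed (use h in auto)
   thus "norm (D1 f (x, b + h) - D1 f (x, b) - h *\<^sub>R ?c) <= e * h" by (simp add: algebra_simps)
  qed (use h in auto)
  have eq: "?p (a + h) - ?p a = f (a + h, b + h) - f (a + h, b) - f (a, b + h) + f (a, b) - h\<^sup>2 *\<^sub>R ?c"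
   by (simp add: power2_eq_square)
  show ?thesis using n unfolding eq by (simp add: power2_eq_square mult.assoc)
 qed
 thus ?thesis using d1(1) d2(1) by (intro exI[of _ d]) (auto simp: d_def)
qed

text \<open>Exchanging the variables turns one mixed derivative into the other and leaves the second
  difference unchanged, so both are limits of the same quotients.\<close>

lemma D2_D1_commute:
 assumes U: "open U" "z : U" and f: "Ck_on 2 U f"
 shows "D2 (D1 f) z = D1 (D2 f) z"
proof (rule ccontr)
 obtain a b where z: "z = (a, b)" by fastforce
 assume ne: "D2 (D1 f) z ~= D1 (D2 f) z"
 \<comment> \<open>With a third of the supposed gap as tolerance, the two estimates together leave
   room for at most two thirds of it.\<close>
 define e where "e = norm (D2 (D1 f) z - D1 (D2 f) z) / 3"
 have e: "e > 0" using ne by (simp add: e_def)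
 let ?s = "%z :: real \<times> real. (snd z, fst z)"
 let ?g = "%z. f (?s z)"
 let ?V = "?s -` U"
 have so: "open ?V" by (intro open_vimage U(1) continuous_intros)
 have "Ck_on 2 ?V ?s"
  by (rule bounded_linear.Ck_on_compose_linear[OF
    bounded_linear_Pair[OF bounded_linear_snd bounded_linear_fst] Ck_on_ident])
 hence s: "Ck_on 2 ?V ?g" by (rule Ck_on_compose[OF so f]) auto
 have eq: "D2 (D1 ?g) (b, a) = D1 (D2 f) (a, b)"
  by (simp add: radial_derivative_def angular_derivative_def)
 obtain d where d: "d > 0" "!!h. 0 < h ==> h < d ==>
  norm (f (a + h, b + h) - f (a + h, b) - f (a, b + h) + f (a, b) - h\<^sup>2 *\<^sub>R D2 (D1 f) (a, b)) <= e * h\<^sup>2"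
  using mixed_difference_bound[OF U(1) _ f e] U(2) z by metis
 obtain d' where d': "d' > 0" "!!h. 0 < h ==> h < d' ==>
  norm (?g (b + h, a + h) - ?g (b + h, a) - ?g (b, a + h) + ?g (b, a) - h\<^sup>2 *\<^sub>R D2 (D1 ?g) (b, a)) <= e * h\<^sup>2"
  using mixed_difference_bound[OF so _ s e, of b a] U(2) z by auto
 define h where "h = min d d' / 2"
 have h: "0 < h" "h < d" "h < d'" using d(1) d'(1) by (auto simp: h_def)
 let ?X = "f (a + h, b + h) - f (a + h, b) - f (a, b + h) + f (a, b)"
 have 1: "norm (?X - h\<^sup>2 *\<^sub>R D2 (D1 f) (a, b)) <= e * h\<^sup>2" using d(2) h by blast
 have 2: "norm (?X - h\<^sup>2 *\<^sub>R D1 (D2 f) (a, b)) <= e * h\<^sup>2"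
  using d'(2)[OF h(1) h(3)] by (simp add: eq algebra_simps)
 have "norm (h\<^sup>2 *\<^sub>R D2 (D1 f) (a, b) - h\<^sup>2 *\<^sub>R D1 (D2 f) (a, b)) <= e * h\<^sup>2 + e * h\<^sup>2"
  using norm_triangle_le_diff[of "?X - h\<^sup>2 *\<^sub>R D1 (D2 f) (a, b)" "?X - h\<^sup>2 *\<^sub>R D2 (D1 f) (a, b)" "e * h\<^sup>2 + e * h\<^sup>2"] 1 2
  by simp
 hence "h\<^sup>2 * (3 * e) <= h\<^sup>2 * (2 * e)"
  by (simp add: e_def z algebra_simps flip: scaleR_diff_right)
 thus False using h e by simp
qed

lemma D1_add: "f differentiable (at z) ==> g differentiable (at z) ==> D1 (%x. f x + g x) z = D1 f z + D1 g z"
 and D2_add: "f differentiable (at z) ==> g differentiable (at z) ==> D2 (%x. f x + g x) z = D2 f z + D2 g z"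
proof -
 assume "f differentiable (at z)" "g differentiable (at z)"
 then obtain F G where F: "(f has_derivative F) (at z)" and G: "(g has_derivative G) (at z)"
  by (auto simp: differentiable_def)
 have H: "((%x. f x + g x) has_derivative (%h. F h + G h)) (at z)" by (rule has_derivative_add[OF F G])
 show "D1 (%x. f x + g x) z = D1 f z + D1 g z" by (simp only: D1_eq[OF F] D1_eq[OF G] D1_eq[OF H])
 show "D2 (%x. f x + g x) z = D2 f z + D2 g z" by (simp only: D2_eq[OF F] D2_eq[OF G] D2_eq[OF H])
qed

lemma D1_mult: "f differentiable (at z) ==> g differentiable (at z) ==> D1 (%x. f x * g x) z = D1 f z * g z + f z * D1 g z"
 and D2_mult: "f differentiable (at z) ==> g differentiable (at z) ==> D2 (%x. f x * g x) z = D2 f z * g z + f z * D2 g z"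
proof -
 assume "f differentiable (at z)" "g differentiable (at z)"
 then obtain F G where F: "(f has_derivative F) (at z)" and G: "(g has_derivative G) (at z)"
  by (auto simp: differentiable_def)
 have H: "((%x. f x * g x) has_derivative (%h. f z * G h + F h * g z)) (at z)"
  by (rule has_derivative_mult[OF F G])
 show "D1 (%x. f x * g x) z = D1 f z * g z + f z * D1 g z"
  by (simp only: D1_eq[OF F] D1_eq[OF G] D1_eq[OF H] add.commute)
 show "D2 (%x. f x * g x) z = D2 f z * g z + f z * D2 g z"
  by (simp only: D2_eq[OF F] D2_eq[OF G] D2_eq[OF H] add.commute)
qed

lemma D1_const [simp]: "D1 (%x. c) z = 0" and D2_const [simp]: "D2 (%x. c) z = 0"
 using D1_eq[OF has_derivative_const] D2_eq[OF has_derivative_const] by blast+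

lemma differentiable_sum_list:
 "(!!l. l : set L ==> f l differentiable (at z)) ==> (%x. \<Sum>l\<leftarrow>L. f l x) differentiable (at z)"
 by (induction L) auto

lemma D1_sum_list: "(!!l. l : set L ==> f l differentiable (at z)) ==> D1 (%x. \<Sum>l\<leftarrow>L. f l x) z = (\<Sum>l\<leftarrow>L. D1 (f l) z)"
 by (induction L) (simp_all add: D1_add differentiable_sum_list)

lemma D2_sum_list: "(!!l. l : set L ==> f l differentiable (at z)) ==> D2 (%x. \<Sum>l\<leftarrow>L. f l x) z = (\<Sum>l\<leftarrow>L. D2 (f l) z)"
 by (induction L) (simp_all add: D2_add differentiable_sum_list)

text \<open>The order of differentiation is that of \<open>weighted_term\<close>, so that in polar
  coordinates these are literally the derivatives of the weighted norm; the same notation serves for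
  Cartesian coordinates.\<close>

definition partials :: "nat => nat => (real \<times> real => complex) => real \<times> real => complex" where
 "partials a b f = (D1 ^^ a) ((D2 ^^ b) f)"

lemma Ck_on_D2_iter: "open U ==> Ck_on (b + m) U f ==> Ck_on m U ((D2 ^^ b) f)"
proof (induction b arbitrary: m)
 case (Suc b)
 hence "Ck_on (Suc m) U ((D2 ^^ b) f)" by (metis add_Suc_right add_Suc)
 thus ?case using Ck_on_D2[OF Suc.prems(1)] by simp
qed simp

lemma Ck_on_D1_iter: "open U ==> Ck_on (b + m) U f ==> Ck_on m U ((D1 ^^ b) f)"
proof (induction b arbitrary: m)
 case (Suc b)
 hence "Ck_on (Suc m) U ((D1 ^^ b) f)" by (metis add_Suc_right add_Suc)
 thus ?case using Ck_on_D1[OF Suc.prems(1)] by simp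
qed simp

lemma Ck_on_partials: "open U ==> Ck_on (a + b + m) U f ==> Ck_on m U (partials a b f)"
 unfolding partials_def by (intro Ck_on_D1_iter Ck_on_D2_iter) (auto simp: add.assoc add.left_commute)

lemma D1_partials: "D1 (partials a b f) = partials (Suc a) b f"
 by (simp add: partials_def)

lemma D1_iter_cong:
 assumes "open U" "z : U" "!!x. x : U ==> f x = g x"
 shows "(D1 ^^ a) f z = (D1 ^^ a) g z"
 using assms(2)
proof (induction a arbitrary: z)
 case (Suc a)
 thus ?case by (simp, intro D1_cong[OF assms(1)]) auto
qed (use assms in auto)

lemma D2_iter_cong:
 assumes "open U" "z : U" "!!x. x : U ==> f x = g x"
 shows "(D2 ^^ a) f z = (D2 ^^ a) g z"
 using assms(2)
proof (induction a arbitrary: z)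
 case (Suc a)
 thus ?case by (simp, intro D2_cong[OF assms(1)]) auto
qed (use assms in auto)

lemma partials_cong:
 assumes "open U" "z : U" "!!x. x : U ==> f x = g x"
 shows "partials a b f z = partials a b g z"
 unfolding partials_def
 by (rule D1_iter_cong[OF assms(1,2)]) (rule D2_iter_cong[OF assms(1) _ assms(3)])

lemma D2_D1_iter:
 assumes "open U" "z : U" "Ck_on (Suc a) U f"
 shows "D2 ((D1 ^^ a) f) z = (D1 ^^ a) (D2 f) z"
 using assms(2,3)
proof (induction a arbitrary: z)
 case (Suc a)
 have "Ck_on 2 U ((D1 ^^ a) f)" by (rule Ck_on_D1_iter[OF assms(1)]) (use Suc.prems in \<open>simp del: Ck_on.simps\<close>)
 hence "D2 ((D1 ^^ Suc a) f) z = D1 (D2 ((D1 ^^ a) f)) z"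
  using D2_D1_commute[OF assms(1) Suc.prems(1)] by simp
 also have "... = D1 ((D1 ^^ a) (D2 f)) z"
  by (rule D1_cong[OF assms(1) Suc.prems(1)])
   (rule Suc.IH, assumption, rule Ck_on_Suc_imp[OF Suc.prems(2)])
 finally show ?case by simp
qed simp

text \<open>The new derivative has to be moved past \<open>a\<close> derivatives in the first
  variable, one exchange at a time; this is what the smoothness of order \<open>Suc (a + b)\<close>
  is for.\<close>

lemma D2_partials:
 assumes "open U" "z : U" "Ck_on (Suc (a + b)) U f"
 shows "D2 (partials a b f) z = partials a (Suc b) f z"
proof -
 have "Ck_on (Suc a) U ((D2 ^^ b) f)"
  by (rule Ck_on_D2_iter[OF assms(1)]) (use assms(3) in \<open>simp add: add.commute del: Ck_on.simps\<close>)
 from D2_D1_iter[OF assms(1,2) this] show ?thesis by (simp add: partials_def)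
qed

section \<open>Higher derivatives under a change of coordinates\<close>

lemma chain_rule_aux:
 fixes L :: "real \<times> real => real \<times> real"
 assumes L: "(L has_derivative DL) (at z)" and h: "(h has_derivative Dh) (at (L z))"
 shows "D1 (%z. h (L z)) z = of_real (fst (DL (1, 0))) * D1 h (L z) + of_real (snd (DL (1, 0))) * D2 h (L z)"
  and "D2 (%z. h (L z)) z = of_real (fst (DL (0, 1))) * D1 h (L z) + of_real (snd (DL (0, 1))) * D2 h (L z)"
proof -
 interpret linear Dh using h by (rule has_derivative_linear)
 have e: "Dh v = of_real (fst v) * D1 h (L z) + of_real (snd v) * D2 h (L z)" for v
 proof -
  have "Dh (fst v *\<^sub>R (1, 0) + snd v *\<^sub>R (0, 1)) = fst v *\<^sub>R D1 h (L z) + snd v *\<^sub>R D2 h (L z)"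
   by (simp only: add scale D1_eq[OF h] D2_eq[OF h])
  thus ?thesis by (cases v) (simp add: scaleR_conv_of_real)
 qed
 have H: "((%z. h (L z)) has_derivative (%v. Dh (DL v))) (at z)"
  by (rule has_derivative_compose[OF L h])
 show "D1 (%z. h (L z)) z = of_real (fst (DL (1, 0))) * D1 h (L z) + of_real (snd (DL (1, 0))) * D2 h (L z)"
  by (simp only: D1_eq[OF H] e)
 show "D2 (%z. h (L z)) z = of_real (fst (DL (0, 1))) * D1 h (L z) + of_real (snd (DL (0, 1))) * D2 h (L z)"
  by (simp only: D2_eq[OF H] e)
qed

lemma sum_list_concat_map: "(\<Sum>l\<leftarrow>concat (map F L). f l) = (\<Sum>l\<leftarrow>L. \<Sum>x\<leftarrow>F l. f x)"
 for f :: "_ => 'a::comm_monoid_add"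
 by (induction L) auto

text \<open>Induction on the order by the chain and product rules. Three features matter later: the
  list \<open>T\<close> does not depend on \<open>f\<close>; its coefficients are continuous on the
  larger set \<open>W\<close>, hence bounded on compact subsets of it; and no derivative of order
  zero occurs, in accordance with the range of the multi-indices in the weighted norm.\<close>

lemma partials_compose:
 fixes L :: "real \<times> real => real \<times> real"
 assumes op: "open V" "open D" "open W" "V <= W" and L: "Ck_on k W L" "L ` V <= D"
  and ab: "1 <= a + b" "a + b <= k"
 shows "\<exists>T :: ((real \<times> real => complex) \<times> nat \<times> nat) list.
  (\<forall>(c, p, q)\<in>set T. Ck_on (k - (a + b)) W c & 1 <= p + q & p + q <= a + b) &
  (\<forall>f. Ck_on k D f --> (\<forall>z\<in>V. partials a b (%z. f (L z)) z = (\<Sum>(c, p, q)\<leftarrow>T. c z * partials p q f (L z))))"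
proof -
 obtain k' where k': "k = Suc k'" using ab by (cases k) auto
 obtain DL where DL: "!!z. z : W ==> (L has_derivative DL z) (at z)"
   "!!v. v : Basis ==> Ck_on k' W (%z. DL z v)"
  using L(1) unfolding k' by auto
 \<comment> \<open>\<open>E i j\<close> is an entry of the Jacobian matrix of \<open>L\<close>:
   \<open>i\<close> selects the direction of differentiation and \<open>j\<close> the
   component.\<close>
 define E where "E i j z = (complex_of_real ((if j then fst else snd) (DL z (if i then (1, 0) else (0, 1)))))" for i j z
 have E: "Ck_on k' W (E i j)" for i j
 proof -
  have bl: "bounded_linear (%v. complex_of_real ((if j then fst else snd) v) :: complex)"
   by (cases j) (auto intro: bounded_linear_compose[OF bounded_linear_of_real] bounded_linear_fst bounded_linear_snd)
  have "Ck_on k' W (%z. DL z (if i then (1, 0) else (0, 1)))" by (rule DL(2)) (auto simp: Basis_plane)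
  from bounded_linear.Ck_on_compose_linear[OF bl this] show ?thesis unfolding E_def .
 qed
 define d where "d i = (if i then D1 else D2)" for i :: bool
 \<comment> \<open>One further derivative of a single term falls on the coefficient, or on
   \<open>partials p q f\<close> through either component of \<open>L\<close>.\<close>
 define step where "step i = (%(c, p :: nat, q :: nat). [(d i c, p, q), (%z. c z * E i True z, Suc p, q), (%z. c z * E i False z, p, Suc q)])" for i
 have d_step: "d i (%z. c z * partials p q f (L z)) z = (\<Sum>(c, p, q)\<leftarrow>step i (c, p, q). c z * partials p q f (L z))"
  if c: "c differentiable (at z)" and z: "z : V" and f: "Ck_on (Suc (p + q)) D f" for i c p q f z
 proof -
  have zW: "z : W" and zD: "L z : D" using op z L by auto
  have "Ck_on (Suc 0) D (partials p q f)"
   by (rule Ck_on_partials[OF op(2)]) (use f in \<open>simp del: Ck_on.simps\<close>)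
  from Ck_on_has_derivative[OF this zD]
  have h: "(partials p q f has_derivative (%h. fst h *\<^sub>R D1 (partials p q f) (L z) + snd h *\<^sub>R D2 (partials p q f) (L z))) (at (L z))" .
  have dif: "(%z. partials p q f (L z)) differentiable (at z)"
   using has_derivative_compose[OF DL(1)[OF zW] h] by (auto simp: differentiable_def)
  note ch = chain_rule_aux[OF DL(1)[OF zW] h]
  show ?thesis
   by (cases i) (simp_all add: d_def step_def D1_mult[OF c dif] D2_mult[OF c dif] ch E_def D1_partials
     D2_partials[OF op(2) zD f] algebra_simps)
 qed
 have Esuc: "\<exists>T. (\<forall>(c, p, q)\<in>set T. Ck_on (k - (Suc m)) W c & 1 <= p + q & p + q <= Suc m) &
  (\<forall>f. Ck_on k D f --> (\<forall>z\<in>V. d i (%z. \<Sum>(c, p, q)\<leftarrow>S. c z * partials p q f (L z)) z = (\<Sum>(c, p, q)\<leftarrow>T. c z * partials p q f (L z))))"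
  if S: "\<forall>(c, p, q)\<in>set S. Ck_on (k - m) W c & 1 <= p + q & p + q <= m" and m: "Suc m <= k" for S m i
 proof (intro exI[of _ "concat (map (step i) S)"] conjI allI impI ballI)
  have km: "k - m = Suc (k - Suc m)" using m by simp
  have "Ck_on (k - Suc m) W c' & 1 <= p' + q' & p' + q' <= Suc m"
   if "(c, p, q) : set S" "(c', p', q') : set (step i (c, p, q))" for c p q c' p' q'
  proof -
   have c: "Ck_on (Suc (k - Suc m)) W c" and pq: "1 <= p + q" "p + q <= m" using S that(1) km by fastforce+
   have "Ck_on (k - Suc m) W (D1 c)" "Ck_on (k - Suc m) W (D2 c)"
    using Ck_on_D1[OF op(3) c] Ck_on_D2[OF op(3) c] by blast+
   moreover have "Ck_on (k - Suc m) W (%z. c z * E i j z)" for i j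
    by (rule Ck_on_mult[OF Ck_on_Suc_imp[OF c] Ck_on_le[OF E]]) (simp add: k')
   ultimately show ?thesis using that(2) pq by (auto simp: step_def d_def)
  qed
  thus "case x of (c, p, q) => Ck_on (k - Suc m) W c & 1 <= p + q & p + q <= Suc m"
   if "x : set (concat (map (step i) S))" for x using that by fastforce
  fix f :: "real \<times> real => complex" and z assume f: "Ck_on k D f" and z: "z : V"
  have zW: "z : W" and zD: "L z : D" using op z L by auto
  have cd: "c differentiable (at z)" if "(c, p, q) : set S" for c p q
   using S that km zW by (metis (no_types, lifting) Ck_on_differentiable case_prodD)
  have fd: "Ck_on (Suc (p + q)) D f" if "(c, p, q) : set S" for c p q
  proof (rule Ck_on_le[OF f])
   have "p + q <= m" using S that by blast
   thus "Suc (p + q) <= k" using m by simp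
  qed
  have dd: "(%z. (case l of (c, p, q) => %z. c z * partials p q f (L z)) z) differentiable (at z)" if lS: "l : set S" for l
  proof -
   obtain c p q where l: "l = (c, p, q)" by (metis prod_cases3)
   have "Ck_on (Suc 0) D (partials p q f)"
    by (rule Ck_on_partials[OF op(2)]) (use fd lS l in \<open>simp del: Ck_on.simps\<close>)
   from Ck_on_has_derivative[OF this zD] has_derivative_compose[OF DL(1)[OF zW]]
   have "(%z. partials p q f (L z)) differentiable (at z)" unfolding differentiable_def by blast
   thus ?thesis using cd lS l by auto
  qed
  have "d i (%z. \<Sum>l\<leftarrow>S. (case l of (c, p, q) => %z. c z * partials p q f (L z)) z) z
   = (\<Sum>l\<leftarrow>S. d i (%z. (case l of (c, p, q) => %z. c z * partials p q f (L z)) z) z)"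
   unfolding d_def by (cases i) (simp_all only: if_True if_False D1_sum_list[OF dd] D2_sum_list[OF dd])
  also have "... = (\<Sum>l\<leftarrow>S. \<Sum>(c, p, q)\<leftarrow>step i l. c z * partials p q f (L z))"
  proof (intro arg_cong[of _ _ sum_list] map_cong refl)
   fix l assume lS: "l : set S"
   obtain c p q where l: "l = (c, p, q)" by (metis prod_cases3)
   show "d i (%z. (case l of (c, p, q) => %z. c z * partials p q f (L z)) z) z = (\<Sum>(c, p, q)\<leftarrow>step i l. c z * partials p q f (L z))"
    unfolding l prod.case by (rule d_step[OF cd[OF lS[unfolded l]] z fd[OF lS[unfolded l]]])
  qed
  finally show "d i (%z. \<Sum>(c, p, q)\<leftarrow>S. c z * partials p q f (L z)) z = (\<Sum>(c, p, q)\<leftarrow>concat (map (step i) S). c z * partials p q f (L z))"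
   by (simp add: sum_list_concat_map case_prod_unfold)
 qed
 have base: "\<exists>T. (\<forall>(c, p, q)\<in>set T. Ck_on (k - 1) W c & 1 <= p + q & p + q <= 1) &
  (\<forall>f. Ck_on k D f --> (\<forall>z\<in>V. d i (%z. f (L z)) z = (\<Sum>(c, p, q)\<leftarrow>T. c z * partials p q f (L z))))" for i
 proof (intro exI[of _ "[(E i True, 1, 0), (E i False, 0, 1)]"] conjI allI impI ballI)
  fix f :: "real \<times> real => complex" and z assume f: "Ck_on k D f" and z: "z : V"
  have "Ck_on (Suc (0 + 0)) D f" by (rule Ck_on_le[OF f]) (simp add: k')
  \<comment> \<open>The constant coefficient 1 makes the term with the differentiated coefficient
    vanish; this is why no derivative of order zero survives.\<close>
  from d_step[OF _ z this, of "%z. 1" i]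
  show "d i (%z. f (L z)) z = (\<Sum>(c, p, q)\<leftarrow>[(E i True, 1, 0), (E i False, 0, 1)]. c z * partials p q f (L z))"
   by (cases i) (simp_all add: step_def d_def partials_def)
 qed (use E k' in auto)
 have main: "1 <= m ==> m <= k ==> \<forall>a b. a + b = m --> (\<exists>T. (\<forall>(c, p, q)\<in>set T. Ck_on (k - m) W c & 1 <= p + q & p + q <= m) &
  (\<forall>f. Ck_on k D f --> (\<forall>z\<in>V. partials a b (%z. f (L z)) z = (\<Sum>(c, p, q)\<leftarrow>T. c z * partials p q f (L z)))))" for m
 proof (induction m)
  case (Suc m)
  show ?case
  proof (intro allI impI)
   fix a b assume abm: "a + b = Suc m"
   obtain i a' b' where i: "a' + b' = m" "!!f. partials a b f = d i (partials a' b' f)"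
   proof (cases a)
    case 0
    with abm have "partials a b f = d False (partials 0 m f)" for f by (simp add: partials_def d_def)
    with that[of 0 m False] show ?thesis by simp
   next
    case (Suc a')
    have "partials a b f = d True (partials a' b f)" for f by (simp add: partials_def d_def Suc)
    with that[of a' b True] Suc abm show ?thesis by simp
   qed
   show "\<exists>T. (\<forall>(c, p, q)\<in>set T. Ck_on (k - Suc m) W c & 1 <= p + q & p + q <= Suc m) &
    (\<forall>f. Ck_on k D f --> (\<forall>z\<in>V. partials a b (%z. f (L z)) z = (\<Sum>(c, p, q)\<leftarrow>T. c z * partials p q f (L z))))"
   proof (cases "m = 0")
    case True
    hence "a' = 0" "b' = 0" using i by auto
    thus ?thesis using base[of i] i(2) True by (simp add: partials_def)
   next
    case False
    hence "1 <= m" "m <= k" using Suc.prems by auto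
    from Suc.IH[OF this, rule_format, OF i(1)] obtain S where S: "\<forall>(c, p, q)\<in>set S. Ck_on (k - m) W c & 1 <= p + q & p + q <= m"
     "!!f z. Ck_on k D f ==> z : V ==> partials a' b' (%z. f (L z)) z = (\<Sum>(c, p, q)\<leftarrow>S. c z * partials p q f (L z))"
     by blast
    have "d i (partials a' b' (%z. f (L z))) z = d i (%z. \<Sum>(c, p, q)\<leftarrow>S. c z * partials p q f (L z)) z"
     if "Ck_on k D f" "z : V" for f z
     unfolding d_def using D1_cong[OF op(1) that(2) S(2)[OF that(1)]] D2_cong[OF op(1) that(2) S(2)[OF that(1)]] by simp
    thus ?thesis using Esuc[OF S(1) Suc.prems(2), of i] i(2) by simp
   qed
  qed
 qed simp
 from main[of "a + b"] ab show ?thesis by blast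
qed

section \<open>Polar coordinates\<close>

inductive trig :: "(real => real) => bool" where
 trig_const: "trig (%x. c)"
| trig_cos: "trig cos"
| trig_sin: "trig sin"
| trig_add: "trig f ==> trig g ==> trig (%x. f x + g x)"
| trig_mult: "trig f ==> trig g ==> trig (%x. f x * g x)"

lemma trig_uminus: "trig f ==> trig (%x. - f x)"
 using trig_mult[OF trig_const[of "-1"], of f] by simp

text \<open>Trigonometric polynomials contain the entries of a rotation and are closed under the
  product rule, so all angular coefficients below stay in this class; being bounded, they lead to
  constants that do not depend on the angle.\<close>

lemma trig_derivative: "trig f ==> \<exists>f'. trig f' & (\<forall>x. (f has_real_derivative f' x) (at x))"
proof (induction rule: trig.induct)
 case (trig_const c)
 thus ?case using trig.trig_const[of 0] by (intro exI[of _ "%x. 0"]) auto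
next
 case trig_cos
 thus ?case using trig_uminus[OF trig_sin] DERIV_cos by blast
next
 case trig_sin
 thus ?case using trig.trig_cos DERIV_sin by blast
next
 case (trig_add f g)
 then obtain f' g' where d: "trig f'" "trig g'" "!!x. (f has_real_derivative f' x) (at x)"
  "!!x. (g has_real_derivative g' x) (at x)" by blast
 show ?case using trig.trig_add[OF d(1,2)] DERIV_add[OF d(3,4)] by blast
next
 case (trig_mult f g)
 then obtain f' g' where d: "trig f'" "trig g'" "!!x. (f has_real_derivative f' x) (at x)"
  "!!x. (g has_real_derivative g' x) (at x)" by blast
 have "trig (%x. f x * g' x + f' x * g x)"
  by (intro trig.trig_add trig.trig_mult d trig_mult.hyps)
 moreover have "((%x. f x * g x) has_real_derivative (f x * g' x + f' x * g x)) (at x)" for x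
  using DERIV_mult[OF d(3,4)] by (simp add: mult.commute add.commute)
 ultimately show ?case by blast
qed

lemma trig_bounded: "trig f ==> \<exists>B. \<forall>x. \<bar>f x\<bar> <= B"
proof (induction rule: trig.induct)
 case (trig_add f g)
 then obtain A B where "!!x. \<bar>f x\<bar> <= A" "!!x. \<bar>g x\<bar> <= B" by blast
 hence "\<bar>f x + g x\<bar> <= A + B" for x by (meson abs_triangle_ineq add_mono order_trans)
 thus ?case by blast
next
 case (trig_mult f g)
 then obtain A B where ab: "!!x. \<bar>f x\<bar> <= A" "!!x. \<bar>g x\<bar> <= B" by blast
 hence "\<bar>f x * g x\<bar> <= A * B" for x
  unfolding abs_mult by (intro mult_mono ab) (use abs_ge_zero[of "f 0"] ab(1)[of 0] in linarith, simp)
 thus ?case by blast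
qed (auto intro: exI[of _ "1"])

definition polar :: "real \<times> real => real \<times> real" where
 "polar x = (fst x * cos (snd x), fst x * sin (snd x))"

lemma polar_Pair: "polar (r, t) = (r * cos t, r * sin t)"
 by (simp add: polar_def)

lemma polar_derivative:
 "(polar has_derivative (%h. (fst h * cos (snd x) - fst x * sin (snd x) * snd h,
   fst h * sin (snd x) + fst x * cos (snd x) * snd h))) (at x)"
 unfolding polar_def[abs_def] by (auto intro!: derivative_eq_intros simp: algebra_simps)

lemma Ck_on_of_real_fst: "Ck_on m U (%x. fst x :: real)" and Ck_on_snd: "Ck_on m U (%x. snd x :: real)"
 by (auto intro!: bounded_linear.Ck_on_compose_linear[OF bounded_linear_fst Ck_on_ident]
   bounded_linear.Ck_on_compose_linear[OF bounded_linear_snd Ck_on_ident] simp del: Ck_on.simps)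

lemma trig_Ck_on_snd: "trig C ==> Ck_on m U (%x :: real \<times> real. C (snd x))"
proof (induction m arbitrary: C)
 case 0
 then obtain C' where "!!x. (C has_real_derivative C' x) (at x)" using trig_derivative by blast
 hence "continuous_on UNIV C" using DERIV_isCont continuous_at_imp_continuous_on by blast
 thus ?case by (auto intro!: continuous_on_compose2[of UNIV C] continuous_intros)
next
 case (Suc m)
 then obtain C' where C': "trig C'" "!!x. (C has_real_derivative C' x) (at x)" using trig_derivative by blast
 show ?case
 proof (rule Ck_on_SucI[where D = "%x h. C' (snd x) * snd h"])
  show "((%x. C (snd x)) has_derivative (%h. C' (snd x) * snd h)) (at x)" for x :: "real \<times> real"
   using has_derivative_compose[OF has_derivative_snd[OF has_derivative_ident] C'(2)[of "snd x", unfolded has_field_derivative_def]]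
   by simp
  show "Ck_on m U (%x. C' (snd x) * snd b)" for b :: "real \<times> real"
   by (rule Ck_on_mult[OF Suc.IH[OF C'(1)] Ck_on_const])
 qed
qed

lemma Ck_on_Pair:
 assumes "Ck_on m U f" "Ck_on m U g"
 shows "Ck_on m U (%x. (f x, g x))"
proof -
 have "Ck_on m U (%x. (f x, 0) + (0, g x))"
  by (intro Ck_on_add bounded_linear.Ck_on_compose_linear[OF bounded_linear_Pair[OF bounded_linear_ident bounded_linear_zero] assms(1)]
   bounded_linear.Ck_on_compose_linear[OF bounded_linear_Pair[OF bounded_linear_zero bounded_linear_ident] assms(2)])
 thus ?thesis by simp
qed

lemma Ck_on_polar: "Ck_on m U polar"
 unfolding polar_def[abs_def]
 by (intro Ck_on_Pair Ck_on_mult Ck_on_of_real_fst trig_Ck_on_snd trig_cos trig_sin)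

lemma continuous_polar: "continuous_on U polar"
 by (rule Ck_on_continuous[OF Ck_on_polar])

text \<open>The polar derivatives are the Cartesian ones after a rotation, with an additional factor
  r in the angular one; these formulas invert that relation.\<close>

lemma polar_partials_aux:
 assumes h: "(h has_derivative Dh) (at (polar (r, t)))" and r: "r > 0"
 shows "D1 h (polar (r, t)) = of_real (cos t) * D1 (%z. h (polar z)) (r, t) - of_real (sin t / r) * D2 (%z. h (polar z)) (r, t)"
  and "D2 h (polar (r, t)) = of_real (sin t) * D1 (%z. h (polar z)) (r, t) + of_real (cos t / r) * D2 (%z. h (polar z)) (r, t)"
proof -
 define A B where "A = D1 h (polar (r, t))" and "B = D2 h (polar (r, t))"
 define c s :: complex where "c = of_real (cos t)" and "s = of_real (sin t)"
 have cs: "c * c + s * s = 1" unfolding c_def s_def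
  by (metis of_real_1 of_real_add of_real_mult power2_eq_square sin_cos_squared_add2)
 have 1: "D1 (%z. h (polar z)) (r, t) = c * A + s * B"
  and 2: "D2 (%z. h (polar z)) (r, t) = of_real r * (c * B - s * A)"
  using chain_rule_aux[OF polar_derivative h] by (simp_all add: A_def B_def c_def s_def algebra_simps)
 have r0: "complex_of_real r ~= 0" using r by simp
 have st: "complex_of_real (sin t / r) = s / of_real r" "complex_of_real (cos t / r) = c / of_real r"
  by (simp_all add: c_def s_def)
 have "c * (c * A + s * B) - s / of_real r * (of_real r * (c * B - s * A)) = (c * c + s * s) * A"
  using r0 by (simp add: field_simps)
 moreover have "s * (c * A + s * B) + c / of_real r * (of_real r * (c * B - s * A)) = (c * c + s * s) * B"
  using r0 by (simp add: field_simps)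
 ultimately show "D1 h (polar (r, t)) = of_real (cos t) * D1 (%z. h (polar z)) (r, t) - of_real (sin t / r) * D2 (%z. h (polar z)) (r, t)"
  "D2 h (polar (r, t)) = of_real (sin t) * D1 (%z. h (polar z)) (r, t) + of_real (cos t / r) * D2 (%z. h (polar z)) (r, t)"
  unfolding 1 2 st A_def[symmetric] B_def[symmetric] c_def[symmetric] s_def[symmetric] cs by simp_all
qed

text \<open>Each Cartesian derivative lowers the homogeneity in r by one. The power is kept in the
  form \<open>r ^ p / r ^ (a + b)\<close> because the weighted norm contains exactly r^p together
  with p radial derivatives.\<close>

lemma partials_polar:
 assumes D: "open D" and ab: "1 <= a + b"
 shows "\<exists>T :: ((real => real) \<times> nat \<times> nat) list.
  (\<forall>(C, p, q)\<in>set T. trig C & 1 <= p + q & p + q <= a + b) &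
  (\<forall>f r t. Ck_on (a + b) D f --> 0 < r --> polar (r, t) : D -->
   partials a b f (polar (r, t)) =
    (\<Sum>(C, p, q)\<leftarrow>T. of_real (C t * r ^ p / r ^ (a + b)) * partials p q (%z. f (polar z)) (r, t)))"
proof -
 define O' where "O' = polar -` D \<inter> {z. fst z > 0}"
 have op: "open O'" unfolding O'_def
  by (intro open_Int open_vimage D continuous_polar open_Collect_less continuous_intros)
 have CkF: "Ck_on m O' (%z. f (polar z))" if "Ck_on m D f" for m and f :: "real \<times> real => complex"
  by (rule Ck_on_compose[OF op that Ck_on_polar]) (auto simp: O'_def)
 define d where "d i = (if i then D1 else D2)" for i :: bool
 define dC where "dC C = (SOME C'. trig C' & (\<forall>x. (C has_real_derivative C' x) (at x)))" for C
 have dC: "trig (dC C)" "(C has_real_derivative dC C x) (at x)" if "trig C" for C x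
  using someI_ex[OF trig_derivative[OF that]] by (auto simp: dC_def)
 define ca where "ca i = (if i then cos else sin :: real => real)" for i
 define sa where "sa i x = (if i then - sin x else cos x :: real)" for i x
 have tca: "trig (ca i)" "trig (sa i)" for i
  by (cases i; simp add: ca_def sa_def[abs_def] trig_cos trig_sin trig_uminus)+
 \<comment> \<open>Four contributions of one Cartesian derivative: radial on the power of r, radial
   on the function, angular on the coefficient, angular on the function. The common factor 1/r turns
   \<open>tm m\<close> into \<open>tm (Suc m)\<close>.\<close>
 define step where "step i m = (%(C, p :: nat, q :: nat).
   [(%x. ca i x * C x * (real p - real m), p, q), (%x. ca i x * C x, Suc p, q),
   (%x. sa i x * dC C x, p, q), (%x. sa i x * C x, p, Suc q)])" for i m
 define tm where "tm m F z = (%(C, p :: nat, q). of_real (C (snd z) * fst z ^ p / fst z ^ m) * partials p q F z)"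
  for m :: nat and F z
 have aux: "of_real (ca i t) * D1 (%z. tm m F z (C, p, q)) (r, t) + of_real (sa i t / r) * D2 (%z. tm m F z (C, p, q)) (r, t)
   = (\<Sum>l\<leftarrow>step i m (C, p, q). tm (Suc m) F (r, t) l)"
   and aux': "(%z. tm m F z (C, p, q)) differentiable (at (r, t))"
  if C: "trig C" and F: "Ck_on (Suc (p + q)) O' F" and z: "(r, t) : O'" for i m F C p q r t
 proof -
  have r: "r > 0" using z by (simp add: O'_def)
  let ?c = "%z :: real \<times> real. complex_of_real (C (snd z) * fst z ^ p / fst z ^ m)"
  have H1: "((%z :: real \<times> real. C (snd z)) has_derivative (%h. dC C t * snd h)) (at (r, t))"
   using has_derivative_compose[OF has_derivative_snd[OF has_derivative_ident] dC(2)[OF C, of "snd (r, t)", unfolded has_field_derivative_def]]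
   by simp
  have H2: "((%z :: real \<times> real. fst z ^ p / fst z ^ m) has_derivative
    (%h. fst h * ((real p - real m) * r ^ p / r ^ Suc m))) (at (r, t))"
  proof -
   \<comment> \<open>For n = 0 the truncated exponent is harmless because of the factor
     \<open>real n\<close>.\<close>
   have P: "real n * r ^ (n - Suc 0) * r = real n * r ^ n" for n by (cases n) auto
   have "((%x. x ^ p / x ^ m) has_real_derivative
     (real p * r ^ (p - Suc 0) * r ^ m - r ^ p * (real m * r ^ (m - Suc 0))) / (r ^ m * r ^ m)) (at r)"
    by (rule DERIV_divide[OF DERIV_pow DERIV_pow]) (use r in auto)
   also have "(real p * r ^ (p - Suc 0) * r ^ m - r ^ p * (real m * r ^ (m - Suc 0))) / (r ^ m * r ^ m)
     = ((real p * r ^ (p - Suc 0) * r) * r ^ m - r ^ p * (real m * r ^ (m - Suc 0) * r)) / (r * r ^ m * r ^ m)"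
    using r by (simp add: field_simps)
   also have "... = (real p - real m) * r ^ p / r ^ Suc m"
    unfolding P using r by (simp add: field_simps)
   finally have "((%x. x ^ p / x ^ m) has_real_derivative (real p - real m) * r ^ p / r ^ Suc m) (at r)" .
   hence "((%x. x ^ p / x ^ m) has_derivative (*) ((real p - real m) * r ^ p / r ^ Suc m)) (at (fst (r, t)))"
    unfolding has_field_derivative_def fst_conv .
   from has_derivative_compose[OF has_derivative_fst[OF has_derivative_ident] this]
   show ?thesis by (simp add: mult.commute)
  qed
  from has_derivative_mult[OF H1 H2]
  have "((%z :: real \<times> real. C (snd z) * (fst z ^ p / fst z ^ m)) has_derivative
    (%h. C t * (fst h * ((real p - real m) * r ^ p / r ^ Suc m)) + dC C t * snd h * (r ^ p / r ^ m))) (at (r, t))"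
   by (simp only: fst_conv snd_conv)
  from has_derivative_of_real[OF this]
  have c: "(?c has_derivative (%h. complex_of_real (C t * (fst h * ((real p - real m) * r ^ p / r ^ Suc m)) + dC C t * snd h * (r ^ p / r ^ m)))) (at (r, t))"
   by (simp only: times_divide_eq_right)
  have cd: "?c differentiable (at (r, t))" using c by (auto simp only: differentiable_def)
  have "Ck_on (Suc 0) O' (partials p q F)"
   by (rule Ck_on_partials[OF op]) (use F in \<open>simp del: Ck_on.simps\<close>)
  hence Fd: "partials p q F differentiable (at (r, t))" by (rule Ck_on_differentiable[OF _ z])
  have e: "(%z. tm m F z (C, p, q)) = (%z. ?c z * partials p q F z)" by (simp add: tm_def)
  show "(%z. tm m F z (C, p, q)) differentiable (at (r, t))"
   unfolding e by (rule differentiable_mult[OF cd Fd])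
  have d1: "D1 (%z. tm m F z (C, p, q)) (r, t) = of_real (C t * ((real p - real m) * r ^ p / r ^ Suc m)) * partials p q F (r, t)
    + of_real (C t * r ^ p / r ^ m) * partials (Suc p) q F (r, t)"
   unfolding e D1_mult[OF cd Fd] D1_eq[OF c] D1_partials by simp
  have d2: "D2 (%z. tm m F z (C, p, q)) (r, t) = of_real (dC C t * (r ^ p / r ^ m)) * partials p q F (r, t)
    + of_real (C t * r ^ p / r ^ m) * partials p (Suc q) F (r, t)"
   unfolding e D2_mult[OF cd Fd] D2_eq[OF c] D2_partials[OF op z F] by simp
  have r0: "complex_of_real r ~= 0" using r by simp
  show "of_real (ca i t) * D1 (%z. tm m F z (C, p, q)) (r, t) + of_real (sa i t / r) * D2 (%z. tm m F z (C, p, q)) (r, t)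
   = (\<Sum>l\<leftarrow>step i m (C, p, q). tm (Suc m) F (r, t) l)"
   unfolding d1 d2 unfolding step_def tm_def using r0 by (simp add: field_simps)
 qed
 have main: "1 <= m ==> \<forall>a b. a + b = m --> (\<exists>T. (\<forall>(C, p, q)\<in>set T. trig C & 1 <= p + q & p + q <= m) &
  (\<forall>f. Ck_on m D f --> (\<forall>z\<in>O'. partials a b f (polar z) = (\<Sum>l\<leftarrow>T. tm m (%z. f (polar z)) z l))))" for m
 proof (induction m)
  case (Suc m)
  show ?case
  proof (intro allI impI)
   fix a b assume abm: "a + b = Suc m"
   obtain i a' b' where i: "a' + b' = m" "!!f. partials a b f = d i (partials a' b' f)"
   proof (cases a)
    case 0
    with abm have "partials a b f = d False (partials 0 m f)" for f by (simp add: partials_def d_def)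
    with that[of 0 m False] show ?thesis by simp
   next
    case (Suc a')
    have "partials a b f = d True (partials a' b f)" for f by (simp add: partials_def d_def Suc)
    with that[of a' b True] Suc abm show ?thesis by simp
   qed
   have pd: "d i h (polar (r, t)) = of_real (ca i t) * D1 (%z. h (polar z)) (r, t) + of_real (sa i t / r) * D2 (%z. h (polar z)) (r, t)"
    if "Ck_on (Suc 0) D h" "(r, t) : O'" for h r t
   proof -
    have "polar (r, t) : D" "r > 0" using that(2) by (auto simp: O'_def)
    from polar_partials_aux[OF Ck_on_has_derivative[OF that(1) this(1)] this(2)]
    show ?thesis by (cases i) (simp_all add: d_def ca_def sa_def)
   qed
   show "\<exists>T. (\<forall>(C, p, q)\<in>set T. trig C & 1 <= p + q & p + q <= Suc m) &
    (\<forall>f. Ck_on (Suc m) D f --> (\<forall>z\<in>O'. partials a b f (polar z) = (\<Sum>l\<leftarrow>T. tm (Suc m) (%z. f (polar z)) z l)))"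
   proof (cases "m = 0")
    case True
    hence i0: "a' = 0" "b' = 0" using i by auto
    show ?thesis
    proof (intro exI[of _ "[(ca i, 1, 0), (sa i, 0, 1)]"] conjI allI impI ballI)
     fix f :: "real \<times> real => complex" and z assume f: "Ck_on (Suc m) D f" and z: "z : O'"
     obtain r t where rt: "z = (r, t)" by fastforce
     have r: "r > 0" using z rt by (simp add: O'_def)
     show "partials a b f (polar z) = (\<Sum>l\<leftarrow>[(ca i, 1, 0), (sa i, 0, 1)]. tm (Suc m) (%z. f (polar z)) z l)"
      using pd[of f r t] f z r unfolding i(2) rt i0 by (simp add: True partials_def tm_def del: Ck_on.simps)
    qed (use tca in auto)
   next
    case False
    hence "1 <= m" by simp
    from Suc.IH[OF this, rule_format, OF i(1)] obtain S where
     S: "\<forall>(C, p, q)\<in>set S. trig C & 1 <= p + q & p + q <= m"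
     "!!f z. Ck_on m D f ==> z : O' ==> partials a' b' f (polar z) = (\<Sum>l\<leftarrow>S. tm m (%z. f (polar z)) z l)"
     by blast
    show ?thesis
    proof (intro exI[of _ "concat (map (step i m) S)"] conjI allI impI ballI)
     have "trig C' & 1 <= p' + q' & p' + q' <= Suc m"
      if "(C, p, q) : set S" "(C', p', q') : set (step i m (C, p, q))" for C p q C' p' q'
     proof -
      have c: "trig C" and pq: "1 <= p + q" "p + q <= m" using S that(1) by fastforce+
      show ?thesis using that(2) pq tca dC(1)[OF c] c
       by (auto simp: step_def intro!: trig_mult trig_const)
     qed
     thus "case x of (C, p, q) => trig C & 1 <= p + q & p + q <= Suc m"
      if "x : set (concat (map (step i m) S))" for x using that by fastforce
     fix f :: "real \<times> real => complex" and z assume f: "Ck_on (Suc m) D f" and z: "z : O'"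
     let ?F = "%z. f (polar z)"
     obtain r t where rt: "z = (r, t)" by fastforce
     have fp: "Ck_on (Suc 0) D (partials a' b' f)"
      by (rule Ck_on_partials[OF D]) (use f i in \<open>simp del: Ck_on.simps\<close>)
     note f' = Ck_on_Suc_imp[OF f]
     have Sl: "trig C & Ck_on (Suc (p + q)) O' ?F" if "(C, p, q) : set S" for C p q
     proof -
      have "p + q <= m" "trig C" using S(1) that by auto
      thus ?thesis using Ck_on_le[OF CkF[OF f], of "Suc (p + q)"] by (simp del: Ck_on.simps)
     qed
     have dif: "(%z. tm m ?F z l) differentiable (at (r, t))" if "l : set S" for l
      using aux' Sl z that unfolding rt by (metis prod_cases3)
     have "partials a b f (polar z) = of_real (ca i t) * D1 (%z. partials a' b' f (polar z)) (r, t)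
       + of_real (sa i t / r) * D2 (%z. partials a' b' f (polar z)) (r, t)"
      using pd[OF fp z[unfolded rt]] unfolding i(2) rt .
     also have "D1 (%z. partials a' b' f (polar z)) (r, t) = D1 (%z. \<Sum>l\<leftarrow>S. tm m ?F z l) (r, t)"
      by (rule D1_cong[OF op z[unfolded rt]]) (rule S(2)[OF f'])
     also have "... = (\<Sum>l\<leftarrow>S. D1 (%z. tm m ?F z l) (r, t))" by (rule D1_sum_list[OF dif])
     also have "D2 (%z. partials a' b' f (polar z)) (r, t) = D2 (%z. \<Sum>l\<leftarrow>S. tm m ?F z l) (r, t)"
      by (rule D2_cong[OF op z[unfolded rt]]) (rule S(2)[OF f'])
     also have "... = (\<Sum>l\<leftarrow>S. D2 (%z. tm m ?F z l) (r, t))" by (rule D2_sum_list[OF dif])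
     also have "of_real (ca i t) * (\<Sum>l\<leftarrow>S. D1 (%z. tm m ?F z l) (r, t)) + of_real (sa i t / r) * (\<Sum>l\<leftarrow>S. D2 (%z. tm m ?F z l) (r, t))
      = (\<Sum>l\<leftarrow>S. of_real (ca i t) * D1 (%z. tm m ?F z l) (r, t) + of_real (sa i t / r) * D2 (%z. tm m ?F z l) (r, t))"
      by (simp only: sum_list_addf sum_list_const_mult)
     also have "... = (\<Sum>l\<leftarrow>S. \<Sum>l'\<leftarrow>step i m l. tm (Suc m) ?F (r, t) l')"
     proof (intro arg_cong[of _ _ sum_list] map_cong refl)
      fix l assume lS: "l : set S"
      obtain C p q where l: "l = (C, p, q)" by (metis prod_cases3)
      show "of_real (ca i t) * D1 (%z. tm m ?F z l) (r, t) + of_real (sa i t / r) * D2 (%z. tm m ?F z l) (r, t)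
       = (\<Sum>l'\<leftarrow>step i m l. tm (Suc m) ?F (r, t) l')"
       unfolding l by (rule aux) (use Sl lS l z rt in auto)
     qed
     finally show "partials a b f (polar z) = (\<Sum>l\<leftarrow>concat (map (step i m) S). tm (Suc m) ?F z l)"
      by (simp only: sum_list_concat_map rt)
    qed
   qed
  qed
 qed simp
 from main[OF ab, rule_format, of a b] obtain T where T: "\<forall>(C, p, q)\<in>set T. trig C & 1 <= p + q & p + q <= a + b"
  "!!f z. Ck_on (a + b) D f ==> z : O' ==> partials a b f (polar z) = (\<Sum>l\<leftarrow>T. tm (a + b) (%z. f (polar z)) z l)"
  by blast
 have "partials a b f (polar (r, t)) =
    (\<Sum>(C, p, q)\<leftarrow>T. of_real (C t * r ^ p / r ^ (a + b)) * partials p q (%z. f (polar z)) (r, t))"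
  if "Ck_on (a + b) D f" "0 < r" "polar (r, t) : D" for f r t
  using T(2)[OF that(1), of "(r, t)"] that by (simp add: O'_def tm_def)
 with T(1) show ?thesis by blast
qed

section \<open>Functionals with vanishing moments\<close>

text \<open>The integral of the squared deviation of \<open>g\<close> from its mean is
  nonnegative.\<close>

lemma integral_square_le:
 fixes g :: "real => real"
 assumes "h > 0" "continuous_on {c..c + h} g"
 shows "(integral {c..c + h} g)\<^sup>2 <= h * integral {c..c + h} (%t. (g t)\<^sup>2)"
proof -
 let ?I = "integral {c..c + h} g"
 have i: "g integrable_on {c..c + h}" "(%t. (g t)\<^sup>2) integrable_on {c..c + h}"
  by (intro integrable_continuous_real assms continuous_intros)+
 have "((%t. (?I / h)\<^sup>2) has_integral (?I / h)\<^sup>2 * h) {c..c + h}"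
  using has_integral_const_real[of "(?I / h)\<^sup>2" c "c + h"] assms(1) by (simp add: mult.commute)
 hence "((%t. (g t)\<^sup>2 - (2 * ?I / h) * g t + (?I / h)\<^sup>2) has_integral
   integral {c..c + h} (%t. (g t)\<^sup>2) - (2 * ?I / h) * ?I + (?I / h)\<^sup>2 * h) {c..c + h}"
  by (intro has_integral_add has_integral_diff has_integral_mult_right integrable_integral i)
 moreover have "0 <= (g t)\<^sup>2 - (2 * ?I / h) * g t + (?I / h)\<^sup>2" for t
 proof -
  have "(g t)\<^sup>2 - (2 * ?I / h) * g t + (?I / h)\<^sup>2 = (g t - ?I / h)\<^sup>2"
   by (simp add: power2_diff)
  thus ?thesis by simp
 qed
 ultimately have "0 <= integral {c..c + h} (%t. (g t)\<^sup>2) - (2 * ?I / h) * ?I + (?I / h)\<^sup>2 * h"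
  by (rule has_integral_nonneg)
 also have "... = integral {c..c + h} (%t. (g t)\<^sup>2) - ?I\<^sup>2 / h"
  using assms(1) by (simp add: power2_eq_square field_simps)
 finally show ?thesis using assms(1) by (simp add: field_simps)
qed

text \<open>Taylor's formula with integral remainder; the integration is extended to the whole
  interval so that the bound does not depend on the two points.\<close>

lemma taylor_remainder_le:
 fixes Df :: "nat => real => 'a::banach"
 assumes k: "0 < k" and y: "y : {c..c + h}" and x: "x : {c..c + h}" and "y <= x"
  and D: "!!l t. l < k ==> t : {c..c + h} ==> (Df l has_vector_derivative Df (Suc l) t) (at t)"
  and cont: "continuous_on {c..c + h} (Df k)"
 shows "norm (Df 0 x - (\<Sum>l<k. ((x - y) ^ l / fact l) *\<^sub>R Df l y)) <= h ^ (k - 1) * integral {c..c + h} (%t. norm (Df k t))"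
proof -
 have sub: "{y..x} <= {c..c + h}" using x y by auto
 let ?i = "%t. ((x - t) ^ (k - 1) / fact (k - 1)) *\<^sub>R Df k t"
 have "Df 0 x = (\<Sum>l<k. ((x - y) ^ l / fact l) *\<^sub>R Df l y) + integral {y..x} ?i"
  using Taylor_integral[of k Df "Df 0" y x] k D sub \<open>y \<le> x\<close>
  by (metis atLeastAtMost_iff has_vector_derivative_at_within subset_iff)
 moreover have "norm (integral {y..x} ?i) <= integral {y..x} (%t. h ^ (k - 1) * norm (Df k t))"
 proof (rule integral_norm_bound_integral)
  show "?i integrable_on {y..x}" "(%t. h ^ (k - 1) * norm (Df k t)) integrable_on {y..x}"
   by (intro integrable_continuous_real continuous_intros continuous_on_subset[OF cont sub]; simp)+
  show "norm (?i t) <= h ^ (k - 1) * norm (Df k t)" if "t : {y..x}" for t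
  proof -
   have "\<bar>x - t\<bar> ^ (k - 1) / fact (k - 1) <= h ^ (k - 1) / 1"
    using that x y by (intro frac_le power_mono fact_ge_1) auto
   hence "\<bar>x - t\<bar> ^ (k - 1) / fact (k - 1) * norm (Df k t) <= h ^ (k - 1) / 1 * norm (Df k t)"
    by (rule mult_right_mono) simp
   thus ?thesis by (simp only: norm_scaleR abs_divide power_abs[symmetric] abs_of_pos[OF fact_gt_zero] div_by_1)
  qed
 qed
 moreover have "integral {y..x} (%t. h ^ (k - 1) * norm (Df k t)) <= integral {c..c + h} (%t. h ^ (k - 1) * norm (Df k t))"
 proof (rule integral_subset_le[OF sub])
  show "(%t. h ^ (k - 1) * norm (Df k t)) integrable_on {y..x}"
   by (intro integrable_continuous_real continuous_on_mult continuous_on_const continuous_on_norm continuous_on_subset[OF cont sub])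
  show "(%t. h ^ (k - 1) * norm (Df k t)) integrable_on {c..c + h}"
   by (intro integrable_continuous_real continuous_on_mult continuous_on_const continuous_on_norm cont)
 qed (use x in simp)
 ultimately show ?thesis by simp
qed

text \<open>For x < y the reflection t to -t, which puts the sign (-1)^l on the l-th derivative,
  leads back to the ordered case. Squaring by \<open>integral_square_le\<close> produces the
  exponent 2(k - 1) + 1.\<close>

lemma taylor_remainder:
 fixes Df :: "nat => real => 'a::banach"
 assumes k: "0 < k" and y: "y : {c..c + h}" and x: "x : {c..c + h}" and h: "h > 0"
  and D: "!!l t. l < k ==> t : {c..c + h} ==> (Df l has_vector_derivative Df (Suc l) t) (at t)"
  and cont: "continuous_on {c..c + h} (Df k)"
 shows "ennreal ((norm (Df 0 x - (\<Sum>l<k. ((x - y) ^ l / fact l) *\<^sub>R Df l y)))\<^sup>2)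
  <= ennreal (h ^ (2 * k - 1)) * (NN t. ennreal ((norm (Df k t))\<^sup>2) * indicator {c..c + h} t)"
proof -
 have "norm (Df 0 x - (\<Sum>l<k. ((x - y) ^ l / fact l) *\<^sub>R Df l y)) <= h ^ (k - 1) * integral {c..c + h} (%t. norm (Df k t))"
 proof (cases "y <= x")
  case True
  thus ?thesis by (rule taylor_remainder_le[OF k y x _ D cont])
 next
  case False
  define Ef where "Ef l t = (- 1) ^ l *\<^sub>R Df l (- t)" for l and t :: real
  let ?c = "- c - h"
  have m: "- t : {c..c + h} \<longleftrightarrow> t : {?c..?c + h}" for t by auto
  have E: "norm (Ef 0 (- x) - (\<Sum>l<k. ((- x - - y) ^ l / fact l) *\<^sub>R Ef l (- y))) <= h ^ (k - 1) * integral {?c..?c + h} (%t. norm (Ef k t))"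
  proof (rule taylor_remainder_le[OF k])
   show "(Ef l has_vector_derivative Ef (Suc l) t) (at t)" if "l < k" "t : {?c..?c + h}" for l t
   proof -
    have u: "((%t::real. - t) has_vector_derivative - 1) (at t)" by (auto intro!: derivative_eq_intros)
    have "(Df l has_vector_derivative Df (Suc l) (- t)) (at (- t))" using D that m by blast
    from vector_diff_chain_at[OF u this]
    have "((%t. Df l (- t)) has_vector_derivative (- 1) *\<^sub>R Df (Suc l) (- t)) (at t)"
     by (simp only: o_def)
    from has_vector_derivative_scaleR[OF DERIV_const[of "(-1) ^ l"] this]
    show ?thesis unfolding Ef_def by simp
   qed
   show "continuous_on {?c..?c + h} (Ef k)" unfolding Ef_def
    by (intro continuous_intros continuous_on_compose2[OF cont]) auto
  qed (use x y False in auto)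
  have a: "((- x - - y) ^ l / fact l) *\<^sub>R Ef l (- y) = ((x - y) ^ l / fact l) *\<^sub>R Df l y" for l
  proof -
   have "(- x - - y) ^ l * (- 1) ^ l = (x - y) ^ l" unfolding power_mult_distrib[symmetric] by simp
   thus ?thesis by (simp add: Ef_def)
  qed
  have b: "integral {?c..?c + h} (%t. norm (Ef k t)) = integral {c..c + h} (%t. norm (Df k t))"
   using Henstock_Kurzweil_Integration.integral_reflect_real[of "c + h" c "%t. norm (Df k t)"] by (simp add: Ef_def)
  have c: "Ef 0 (- x) = Df 0 x" by (simp add: Ef_def)
  show ?thesis using E unfolding a b c .
 qed
 hence "(norm (Df 0 x - (\<Sum>l<k. ((x - y) ^ l / fact l) *\<^sub>R Df l y)))\<^sup>2 <= (h ^ (k - 1) * integral {c..c + h} (%t. norm (Df k t)))\<^sup>2"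
  by (rule power_mono) simp
 also have "... <= (h ^ (k - 1))\<^sup>2 * (h * integral {c..c + h} (%t. (norm (Df k t))\<^sup>2))"
  unfolding power_mult_distrib by (intro mult_left_mono integral_square_le h continuous_intros cont) simp
 also have "... = h ^ (2 * k - 1) * integral {c..c + h} (%t. (norm (Df k t))\<^sup>2)"
 proof -
  have "2 * k - 1 = (k - 1) + (k - 1) + 1" using k by simp
  hence "h ^ (2 * k - 1) = (h ^ (k - 1))\<^sup>2 * h"
   by (simp only: power_add power2_eq_square power_one_right)
  thus ?thesis by simp
 qed
 finally have "ennreal ((norm (Df 0 x - (\<Sum>l<k. ((x - y) ^ l / fact l) *\<^sub>R Df l y)))\<^sup>2)
  <= ennreal (h ^ (2 * k - 1)) * ennreal (integral {c..c + h} (%t. (norm (Df k t))\<^sup>2))"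
  using h by (simp add: ennreal_mult'[symmetric] ennreal_leI)
 also have "ennreal (integral {c..c + h} (%t. (norm (Df k t))\<^sup>2)) = (NN t. ennreal ((norm (Df k t))\<^sup>2) * indicator {c..c + h} t)"
  by (rule nn_integral_has_integral_lebesgue'[symmetric])
   (auto intro!: integrable_integral integrable_continuous_real continuous_intros cont)
 finally show ?thesis .
qed

text \<open>On the compact set \<open>p\<close> is bounded, and |eta| <= 1 + |eta|^2 does the work
  of Hoelder's inequality.\<close>

lemma integrable_mult_L2_support:
 fixes eta :: "real \<times> real => complex"
 assumes Q: "compact Q" and p: "continuous_on Q p"
  and eta: "eta : borel_measurable borel" "!!z. z ~: Q ==> eta z = 0"
   "(NN z. ennreal ((norm (eta z))\<^sup>2)) < \<infinity>"
 shows "integrable lborel (%z. p z * eta z)"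
proof -
 obtain B where B: "!!z. z : Q ==> norm (p z) <= B" "B > 0"
  using compact_imp_bounded[OF compact_continuous_image[OF p Q]] unfolding bounded_pos by auto
 have Qm: "Q : sets borel" by (rule borel_closed[OF compact_imp_closed[OF Q]])
 have e: "(%z. p z * eta z) = (%z. (indicator Q z *\<^sub>R p z) * eta z)"
 proof
  show "p z * eta z = (indicator Q z *\<^sub>R p z) * eta z" for z
   by (cases "z : Q") (simp_all add: eta(2))
 qed
 have m: "(%z. p z * eta z) : borel_measurable lborel"
  unfolding e measurable_lborel2
  by (rule borel_measurable_times[OF borel_measurable_continuous_on_indicator[OF Qm p] eta(1)])
 have "(NN z. ennreal (norm (p z * eta z))) <= (NN z. ennreal B * indicator Q z + ennreal B * ennreal ((norm (eta z))\<^sup>2))"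
 proof (rule nn_integral_mono)
  fix z
  show "ennreal (norm (p z * eta z)) <= ennreal B * indicator Q z + ennreal B * ennreal ((norm (eta z))\<^sup>2)"
  proof (cases "z : Q")
   case True
   have "norm (p z) * norm (eta z) <= B * (1 + (norm (eta z))\<^sup>2)"
   proof (intro mult_mono B True)
    have "0 <= (norm (eta z) - 1)\<^sup>2" by simp
    hence "2 * norm (eta z) <= 1 + (norm (eta z))\<^sup>2" by (simp add: power2_diff)
    thus "norm (eta z) <= 1 + (norm (eta z))\<^sup>2"
     using norm_ge_zero[of "eta z"] by linarith
   qed (use B(2) in auto)
   hence "ennreal (norm (p z * eta z)) <= ennreal (B + B * (norm (eta z))\<^sup>2)"
    by (intro ennreal_leI) (simp add: norm_mult algebra_simps)
   thus ?thesis using True B(2) by (simp add: ennreal_plus ennreal_mult)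
  qed (simp add: eta(2))
 qed
 also have "... = ennreal B * emeasure lborel Q + ennreal B * (NN z. ennreal ((norm (eta z))\<^sup>2))"
  using eta(1) Qm by (simp add: nn_integral_add nn_integral_cmult)
 also have "... < \<infinity>"
  using emeasure_lborel_cbox_finite emeasure_bounded_finite[OF compact_imp_bounded[OF Q]] eta(3)
  by (simp add: ennreal_mult_less_top)
 finally show ?thesis using m by (simp add: integrable_iff_bounded)
qed

text \<open>The binomial theorem in each variable expresses the shifted monomial by monomials of no
  larger degree.\<close>

lemma shifted_moments:
 fixes eta :: "real \<times> real => complex"
 assumes Q: "compact Q"
  and eta: "eta : borel_measurable borel" "!!z. z ~: Q ==> eta z = 0"
   "(NN z. ennreal ((norm (eta z))\<^sup>2)) < \<infinity>"
  and M: "!!a b. a + b < k ==> (LINT z|lborel. of_real (fst z ^ a * snd z ^ b) * eta z) = 0"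
  and ab: "a + b < k"
 shows "(LINT z|lborel. of_real ((fst z - u) ^ a * (snd z - v) ^ b) * eta z) = 0"
proof -
 let ?c = "%i j. complex_of_real (of_nat (a choose i) * (- u) ^ (a - i) * (of_nat (b choose j) * (- v) ^ (b - j)))"
 have "(fst z - u) ^ a * (snd z - v) ^ b = (\<Sum>i\<le>a. \<Sum>j\<le>b. (of_nat (a choose i) * (- u) ^ (a - i) * (of_nat (b choose j) * (- v) ^ (b - j))) * (fst z ^ i * snd z ^ j))" for z
  using binomial_ring[of "fst z" "- u" a] binomial_ring[of "snd z" "- v" b]
  by (simp add: sum_product mult_ac)
 hence e: "(%z. of_real ((fst z - u) ^ a * (snd z - v) ^ b) * eta z)
   = (%z. \<Sum>i\<le>a. \<Sum>j\<le>b. ?c i j * (of_real (fst z ^ i * snd z ^ j) * eta z))"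
  by (simp only: of_real_sum of_real_mult sum_distrib_right mult.assoc)
 have i: "integrable lborel (%z. ?c i j * (of_real (fst z ^ i * snd z ^ j) * eta z))" for i j
  by (intro integrable_mult_right integrable_mult_L2_support[OF Q _ eta] continuous_intros)
 have "(LINT z|lborel. of_real ((fst z - u) ^ a * (snd z - v) ^ b) * eta z)
  = (\<Sum>i\<le>a. \<Sum>j\<le>b. LINT z|lborel. ?c i j * (of_real (fst z ^ i * snd z ^ j) * eta z))"
  unfolding e by (subst Bochner_Integration.integral_sum, intro Bochner_Integration.integrable_sum i,
   intro sum.cong refl Bochner_Integration.integral_sum i)
 also have "... = (\<Sum>i\<le>a. \<Sum>j\<le>b. 0)"
 proof (intro sum.cong refl)
  fix i j assume "i : {..a}" "j : {..b}"
  hence "i + j < k" using ab by simp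
  thus "(LINT z|lborel. ?c i j * (of_real (fst z ^ i * snd z ^ j) * eta z)) = 0"
   by (simp only: integral_mult_right_zero M mult_zero_right)
 qed
 finally show ?thesis by simp
qed

lemma nn_integral_square_Fubini:
 fixes G :: "real \<times> real => ennreal"
 assumes [measurable]: "G : borel_measurable borel"
 shows "(NN z. G z) = (NN x. NN y. G (x, y))"
  and "(NN z. G z) = (NN y. NN x. G (x, y))"
proof -
 have m: "G : borel_measurable (lborel \<Otimes>\<^sub>M lborel)" by (simp add: lborel_prod)
 show "(NN z. G z) = (NN x. NN y. G (x, y))"
  using lborel.nn_integral_fst[OF m] by (simp add: lborel_prod)
 show "(NN z. G z) = (NN y. NN x. G (x, y))"
  using lborel_pair.nn_integral_snd[of "%z. G z"] m by (simp add: lborel_prod)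
qed

text \<open>Since \<open>eta\<close> annihilates polynomials of total degree below \<open>k\<close>,
  \<open>w\<close> may be replaced by a Taylor remainder. This remainder contains integrals of
  derivatives along a single vertical line, which integrals over the square do not control; the
  position \<open>y1\<close> of the line is therefore left free and averaged at the end.\<close>

lemma vanishing_moment_bound:
 fixes w eta :: "real \<times> real => complex"
 assumes k: "k > 0" and h: "h > 0" and Qdef: "Q = {c1..c1 + h} \<times> {c2..c2 + h}"
  and U: "open U" "Q <= U" and w: "Ck_on k U w"
  and eta: "eta : borel_measurable borel" "!!z. z ~: Q ==> eta z = 0"
   "(NN z. ennreal ((norm (eta z))\<^sup>2)) < \<infinity>"
  and M: "!!a b. a + b < k ==> (LINT z|lborel. of_real (fst z ^ a * snd z ^ b) * eta z) = 0"
 shows "ennreal ((norm (LINT z|lborel. w z * eta z))\<^sup>2)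
  <= (NN z. ennreal ((norm (eta z))\<^sup>2)) * (ennreal (real (k + 1) * h ^ (2 * k)) *
   (\<Sum>a\<le>k. NN z. ennreal ((norm (partials a (k - a) w z))\<^sup>2) * indicator Q z))"
proof -
 define I1 I2 where "I1 = {c1..c1 + h}" and "I2 = {c2..c2 + h}"
 have QI: "Q = I1 \<times> I2" by (simp add: Qdef I1_def I2_def)
 have cQ: "compact Q" unfolding Qdef by (intro compact_Times compact_Icc)
 have [measurable]: "Q : sets borel" "I1 : sets borel" "I2 : sets borel"
  by (rule borel_closed[OF compact_imp_closed[OF cQ]]) (simp_all add: I1_def I2_def)
 note [measurable] = eta(1)
 define N where "N = (NN z. ennreal ((norm (eta z))\<^sup>2))"
 define G where "G a z = ennreal ((norm (partials a (k - a) w z))\<^sup>2) * indicator Q z" for a z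
 have pc: "continuous_on U (partials a b w)" if "a + b <= k" for a b
 proof (rule Ck_on_continuous[of 0])
  show "Ck_on 0 U (partials a b w)"
   by (rule Ck_on_partials[OF U(1)]) (use that in \<open>simp add: Ck_on_le[OF w] del: Ck_on.simps\<close>)
 qed
 have Gm [measurable]: "G a : borel_measurable borel" if "a <= k" for a
 proof -
  have "(%z. indicator Q z *\<^sub>R partials a (k - a) w z) : borel_measurable borel"
   by (rule borel_measurable_continuous_on_indicator) (use pc[of a "k - a"] that U in \<open>auto intro: continuous_on_subset\<close>)
  hence "(%z. ennreal ((norm (indicator Q z *\<^sub>R partials a (k - a) w z))\<^sup>2)) : borel_measurable borel"
   by measurable
  moreover have "(%z. ennreal ((norm (indicator Q z *\<^sub>R partials a (k - a) w z))\<^sup>2)) = G a"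
   by (auto simp: G_def indicator_def)
  ultimately show ?thesis by (simp only:)
 qed
 have Gx: "G a (x, y) = ennreal ((norm (partials a (k - a) w (x, y)))\<^sup>2) * indicator I1 x * indicator I2 y" for a x y
  by (simp add: G_def QI indicator_def)
 define A where "A y = (NN t. ennreal ((norm (partials k 0 w (t, y)))\<^sup>2) * indicator I1 t)" for y
 define B where "B a x = (NN t. ennreal ((norm (partials a (k - a) w (x, t)))\<^sup>2) * indicator I2 t)" for a x
 \<comment> \<open>Expansion in the first variable about \<open>y1\<close>, followed by expansion of
   its coefficients in the second variable about \<open>c2\<close> up to the order that keeps the
   total degree below \<open>k\<close>. Hence all remainders contain derivatives of order exactly
   \<open>k\<close>.\<close>
 define T where "T y1 z = (\<Sum>a<k. ((fst z - y1) ^ a / fact a) *\<^sub>R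
   (\<Sum>b<k - a. ((snd z - c2) ^ b / fact b) *\<^sub>R partials a b w (y1, c2)))" for y1 z
 define C where "C = ennreal (real (k + 1) * h ^ (2 * k - 1))"
 have dv1: "((%t. partials a 0 w (t, y)) has_vector_derivative partials (Suc a) 0 w (t, y)) (at t)"
  if "a < k" "(t, y) : Q" for a t y
 proof -
  have "Ck_on (Suc 0) U (partials a 0 w)"
   by (rule Ck_on_partials[OF U(1)]) (use that in \<open>simp add: Ck_on_le[OF w] del: Ck_on.simps\<close>)
  from has_derivative_D1[OF Ck_on_has_derivative[OF this]] show ?thesis using that U by (auto simp: D1_partials)
 qed
 have dv2: "((%t. partials a b w (x, t)) has_vector_derivative partials a (Suc b) w (x, t)) (at t)"
  if "a + b < k" "(x, t) : Q" for a b t x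
 proof -
  have zU: "(x, t) : U" using that U by blast
  have "Ck_on (Suc 0) U (partials a b w)"
   by (rule Ck_on_partials[OF U(1)]) (use that in \<open>simp add: Ck_on_le[OF w] del: Ck_on.simps\<close>)
  from has_derivative_D2[OF Ck_on_has_derivative[OF this zU]] D2_partials[OF U(1) zU, of a b w]
  show ?thesis using that Ck_on_le[OF w, of "Suc (a + b)"] by (simp del: Ck_on.simps)
 qed
 have R0: "ennreal ((norm (w (x1, x2) - (\<Sum>a<k. ((x1 - y1) ^ a / fact a) *\<^sub>R partials a 0 w (y1, x2))))\<^sup>2)
   <= ennreal (h ^ (2 * k - 1)) * A x2" if "x1 : I1" "y1 : I1" "x2 : I2" for x1 y1 x2
 proof -
  have "continuous_on {c1..c1 + h} (%t. partials k 0 w (t, x2))"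
   by (rule continuous_on_compose2[OF pc[of k 0]]) (use that U in \<open>auto simp: QI I1_def intro!: continuous_intros\<close>)
  from taylor_remainder[where Df = "%a t. partials a 0 w (t, x2)", OF k _ _ h _ this] that
  show ?thesis unfolding A_def I1_def
   using dv1[of _ _ x2] by (auto simp: QI I1_def partials_def)
 qed
 have R: "ennreal ((norm (partials a 0 w (y1, x2) - (\<Sum>b<k - a. ((x2 - c2) ^ b / fact b) *\<^sub>R partials a b w (y1, c2))))\<^sup>2)
   <= ennreal (h ^ (2 * (k - a) - 1)) * B a y1" if "y1 : I1" "x2 : I2" "a < k" for a y1 x2
 proof -
  have "continuous_on {c2..c2 + h} (%t. partials a (k - a) w (y1, t))"
   by (rule continuous_on_compose2[OF pc[of a "k - a"]]) (use that U in \<open>auto simp: QI I2_def intro!: continuous_intros\<close>)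
  from taylor_remainder[where Df = "%b t. partials a b w (y1, t)" and k = "k - a" and y = c2, OF _ _ _ h _ this, of x2] that
  show ?thesis unfolding B_def I2_def
   using dv2[of a _ y1] h by (auto simp: QI I2_def)
 qed
 have pw: "ennreal ((norm (w z - T y1 z))\<^sup>2) <= C * (A (snd z) + (\<Sum>a<k. B a y1))" if z: "z : Q" and y1: "y1 : I1" for z y1
 proof -
  obtain x1 x2 where zx: "z = (x1, x2)" by fastforce
  have x: "x1 : I1" "x2 : I2" using z by (auto simp: QI zx)
  define r0 where "r0 = w (x1, x2) - (\<Sum>a<k. ((x1 - y1) ^ a / fact a) *\<^sub>R partials a 0 w (y1, x2))"
  define r where "r a = ((x1 - y1) ^ a / fact a) *\<^sub>R (partials a 0 w (y1, x2) - (\<Sum>b<k - a. ((x2 - c2) ^ b / fact b) *\<^sub>R partials a b w (y1, c2)))" for a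
  have "w z - T y1 z = r0 + (\<Sum>a<k. r a)"
   by (simp add: r0_def r_def T_def zx sum_subtractf scaleR_diff_right)
  hence "norm (w z - T y1 z) <= norm r0 + (\<Sum>a<k. norm (r a))"
   by (metis add_left_mono norm_sum norm_triangle_le)
  \<comment> \<open>The index \<open>k\<close> stands for the horizontal remainder, the smaller ones
    for the vertical remainders: \<open>k + 1\<close> terms in the inequality for squares of
    sums.\<close>
  also have "... = (\<Sum>a\<le>k. if a = k then norm r0 else norm (r a))"
   by (simp add: lessThan_Suc_atMost[symmetric] add.commute)
  finally have "(norm (w z - T y1 z))\<^sup>2 <= (\<Sum>a\<le>k. if a = k then norm r0 else norm (r a))\<^sup>2"
   by (intro power_mono) auto
  also have "... <= (\<Sum>a\<le>k. (if a = k then norm r0 else norm (r a))\<^sup>2) * real (card {..k})"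
   by (rule sum_squared_le_sum_of_squares)
  also have "... = real (k + 1) * ((norm r0)\<^sup>2 + (\<Sum>a<k. (norm (r a))\<^sup>2))"
   by (simp add: lessThan_Suc_atMost[symmetric] add.commute mult.commute)
  finally have "ennreal ((norm (w z - T y1 z))\<^sup>2) <= ennreal (real (k + 1)) * (ennreal ((norm r0)\<^sup>2) + (\<Sum>a<k. ennreal ((norm (r a))\<^sup>2)))"
   by (simp add: ennreal_mult[symmetric] ennreal_plus[symmetric] sum_ennreal sum_nonneg ennreal_leI del: ennreal_plus)
  also have "... <= ennreal (real (k + 1)) * (ennreal (h ^ (2 * k - 1)) * A x2 + (\<Sum>a<k. ennreal (h ^ (2 * k - 1)) * B a y1))"
  proof (intro mult_left_mono add_mono sum_mono)
   show "ennreal ((norm r0)\<^sup>2) <= ennreal (h ^ (2 * k - 1)) * A x2" unfolding r0_def by (rule R0[OF x(1) y1 x(2)])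
   fix a assume "a : {..<k}"
   hence a: "a < k" by simp
   let ?R = "partials a 0 w (y1, x2) - (\<Sum>b<k - a. ((x2 - c2) ^ b / fact b) *\<^sub>R partials a b w (y1, c2))"
   have "\<bar>x1 - y1\<bar> ^ a / fact a <= h ^ a / 1"
    using x y1 h by (intro frac_le power_mono fact_ge_1) (auto simp: I1_def)
   hence "(norm (r a))\<^sup>2 <= (h ^ a * norm ?R)\<^sup>2"
    unfolding r_def norm_scaleR by (intro power_mono mult_right_mono) (auto simp: power_abs)
   hence "ennreal ((norm (r a))\<^sup>2) <= ennreal ((h ^ a)\<^sup>2) * ennreal ((norm ?R)\<^sup>2)"
    by (simp add: power_mult_distrib ennreal_mult[symmetric] ennreal_leI)
   also have "... <= ennreal ((h ^ a)\<^sup>2) * (ennreal (h ^ (2 * (k - a) - 1)) * B a y1)"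
    by (intro mult_left_mono R[OF y1 x(2) a]) simp
   also have "... = ennreal (h ^ (2 * k - 1)) * B a y1"
   proof -
    have "a + a + (2 * (k - a) - 1) = 2 * k - 1" using a by simp
    hence "(h ^ a)\<^sup>2 * h ^ (2 * (k - a) - 1) = h ^ (2 * k - 1)"
     by (metis power2_eq_square power_add)
    thus ?thesis using h by (simp add: mult.assoc[symmetric] ennreal_mult[symmetric])
   qed
   finally show "ennreal ((norm (r a))\<^sup>2) <= ennreal (h ^ (2 * k - 1)) * B a y1" .
  qed simp
  also have "... = C * (A (snd z) + (\<Sum>a<k. B a y1))"
   unfolding C_def zx using h by (simp only: ennreal_mult'' distrib_left sum_distrib_left mult.assoc snd_conv) (simp add: ennreal_mult mult.assoc)
  finally show ?thesis .
 qed
 let ?L = "LINT z|lborel. w z * eta z"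
 have wc: "continuous_on Q w" using Ck_on_continuous[OF w] U(2) continuous_on_subset by blast
 have Tc: "continuous_on Q (T y1)" for y1 unfolding T_def by (intro continuous_intros) simp_all
 have T0: "(LINT z|lborel. T y1 z * eta z) = 0" for y1
 proof -
  let ?c = "%a b. complex_of_real (1 / fact a * (1 / fact b)) * partials a b w (y1, c2)"
  have e: "(%z. T y1 z * eta z) = (%z. \<Sum>a<k. \<Sum>b<k - a. ?c a b * (of_real ((fst z - y1) ^ a * (snd z - c2) ^ b) * eta z))"
   unfolding T_def by (simp add: scaleR_conv_of_real sum_distrib_left sum_distrib_right mult_ac)
  have i: "integrable lborel (%z. ?c a b * (of_real ((fst z - y1) ^ a * (snd z - c2) ^ b) * eta z))" for a b
   by (intro integrable_mult_right integrable_mult_L2_support[OF cQ _ eta] continuous_intros)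
  have "(LINT z|lborel. T y1 z * eta z) = (\<Sum>a<k. \<Sum>b<k - a. LINT z|lborel. ?c a b * (of_real ((fst z - y1) ^ a * (snd z - c2) ^ b) * eta z))"
   unfolding e by (subst Bochner_Integration.integral_sum, intro Bochner_Integration.integrable_sum i,
   intro sum.cong refl Bochner_Integration.integral_sum i)
  also have "... = (\<Sum>a<k. \<Sum>b<k - a. 0)"
   by (intro sum.cong refl) (simp only: integral_mult_right_zero, subst shifted_moments[OF cQ eta M], auto)
  finally show ?thesis by simp
 qed
 have L1: "ennreal ((norm ?L)\<^sup>2) <= N * (C * (ennreal h * (NN z. G k z) + ennreal h * ennreal h * (\<Sum>a<k. B a y1)))" if y1: "y1 : I1" for y1
 proof -
  let ?W = "%z. indicator Q z *\<^sub>R (w z - T y1 z)"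
  have Wm [measurable]: "?W : borel_measurable borel"
   by (rule borel_measurable_continuous_on_indicator) (auto intro!: continuous_intros wc Tc)
  note iw = integrable_mult_L2_support[OF cQ wc eta] integrable_mult_L2_support[OF cQ Tc[of y1] eta]
  have We: "(%z. w z * eta z - T y1 z * eta z) = (%z. ?W z * eta z)"
  proof
   show "w z * eta z - T y1 z * eta z = ?W z * eta z" for z
    by (cases "z : Q") (simp_all add: eta(2) left_diff_distrib)
  qed
  have "?L = (LINT z|lborel. w z * eta z) - (LINT z|lborel. T y1 z * eta z)" by (simp add: T0)
  also have "... = (LINT z|lborel. w z * eta z - T y1 z * eta z)"
   by (rule Bochner_Integration.integral_diff[OF iw, symmetric])
  also note We
  finally have L: "?L = (LINT z|lborel. ?W z * eta z)" .
  have "ennreal (norm ?L) <= (NN z. ennreal (norm (?W z * eta z)))"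
   unfolding L by (rule integral_norm_bound_ennreal[OF Bochner_Integration.integrable_diff[OF iw, unfolded We]])
  also have "... = (NN z. ennreal (norm (?W z)) * ennreal (norm (eta z)))"
   by (simp only: norm_mult ennreal_mult[OF norm_ge_zero norm_ge_zero])
  finally have "(ennreal (norm ?L))\<^sup>2 <= (NN z. ennreal (norm (?W z)) * ennreal (norm (eta z)))\<^sup>2"
   by (rule power_mono) simp
  also have "... <= (NN z. (ennreal (norm (?W z)))\<^sup>2) * (NN z. (ennreal (norm (eta z)))\<^sup>2)"
   by (rule Cauchy_Schwarz_nn_integral) measurable
  also have "... = N * (NN z. ennreal ((norm (?W z))\<^sup>2))"
   by (simp only: N_def ennreal_power[OF norm_ge_zero] mult.commute)
  also have "... <= N * (NN z. C * (A (snd z) + (\<Sum>a<k. B a y1)) * indicator Q z)"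
  proof (intro mult_left_mono nn_integral_mono)
   fix z show "ennreal ((norm (?W z))\<^sup>2) <= C * (A (snd z) + (\<Sum>a<k. B a y1)) * indicator Q z"
    by (cases "z : Q") (use pw[OF _ y1] in auto)
  qed simp
  also have "(NN z. C * (A (snd z) + (\<Sum>a<k. B a y1)) * indicator Q z)
   = C * (ennreal h * (NN z. G k z) + ennreal h * ennreal h * (\<Sum>a<k. B a y1))"
  proof -
   have Am: "(%y. A y * indicator I2 y) : borel_measurable borel"
   proof -
    have "(%y. NN x. G k (x, y)) : borel_measurable borel"
     using lborel.borel_measurable_nn_integral_fst[of "%(y, x). G k (x, y)" lborel] Gm[of k]
     by (simp add: lborel_prod measurable_split_conv)
    moreover have "(%y. NN x. G k (x, y)) = (%y. A y * indicator I2 y)"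
     unfolding A_def Gx by (auto simp: indicator_def)
    ultimately show ?thesis by simp
   qed
   have e: "(%z. (A (snd z) + (\<Sum>a<k. B a y1)) * indicator Q z) = (%z. (A (snd z) * indicator I2 (snd z)) * indicator I1 (fst z) + (\<Sum>a<k. B a y1) * indicator Q z)"
    by (auto simp: QI indicator_def)
   have Fm: "(%z :: real \<times> real. (A (snd z) * indicator I2 (snd z)) * indicator I1 (fst z)) : borel_measurable borel"
   proof -
    have mf: "(%z :: real \<times> real. fst z) : borel_measurable borel"
     and ms: "(%z :: real \<times> real. snd z) : borel_measurable borel"
     by (intro borel_measurable_continuous_onI continuous_intros)+
    have iI: "indicator I1 : borel_measurable (borel :: real measure)" by measurable
    have 1: "(%z :: real \<times> real. A (snd z) * indicator I2 (snd z)) : borel_measurable borel"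
     by (rule measurable_compose[OF ms Am])
    have 2: "(%z :: real \<times> real. indicator I1 (fst z) :: ennreal) : borel_measurable borel"
     by (rule measurable_compose[OF mf iI])
    show ?thesis by (rule borel_measurable_times_ennreal[OF 1 2])
   qed
   have "(NN z. (A (snd z) * indicator I2 (snd z)) * indicator I1 (fst z)) = (NN y. NN x. (A y * indicator I2 y) * indicator I1 x)"
    using nn_integral_square_Fubini(2)[OF Fm] by simp
   also have "... = (NN y. (A y * indicator I2 y) * ennreal h)"
    using h by (simp add: nn_integral_cmult_indicator I1_def)
   also have "... = ennreal h * (NN y. A y * indicator I2 y)"
    by (subst nn_integral_multc) (use Am in \<open>simp_all add: mult.commute\<close>)
   also have "(NN y. A y * indicator I2 y) = (NN z. G k z)"
    unfolding nn_integral_square_Fubini(2)[OF Gm[OF order_refl]]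
    by (intro nn_integral_cong) (auto simp: A_def Gx indicator_def)
   finally have 1: "(NN z. (A (snd z) * indicator I2 (snd z)) * indicator I1 (fst z)) = ennreal h * (NN z. G k z)" .
   have "emeasure lborel Q = ennreal h * ennreal h"
    unfolding QI I1_def I2_def lborel_prod[symmetric] using h by (simp add: lborel.emeasure_pair_measure_Times)
   hence 2: "(NN z. (\<Sum>a<k. B a y1) * indicator Q z) = ennreal h * ennreal h * (\<Sum>a<k. B a y1)"
    by (subst nn_integral_cmult_indicator) (simp_all add: mult.commute)
   have "(NN z. C * (A (snd z) + (\<Sum>a<k. B a y1)) * indicator Q z) = (NN z. C * ((A (snd z) * indicator I2 (snd z)) * indicator I1 (fst z) + (\<Sum>a<k. B a y1) * indicator Q z))"
    by (simp only: mult.assoc fun_cong[OF e])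
   also have "... = C * (NN z. (A (snd z) * indicator I2 (snd z)) * indicator I1 (fst z) + (\<Sum>a<k. B a y1) * indicator Q z)"
    by (rule nn_integral_cmult) (use Fm in measurable)
   also have "... = C * ((NN z. (A (snd z) * indicator I2 (snd z)) * indicator I1 (fst z)) + (NN z. (\<Sum>a<k. B a y1) * indicator Q z))"
    by (subst nn_integral_add) (use Fm in measurable)
   finally show ?thesis unfolding 1 2 .
  qed
  finally show ?thesis by (simp add: ennreal_power)
 qed
 have hI1: "emeasure lborel I1 = ennreal h" using h by (simp add: I1_def)
 have Bm: "(%x. B a x * indicator I1 x) : borel_measurable borel" and
  BI: "(NN x. B a x * indicator I1 x) = (NN z. G a z)" if "a < k" for a
 proof -
  have m: "G a : borel_measurable borel" by (rule Gm) (use that in simp)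
  have e: "(%x. NN y. G a (x, y)) = (%x. B a x * indicator I1 x)"
   unfolding B_def Gx by (auto simp: indicator_def)
  have "(%x. NN y. G a (x, y)) : borel_measurable borel"
   using lborel.borel_measurable_nn_integral_fst[of "G a" lborel] m by (simp add: lborel_prod)
  thus "(%x. B a x * indicator I1 x) : borel_measurable borel" unfolding e .
  show "(NN x. B a x * indicator I1 x) = (NN z. G a z)"
   unfolding nn_integral_square_Fubini(1)[OF m] e ..
 qed
 let ?g = "NN z. G k z"
 \<comment> \<open>The left-hand side of \<open>L1\<close> is the same for every \<open>y1\<close>,
   so integration over \<open>y1\<close> turns the integrals along vertical lines into integrals
   over the square, at the cost of a factor h on the left.\<close>
 have "ennreal h * ennreal ((norm ?L)\<^sup>2) = (NN y. ennreal ((norm ?L)\<^sup>2) * indicator I1 y)"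
  by (subst nn_integral_cmult_indicator) (simp_all add: hI1 mult.commute)
 also have "... <= (NN y. N * C * (ennreal h * ?g) * indicator I1 y + N * C * (ennreal h * ennreal h) * (\<Sum>a<k. B a y * indicator I1 y))"
 proof (rule nn_integral_mono)
  fix y show "ennreal ((norm ?L)\<^sup>2) * indicator I1 y <= N * C * (ennreal h * ?g) * indicator I1 y + N * C * (ennreal h * ennreal h) * (\<Sum>a<k. B a y * indicator I1 y)"
   by (cases "y : I1") (use L1[of y] in \<open>auto simp: algebra_simps\<close>)
 qed
 also have "... = N * C * (ennreal h * ?g) * ennreal h + N * C * (ennreal h * ennreal h) * (\<Sum>a<k. NN z. G a z)"
 proof -
  have "(%y. \<Sum>a<k. B a y * indicator I1 y) : borel_measurable borel" using Bm by (intro borel_measurable_sum) auto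
  hence "(NN y. N * C * (ennreal h * ?g) * indicator I1 y + N * C * (ennreal h * ennreal h) * (\<Sum>a<k. B a y * indicator I1 y))
   = (NN y. N * C * (ennreal h * ?g) * indicator I1 y) + N * C * (ennreal h * ennreal h) * (NN y. (\<Sum>a<k. B a y * indicator I1 y))"
   by (subst nn_integral_add) (auto simp: nn_integral_cmult)
  also have "(NN y. (\<Sum>a<k. B a y * indicator I1 y)) = (\<Sum>a<k. NN y. B a y * indicator I1 y)"
   by (rule nn_integral_sum) (use Bm in auto)
  finally show ?thesis by (simp add: BI nn_integral_cmult_indicator hI1)
 qed
 also have "... = ennreal h * (N * (C * ennreal h * (\<Sum>a\<le>k. NN z. G a z)))"
  by (simp add: lessThan_Suc_atMost[symmetric] algebra_simps)
 finally have "ennreal ((norm ?L)\<^sup>2) <= N * (C * ennreal h * (\<Sum>a\<le>k. NN z. G a z))"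
  using h by (simp add: ennreal_mult_le_mult_iff)
 also have "C * ennreal h = ennreal (real (k + 1) * h ^ (2 * k))"
 proof -
  have "h ^ (2 * k - 1) * h = h ^ (2 * k)" using k by (metis power_minus_mult mult_pos_pos zero_less_numeral)
  thus ?thesis unfolding C_def using h by (simp add: ennreal_mult[symmetric] mult.assoc)
 qed
 finally show ?thesis unfolding N_def G_def .
qed

section \<open>Change of variables in the plane\<close>

definition to_pair :: "real ^ 2 => real \<times> real" where "to_pair v = (v $ 1, v $ 2)"
definition of_pair :: "real \<times> real => real ^ 2" where "of_pair x = (\<chi> i. if i = 1 then fst x else snd x)"

lemma to_of_pair [simp]: "to_pair (of_pair x) = x" and of_to_pair [simp]: "of_pair (to_pair v) = v"
 by (auto simp: to_pair_def of_pair_def vec_eq_iff forall_2)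

lemma linear_to_pair: "linear to_pair" and linear_of_pair: "linear of_pair"
 by (auto intro!: linearI simp: to_pair_def of_pair_def vec_eq_iff)

lemma has_derivative_to_pair: "(to_pair has_derivative to_pair) (at x within A)"
 and has_derivative_of_pair: "(of_pair has_derivative of_pair) (at y within B)"
 using linear_to_pair linear_of_pair by (simp_all add: linear_imp_has_derivative)

lemma Basis_real2: "(Basis :: (real ^ 2) set) = {axis 1 1, axis 2 1}"
 by (auto simp: Basis_vec_def UNIV_2)

lemma measurable_to_pair [measurable]: "to_pair : borel_measurable borel"
 by (intro borel_measurable_continuous_onI linear_continuous_on)
  (use linear_to_pair linear_conv_bounded_linear in blast)

lemma distr_to_pair: "distr lborel borel to_pair = (lborel :: (real \<times> real) measure)"
proof (rule lborel_eqI[symmetric])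
 fix l u :: "real \<times> real" assume lu: "!!b. b : Basis ==> l \<bullet> b <= u \<bullet> b"
 have lu': "fst l <= fst u" "snd l <= snd u" using lu[of "(1, 0)"] lu[of "(0, 1)"] by (auto simp: Basis_prod_def inner_prod_def)
 have ne: "axis 1 1 ~= (axis 2 1 :: real ^ 2)" by (simp add: axis_eq_axis)
 have "to_pair -` box l u \<inter> space lborel = box (of_pair l) (of_pair u)"
  by (auto simp: mem_box to_pair_def of_pair_def Basis_real2 Basis_prod_def inner_prod_def inner_axis)
 hence "emeasure (distr lborel borel to_pair) (box l u) = emeasure lborel (box (of_pair l) (of_pair u))"
  by (subst emeasure_distr) auto
 also have "... = ennreal (\<Prod>b\<in>Basis. (of_pair u - of_pair l) \<bullet> b)"
  by (rule emeasure_lborel_box) (use lu' in \<open>auto simp: Basis_real2 of_pair_def inner_axis\<close>)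
 also have "(\<Prod>b\<in>Basis. (of_pair u - of_pair l) \<bullet> b) = (fst u - fst l) * (snd u - snd l)"
  using ne by (simp add: Basis_real2 of_pair_def inner_axis)
 also have "... = (\<Prod>b\<in>Basis. (u - l) \<bullet> b)"
  by (simp add: Basis_prod_def inner_prod_def)
 finally show "emeasure (distr lborel borel to_pair) (box l u) = ennreal (\<Prod>b\<in>Basis. (u - l) \<bullet> b)" .
qed simp

lemma nn_integral_to_pair:
 "f : borel_measurable borel ==> (\<integral>\<^sup>+x. f x \<partial>(lborel :: (real \<times> real) measure)) = (NN v. f (to_pair v))"
 by (subst distr_to_pair[symmetric], subst nn_integral_distr) auto

definition jac :: "(real \<times> real => real \<times> real) => real" where
 "jac D = fst (D (1, 0)) * snd (D (0, 1)) - snd (D (1, 0)) * fst (D (0, 1))"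

text \<open>The substitution rule is applied on \<open>real ^ 2\<close>, where the Jacobian is a
  matrix determinant, and carried over by \<open>to_pair\<close>. Points with several preimages only
  enlarge the right-hand side, and an infinite right-hand side leaves nothing to prove.\<close>

lemma nn_integral_image_le:
 fixes g :: "real \<times> real => real \<times> real" and f :: "real \<times> real => real"
 assumes S: "open S" and g: "!!x. x : S ==> (g has_derivative g' x) (at x)"
  and jc: "continuous_on S (%x. jac (g' x))"
  and f [measurable]: "f : borel_measurable borel" and f0: "!!y. 0 <= f y"
  and gS: "g ` S : sets borel"
 shows "(NN y. ennreal (f y) * indicator (g ` S) y)
  <= (NN x. ennreal (\<bar>jac (g' x)\<bar> * f (g x)) * indicator S x)"
proof (cases "(NN x. ennreal (\<bar>jac (g' x)\<bar> * f (g x)) * indicator S x) < \<infinity>")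
 case True
 have [measurable]: "S : sets borel" using S by simp
 have gc: "continuous_on S g" using g has_derivative_continuous continuous_at_imp_continuous_on by blast
 define K where "K x = indicator S x * (\<bar>jac (g' x)\<bar> * f (g x))" for x
 have Km [measurable]: "K : borel_measurable borel"
 proof -
  have 1: "(%x. indicator S x *\<^sub>R jac (g' x)) : borel_measurable borel"
   by (rule borel_measurable_continuous_on_indicator[OF _ jc]) simp
  have 2: "(%x. indicator S x *\<^sub>R g x) : borel_measurable borel"
   by (rule borel_measurable_continuous_on_indicator[OF _ gc]) simp
  have "(%x. \<bar>indicator S x *\<^sub>R jac (g' x)\<bar> * f (indicator S x *\<^sub>R g x)) : borel_measurable borel"
   using measurable_compose[OF 2 f] 1 by measurable
  moreover have "(%x. \<bar>indicator S x *\<^sub>R jac (g' x)\<bar> * f (indicator S x *\<^sub>R g x)) = K"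
   by (auto simp: K_def indicator_def)
  ultimately show ?thesis by (simp only:)
 qed
 have K0: "0 <= K x" for x by (simp add: K_def f0)
 define R where "R = (NN x. ennreal (K x))"
 have Re: "(NN x. ennreal (\<bar>jac (g' x)\<bar> * f (g x)) * indicator S x) = R"
  unfolding R_def by (intro nn_integral_cong) (auto simp: K_def indicator_def)
 then obtain r where r: "R = ennreal r" "0 <= r" using True by (cases R rule: ennreal_cases) auto
 let ?S = "to_pair -` S" and ?G = "%v. of_pair (g (to_pair v))"
 have "(NN v. ennreal (K (to_pair v))) = ennreal r"
  using nn_integral_to_pair[of "%x. ennreal (K x)"] r by (simp add: R_def)
 hence hK: "((%v. K (to_pair v)) has_integral r) UNIV"
  by (intro nn_integral_has_integral) (auto simp: K0 r)
 let ?D = "%v w. of_pair (g' (to_pair v) (to_pair w))"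
 have det: "det (matrix (?D v)) = jac (g' (to_pair v))" for v
  by (simp add: det_2 matrix_def jac_def to_pair_def of_pair_def axis_def)
 have "(%v. K (to_pair v)) = (%v. if v : ?S then \<bar>det (matrix (?D v))\<bar> * f (to_pair (?G v)) else 0)"
  by (auto simp: K_def det)
 hence hS: "((%v. \<bar>det (matrix (?D v))\<bar> * f (to_pair (?G v))) has_integral r) ?S"
  using hK has_integral_restrict_UNIV[of ?S "%v. \<bar>det (matrix (?D v))\<bar> * f (to_pair (?G v))" r] by simp
 have "(%v. f (to_pair v)) integrable_on (?G ` ?S) & integral (?G ` ?S) (%v. f (to_pair v)) <= integral ?S (%v. \<bar>det (matrix (?D v))\<bar> * f (to_pair (?G v)))"
 proof (rule integral_on_image_ubound_nonneg)
  fix v assume v: "v : ?S"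
  have "(g has_derivative g' (to_pair v)) (at (to_pair v))" using g v by auto
  from has_derivative_compose[OF has_derivative_compose[OF has_derivative_to_pair this] has_derivative_of_pair]
  show "(?G has_derivative ?D v) (at v within ?S)" .
 qed (use f0 hS in auto)
 then obtain I where I: "((%v. f (to_pair v)) has_integral I) (?G ` ?S)" "I <= r"
  unfolding integral_unique[OF hS] using integrable_integral by blast
 have "(NN y. ennreal (f y) * indicator (g ` S) y) = (NN v. ennreal (f (to_pair v)) * indicator (g ` S) (to_pair v))"
  by (rule nn_integral_to_pair) (use gS in measurable)
 also have "... = (NN v. ennreal (f (to_pair v)) * indicator (?G ` ?S) v)"
 proof (intro nn_integral_cong)
  fix v
  have "to_pair v : g ` S \<longleftrightarrow> v : ?G ` ?S"
  proof
   assume "to_pair v : g ` S"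
   then obtain x where x: "x : S" "to_pair v = g x" by blast
   hence "v = ?G (of_pair x)" by (metis of_to_pair to_of_pair)
   moreover have "of_pair x : ?S" using x by simp
   ultimately show "v : ?G ` ?S" by blast
  qed auto
  thus "ennreal (f (to_pair v)) * indicator (g ` S) (to_pair v) = ennreal (f (to_pair v)) * indicator (?G ` ?S) v"
   by (simp add: indicator_def)
 qed
 also have "... = ennreal I" by (rule nn_integral_has_integral_lebesgue'[OF _ I(1)]) (simp add: f0)
 also have "... <= ennreal r" by (rule ennreal_leI[OF I(2)])
 finally show ?thesis using Re r by simp
qed (simp add: not_less top_unique)

section \<open>Locally conic and convex sets\<close>

text \<open>Near \<open>y\<close> the set consists of initial pieces of rays from \<open>y\<close>.
  Since \<open>y\<close> itself may lie outside, a finite union of polyhedral pieces can be treated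
  piece by piece.\<close>

definition locally_conic :: "'a::real_normed_vector => 'a set => bool" where
 "locally_conic y X \<longleftrightarrow> (\<exists>e>0. \<forall>h s. norm h < e --> 0 < s --> s <= 1 --> (y + h : X \<longleftrightarrow> y + s *\<^sub>R h : X))"

lemma locally_conic_Un:
 assumes "locally_conic y X" "locally_conic y Y"
 shows "locally_conic y (X \<union> Y)"
proof -
 obtain e1 e2 where e: "e1 > 0" "e2 > 0"
  "!!h s. norm h < e1 ==> 0 < s ==> s <= 1 ==> (y + h : X \<longleftrightarrow> y + s *\<^sub>R h : X)"
  "!!h s. norm h < e2 ==> 0 < s ==> s <= 1 ==> (y + h : Y \<longleftrightarrow> y + s *\<^sub>R h : Y)"
  using assms unfolding locally_conic_def by blast
 show ?thesis unfolding locally_conic_def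
  using e by (intro exI[of _ "min e1 e2"]) auto
qed

lemma locally_conic_Int:
 assumes "locally_conic y X" "locally_conic y Y"
 shows "locally_conic y (X \<inter> Y)"
proof -
 obtain e1 e2 where e: "e1 > 0" "e2 > 0"
  "!!h s. norm h < e1 ==> 0 < s ==> s <= 1 ==> (y + h : X \<longleftrightarrow> y + s *\<^sub>R h : X)"
  "!!h s. norm h < e2 ==> 0 < s ==> s <= 1 ==> (y + h : Y \<longleftrightarrow> y + s *\<^sub>R h : Y)"
  using assms unfolding locally_conic_def by blast
 show ?thesis unfolding locally_conic_def
  using e by (intro exI[of _ "min e1 e2"]) auto
qed

lemma locally_conic_empty: "locally_conic y {}"
 unfolding locally_conic_def by (auto intro: exI[of _ 1])

lemma locally_conic_UN:
 "finite I ==> (!!i. i : I ==> locally_conic y (X i)) ==> locally_conic y (\<Union>i\<in>I. X i)"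
 by (induction I rule: finite_induct) (auto simp: locally_conic_empty intro: locally_conic_Un)

lemma locally_conic_away:
 assumes "closed X" "y ~: X"
 shows "locally_conic y X"
proof -
 obtain e where e: "e > 0" "ball y e \<inter> X = {}"
  using assms by (metis ComplI open_Compl open_contains_ball disjoint_eq_subset_Compl)
 have "y + h ~: X & y + s *\<^sub>R h ~: X" if "norm h < e" "0 < s" "s <= 1" for h s
 proof -
  have "norm (s *\<^sub>R h) <= norm h" using that by (simp add: mult_left_le_one_le)
  hence "y + h : ball y e" "y + s *\<^sub>R h : ball y e" using that by (auto simp: dist_norm)
  thus ?thesis using e by blast
 qed
 thus ?thesis unfolding locally_conic_def using e(1) by blast
qed

lemma locally_conic_segment: "locally_conic y (closed_segment a b)"
proof (cases "y : closed_segment a b")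
 case False
 thus ?thesis by (intro locally_conic_away closed_segment)
next
 case True
 show ?thesis
 proof (cases "a = b")
  case eq: True
  hence "y = a" using True by simp
  thus ?thesis unfolding locally_conic_def eq by (auto intro!: exI[of _ 1])
 next
  case False
  hence d: "norm (b - a) > 0" by simp
  obtain l where l: "0 <= l" "l <= 1" "y = a + l *\<^sub>R (b - a)"
   using True by (auto simp: in_segment algebra_simps)
  \<comment> \<open>The distance of \<open>y\<close> to the end points that differ from it; the
    default 1 keeps the minimum positive when \<open>y\<close> is an end point.\<close>
  define e where "e = norm (b - a) * min (if l > 0 then l else 1) (if l < 1 then 1 - l else 1)"
  have e: "e > 0" using d l by (auto simp: e_def)
  have "y + h : closed_segment a b" if h: "norm h < e" "0 < s" "s <= 1" "y + s *\<^sub>R h : closed_segment a b" for h s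
  proof -
   obtain m where m: "0 <= m" "m <= 1" "y + s *\<^sub>R h = a + m *\<^sub>R (b - a)"
    using h(4) by (auto simp: in_segment algebra_simps)
   hence "s *\<^sub>R h = (m - l) *\<^sub>R (b - a)" using l(3) by (simp add: algebra_simps)
   hence hh: "h = ((m - l) / s) *\<^sub>R (b - a)"
    using h(2) by (metis scaleR_scaleR scaleR_one divide_inverse mult.commute less_irrefl left_inverse)
   define n where "n = (m - l) / s"
   have hn: "h = n *\<^sub>R (b - a)" using hh by (simp add: n_def)
   hence "\<bar>n\<bar> * norm (b - a) < norm (b - a) * min (if l > 0 then l else 1) (if l < 1 then 1 - l else 1)"
    using h(1) by (simp add: e_def)
   hence "\<bar>n\<bar> < min (if l > 0 then l else 1) (if l < 1 then 1 - l else 1)"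
    using d by (simp add: mult.commute)
   moreover have "n >= 0" if "l = 0" using that m(1) h(2) by (simp add: n_def)
   moreover have "n <= 0" if "l = 1" using that m(2) h(2) by (simp add: n_def divide_nonpos_pos)
   ultimately have "0 <= l + n" "l + n <= 1" using l(1,2) by (auto split: if_splits)
   moreover have "y + h = (1 - (l + n)) *\<^sub>R a + (l + n) *\<^sub>R b" unfolding l(3) hn by (simp add: algebra_simps)
   ultimately show ?thesis unfolding in_segment by blast
  qed
  moreover have "y + s *\<^sub>R h : closed_segment a b" if "y + h : closed_segment a b" "0 < s" "s <= 1" for h s
  proof -
   have "(1 - s) *\<^sub>R y + s *\<^sub>R (y + h) : closed_segment a b"
    by (rule convexD_alt[OF convex_closed_segment True that(1)]) (use that in auto)
   thus ?thesis by (simp add: algebra_simps)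
  qed
  ultimately show ?thesis unfolding locally_conic_def using e by blast
 qed
qed

lemma locally_conic_halfspace: "locally_conic y {x. a \<bullet> x <= b}"
proof (cases "a \<bullet> y = b")
 case True
 have "a \<bullet> (y + h) <= b \<longleftrightarrow> a \<bullet> (y + s *\<^sub>R h) <= b" if "0 < s" for h s
 proof -
  have "s * (a \<bullet> h) <= 0 \<longleftrightarrow> a \<bullet> h <= 0" using that by (simp add: mult_le_0_iff)
  thus ?thesis unfolding inner_add_right inner_scaleR_right True by linarith
 qed
 hence "\<forall>h s. norm h < 1 --> 0 < s --> s <= 1 --> (y + h : {x. a \<bullet> x <= b} \<longleftrightarrow> y + s *\<^sub>R h : {x. a \<bullet> x <= b})"
  unfolding mem_Collect_eq by blast
 thus ?thesis unfolding locally_conic_def using zero_less_one by blast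
next
 case False
 define e where "e = \<bar>b - a \<bullet> y\<bar> / (norm a + 1)"
 have n: "norm a + 1 > 0" using norm_ge_zero[of a] by linarith
 have e: "e > 0" using False n by (simp add: e_def)
 have b: "\<bar>a \<bullet> h\<bar> < \<bar>b - a \<bullet> y\<bar>" if "norm h < e" for h
 proof -
  have "\<bar>a \<bullet> h\<bar> <= norm a * norm h" by (rule Cauchy_Schwarz_ineq2)
  also have "... <= (norm a + 1) * norm h" by (simp add: algebra_simps)
  also have "... < (norm a + 1) * e" using that n by simp
  also have "... = \<bar>b - a \<bullet> y\<bar>" using n by (simp add: e_def)
  finally show ?thesis .
 qed
 have "a \<bullet> (y + h) <= b \<longleftrightarrow> a \<bullet> (y + s *\<^sub>R h) <= b" if "norm h < e" "0 < s" "s <= 1" for h s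
 proof -
  have "norm (s *\<^sub>R h) <= norm h" using that by (simp add: mult_left_le_one_le)
  hence "norm (s *\<^sub>R h) < e" using that by linarith
  from b[OF this] b[OF that(1)] False show ?thesis unfolding inner_add_right by (auto simp: abs_if split: if_splits)
 qed
 thus ?thesis unfolding locally_conic_def using e by blast
qed

text \<open>On a short ray from \<open>y\<close> the conic set \<open>P\<close> is met everywhere or
  nowhere. In the second case the ray without \<open>y\<close> is connected and avoids
  \<open>P\<close>, so within \<open>A\<close> it lies in one of the disjoint relatively open sets
  \<open>X - P\<close> and \<open>A - X\<close>.\<close>

lemma locally_conic_from_boundary:
 fixes y :: "'a::real_normed_vector"
 assumes A: "affine A" "y : A" and X: "X <= A" "P <= X"
  and op: "openin (top_of_set A) (X - P)" "openin (top_of_set A) (A - X)"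
  and lc: "locally_conic y P"
 shows "locally_conic y X"
proof -
 obtain e where e: "e > 0" "!!h s. norm h < e ==> 0 < s ==> s <= 1 ==> (y + h : P \<longleftrightarrow> y + s *\<^sub>R h : P)"
  using lc unfolding locally_conic_def by blast
 have "y + h : X \<longleftrightarrow> y + s *\<^sub>R h : X" if h: "norm h < e" "0 < s" "s <= 1" for h s
 proof -
  have aff: "y + t *\<^sub>R v : A" if "y + v : A" for v t
  proof -
   have "(1 - t) *\<^sub>R y + t *\<^sub>R (y + v) : A" using A that unfolding affine_alt by blast
   thus ?thesis by (simp add: algebra_simps)
  qed
  consider "y + h : P" | "y + h ~: P" "y + h : A" | "y + h ~: A" by blast
  thus ?thesis
  proof cases
   case 1
   thus ?thesis using e(2)[OF h] X by blast
  next
   case 2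
   define C where "C = (%t. y + t *\<^sub>R h) ` {0<..1}"
   have "connected C" unfolding C_def
    by (intro connected_continuous_image continuous_intros convex_connected) auto
   moreover have "C <= A" using aff[OF 2(2)] by (auto simp: C_def)
   moreover have "C \<inter> P = {}" using e(2)[OF h(1)] 2 by (auto simp: C_def)
   ultimately have "C <= X - P \<or> C <= A - X"
   proof -
    obtain U1 U2 where U: "open U1" "X - P = A \<inter> U1" "open U2" "A - X = A \<inter> U2"
     using op unfolding openin_open by blast
    have "C <= U1 \<union> U2" using U \<open>C \<subseteq> A\<close> \<open>C \<inter> P = {}\<close> by blast
    moreover have "U1 \<inter> U2 \<inter> C = {}" using U \<open>C \<subseteq> A\<close> by blast
    ultimately have "U1 \<inter> C = {} \<or> U2 \<inter> C = {}"
     using connectedD[OF \<open>connected C\<close> U(1,3)] by blast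
    thus ?thesis using \<open>C \<subseteq> U1 \<union> U2\<close> U \<open>C \<subseteq> A\<close> by blast
   qed
   moreover have "y + h : C" "y + s *\<^sub>R h : C"
    unfolding C_def using h by (auto intro: image_eqI[of _ _ 1])
   ultimately show ?thesis by blast
  next
   case 3
   have "y + s *\<^sub>R h ~: A"
    using aff[of "s *\<^sub>R h" "1 / s"] 3 h(2) by auto
   thus ?thesis using 3 X by blast
  qed
 qed
 thus ?thesis unfolding locally_conic_def using e(1) by blast
qed

text \<open>The Tietze-Nakajima theorem by discrete curve shortening. Among the chains in
  \<open>G\<close> from x to y with N steps of length at most d one minimises the sum of squared
  step lengths. Moving a point to the midpoint of its neighbours stays in \<open>G\<close> by local
  convexity and lowers the sum unless it is already there, so the minimiser is equidistant on a
  straight line.\<close>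

lemma locally_convex_imp_convex:
 fixes G :: "'a::euclidean_space set"
 assumes G: "compact G" "path_connected G" and loc: "!!y. y : G ==> \<exists>e>0. convex (G \<inter> ball y e)"
 shows "convex G"
proof -
 obtain r where r: "!!y. y : G ==> r y > 0 & convex (G \<inter> ball y (r y))" using loc by metis
 \<comment> \<open>A Lebesgue number of the cover: one radius of convexity for all points.\<close>
 obtain eta where eta: "eta > 0" "!!y. y : G ==> \<exists>B\<in>(%y. ball y (r y)) ` G. ball y eta <= B"
  by (rule Heine_Borel_lemma[OF G(1), of "(%y. ball y (r y)) ` G"]) (use r in force)+
 have cv: "convex (G \<inter> ball y eta)" if yG: "y : G" for y
 proof -
  obtain z where z: "z : G" "ball y eta <= ball z (r z)" using eta(2)[OF yG] by blast
  hence "G \<inter> ball y eta = (G \<inter> ball z (r z)) \<inter> ball y eta" by blast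
  thus ?thesis using r[OF z(1)] by (simp add: convex_Int)
 qed
 define d where "d = eta / 2"
 have d: "d > 0" "d < eta" using eta by (auto simp: d_def)
 have "closed_segment x y <= G" if xy: "x : G" "y : G" for x y
 proof -
  obtain g where g: "path g" "path_image g <= G" "pathstart g = x" "pathfinish g = y"
   using G(2) xy unfolding path_connected_def by blast
  have "uniformly_continuous_on {0..1} g"
   using g(1) compact_uniformly_continuous unfolding path_def by blast
  then obtain \<delta> where \<delta>: "\<delta> > 0" "!!s t. s : {0..1} ==> t : {0..1} ==> dist t s < \<delta> ==> dist (g t) (g s) < d"
   using d(1) unfolding uniformly_continuous_on_def by metis
  obtain N0 where "inverse (real (Suc N0)) < \<delta>" using reals_Archimedean[OF \<delta>(1)] by blast
  then obtain N where N: "N > 0" "1 / real N < \<delta>" by (metis inverse_eq_divide zero_less_Suc)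
  \<comment> \<open>Chains are whole sequences in the compact set \<open>G\<close>, so that
    Tychonoff's theorem yields compactness; only the entries up to \<open>N\<close> are subject to
    further conditions.\<close>
  define S where "S = {p :: nat => 'a. \<forall>i. p i : G} \<inter> ({p. p 0 = x} \<inter> {p. p N = y} \<inter> (\<Inter>i\<in>{..<N}. {p. dist (p i) (p (Suc i)) <= d}))"
  have co: "continuous_on UNIV (%p :: nat => 'a. p i)" for i by (rule continuous_on_product_coordinates)
  have "compact {p :: nat => 'a. \<forall>i. p i : G}"
  proof -
   have "compactin (product_topology (%i::nat. euclidean :: 'a topology) UNIV) (PiE UNIV (%i. G))"
    unfolding compactin_PiE using G(1) by (simp add: compactin_euclidean_iff)
   thus ?thesis by (simp add: euclidean_product_topology compactin_euclidean_iff PiE_UNIV_domain Pi_def)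
  qed
  moreover have "closed ({p. p 0 = x} \<inter> {p. p N = y} \<inter> (\<Inter>i\<in>{..<N}. {p :: nat => 'a. dist (p i) (p (Suc i)) <= d}))"
   by (intro closed_Int closed_INT ballI closed_Collect_eq closed_Collect_le continuous_intros co)
  ultimately have cS: "compact S" unfolding S_def by (rule compact_Int_closed)
  have "(%i. g (real (min i N) / real N)) : S"
  proof -
   have "g t : G" if "t : {0..1}" for t using g(2) that by (auto simp: path_image_def)
   moreover have "dist (g (real i / real N)) (g (real (Suc i) / real N)) <= d" if "i < N" for i
   proof -
    have "dist (real i / real N) (real (Suc i) / real N) < \<delta>"
     using N that by (simp add: dist_real_def field_simps abs_if)
    thus ?thesis using \<delta>(2)[of "real (Suc i) / real N" "real i / real N"] that N(1) by (simp add: less_imp_le)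
   qed
   ultimately show ?thesis using g(3,4) N(1) unfolding S_def pathstart_def pathfinish_def
    by (auto simp: min_def)
  qed
  hence "S ~= {}" by blast
  define E where "E p = (\<Sum>i<N. (dist (p i) (p (Suc i)))\<^sup>2)" for p :: "nat => 'a"
  have "continuous_on S E" unfolding E_def
   by (intro continuous_intros continuous_on_subset[OF co] subset_UNIV)
  then obtain p where p: "p : S" "!!q. q : S ==> E p <= E q"
   using continuous_attains_inf[OF cS \<open>S \<noteq> {}\<close>] by blast
  have pG: "p i : G" for i using p(1) by (auto simp: S_def)
  have pd: "dist (p i) (p (Suc i)) <= d" if "i < N" for i using p(1) that by (auto simp: S_def)
  have mid: "p (Suc i) = midpoint (p i) (p (Suc (Suc i)))" if i: "Suc i < N" for i
  proof -
   let ?m = "midpoint (p i) (p (Suc (Suc i)))"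
   let ?q = "p(Suc i := ?m)"
   have "p i : G \<inter> ball (p (Suc i)) eta" "p (Suc (Suc i)) : G \<inter> ball (p (Suc i)) eta"
    using pd[of i] pd[OF i] i d pG by (auto simp: dist_commute)
   hence "?m : G" using convexD_alt[OF cv[OF pG], of "p i" "Suc i" "p (Suc (Suc i))" "1/2"]
    by (auto simp: midpoint_def scaleR_add_right)
   have "dist (p i) (p (Suc (Suc i))) <= 2 * d"
    using dist_triangle[of "p i" "p (Suc (Suc i))" "p (Suc i)"] pd[of i] pd[OF i] i by linarith
   hence "?q : S" using p(1) i \<open>?m \<in> G\<close> unfolding S_def by (auto simp: dist_midpoint less_Suc_eq)
   from p(2)[OF this] have le: "E p <= E ?q" .
   have Ed: "E v = (\<Sum>j\<in>{..<N} - {i, Suc i}. (dist (v j) (v (Suc j)))\<^sup>2) + ((dist (v i) (v (Suc i)))\<^sup>2 + (dist (v (Suc i)) (v (Suc (Suc i))))\<^sup>2)" for v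
    unfolding E_def using i by (subst sum.subset_diff[of "{i, Suc i}"]) auto
   have "(\<Sum>j\<in>{..<N} - {i, Suc i}. (dist (?q j) (?q (Suc j)))\<^sup>2) = (\<Sum>j\<in>{..<N} - {i, Suc i}. (dist (p j) (p (Suc j)))\<^sup>2)"
    by (intro sum.cong) auto
   hence le2: "(dist (p i) (p (Suc i)))\<^sup>2 + (dist (p (Suc i)) (p (Suc (Suc i))))\<^sup>2 <= (dist (p i) ?m)\<^sup>2 + (dist ?m (p (Suc (Suc i))))\<^sup>2"
    using le unfolding Ed by simp
   \<comment> \<open>Parallelogram identity: the sum of squares exceeds its value at the midpoint by
     twice the squared distance to the midpoint.\<close>
   have par: "(dist a v)\<^sup>2 + (dist v b)\<^sup>2 = 2 * (dist v (midpoint a b))\<^sup>2 + (dist a (midpoint a b))\<^sup>2 + (dist (midpoint a b) b)\<^sup>2" for a b v :: 'a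
    unfolding dist_norm power2_norm_eq_inner midpoint_def
    by (simp add: inner_simps inner_commute algebra_simps)
   from le2 par[of "p i" "p (Suc i)" "p (Suc (Suc i))"] have "2 * (dist (p (Suc i)) ?m)\<^sup>2 <= 0"
    by linarith
   thus ?thesis by simp
  qed
  define v where "v = p 1 - p 0"
  have step: "p (Suc i) - p i = v" if "i < N" for i
   using that
  proof (induction i)
   case (Suc i)
   have "p (Suc (Suc i)) - p (Suc i) = p (Suc i) - p i"
   proof -
    have "midpoint a b + midpoint a b = a + b" for a b :: 'a
     by (simp add: midpoint_def flip: scaleR_2)
    from this[of "p i" "p (Suc (Suc i))"] have "p (Suc i) + p (Suc i) = p i + p (Suc (Suc i))"
     unfolding mid[OF Suc.prems, symmetric] .
    thus ?thesis by (simp add: algebra_simps)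
   qed
   thus ?case using Suc by simp
  qed (simp add: v_def)
  have pi: "p i = x + real i *\<^sub>R v" if "i <= N" for i
   using that
  proof (induction i)
   case (Suc i)
   thus ?case using step[of i] by (simp add: algebra_simps)
  qed (use p(1) in \<open>simp add: S_def\<close>)
  have Nv: "y = x + real N *\<^sub>R v" using pi[of N] p(1) by (simp add: S_def)
  show ?thesis
  proof
   fix z assume "z : closed_segment x y"
   then obtain t where t: "0 <= t" "t <= 1" "z = x + t *\<^sub>R (y - x)" by (auto simp: in_segment algebra_simps)
   \<comment> \<open>At t = 1 the floor would give N, one past the last step of the chain.\<close>
   define i where "i = (if t = 1 then N - 1 else nat \<lfloor>t * real N\<rfloor>)"
   have i: "i < N" "real i <= t * real N" "t * real N <= real (Suc i)"
   proof -
    show "i < N" using t N(1) unfolding i_def by (auto simp: nat_less_iff floor_less_iff)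
    show "real i <= t * real N" using t N(1) unfolding i_def by auto
    show "t * real N <= real (Suc i)" using t N(1) unfolding i_def
     by (auto simp: of_nat_diff) linarith
   qed
   define u where "u = t * real N - real i"
   have "(1 - u) *\<^sub>R p i + u *\<^sub>R p (Suc i) : G \<inter> ball (p i) eta"
    by (rule convexD_alt[OF cv[OF pG]]) (use i pd[OF i(1)] pG d eta(1) in \<open>auto simp: u_def\<close>)
   moreover have "(1 - u) *\<^sub>R p i + u *\<^sub>R p (Suc i) = z"
   proof -
    have "z = x + (t * real N) *\<^sub>R v" unfolding t(3) Nv by simp
    moreover have "(1 - u) *\<^sub>R p i + u *\<^sub>R p (Suc i) = x + (real i + u) *\<^sub>R v"
     using pi[of i] pi[of "Suc i"] i(1) by (simp add: algebra_simps)
    ultimately show ?thesis by (simp add: u_def)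
   qed
   ultimately show "z : G" by blast
  qed
 qed
 thus ?thesis unfolding convex_contains_segment by blast
qed

text \<open>The point \<open>f (z + s w)\<close> of \<open>G\<close> is \<open>f z\<close> plus s
  times a difference quotient. As \<open>G\<close> is conic at \<open>f z\<close>, the factor s may
  be replaced by the fixed \<sigma>, and closedness of \<open>G\<close> allows s to tend to 0 in the
  quotient.\<close>

lemma tangent_image:
 fixes f :: "'a::real_normed_vector => 'b::real_normed_vector"
 assumes f: "(f has_derivative L) (at z within Q)" "f ` Q <= G" and zQ: "z : Q"
  and G: "closed G"
  and eG: "!!h s. norm h < e ==> 0 < s ==> s <= 1 ==> (f z + h : G \<longleftrightarrow> f z + s *\<^sub>R h : G)"
  and w: "s0 > 0" "!!s. 0 < s ==> s <= s0 ==> z + s *\<^sub>R w : Q"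
  and \<sigma>: "0 < \<sigma>" "\<sigma> * norm (L w) < e"
 shows "f z + \<sigma> *\<^sub>R L w : G" "((%s. (f (z + s *\<^sub>R w) - f z) /\<^sub>R s) \<longlongrightarrow> L w) (at_right 0)"
proof -
 have "((%s. z + s *\<^sub>R w) has_derivative (%s. s *\<^sub>R w)) (at 0 within {0..s0})"
  by (auto intro!: derivative_eq_intros)
 moreover have "(f has_derivative L) (at (z + 0 *\<^sub>R w) within (%s. z + s *\<^sub>R w) ` {0..s0})"
 proof -
  have "(%s. z + s *\<^sub>R w) ` {0..s0} <= Q"
  proof clarify
   fix s assume "s : {0..s0}"
   thus "z + s *\<^sub>R w : Q" using w(2)[of s] zQ by (cases "s = 0") auto
  qed
  thus ?thesis using has_derivative_subset[OF f(1)] by simp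
 qed
 ultimately have "((%s. f (z + s *\<^sub>R w)) has_derivative (%s. L (s *\<^sub>R w))) (at 0 within {0..s0})"
  by (rule has_derivative_in_compose)
 hence d: "((%s. norm (f (z + s *\<^sub>R w) - f (z + 0 *\<^sub>R w) - L ((s - 0) *\<^sub>R w)) / norm (s - 0)) \<longlongrightarrow> 0) (at 0 within {0..s0})"
  unfolding has_derivative_iff_norm by blast
 have "((%s. norm ((f (z + s *\<^sub>R w) - f z) /\<^sub>R s - L w)) \<longlongrightarrow> 0) (at 0 within {0..s0})"
 proof (rule Lim_transform_eventually[OF d])
  show "\<forall>\<^sub>F s in at 0 within {0..s0}. norm (f (z + s *\<^sub>R w) - f (z + 0 *\<^sub>R w) - L ((s - 0) *\<^sub>R w)) / norm (s - 0)
    = norm ((f (z + s *\<^sub>R w) - f z) /\<^sub>R s - L w)"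
   unfolding eventually_at_filter
  proof (rule always_eventually, intro allI impI)
   fix s :: real assume s: "s ~= 0"
   have "(f (z + s *\<^sub>R w) - f z) /\<^sub>R s - L w = (f (z + s *\<^sub>R w) - f z - L (s *\<^sub>R w)) /\<^sub>R s"
    using s by (simp only: linear_scale[OF has_derivative_linear[OF f(1)]] scaleR_diff_right) simp
   thus "norm (f (z + s *\<^sub>R w) - f (z + 0 *\<^sub>R w) - L ((s - 0) *\<^sub>R w)) / norm (s - 0)
    = norm ((f (z + s *\<^sub>R w) - f z) /\<^sub>R s - L w)"
    by (simp only: norm_scaleR) (simp add: divide_inverse mult.commute)
  qed
 qed
 hence "((%s. (f (z + s *\<^sub>R w) - f z) /\<^sub>R s) \<longlongrightarrow> L w) (at 0 within {0..s0})"
  by (rule LIM_zero_cancel[OF tendsto_norm_zero_cancel])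
 moreover have "at 0 within {0..s0} = at_right 0"
  using w(1) by (metis at_within_Icc_at_right)
 ultimately show lim: "((%s. (f (z + s *\<^sub>R w) - f z) /\<^sub>R s) \<longlongrightarrow> L w) (at_right 0)" by simp
 let ?h = "%s. (f (z + s *\<^sub>R w) - f z) /\<^sub>R s"
 have "((%s. \<sigma> * norm (?h s)) \<longlongrightarrow> \<sigma> * norm (L w)) (at_right 0)" by (intro tendsto_intros lim)
 hence "\<forall>\<^sub>F s in at_right 0. \<sigma> * norm (?h s) < e" using \<sigma>(2) by (rule order_tendstoD)
 moreover have "\<forall>\<^sub>F s in at_right 0. s < min s0 \<sigma>" "\<forall>\<^sub>F s in at_right (0::real). s > 0"
  using w(1) \<sigma>(1) by (auto intro!: eventually_at_right_less eventually_at_rightI[of 0 "min s0 \<sigma>"])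
 ultimately have ev: "\<forall>\<^sub>F s in at_right 0. f z + \<sigma> *\<^sub>R ?h s : G"
 proof eventually_elim
  case (elim s)
  have "f z + (s / \<sigma>) *\<^sub>R (\<sigma> *\<^sub>R ?h s) = f (z + s *\<^sub>R w)" using elim \<sigma>(1) by simp
  moreover have "f (z + s *\<^sub>R w) : G" using w(2)[of s] elim f(2) by auto
  moreover have "norm (\<sigma> *\<^sub>R ?h s) < e" using elim \<sigma>(1) by simp
  ultimately show ?case using eG[of "\<sigma> *\<^sub>R ?h s" "s / \<sigma>"] elim \<sigma>(1) by simp
 qed
 have lim': "((%s. f z + \<sigma> *\<^sub>R ?h s) \<longlongrightarrow> f z + \<sigma> *\<^sub>R L w) (at_right 0)" by (intro tendsto_intros lim)
 show "f z + \<sigma> *\<^sub>R L w : G"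
  by (rule Lim_in_closed_set[OF G ev trivial_limit_at_right_real lim'])
qed

lemma small_scale: "d > 0 ==> \<exists>\<sigma>>0. \<sigma> * norm v < d"
proof (intro exI[of _ "d / (norm v + 1)"] conjI)
 assume d: "d > 0"
 have n: "norm v + 1 > 0" using norm_ge_zero[of v] by linarith
 thus "d / (norm v + 1) > 0" using d by simp
 show "d / (norm v + 1) * norm v < d" using n d by (simp add: field_simps)
qed

text \<open>Tangent directions correspond under the derivatives: a direction h of \<open>G\<close>
  is \<open>L w\<close> with w = \<open>M h\<close> a direction of \<open>Q\<close>, because
  \<open>f\<close> undoes \<open>g\<close> on \<open>G\<close>. The directions of the convex set
  \<open>Q\<close> form a convex cone, and near \<open>f z\<close> the set \<open>G\<close> is its
  image under the linear map \<open>L\<close>.\<close>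

lemma conic_diffeo_convex:
 fixes f :: "'a::real_normed_vector => 'b::real_normed_vector"
 assumes f: "f ` Q <= G" "(f has_derivative L) (at z within Q)"
  and g: "g ` G <= Q" "(g has_derivative M) (at (f z) within G)"
  and fg: "!!v. v : G ==> f (g v) = v" and z: "z : Q" "g (f z) = z"
  and Q: "locally_conic z Q" "convex Q" "closed Q" and G: "locally_conic (f z) G" "closed G"
 shows "\<exists>e>0. convex (G \<inter> ball (f z) e)"
proof -
 let ?y = "f z"
 obtain e where e: "e > 0" "!!h s. norm h < e ==> 0 < s ==> s <= 1 ==> (?y + h : G \<longleftrightarrow> ?y + s *\<^sub>R h : G)"
  using G(1) unfolding locally_conic_def by blast
 obtain e' where e': "e' > 0" "!!h s. norm h < e' ==> 0 < s ==> s <= 1 ==> (z + h : Q \<longleftrightarrow> z + s *\<^sub>R h : Q)"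
  using Q(1) unfolding locally_conic_def by blast
 have yG: "?y : G" using f z by blast
 have linL: "linear L" and linM: "linear M" using f(2) g(2) has_derivative_linear by blast+
 have bk: "\<exists>w s0. s0 > 0 & (\<forall>s. 0 < s & s <= s0 --> z + s *\<^sub>R w : Q) & L w = h" if h: "norm h < e" "?y + h : G" for h
 proof -
  have hs: "?y + s *\<^sub>R h : G" if "0 < s" "s <= 1" for s using e(2)[OF h(1) that] h(2) by blast
  obtain \<sigma> where \<sigma>: "\<sigma> > 0" "\<sigma> * norm (M h) < e'" using small_scale[OF e'(1)] by blast
  have "g ?y + \<sigma> *\<^sub>R M h : Q"
   by (rule tangent_image(1)[OF g(2,1) yG Q(3) _ zero_less_one hs \<sigma>]) (use e'(2) z(2) in auto)
  hence Q': "z + s *\<^sub>R M h : Q" if "0 < s" "s <= \<sigma>" for s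
  proof -
   have "z + (s / \<sigma>) *\<^sub>R (\<sigma> *\<^sub>R M h) : Q"
    using e'(2)[of "\<sigma> *\<^sub>R M h" "s / \<sigma>"] \<sigma> that \<open>g ?y + \<sigma> *\<^sub>R M h \<in> Q\<close> z(2) by simp
   thus ?thesis using \<sigma>(1) by simp
  qed
  have "((%v. f (g v)) has_derivative (%v. L (M v))) (at ?y within G)"
   by (rule has_derivative_in_compose[OF g(2)]) (use f(2) z(2) has_derivative_subset[OF f(2) g(1)] in auto)
  hence d: "((%v. v) has_derivative (%v. L (M v))) (at ?y within G)"
   by (rule has_derivative_transform[OF yG, rotated]) (simp add: fg)
  \<comment> \<open>The identity of \<open>G\<close> is differentiated along the ray in direction h,
    where its difference quotients are constantly h; comparing limits gives
    \<open>L (M h) = h\<close>.\<close>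
  have "((%s. (?y + s *\<^sub>R h - ?y) /\<^sub>R s) \<longlongrightarrow> L (M h)) (at_right 0)"
  proof -
   obtain \<sigma>' where s': "\<sigma>' > 0" "\<sigma>' * norm (L (M h)) < e" using small_scale[OF e(1)] by blast
   show ?thesis
    by (rule tangent_image(2)[OF d _ yG G(2) _ zero_less_one hs s']) (use e(2) in auto)
  qed
  moreover have "((%s. (?y + s *\<^sub>R h - ?y) /\<^sub>R s) \<longlongrightarrow> h) (at_right 0)"
   by (rule Lim_transform_eventually[OF tendsto_const])
    (auto simp: eventually_at_right_less intro!: eventually_mono[OF eventually_at_right_less])
  ultimately have "L (M h) = h" using tendsto_unique trivial_limit_at_right_real by blast
  thus ?thesis using Q' \<sigma>(1) by blast
 qed
 have "convex (G \<inter> ball ?y e)"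
 proof (rule convexI)
  fix a b and u v :: real assume ab: "a : G \<inter> ball ?y e" "b : G \<inter> ball ?y e" and uv: "0 <= u" "0 <= v" "u + v = 1"
  let ?c = "u *\<^sub>R a + v *\<^sub>R b"
  have cb: "?c : ball ?y e" using convexD[OF convex_ball _ _ uv] ab by blast
  obtain w1 s1 where w1: "s1 > 0" "!!s. 0 < s ==> s <= s1 ==> z + s *\<^sub>R w1 : Q" "L w1 = a - ?y"
   using bk[of "a - ?y"] ab by (auto simp: dist_norm norm_minus_commute)
  obtain w2 s2 where w2: "s2 > 0" "!!s. 0 < s ==> s <= s2 ==> z + s *\<^sub>R w2 : Q" "L w2 = b - ?y"
   using bk[of "b - ?y"] ab by (auto simp: dist_norm norm_minus_commute)
  let ?w = "u *\<^sub>R w1 + v *\<^sub>R w2"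
  have wQ: "z + s *\<^sub>R ?w : Q" if "0 < s" "s <= min s1 s2" for s
  proof -
   have "u *\<^sub>R (z + s *\<^sub>R w1) + v *\<^sub>R (z + s *\<^sub>R w2) : Q"
    by (rule convexD[OF Q(2) _ _ uv]) (use w1(2) w2(2) that in auto)
   moreover have "u *\<^sub>R (z + s *\<^sub>R w1) + v *\<^sub>R (z + s *\<^sub>R w2) = (u + v) *\<^sub>R z + s *\<^sub>R ?w"
    by (simp add: algebra_simps)
   ultimately show ?thesis by (simp add: uv)
  qed
  have Lw: "L ?w = ?c - ?y"
  proof -
   have "L ?w = u *\<^sub>R (a - ?y) + v *\<^sub>R (b - ?y)"
    using linL w1(3) w2(3) by (simp add: linear_add linear_scale)
   also have "... = ?c - (u + v) *\<^sub>R ?y" by (simp add: algebra_simps)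
   finally show ?thesis by (simp add: uv)
  qed
  have "?y + 1 *\<^sub>R L ?w : G"
   by (rule tangent_image(1)[where ?s0.0 = "min s1 s2", OF f(2,1) z(1) G(2) _ _ wQ])
    (use e(2) w1(1) w2(1) cb Lw in \<open>auto simp: dist_norm norm_minus_commute\<close>)
  thus "?c : G \<inter> ball ?y e" using Lw cb by simp
 qed
 thus ?thesis using e(1) by blast
qed

lemma locally_conic_unit_square: "locally_conic z (unit_square :: (real \<times> real) set)"
proof -
 have "(unit_square :: (real \<times> real) set) = {x. (1, 0) \<bullet> x <= 1} \<inter> {x. (0, 1) \<bullet> x <= 1} \<inter> ({x. (-1, 0) \<bullet> x <= 0} \<inter> {x. (0, -1) \<bullet> x <= 0})"
  by (auto simp: inner_prod_def)
 thus ?thesis by (simp only: locally_conic_Int locally_conic_halfspace)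
qed

text \<open>In a Lipschitz chart the boundary is a graph over a plane; a segment in the plane lifts
  to a path in the boundary that is longer by at most a fixed factor in extent.\<close>

lemma lipschitz_boundary_local_path:
 assumes D: "closed D" "lipschitz_boundary D" and p: "p : frontier D"
 shows "\<exists>r>0. \<exists>C>0. \<forall>x\<in>frontier D \<inter> ball p r. \<forall>y\<in>frontier D \<inter> ball p r.
  \<exists>c. path c & pathstart c = x & pathfinish c = y & path_image c <= frontier D \<inter> cball x (C * dist x y)"
proof -
 obtain e r h L and g :: "point => real" where e: "norm e = 1" "r > 0" "h > 0" and g: "L-lipschitz_on {y. y \<bullet> e = 0} g"
  and D': "!!y t. y \<bullet> e = 0 ==> norm y < r ==> \<bar>t\<bar> < h ==> (p + y + t *\<^sub>R e : D \<longleftrightarrow> g y <= t)"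
  using D(2) p unfolding lipschitz_boundary_def by blast
 define L' where "L' = L + 1"
 have L: "L' > 0" using lipschitz_on_nonneg[OF g] by (simp add: L'_def)
 have gl: "\<bar>g x - g y\<bar> <= L' * dist x y" if "x \<bullet> e = 0" "y \<bullet> e = 0" for x y
 proof -
  have "\<bar>g x - g y\<bar> <= L * dist x y" using lipschitz_onD[OF g, of x y] that by (simp add: dist_real_def)
  also have "... <= L' * dist x y" by (simp add: L'_def mult_right_mono)
  finally show ?thesis .
 qed
 have ee: "e \<bullet> e = 1" using e(1) by (simp add: dot_square_norm)
 define V where "V x = x - p - ((x - p) \<bullet> e) *\<^sub>R e" for x
 define T where "T x = (x - p) \<bullet> e" for x
 have dec: "x = p + V x + T x *\<^sub>R e" for x by (simp add: V_def T_def)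
 have Ve: "V x \<bullet> e = 0" for x by (simp add: V_def inner_diff_left inner_scaleR_left ee)
 have T1: "\<bar>T x\<bar> <= dist p x" for x
  using Cauchy_Schwarz_ineq2[of "x - p" e] e(1) by (simp add: T_def dist_norm norm_minus_commute)
 have Vd: "norm (V x - V y) <= dist x y" for x y
 proof -
  let ?d = "x - y"
  have vd: "V x - V y = ?d - (?d \<bullet> e) *\<^sub>R e" by (simp add: V_def inner_diff_left algebra_simps)
  have "(norm (V x - V y))\<^sup>2 = ?d \<bullet> ?d - (?d \<bullet> e)\<^sup>2"
   unfolding vd power2_norm_eq_inner
   by (simp add: inner_diff_left inner_diff_right inner_commute ee power2_eq_square)
  also have "... <= (dist x y)\<^sup>2" by (simp add: dist_norm power2_norm_eq_inner)
  finally show ?thesis by (rule power2_le_imp_le) simp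
 qed
 have V0: "V p = 0" by (simp add: V_def)
 have Vn: "norm (V x) <= dist p x" for x using Vd[of x p] V0 by (simp add: dist_commute)
 have contV: "continuous_on UNIV V" "continuous_on UNIV T" unfolding V_def T_def by (intro continuous_intros)+
 have contg: "continuous_on UNIV (%x. g (V x))"
  by (rule continuous_on_compose2[OF lipschitz_on_continuous_on[OF g] contV(1)]) (auto simp: Ve)
 define N where "N = {x. norm (V x) < r} \<inter> {x. \<bar>T x\<bar> < h}"
 have opN: "open N" unfolding N_def by (intro open_Int open_Collect_less continuous_intros contV)
 have DN: "x : D \<longleftrightarrow> g (V x) <= T x" if "x : N" for x
  using D'[OF Ve, of x "T x"] that dec[of x] by (simp add: N_def)
 \<comment> \<open>Inside the chart the frontier is exactly the graph: what lies strictly above is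
   interior to \<open>D\<close>, and a point of the graph leaves \<open>D\<close> when it is
   lowered.\<close>
 have fr: "x : frontier D \<longleftrightarrow> T x = g (V x)" if xN: "x : N" for x
 proof
  assume x: "x : frontier D"
  hence "x : D" using D(1) frontier_subset_closed by blast
  hence le: "g (V x) <= T x" using DN[OF xN] by blast
  show "T x = g (V x)"
  proof (rule ccontr)
   assume "T x ~= g (V x)"
   hence "x : N \<inter> {x. g (V x) < T x}" using le xN by simp
   moreover have "open (N \<inter> {x. g (V x) < T x})" by (intro open_Int opN open_Collect_less contg contV)
   moreover have "N \<inter> {x. g (V x) < T x} <= D" using DN by force
   ultimately have "x : interior D" using interiorI by blast
   thus False using x by (simp add: frontier_def)
  qed
 next
  assume eq: "T x = g (V x)"
  hence "x : D" using DN[OF xN] by simp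
  moreover have "x ~: interior D"
  proof
   assume "x : interior D"
   then obtain d1 where d1: "d1 > 0" "ball x d1 <= D" by (meson mem_interior)
   obtain d2 where d2: "d2 > 0" "ball x d2 <= N" using opN xN open_contains_ball by blast
   define d where "d = min d1 d2 / 2"
   have d: "d > 0" "d < d1" "d < d2" using d1 d2 by (auto simp: d_def)
   let ?x = "x - d *\<^sub>R e"
   have "dist x ?x = d" using d e(1) by (simp add: dist_norm)
   hence "?x : N" "?x : D" using d1 d2 d by auto
   moreover have "T ?x = T x - d" by (simp add: T_def inner_diff_left ee)
   moreover have "V ?x = V x" by (simp add: V_def inner_diff_left ee algebra_simps)
   ultimately show False using DN[of ?x] eq d by simp
  qed
  ultimately show "x : frontier D" using closure_subset by (auto simp: frontier_def)
 qed
 \<comment> \<open>The graph passes through \<open>p\<close>, so over the disc of radius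
   \<open>rho\<close> its height is at most \<open>L' * rho\<close>; with this choice lifted
   segments stay inside the chart.\<close>
 define rho where "rho = min r (h / (L' + 1))"
 have rho: "rho > 0" "rho <= r" using e L by (auto simp: rho_def)
 have "rho <= h / (L' + 1)" by (simp add: rho_def)
 hence rho3: "rho * (L' + 1) <= h" using L by (subst (asm) pos_le_divide_eq) auto
 have "p : N" using e by (simp add: N_def V0 T_def)
 hence g0: "g 0 = 0" using fr[of p] p by (simp add: V0 T_def)
 have bN: "x : N" if "x : ball p rho" for x
 proof -
  have "0 <= rho * L'" using rho(1) L by simp
  hence "rho <= h" using rho3 unfolding distrib_left mult_1_right by linarith
  thus ?thesis using that Vn[of x] T1[of x] rho by (auto simp: N_def)
 qed
 have "\<exists>c. path c & pathstart c = x & pathfinish c = y & path_image c <= frontier D \<inter> cball x ((1 + L') * dist x y)"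
  if x: "x : frontier D \<inter> ball p rho" and y: "y : frontier D \<inter> ball p rho" for x y
 proof -
  define v where "v s = (1 - s) *\<^sub>R V x + s *\<^sub>R V y" for s
  define c where "c s = p + v s + g (v s) *\<^sub>R e" for s
  have ve: "v s \<bullet> e = 0" for s by (simp add: v_def inner_add_left Ve)
  have Vc: "V (c s) = v s" "T (c s) = g (v s)" for s
   by (auto simp: V_def T_def c_def inner_add_left ee ve)
  have "continuous_on {0..1} c" unfolding c_def v_def
   by (intro continuous_intros continuous_on_compose2[OF lipschitz_on_continuous_on[OF g]])
    (auto simp: inner_add_left Ve)
  hence 1: "path c" by (simp add: path_def)
  have fx: "T x = g (V x)" "T y = g (V y)" using fr[OF bN] x y by auto
  have 2: "pathstart c = x" using dec[of x] fx by (simp add: pathstart_def c_def v_def)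
  have 3: "pathfinish c = y" using dec[of y] fx by (simp add: pathfinish_def c_def v_def)
  have "c s : frontier D \<inter> cball x ((1 + L') * dist x y)" if s: "s : {0..1}" for s
  proof
   have "norm (v s) < rho"
   proof -
    have "V x : ball 0 rho" "V y : ball 0 rho" using x y Vn[of x] Vn[of y] by auto
    hence "v s : ball 0 rho" unfolding v_def by (rule convexD_alt[OF convex_ball]) (use s in auto)
    thus ?thesis by simp
   qed
   moreover have "\<bar>g (v s)\<bar> <= L' * norm (v s)" using gl[of "v s" 0] ve g0 by simp
   moreover have "L' * norm (v s) < h"
   proof -
    have "L' * norm (v s) <= L' * rho" using calculation(1) L by simp
    also have "... < rho * (L' + 1)" using rho(1) by (simp add: algebra_simps)
    finally show ?thesis using rho3 by simp
   qed
   ultimately have "c s : N" using rho(2) by (simp add: N_def Vc)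
   thus "c s : frontier D" using fr Vc by simp
   have "c s - x = (v s - V x) + (g (v s) - g (V x)) *\<^sub>R e"
    unfolding c_def using dec[of x] fx by (simp add: algebra_simps)
   hence "norm (c s - x) <= norm (v s - V x) + \<bar>g (v s) - g (V x)\<bar>"
    using norm_triangle_ineq[of "v s - V x" "(g (v s) - g (V x)) *\<^sub>R e"] e(1) by simp
   hence "dist x (c s) <= norm (v s - V x) + \<bar>g (v s) - g (V x)\<bar>"
    by (subst dist_commute) (simp only: dist_norm)
   also have "... <= (1 + L') * norm (v s - V x)"
    using gl[OF ve Ve, of s x] by (simp add: dist_norm algebra_simps)
   also have "norm (v s - V x) <= dist x y"
   proof -
    have "v s - V x = s *\<^sub>R (V y - V x)" by (simp add: v_def algebra_simps)
    hence "norm (v s - V x) = s * norm (V x - V y)" using s by (simp add: norm_minus_commute)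
    also have "... <= 1 * dist x y" by (rule mult_mono) (use s Vd in auto)
    finally show ?thesis by simp
   qed
   finally show "c s : cball x ((1 + L') * dist x y)" using L by (simp add: mult_left_mono)
  qed
  hence 4: "path_image c <= frontier D \<inter> cball x ((1 + L') * dist x y)" by (auto simp: path_image_def)
  show ?thesis using 1 2 3 4 by blast
 qed
 thus ?thesis using rho(1) L by (intro exI[of _ rho] conjI exI[of _ "1 + L'"] ballI) auto
qed

text \<open>A path in the frontier from \<open>F\<close> to its complement has to cross the relative
  boundary \<open>K\<close>, and by \<open>lipschitz_boundary_local_path\<close> it stays within a
  multiple of the Euclidean distance of its ends. For ends farther apart than a Lebesgue number the
  boundedness of the frontier suffices. This later keeps small supports inside one patch.\<close>

lemma frontier_separation:
 assumes D: "compact D" "lipschitz_boundary D"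
  and F: "openin (top_of_set (frontier D)) F" "K = closure F - F" "K ~= {}"
 shows "\<exists>c>0. \<forall>x\<in>F. \<forall>y\<in>frontier D - F. c * infdist x K <= dist x y"
proof -
 have Fs: "F <= frontier D" using F(1) openin_subset by fastforce
 have comp: "compact (frontier D)" using D(1) by (simp add: compact_frontier)
 have KD: "K <= frontier D" using F(2) Fs closure_mono[OF Fs] compact_imp_closed[OF comp] by auto
 obtain r C where rC: "!!p. p : frontier D ==> r p > 0 & C p > 0 & (\<forall>x\<in>frontier D \<inter> ball p (r p). \<forall>y\<in>frontier D \<inter> ball p (r p).
  \<exists>c. path c & pathstart c = x & pathfinish c = y & path_image c <= frontier D \<inter> cball x (C p * dist x y))"
  using lipschitz_boundary_local_path[OF compact_imp_closed[OF D(1)] D(2)] by metis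
 obtain P where P: "finite P" "P <= frontier D" "frontier D <= (\<Union>p\<in>P. ball p (r p))"
  using compactE_image[OF comp, of "frontier D" "%p. ball p (r p)"] rC by (metis (no_types, lifting) UN_I centre_in_ball open_ball subsetI)
 obtain eta where eta: "eta > 0" "!!x. x : frontier D ==> \<exists>B\<in>(%p. ball p (r p)) ` P. ball x eta <= B"
  by (rule Heine_Borel_lemma[OF comp, of "(%p. ball p (r p)) ` P"]) (use P in auto)
 define C0 where "C0 = (\<Sum>p\<in>P. C p)"
 obtain B where B: "!!x y. x : frontier D ==> y : frontier D ==> dist x y <= B"
  using compact_imp_bounded[OF comp] diameter_bounded_bound by blast
 define M where "M = max (max C0 (B / eta)) 1"
 have "infdist x K <= M * dist x y" if x: "x : F" and y: "y : frontier D - F" for x y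
 proof (cases "dist x y < eta")
  case True
  have xD: "x : frontier D" using x Fs by blast
  obtain p where p: "p : P" "ball x eta <= ball p (r p)" using eta(2)[OF xD] by blast
  moreover have "x : ball x eta" "y : ball x eta" using True eta(1) by auto
  ultimately have "x : frontier D \<inter> ball p (r p)" "y : frontier D \<inter> ball p (r p)" using xD y by blast+
  then obtain c where c: "path c" "pathstart c = x" "pathfinish c = y" "path_image c <= frontier D \<inter> cball x (C p * dist x y)"
   using rC[of p] p(1) P(2) by blast
  have "path_image c \<inter> K ~= {}"
  proof
   assume e: "path_image c \<inter> K = {}"
   obtain U where U: "open U" "F = frontier D \<inter> U" using F(1) unfolding openin_open by blast
   have "connected (path_image c)" using c(1) by (rule connected_path_image)
   moreover have "path_image c <= U \<union> - closure F" using e c(4) U F(2) by blast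
   moreover have "U \<inter> - closure F \<inter> path_image c = {}" using U c(4) closure_subset[of F] by blast
   moreover have "U \<inter> path_image c ~= {}" using c(2) x U pathstart_in_path_image[of c] by auto
   moreover have "- closure F \<inter> path_image c ~= {}"
   proof -
    have "y : path_image c" using c(3) pathfinish_in_path_image[of c] by auto
    thus ?thesis using y e F(2) by auto
   qed
   ultimately show False using connectedD[of "path_image c" U "- closure F"] U(1) by auto
  qed
  then obtain k where k: "k : K" "k : path_image c" by blast
  hence "k : cball x (C p * dist x y)" using c(4) by blast
  with k have k: "k : K" "dist x k <= C p * dist x y" by simp_all
  have "infdist x K <= dist x k" using infdist_le k(1) by blast
  also have "... <= C p * dist x y" by (rule k(2))
  also have "... <= M * dist x y"
  proof (rule mult_right_mono)
   have "C p <= C0" unfolding C0_def using P(1,2) p(1) rC by (intro member_le_sum) (auto simp: less_imp_le)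
   thus "C p <= M" by (simp add: M_def)
  qed simp
  finally show ?thesis .
 next
  case False
  obtain k where k: "k : K" using F(3) by blast
  have "infdist x K <= dist x k" using infdist_le k by blast
  also have "... <= B" using B x Fs k KD by blast
  also have "... = B / eta * eta" using eta(1) by simp
  also have "... <= M * dist x y"
   by (rule mult_mono) (use False eta(1) in \<open>auto simp: M_def\<close>)
  finally show ?thesis .
 qed
 hence "inverse M * infdist x K <= dist x y" if "x : F" "y : frontier D - F" for x y
  using that by (simp add: field_simps M_def)
 moreover have "inverse M > 0" by (simp add: M_def)
 ultimately show ?thesis by blast
qed

section \<open>Geometry of the patches\<close>

text \<open>After subtraction of \<open>f 0\<close> the map preserves inner products by
  polarisation. The images of two independent vectors then determine a linear isometry, and the
  squared norm of the difference to it expands to zero. The second vector is general because a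
  narrow sector need not contain (0, 1).\<close>

lemma isometry_extend_linear:
 fixes f :: "real \<times> real => 'a::real_inner"
 assumes f: "!!x y. x : X ==> y : X ==> dist (f x) (f y) = dist x y"
  and X: "0 : X" "(1, 0) : X" "(c, s) : X" and s: "s ~= 0"
 shows "\<exists>T. linear T & (\<forall>x. norm (T x) = norm x) & (\<forall>x\<in>X. f x = f 0 + T x)"
proof -
 define g where "g x = f x - f 0" for x
 have n: "norm (g x - g y) = norm (x - y)" if "x : X" "y : X" for x y
  using f[OF that] by (simp add: g_def dist_norm)
 have n0: "norm (g x) = norm x" if "x : X" for x using n[OF that X(1)] by (simp add: g_def)
 have ip: "g x \<bullet> g y = x \<bullet> y" if "x : X" "y : X" for x y
 proof -
  have "(norm (g x - g y))\<^sup>2 = (norm (x - y))\<^sup>2" using n[OF that] by simp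
  hence "(norm (g x))\<^sup>2 - 2 * (g x \<bullet> g y) + (norm (g y))\<^sup>2 = (norm x)\<^sup>2 - 2 * (x \<bullet> y) + (norm y)\<^sup>2"
   unfolding power2_norm_eq_inner by (simp add: inner_diff_left inner_diff_right inner_commute)
  thus ?thesis using n0 that by simp
 qed
 let ?u = "(1, 0) :: real \<times> real" and ?v = "(c, s)"
 define a b where "a x = fst x - snd x / s * c" and "b x = snd x / s" for x :: "real \<times> real"
 define T where "T x = a x *\<^sub>R g ?u + b x *\<^sub>R g ?v" for x
 have rep: "x = a x *\<^sub>R ?u + b x *\<^sub>R ?v" for x using s by (cases x) (simp add: a_def b_def)
 have "linear T"
  by (rule linearI) (auto simp: T_def a_def b_def algebra_simps add_divide_distrib scaleR_add_left scaleR_diff_left)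
 moreover have "norm (T x) = norm x" for x
 proof -
  have "(norm (T x))\<^sup>2 = (a x)\<^sup>2 * (g ?u \<bullet> g ?u) + 2 * (a x * b x) * (g ?u \<bullet> g ?v) + (b x)\<^sup>2 * (g ?v \<bullet> g ?v)"
   unfolding T_def power2_norm_eq_inner
   by (simp add: inner_add_left inner_add_right inner_commute power2_eq_square algebra_simps)
  also have "... = (a x)\<^sup>2 * (?u \<bullet> ?u) + 2 * (a x * b x) * (?u \<bullet> ?v) + (b x)\<^sup>2 * (?v \<bullet> ?v)"
   using ip X by simp
  also have "... = (norm (a x *\<^sub>R ?u + b x *\<^sub>R ?v))\<^sup>2"
   unfolding power2_norm_eq_inner
   by (simp add: inner_add_left inner_add_right inner_commute power2_eq_square algebra_simps)
  finally show ?thesis using rep[of x] by (simp only: power2_eq_iff_nonneg norm_ge_zero)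
 qed
 moreover have "f x = f 0 + T x" if x: "x : X" for x
 proof -
  have "(norm (g x - T x))\<^sup>2 = g x \<bullet> g x - 2 * (a x * (g x \<bullet> g ?u) + b x * (g x \<bullet> g ?v)) + (norm (T x))\<^sup>2"
   unfolding T_def power2_norm_eq_inner
   by (simp add: inner_diff_left inner_diff_right inner_add_left inner_add_right inner_commute algebra_simps)
  also have "... = x \<bullet> x - 2 * (a x * (x \<bullet> ?u) + b x * (x \<bullet> ?v)) + (norm x)\<^sup>2"
   using ip x X calculation \<open>norm (T x) = norm x\<close> by simp
  also have "a x * (x \<bullet> ?u) + b x * (x \<bullet> ?v) = x \<bullet> (a x *\<^sub>R ?u + b x *\<^sub>R ?v)"
   by (simp add: inner_add_right del: scaleR_Pair add_Pair)
  also have "... = x \<bullet> x" using rep[of x] by simp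
  finally have "(norm (g x - T x))\<^sup>2 = 0" by (simp add: power2_norm_eq_inner)
  hence "f x - f 0 = T x" by (simp add: g_def)
  thus ?thesis by (simp only: diff_eq_eq add.commute)
 qed
 ultimately show ?thesis by blast
qed

lemma affine_plane_chart:
 fixes A :: "'a::euclidean_space set"
 assumes A: "affine A" "aff_dim A = 2"
 shows "\<exists>E :: real \<times> real => 'a. (\<forall>x y. dist (E x) (E y) = dist x y) & A <= range E"
proof -
 have "A ~= {}" using A(2) by auto
 then obtain a where a: "a : A" by blast
 let ?S = "(%x. x - a) ` A"
 have S: "subspace ?S" by (rule affine_diffs_subspace_subtract[OF A(1) a])
 have "int (dim ?S) = aff_dim A" using aff_dim_subspace[OF S] aff_dim_translation_eq_subtract by metis
 hence "dim (UNIV :: (real \<times> real) set) = dim ?S" using A(2) by simp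
 then obtain f where f: "linear f" "f ` (UNIV :: (real \<times> real) set) = ?S" "!!x. norm (f x) = norm x"
  using isometries_subspaces[OF subspace_UNIV S] by (metis UNIV_I)
 let ?E = "%x. a + f x"
 have "dist (?E x) (?E y) = dist x y" for x y
  using f(3)[of "x - y"] by (simp add: dist_norm linear_diff[OF f(1)])
 moreover have "A <= range ?E"
 proof
  fix x assume "x : A"
  then obtain z where "f z = x - a" using f(2) by (metis imageE imageI)
  thus "x : range ?E" by (metis add.commute diff_add_cancel rangeI)
 qed
 ultimately show ?thesis by (intro exI[of _ ?E] conjI allI)
qed

lemma isometry_range_affine:
 fixes E :: "real \<times> real => 'a::euclidean_space"
 assumes E: "!!x y. dist (E x) (E y) = dist x y"
 shows "affine (range E)" "aff_dim (range E) = 2" "closed (range E)"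
  "\<exists>T. linear T & (\<forall>x. norm (T x) = norm x) & (\<forall>x. E x = E 0 + T x)"
proof -
 obtain T where T: "linear T" "!!x. norm (T x) = norm x" "!!x. E x = E 0 + T x"
 proof -
  have "\<exists>T. linear T & (\<forall>x. norm (T x) = norm x) & (\<forall>x\<in>UNIV. E x = E 0 + T x)"
   by (rule isometry_extend_linear[OF E UNIV_I UNIV_I UNIV_I one_neq_zero])
  thus ?thesis using that by (elim exE conjE) blast
 qed
 show "\<exists>T. linear T & (\<forall>x. norm (T x) = norm x) & (\<forall>x. E x = E 0 + T x)"
  by (intro exI[of _ T] conjI allI T)
 have r: "range E = (+) (E 0) ` range T" unfolding image_image by (rule image_cong[OF refl T(3)])
 have sub: "subspace (range T)" using linear_subspace_image[OF T(1) subspace_UNIV] .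
 have inj: "inj T" using T(2) unfolding linear_injective_0[OF T(1)] by (metis norm_eq_zero)
 show "affine (range E)" unfolding r by (rule affine_translation[THEN iffD1, OF subspace_imp_affine[OF sub]])
 show "closed (range E)" unfolding r using closed_subspace[OF sub] by (rule closed_translation)
 have "dim (range T) = dim (UNIV :: (real \<times> real) set)" by (rule dim_image_eq[OF T(1)]) (simp add: inj)
 thus "aff_dim (range E) = 2"
  unfolding r aff_dim_translation_eq aff_dim_subspace[OF sub] by simp
qed

text \<open>A nonempty relatively open part of an affine set spans it, so \<open>A\<close> lies in
  \<open>B\<close>, and the dimensions agree.\<close>

lemma affine_eq_of_open_subset:
 fixes A B :: "'a::euclidean_space set"
 assumes "affine A" "affine B" "openin (top_of_set A) X" "X ~= {}" "X <= B" "aff_dim A = aff_dim B"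
 shows "A = B"
proof -
 have "affine hull X = A" using affine_hull_openin assms(1,3,4) by (metis affine_hull_eq)
 hence "A <= B" using assms(2,5) by (metis hull_minimal)
 thus ?thesis using aff_dim_eq_full_gen assms(1,2,6) affine_dim_equal assms(4) \<open>affine hull X = A\<close> by (metis affine_hull_eq_empty)
qed

section \<open>The patches as subsets of their planes and of the surface\<close>

locale surface_patches =
 fixes m :: nat and S :: surface
 assumes ps: "polyhedral_surface m S" and m1: "1 <= m"
begin

abbreviation "np \<equiv> num_patches S"
abbreviation "E i \<equiv> plane_chart (patch S i)"
abbreviation "G i \<equiv> closure (patch S i)"
text \<open>The relative boundary of the patch, that is, the union of its four edges.\<close>

definition "K i = G i - patch S i"
abbreviation "A i \<equiv> range (E i)"

lemma quad: "i < np ==> open_quadrilateral (patch S i) (corner S i)"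
 and diffeo: "i < np ==> Ck_diffeo m unit_square (G i) (kappa S i)"
 using ps unfolding polyhedral_surface_def by auto

lemma bd_eq: "bd S = (\<Union>i<np. G i)"
 and cOmega: "compact (Omega S)" and lip: "lipschitz_boundary (Omega S)" and Omega_ne: "Omega S ~= {}"
 using ps unfolding polyhedral_surface_def by auto

lemma K_edges: "i < np ==> K i = (\<Union>a<4. edge (corner S i) a)"
 using quad unfolding open_quadrilateral_def K_def by auto

lemma patch_ne: "i < np ==> patch S i ~= {}"
 and patch_bdd: "i < np ==> bounded (patch S i)"
 using quad unfolding open_quadrilateral_def by auto

lemma compact_G: "i < np ==> compact (G i)"
 using patch_bdd by (simp add: compact_closure)

lemma compact_bd: "compact (bd S)" using cOmega by (simp add: compact_frontier)

lemma G_bd: "i < np ==> G i <= bd S" using bd_eq by blast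

lemma K_compact: "i < np ==> compact (K i)"
 unfolding K_edges edge_def by (intro compact_UN) auto

lemma K_ne: "i < np ==> K i ~= {}"
proof -
 assume "i < np"
 moreover have "corner S i 0 : edge (corner S i) 0" by (simp add: edge_def)
 ultimately have "corner S i 0 : K i" unfolding K_edges[OF \<open>i < np\<close>]
  by (intro UN_I[of 0]) auto
 thus ?thesis by blast
qed

text \<open>\<open>plane_chart\<close> is obtained by choice; a chart exists because the patch lies
  in a plane.\<close>

lemma chart_ex:
 assumes i: "i < np"
 shows "(\<forall>x y. dist (E i x) (E i y) = dist x y) & patch S i <= A i"
proof -
 obtain B where B: "affine B" "aff_dim B = 2" "openin (top_of_set B) (patch S i)"
  using quad[OF i] unfolding open_quadrilateral_def by blast
 obtain e :: "real \<times> real => point" where "\<forall>x y. dist (e x) (e y) = dist x y" "B <= range e"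
  using affine_plane_chart[OF B(1,2)] by blast
 moreover have "patch S i <= B" using B(3) openin_subset by fastforce
 ultimately have "\<exists>e :: real \<times> real => point. (\<forall>x y. dist (e x) (e y) = dist x y) & patch S i <= range e"
  by blast
 from someI_ex[OF this] show ?thesis unfolding plane_chart_def .
qed

lemma E_dist: "i < np ==> dist (E i x) (E i y) = dist x y"
 and patch_A: "i < np ==> patch S i <= A i"
 using chart_ex by blast+

lemma A_affine: "i < np ==> affine (A i)"
 and A_dim: "i < np ==> aff_dim (A i) = 2"
 and A_closed: "i < np ==> closed (A i)"
 using isometry_range_affine E_dist by blast+

lemma G_A: "i < np ==> G i <= A i"
 using patch_A A_closed by (simp add: closure_minimal)

lemma patch_openin:
 assumes i: "i < np"
 shows "openin (top_of_set (A i)) (patch S i)"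
proof -
 obtain B where B: "affine B" "aff_dim B = 2" "openin (top_of_set B) (patch S i)"
  using quad[OF i] unfolding open_quadrilateral_def by blast
 have "B = A i"
  by (rule affine_eq_of_open_subset[OF B(1) A_affine[OF i] B(3) patch_ne[OF i] patch_A[OF i]])
   (simp add: B A_dim[OF i])
 thus ?thesis using B(3) by simp
qed

lemma patch_G: "patch S i <= G i" by (rule closure_subset)
lemma K_G: "K i <= G i" by (auto simp: K_def)

text \<open>The segment from \<open>x\<close> to \<open>y\<close> is too short to reach
  \<open>K i\<close>, and a connected subset of the plane that starts in the patch can leave it only
  through \<open>K i\<close>.\<close>

lemma patch_ball:
 assumes i: "i < np" and x: "x : patch S i" and y: "y : A i" "dist x y < infdist x (K i)"
 shows "y : patch S i"
proof (rule ccontr)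
 assume yn: "y ~: patch S i"
 let ?C = "closed_segment x y"
 have CA: "?C <= A i" using x y(1) patch_A[OF i] affine_imp_convex[OF A_affine[OF i]] by (simp add: closed_segment_subset subsetD)
 have CK: "?C \<inter> K i = {}"
 proof (rule ccontr)
  assume "?C \<inter> K i ~= {}"
  then obtain k where k: "k : ?C" "k : K i" by blast
  have "infdist x (K i) <= dist x k" by (rule infdist_le[OF k(2)])
  also have "... <= dist x y" using k(1) by (metis dist_in_closed_segment dist_commute)
  finally show False using y by simp
 qed
 obtain U where U: "open U" "patch S i = A i \<inter> U" using patch_openin[OF i] unfolding openin_open by blast
 have "connected ?C" by (rule connected_segment)
 moreover have "?C <= U \<union> - G i" using CK CA U by (auto simp: K_def)
 moreover have "U \<inter> - G i \<inter> ?C = {}" using CA U patch_G by blast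
 moreover have "U \<inter> ?C ~= {}" using x U by auto
 moreover have "y : - G i \<inter> ?C" using yn CK by (auto simp: K_def)
 ultimately show False using connectedD[of ?C U "- G i"] U(1) by auto
qed

lemma infdist_K_pos:
 assumes i: "i < np" and x: "x : patch S i"
 shows "infdist x (K i) > 0"
proof -
 have "x ~: K i" using x by (simp add: K_def)
 thus ?thesis using infdist_pos_not_in_closed[OF compact_imp_closed[OF K_compact[OF i]] K_ne[OF i]] by blast
qed

lemma locally_conic_K: "i < np ==> locally_conic y (K i)"
 unfolding K_edges edge_def by (intro locally_conic_UN locally_conic_segment) auto

lemma locally_conic_G:
 assumes i: "i < np"
 shows "locally_conic y (G i)"
proof (cases "y : G i")
 case True
 show ?thesis
 proof (rule locally_conic_from_boundary[OF A_affine[OF i] _ G_A[OF i] K_G _ _ locally_conic_K[OF i]])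
  show "y : A i" using True G_A[OF i] by blast
  have "G i - K i = patch S i" using patch_G by (auto simp: K_def)
  thus "openin (top_of_set (A i)) (G i - K i)" using patch_openin[OF i] by simp
  show "openin (top_of_set (A i)) (A i - G i)"
   using closed_closure[of "patch S i"] by (metis Diff_eq openin_open_Int open_Compl)
 qed
qed (simp add: locally_conic_away)

text \<open>The frontier is a finite union of closed patches, each conic at every point, and the set
  inherits this from its frontier.\<close>

lemma locally_conic_Omega: "y : Omega S ==> locally_conic y (Omega S)"
proof (rule locally_conic_from_boundary[of UNIV _ _ "bd S"])
 show "bd S <= Omega S" using cOmega frontier_subset_compact by blast
 have "Omega S - bd S = interior (Omega S)"
  using interior_subset cOmega by (auto simp: frontier_def compact_imp_closed closure_closed)
 thus "openin (top_of_set UNIV) (Omega S - bd S)" by simp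
 show "openin (top_of_set UNIV) (UNIV - Omega S)"
  using cOmega by (simp add: compact_imp_closed Compl_eq_Diff_UNIV[symmetric] open_Compl)
 show "locally_conic y (bd S)" unfolding bd_eq by (intro locally_conic_UN locally_conic_G) auto
qed auto

lemma kappa_data:
 assumes i: "i < np"
 obtains U1 g1 U2 g2 where "open U1" "unit_square <= U1" "Ck_on m U1 g1" "!!z. z : unit_square ==> g1 z = kappa S i z"
  "open U2" "G i <= U2" "Ck_on m U2 g2" "!!z. z : unit_square ==> g2 (kappa S i z) = z"
  "!!y. y : G i ==> g2 y : unit_square & kappa S i (g2 y) = y" "kappa S i ` unit_square = G i" "inj_on (kappa S i) unit_square"
proof -
 have bij: "bij_betw (kappa S i) unit_square (G i)" and c1: "Ck_up_to m unit_square (kappa S i)"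
  and c2: "Ck_up_to m (G i) (inv_into unit_square (kappa S i))"
  using diffeo[OF i] unfolding Ck_diffeo_def by auto
 obtain U1 g1 where 1: "open U1" "unit_square <= U1" "Ck_on m U1 g1" "!!z. z : unit_square ==> g1 z = kappa S i z"
  using c1 unfolding Ck_up_to_def by blast
 obtain U2 g2 where 2: "open U2" "G i <= U2" "Ck_on m U2 g2" "!!y. y : G i ==> g2 y = inv_into unit_square (kappa S i) y"
  using c2 unfolding Ck_up_to_def by blast
 have im: "kappa S i ` unit_square = G i" and inj: "inj_on (kappa S i) unit_square"
  using bij unfolding bij_betw_def by auto
 show ?thesis
 proof (rule that[OF 1 2(1-3) _ _ im inj])
  show "g2 (kappa S i z) = z" if "z : unit_square" for z
   using 2(4)[of "kappa S i z"] im inj that by (metis imageI inv_into_f_f)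
  show "g2 y : unit_square & kappa S i (g2 y) = y" if "y : G i" for y
   using 2(4)[OF that] im that by (metis f_inv_into_f inv_into_into)
 qed
qed

lemma Ck_on_deriv_ex: "Ck_on m U f ==> z : U ==> \<exists>D. (f has_derivative D) (at z)"
 using m1 by (cases m) auto

text \<open>A parametrization by the square that is differentiable up to the boundary together with
  its inverse cannot produce a reflex corner, although \<open>open_quadrilateral\<close> would allow
  one. At the corners and edges differentiability up to the boundary, hence
  \<open>m \<ge> 1\<close>, is essential.\<close>

lemma convex_G:
 assumes i: "i < np"
 shows "convex (G i)"
proof -
 obtain U1 g1 U2 g2 where k: "open U1" "unit_square <= U1" "Ck_on m U1 g1" "!!z. z : unit_square ==> g1 z = kappa S i z"
  "open U2" "G i <= U2" "Ck_on m U2 g2" "!!z. z : unit_square ==> g2 (kappa S i z) = z"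
  "!!y. y : G i ==> g2 y : unit_square & kappa S i (g2 y) = y" "kappa S i ` unit_square = G i" "inj_on (kappa S i) unit_square"
  by (rule kappa_data[OF i], rule that)
 have sq: "convex (unit_square :: (real \<times> real) set)" "closed (unit_square :: (real \<times> real) set)"
  by (intro convex_Times convex_real_interval) (intro closed_Times closed_atLeastAtMost)
 have "\<exists>e>0. convex (G i \<inter> ball y e)" if y: "y : G i" for y
 proof -
  define z where "z = g2 y"
  have z: "z : unit_square" "kappa S i z = y" "g1 z = y" using k(9)[OF y] k(4) by (auto simp: z_def)
  obtain L where L: "(g1 has_derivative L) (at z)" using Ck_on_deriv_ex[OF k(3)] k(2) z by blast
  obtain M where M: "(g2 has_derivative M) (at y)" using Ck_on_deriv_ex[OF k(7)] k(6) y by blast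
  have "\<exists>e>0. convex (G i \<inter> ball (g1 z) e)"
  proof (rule conic_diffeo_convex[where f = g1 and g = g2 and Q = unit_square and L = L and M = M])
   show "g1 ` unit_square <= G i" using k(4,10) by force
   show "g2 ` G i <= unit_square" using k(9) by blast
   show "g1 (g2 v) = v" if "v : G i" for v using k(4,9) that by metis
   show "(g1 has_derivative L) (at z within unit_square)" using L by (rule has_derivative_at_withinI)
   show "(g2 has_derivative M) (at (g1 z) within G i)" using M z(3) by (simp add: has_derivative_at_withinI)
   show "g2 (g1 z) = z" using z by (simp add: z_def)
  qed (use z sq locally_conic_unit_square locally_conic_G[OF i] in auto)
  thus ?thesis using z(3) by simp
 qed
 moreover have "path_connected (G i)"
 proof -
  have "continuous_on unit_square (kappa S i)"
   using continuous_on_subset[OF Ck_on_continuous[OF k(3)] k(2)] k(4) continuous_on_cong by (metis (no_types, lifting))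
  thus ?thesis using path_connected_continuous_image convex_imp_path_connected[OF sq(1)] k(10) by metis
 qed
 ultimately show ?thesis using locally_convex_imp_convex compact_G[OF i] by blast
qed

text \<open>Two closed patches meet at most in an edge or a corner of the first, and both lie in
  \<open>K i\<close>.\<close>

lemma patch_disjoint:
 assumes i: "i < np" and l: "l < np" and ne: "i ~= l"
 shows "patch S i \<inter> G l = {}"
proof -
 let ?J = "G i \<inter> G l"
 have "\<forall>i<np. \<forall>l<np. i ~= l -->
    (let J = closure (patch S i) \<inter> closure (patch S l) in
     J = {} \<or>
     (\<exists>a<4. \<exists>b<4. J = edge (corner S i) a & J = edge (corner S l) b) \<or>
     (\<exists>a<4. \<exists>b<4. J = {corner S i a} & J = {corner S l b}))"
  using ps unfolding polyhedral_surface_def by (elim conjE) assumption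
 from this[unfolded Let_def, rule_format, OF i l ne]
 have "?J = {} \<or> (\<exists>a<4. ?J = edge (corner S i) a) \<or> (\<exists>a<4. ?J = {corner S i a})"
  by (elim disjE exE conjE) (rule disjI1, assumption, rule disjI2, rule disjI1, rule exI, rule conjI, assumption, assumption,
   rule disjI2, rule disjI2, rule exI, rule conjI)
 then consider "?J = {}" | a where "a < 4" "?J = edge (corner S i) a" | a where "a < 4" "?J = {corner S i a}"
  by metis
 hence "?J <= K i"
 proof cases
  case 2
  show ?thesis unfolding 2(2) K_edges[OF i] using 2(1) by (intro UN_upper) simp
 next
  case 3
  have "corner S i a : edge (corner S i) a" by (simp add: edge_def)
  hence "corner S i a : K i" using 3(1) unfolding K_edges[OF i] by (intro UN_I[of a]) auto
  thus ?thesis unfolding 3(2) by simp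
 qed simp
 thus ?thesis using patch_G by (auto simp: K_def)
qed

lemma patch_openin_bd:
 assumes i: "i < np"
 shows "openin (top_of_set (bd S)) (patch S i)"
proof -
 obtain U where U: "open U" "patch S i = A i \<inter> U" using patch_openin[OF i] unfolding openin_open by blast
 let ?C = "\<Union>l\<in>{..<np} - {i}. G l"
 have "patch S i = bd S \<inter> (U - ?C)"
 proof
  show "patch S i <= bd S \<inter> (U - ?C)"
   using U patch_G G_bd[OF i] patch_disjoint[OF i] by blast
  show "bd S \<inter> (U - ?C) <= patch S i"
  proof
   fix x assume x: "x : bd S \<inter> (U - ?C)"
   hence "x : G i" using bd_eq by blast
   thus "x : patch S i" using x U G_A[OF i] by blast
  qed
 qed
 moreover have "open (U - ?C)" by (intro open_Diff U closed_UN) auto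
 ultimately show ?thesis unfolding openin_open by blast
qed

lemma separation:
 "\<exists>c>0. \<forall>i<np. \<forall>x\<in>patch S i. \<forall>y\<in>bd S - patch S i. c * infdist x (K i) <= dist x y"
proof -
 have "\<forall>i\<in>{..<np}. \<exists>c>0. \<forall>x\<in>patch S i. \<forall>y\<in>bd S - patch S i. c * infdist x (K i) <= dist x y"
  by (intro ballI frontier_separation[OF cOmega lip patch_openin_bd K_def K_ne]) simp_all
 from bchoice[OF this] obtain c where c0: "\<forall>i\<in>{..<np}. c i > 0 &
   (\<forall>x\<in>patch S i. \<forall>y\<in>bd S - patch S i. c i * infdist x (K i) <= dist x y)" ..
 hence c: "!!i. i < np ==> c i > 0"
  "!!i x y. i < np ==> x : patch S i ==> y : bd S - patch S i ==> c i * infdist x (K i) <= dist x y"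
 proof -
  show "c i > 0" if "i < np" for i using bspec[OF c0, of i] that by simp
  fix i x y assume i: "i < np" and xy: "x : patch S i" "y : bd S - patch S i"
  from i have "i : {..<np}" by simp
  from bspec[OF c0 this] have "\<forall>x\<in>patch S i. \<forall>y\<in>bd S - patch S i. c i * infdist x (K i) <= dist x y" ..
  thus "c i * infdist x (K i) <= dist x y" using xy by blast
 qed
 define c0 where "c0 = Min (insert 1 (c ` {..<np}))"
 have "c0 > 0" using c(1) unfolding c0_def by (subst Min_gr_iff) auto
 moreover have "c0 * infdist x (K i) <= dist x y" if "i < np" "x : patch S i" "y : bd S - patch S i" for i x y
 proof -
  have "c0 <= c i" unfolding c0_def using that by (intro Min_le) auto
  hence "c0 * infdist x (K i) <= c i * infdist x (K i)" by (simp add: mult_right_mono infdist_nonneg)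
  thus ?thesis using c(2)[OF that] by linarith
 qed
 ultimately show ?thesis by blast
qed

definition "V i = {z : unit_square. kappa S i z : patch S i}"

lemma kappa_continuous:
 assumes i: "i < np"
 shows "continuous_on unit_square (kappa S i)"
proof -
 obtain U1 g1 U2 g2 where k: "open U1" "unit_square <= U1" "Ck_on m U1 g1" "!!z. z : unit_square ==> g1 z = kappa S i z"
  by (rule kappa_data[OF i], rule that)
 show ?thesis using continuous_on_subset[OF Ck_on_continuous[OF k(3)] k(2)] k(4) by (rule continuous_on_eq)
qed

text \<open>The inverse of \<open>kappa\<close>, read in planar coordinates of the patch, is
  continuous and injective on an open subset of the plane, so invariance of domain applies to its
  image.\<close>

lemma V_open:
 assumes i: "i < np"
 shows "open (V i)"
proof -
 obtain U1 g1 U2 g2 where k: "open U1" "unit_square <= U1" "Ck_on m U1 g1" "!!z. z : unit_square ==> g1 z = kappa S i z"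
  "open U2" "G i <= U2" "Ck_on m U2 g2" "!!z. z : unit_square ==> g2 (kappa S i z) = z"
  "!!y. y : G i ==> g2 y : unit_square & kappa S i (g2 y) = y" "kappa S i ` unit_square = G i" "inj_on (kappa S i) unit_square"
  by (rule kappa_data[OF i], rule that)
 have Ec: "continuous_on UNIV (E i)"
  by (rule continuous_on_iff[THEN iffD2]) (auto simp: E_dist[OF i])
 let ?D = "E i -` patch S i"
 obtain U where U: "open U" "patch S i = A i \<inter> U" using patch_openin[OF i] unfolding openin_open by blast
 have "?D = E i -` U" using U by auto
 hence oD: "open ?D" using open_vimage[OF U(1) Ec] by simp
 have "V i = (%x. g2 (E i x)) ` ?D"
 proof
  show "V i <= (%x. g2 (E i x)) ` ?D"
  proof
   fix z assume z: "z : V i"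
   then obtain x where x: "kappa S i z = E i x" using patch_A[OF i] by (auto simp: V_def)
   hence "x : ?D" "g2 (E i x) = z" using z k(8)[of z] by (auto simp: V_def)
   thus "z : (%x. g2 (E i x)) ` ?D" by blast
  qed
  show "(%x. g2 (E i x)) ` ?D <= V i"
  proof (rule image_subsetI)
   fix x assume x: "x : ?D"
   hence "E i x : G i" using patch_G by auto
   from k(9)[OF this] x show "g2 (E i x) : V i" unfolding V_def by auto
  qed
 qed
 moreover have "open ((%x. g2 (E i x)) ` ?D)"
 proof (rule invariance_of_domain[OF _ oD])
  show "continuous_on ?D (%x. g2 (E i x))"
   by (rule continuous_on_compose2[OF Ck_on_continuous[OF k(7)] continuous_on_subset[OF Ec]])
    (use k(6) patch_G in auto)
  show "inj_on (%x. g2 (E i x)) ?D"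
  proof (rule inj_onI)
   fix x y assume "x : ?D" "y : ?D" "g2 (E i x) = g2 (E i y)"
   hence "E i x = E i y" using k(9) patch_G by (metis subsetD vimageE)
   thus "x = y" using E_dist[OF i, of x y] by simp
  qed
 qed
 ultimately show ?thesis by simp
qed

end

section \<open>Sectors, arcs and lengths of segments\<close>

lemma sector_polar: "sector \<omega> = polar ` ({0<..} \<times> {0<..<\<omega>})"
 by (force simp: sector_def polar_def)

lemma norm_polar: "norm (polar (r, t)) = \<bar>r\<bar>"
proof -
 have "(norm (polar (r, t)))\<^sup>2 = r\<^sup>2"
  by (simp add: polar_def power2_norm_eq_inner inner_prod_def power2_eq_square[symmetric] power_mult_distrib distrib_left[symmetric])
 thus ?thesis by (metis abs_norm_cancel power2_eq_iff_nonneg abs_ge_zero power2_abs norm_ge_zero)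
qed

lemma polar_scale: "polar (c * r, t) = c *\<^sub>R polar (r, t)"
 by (simp add: polar_def)

text \<open>Intersecting with a ball bounds the radius, and the image of a compact rectangle under
  \<open>polar\<close> is closed.\<close>

lemma closure_sector:
 assumes "\<omega> > 0"
 shows "closure (sector \<omega>) = polar ` ({0..} \<times> {0..\<omega>})"
proof
 show "polar ` ({0..} \<times> {0..\<omega>}) <= closure (sector \<omega>)"
 proof -
  have "closure {0::real<..} = {0..}"
  proof
   show "closure {0::real<..} <= {0..}" by (rule closure_minimal) auto
   show "{0..} <= closure {0::real<..}"
   proof
    fix x :: real assume x: "x : {0..}"
    have "x + e / 2 : {0<..} & dist (x + e / 2) x < e" if "e > 0" for e
     using x that by (auto simp: dist_real_def)
    thus "x : closure {0<..}" unfolding closure_approachable by blast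
   qed
  qed
  hence "closure ({0::real<..} \<times> {0<..<\<omega>}) = {0..} \<times> {0..\<omega>}" using assms by (simp add: closure_Times)
  moreover have "polar ` closure ({0<..} \<times> {0<..<\<omega>}) <= closure (sector \<omega>)"
   by (rule image_closure_subset[OF continuous_polar closed_closure]) (simp add: sector_polar closure_subset)
  ultimately show ?thesis by simp
 qed
 show "closure (sector \<omega>) <= polar ` ({0..} \<times> {0..\<omega>})"
 proof
  fix x assume x: "x : closure (sector \<omega>)"
  define R where "R = norm x + 1"
  let ?B = "ball 0 R"
  have "x : ?B \<inter> closure (sector \<omega>)" using x by (simp add: R_def)
  hence "x : closure (?B \<inter> sector \<omega>)" using open_Int_closure_subset[OF open_ball] by blast
  moreover have "?B \<inter> sector \<omega> <= polar ` ({0..R} \<times> {0..\<omega>})"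
  proof
   fix y assume y: "y : ?B \<inter> sector \<omega>"
   then obtain r t where rt: "r > 0" "0 < t" "t < \<omega>" "y = polar (r, t)" by (auto simp: sector_polar)
   hence "r <= R" using y norm_polar[of r t] by simp
   thus "y : polar ` ({0..R} \<times> {0..\<omega>})" using rt by (intro image_eqI[of _ _ "(r, t)"]) auto
  qed
  moreover have "closed (polar ` ({0..R} \<times> {0..\<omega>}))"
   by (intro compact_imp_closed compact_continuous_image continuous_polar compact_Times compact_Icc)
  ultimately have "x : polar ` ({0..R} \<times> {0..\<omega>})" using closure_minimal by blast
  thus "x : polar ` ({0..} \<times> {0..\<omega>})" by auto
 qed
qed

text \<open>A chord is at most as long as its arc: the distance is 2 r |sin((a - b)/2)|.\<close>

lemma dist_polar_le: "r >= 0 ==> dist (polar (r, a)) (polar (r, b)) <= r * \<bar>a - b\<bar>"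
proof -
 assume r: "r >= 0"
 have "(cos a - cos b)\<^sup>2 + (sin a - sin b)\<^sup>2 = 2 - 2 * cos (a - b)"
 proof -
  have "(cos a - cos b)\<^sup>2 + (sin a - sin b)\<^sup>2 = ((sin a)\<^sup>2 + (cos a)\<^sup>2) + ((sin b)\<^sup>2 + (cos b)\<^sup>2) - 2 * (cos a * cos b + sin a * sin b)"
   by (simp add: power2_eq_square algebra_simps)
  thus ?thesis by (simp add: cos_diff)
 qed
 also have "... = (2 * sin ((a - b) / 2))\<^sup>2"
 proof -
  have "2 * ((a - b) / 2) = a - b" by simp
  hence "cos (a - b) = 1 - 2 * (sin ((a - b) / 2))\<^sup>2" using cos_double_sin[of "(a - b) / 2"] by (simp only:)
  thus ?thesis by (simp add: power_mult_distrib)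
 qed
 also have "... <= (a - b)\<^sup>2"
 proof -
  have "\<bar>sin ((a - b) / 2)\<bar> <= \<bar>(a - b) / 2\<bar>" by (rule abs_sin_x_le_abs_x)
  hence "\<bar>2 * sin ((a - b) / 2)\<bar> <= \<bar>a - b\<bar>" unfolding abs_mult abs_divide by simp
  thus ?thesis by (rule abs_le_square_iff[THEN iffD1])
 qed
 finally have le: "(cos a - cos b)\<^sup>2 + (sin a - sin b)\<^sup>2 <= (a - b)\<^sup>2" .
 have "(dist (polar (r, a)) (polar (r, b)))\<^sup>2 = (r * cos a - r * cos b)\<^sup>2 + (r * sin a - r * sin b)\<^sup>2"
  by (simp add: polar_Pair dist_Pair_Pair dist_real_def)
 also have "... = r\<^sup>2 * ((cos a - cos b)\<^sup>2 + (sin a - sin b)\<^sup>2)"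
  unfolding right_diff_distrib[symmetric] power_mult_distrib distrib_left[symmetric] ..
 also have "... <= r\<^sup>2 * (a - b)\<^sup>2" by (rule mult_left_mono[OF le zero_le_power2])
 also have "... = (r * \<bar>a - b\<bar>)\<^sup>2" by (simp add: power_mult_distrib)
 finally show ?thesis by (rule power2_le_imp_le) (use r in simp)
qed

lemma sum_sorted_telescope:
 fixes ts :: "real list"
 assumes "ts ~= []"
 shows "(\<Sum>i<length ts - 1. ts ! Suc i - ts ! i) = last ts - hd ts"
proof -
 have "(\<Sum>i<k. ts ! Suc i - ts ! i) = ts ! k - ts ! 0" for k
  by (induction k) auto
 thus ?thesis using assms by (simp add: last_conv_nth hd_conv_nth)
qed

lemma curve_length_linepath_le: "curve_length (linepath a b) <= ennreal (dist a b)"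
 unfolding curve_length_def
proof (rule SUP_least)
 fix ts assume "ts : {ts :: real list. sorted ts & set ts <= {0..1}}"
 hence ts: "sorted ts" "set ts <= {0..1}" by auto
 show "(\<Sum>i<length ts - 1. ennreal (dist (linepath a b (ts ! i)) (linepath a b (ts ! Suc i)))) <= ennreal (dist a b)"
 proof (cases "ts = []")
  case False
  have d: "dist (linepath a b s) (linepath a b t) = (t - s) * dist a b" if "s <= t" for s t
  proof -
   have "linepath a b s - linepath a b t = (t - s) *\<^sub>R (a - b)" by (simp add: linepath_def algebra_simps)
   thus ?thesis using that by (simp add: dist_norm)
  qed
  have mono: "ts ! i <= ts ! Suc i" if "i < length ts - 1" for i
   using ts(1) that by (intro sorted_nth_mono) auto
  have "(\<Sum>i<length ts - 1. ennreal (dist (linepath a b (ts ! i)) (linepath a b (ts ! Suc i))))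
   = ennreal (\<Sum>i<length ts - 1. (ts ! Suc i - ts ! i) * dist a b)"
   by (subst sum_ennreal[symmetric]) (auto simp: d mono)
  also have "(\<Sum>i<length ts - 1. (ts ! Suc i - ts ! i) * dist a b) = (last ts - hd ts) * dist a b"
   unfolding sum_distrib_right[symmetric] sum_sorted_telescope[OF False] ..
  also have "... <= 1 * dist a b"
  proof (rule mult_right_mono)
   have "last ts : {0..1}" "hd ts : {0..1}"
    using subsetD[OF ts(2) last_in_set[OF False]] subsetD[OF ts(2) hd_in_set[OF False]] .
   thus "last ts - hd ts <= 1" by auto
  qed simp
  finally show ?thesis by (simp add: ennreal_leI)
 qed simp
qed

lemma dist_along_le:
 assumes "a : P" "b : Q" "closed_segment a b <= X"
 shows "dist_along X P Q <= ennreal (dist a b)"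
proof -
 have "dist_along X P Q <= curve_length (linepath a b)"
  unfolding dist_along_def by (rule INF_lower) (use assms in auto)
 thus ?thesis using curve_length_linepath_le order_trans by blast
qed

text \<open>Remove the closed sets one at a time: either the current one contains the open set, or
  the part outside of it is open and nonempty and is covered by the rest.\<close>

lemma finite_closed_cover_open:
 assumes "finite T" "!!t. t : T ==> closed (C t)" "openin (top_of_set A) X" "X ~= {}" "X <= (\<Union>t\<in>T. C t)"
 shows "\<exists>t\<in>T. \<exists>Y. openin (top_of_set A) Y & Y ~= {} & Y <= X & Y <= C t"
 using assms
proof (induction T arbitrary: X rule: finite_induct)
 case (insert t T)
 show ?case
 proof (cases "X <= C t")
  case True
  thus ?thesis using insert.prems by blast
 next
  case False
  obtain U where U: "open U" "X = A \<inter> U" using insert.prems(2) unfolding openin_open by blast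
  have o: "openin (top_of_set A) (X - C t)"
   using U insert.prems(1) by (metis Diff_Int_distrib2 Int_Diff insertI1 open_Diff openin_open_Int)
  have "\<exists>t'\<in>T. \<exists>Y. openin (top_of_set A) Y & Y ~= {} & Y <= X - C t & Y <= C t'"
   by (rule insert.IH[OF _ o]) (use False insert.prems in auto)
  thus ?thesis by blast
 qed
qed auto

text \<open>Provides the angle by which a point can be turned past a side of the sector: less than
  the gap 2 pi - w left by the sector, and so small that the arc remains shorter than d.\<close>

lemma small_rotation:
 fixes r q d w :: real
 assumes r: "r > 0" and q: "r * q < d" and w: "w < 2 * pi"
 shows "\<exists>h. 0 < h & h < 2 * pi - w & r * (q + h) < d"
proof -
 define h where "h = min ((2 * pi - w) / 2) ((d - r * q) / (2 * r))"
 have h1: "h <= (2 * pi - w) / 2" unfolding h_def by (rule min.cobounded1)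
 have h2: "h <= (d - r * q) / (2 * r)" unfolding h_def by (rule min.cobounded2)
 have "0 < (2 * pi - w) / 2" "0 < (d - r * q) / (2 * r)" using w q r by auto
 hence 0: "0 < h" unfolding h_def by (simp only: min_less_iff_conj)
 have 1: "h < 2 * pi - w" using h1 w by argo
 have "2 * (r * h) <= d - r * q" using h2 r by (simp add: pos_le_divide_eq mult.commute mult.left_commute)
 hence "r * (q + h) < d" using q unfolding distrib_left by linarith
 with 0 1 show ?thesis by blast
qed

section \<open>Vertices and their tangent cones\<close>

context surface_patches
begin

lemma vertex_facts:
 assumes n: "n < num_vertices S"
 shows "vertex S n : bd S" "vertex S n : Omega S" "i < np ==> vertex S n ~: patch S i"
proof -
 have "bij_betw (vertex S) {..<num_vertices S} {corner S i a | i a. i < np & a < 4}"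
  using ps unfolding polyhedral_surface_def by (elim conjE) assumption
 from bij_betw_imp_surj_on[OF this] have "vertex S n : {corner S i a | i a. i < np & a < 4}"
  using n imageI[of n "{..<num_vertices S}" "vertex S"] by simp
 then obtain l a where l: "l < np" "a < 4" "vertex S n = corner S l a" by blast
 have "corner S l a : edge (corner S l) a" by (simp add: edge_def)
 hence K: "vertex S n : K l" unfolding l(3) K_edges[OF l(1)] using l(2) by (intro UN_I[of a]) auto
 hence G: "vertex S n : G l" using K_G by blast
 thus "vertex S n : bd S" using G_bd[OF l(1)] by blast
 thus "vertex S n : Omega S" using cOmega frontier_subset_compact by blast
 show "vertex S n ~: patch S i" if i: "i < np"
 proof (cases "i = l")
  case True
  thus ?thesis using K by (simp add: K_def)
 next
  case False
  thus ?thesis using patch_disjoint[OF i l(1)] G by blast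
 qed
qed

text \<open>Since \<open>Omega S\<close> is conic at the vertex, it agrees with its tangent cone in
  a ball, and so do the frontiers.\<close>

lemma frontier_tangent_cone:
 assumes n: "n < num_vertices S"
 shows "\<exists>e>0. \<forall>x\<in>ball (vertex S n) e. x : bd S --> x : frontier (tangent_cone (Omega S) (vertex S n))"
proof -
 let ?v = "vertex S n" and ?T = "tangent_cone (Omega S) (vertex S n)"
 obtain e where e: "e > 0" "!!h s. norm h < e ==> 0 < s ==> s <= 1 ==> (?v + h : Omega S \<longleftrightarrow> ?v + s *\<^sub>R h : Omega S)"
  using locally_conic_Omega[OF vertex_facts(2)[OF n]] unfolding locally_conic_def by blast
 have eq: "x : Omega S \<longleftrightarrow> x : ?T" if x: "x : ball ?v e" for x
 proof -
  define h where "h = x - ?v"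
  have h: "norm h < e" "x = ?v + h" using x by (auto simp: h_def dist_norm norm_minus_commute)
  show ?thesis
  proof
   assume xO: "x : Omega S"
   have "?v + g *\<^sub>R (x - ?v) : Omega S" if "g : {0..<1}" for g
   proof (cases "g = 0")
    case True
    thus ?thesis using vertex_facts(2)[OF n] by simp
   next
    case False
    have "?v + h : Omega S" using xO unfolding h(2) .
    hence "?v + g *\<^sub>R h : Omega S" using e(2)[OF h(1), of g] that False by simp
    thus ?thesis by (simp only: h_def)
   qed
   thus "x : ?T" unfolding tangent_cone_def by (intro insertI2 CollectI exI[of _ 1]) auto
  next
   assume "x : ?T"
   then consider "x = ?v" | c where "c > 0" "(%g. ?v + g *\<^sub>R (x - ?v)) ` {0..<c} <= Omega S"
    unfolding tangent_cone_def by blast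
   thus "x : Omega S"
   proof cases
    case 1
    thus ?thesis using vertex_facts(2)[OF n] by simp
   next
    case 2
    \<comment> \<open>The segment in the definition of the tangent cone is half-open; half of
      \<open>c\<close> stays inside.\<close>
    define g where "g = min (c / 2) 1"
    have g: "0 < g" "g <= 1" "g : {0..<c}" using 2(1) by (auto simp: g_def)
    hence "?v + g *\<^sub>R h : Omega S" using 2(2) h_def by blast
    thus ?thesis using e(2)[OF h(1) g(1,2)] h(2) by simp
   qed
  qed
 qed
 have "x : frontier ?T" if x: "x : ball ?v e" "x : bd S" for x
 proof (subst frontier_straddle, intro allI impI)
  fix d :: real assume d: "d > 0"
  obtain r where r: "r > 0" "ball x r <= ball ?v e" using x(1) open_contains_ball[of "ball ?v e"] by blast
  let ?d = "min d r"
  have "?d > 0" using d r by simp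
  then obtain y z where "y : Omega S" "dist x y < ?d" "z ~: Omega S" "dist x z < ?d"
   using x(2) unfolding frontier_straddle by blast
  hence yz: "y : Omega S" "dist x y < d" "z ~: Omega S" "dist x z < d" "y : ball ?v e" "z : ball ?v e"
   using r(2) by auto
  have "y : ?T" "z ~: ?T" using eq[OF yz(5)] eq[OF yz(6)] yz by blast+
  thus "(\<exists>y\<in>?T. dist x y < d) & (\<exists>y. y ~: ?T & dist x y < d)" using yz(2,4) by blast
 qed
 thus ?thesis using e(1) by blast
qed

lemma vertex_data:
 assumes n: "n < num_vertices S"
 shows "!!t. t < num_faces S n ==> 0 < opening_angle S n t & opening_angle S n t < 2 * pi"
  "!!t x y. t < num_faces S n ==> x : closure (sector (opening_angle S n t)) ==> y : closure (sector (opening_angle S n t)) ==>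
    dist (face_chart S n t x) (face_chart S n t y) = dist x y"
  "!!t. t < num_faces S n ==> face_chart S n t (0, 0) = vertex S n"
  "!!t. t < num_faces S n ==> \<exists>!i. meets_face S n t i"
  "frontier (tangent_cone (Omega S) (vertex S n)) = (\<Union>t<num_faces S n. closure (face S n t))"
proof -
 have "\<forall>n<num_vertices S.
    (\<forall>t<num_faces S n.
     0 < opening_angle S n t & opening_angle S n t < 2 * pi &
     (\<forall>x\<in>closure (sector (opening_angle S n t)).
       \<forall>y\<in>closure (sector (opening_angle S n t)).
        dist (face_chart S n t x) (face_chart S n t y) = dist x y) &
     face_chart S n t (0, 0) = vertex S n &
     (\<exists>!i. meets_face S n t i)) &
    disjoint_family_on (face S n) {..<num_faces S n} &
    frontier (tangent_cone (Omega S) (vertex S n)) = (\<Union>t<num_faces S n. closure (face S n t))"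
  using ps unfolding polyhedral_surface_def by (elim conjE) assumption
 from this[THEN spec, THEN mp, OF n] have c: "(\<forall>t<num_faces S n.
     0 < opening_angle S n t & opening_angle S n t < 2 * pi &
     (\<forall>x\<in>closure (sector (opening_angle S n t)).
       \<forall>y\<in>closure (sector (opening_angle S n t)).
        dist (face_chart S n t x) (face_chart S n t y) = dist x y) &
     face_chart S n t (0, 0) = vertex S n &
     (\<exists>!i. meets_face S n t i)) &
    disjoint_family_on (face S n) {..<num_faces S n} &
    frontier (tangent_cone (Omega S) (vertex S n)) = (\<Union>t<num_faces S n. closure (face S n t))" .
 from c have 1: "\<forall>t<num_faces S n.
     0 < opening_angle S n t & opening_angle S n t < 2 * pi &
     (\<forall>x\<in>closure (sector (opening_angle S n t)).
       \<forall>y\<in>closure (sector (opening_angle S n t)).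
        dist (face_chart S n t x) (face_chart S n t y) = dist x y) &
     face_chart S n t (0, 0) = vertex S n &
     (\<exists>!i. meets_face S n t i)" by (rule conjunct1)
 from c have 2: "frontier (tangent_cone (Omega S) (vertex S n)) = (\<Union>t<num_faces S n. closure (face S n t))"
  by (elim conjE) assumption
 show "0 < opening_angle S n t & opening_angle S n t < 2 * pi" if "t < num_faces S n" for t
  using 1[rule_format, OF that] by (elim conjE) (rule conjI)
 show "dist (face_chart S n t x) (face_chart S n t y) = dist x y"
  if "t < num_faces S n" "x : closure (sector (opening_angle S n t))" "y : closure (sector (opening_angle S n t))" for t x y
 proof -
  have "\<forall>x\<in>closure (sector (opening_angle S n t)). \<forall>y\<in>closure (sector (opening_angle S n t)).
    dist (face_chart S n t x) (face_chart S n t y) = dist x y"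
   using 1[rule_format, OF that(1)] by (elim conjE) assumption
  from bspec[OF bspec[OF this that(2)] that(3)] show ?thesis .
 qed
 show "face_chart S n t (0, 0) = vertex S n" if "t < num_faces S n" for t
  using 1[rule_format, OF that] by (elim conjE) assumption
 show "\<exists>!i. meets_face S n t i" if "t < num_faces S n" for t
  using 1[rule_format, OF that] by (elim conjE) assumption
 show "frontier (tangent_cone (Omega S) (vertex S n)) = (\<Union>t<num_faces S n. closure (face S n t))" by (rule 2)
qed

lemma face_chart_linear:
 assumes n: "n < num_vertices S" and t: "t < num_faces S n"
 shows "\<exists>T. linear T & (\<forall>x. norm (T x) = norm x) &
  (\<forall>x\<in>closure (sector (opening_angle S n t)). face_chart S n t x = vertex S n + T x)"
proof -
 let ?w = "opening_angle S n t"
 have w: "0 < ?w" "?w < 2 * pi" using vertex_data(1)[OF n t] by auto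
 have z: "(0 :: real \<times> real) : closure (sector ?w)" "(1, 0) : closure (sector ?w)"
 proof -
  have "polar (0, 0) : polar ` ({0..} \<times> {0..?w})" "polar (1, 0) : polar ` ({0..} \<times> {0..?w})"
   by (rule imageI; use w in simp)+
  thus "(0 :: real \<times> real) : closure (sector ?w)" "(1, 0) : closure (sector ?w)"
   unfolding closure_sector[OF w(1)] by (simp_all add: polar_Pair zero_prod_def)
 qed
 \<comment> \<open>A direction inside the sector at an angle below pi, hence independent of (1, 0)
   even if the sector is wide.\<close>
 define b where "b = min (?w / 2) (pi / 2)"
 have b: "0 < b" "b < ?w" "b < pi" using w pi_gt_zero by (auto simp: b_def min_def)
 have p: "(cos b, sin b) : closure (sector ?w)"
  unfolding closure_sector[OF w(1)] using b by (intro image_eqI[of _ polar "(1, b)"]) (auto simp: polar_def)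
 have "sin b ~= 0" using sin_gt_zero[OF b(1,3)] by simp
 from isometry_extend_linear[OF vertex_data(2)[OF n t] z p this]
 show ?thesis using vertex_data(3)[OF n t] by (simp add: zero_prod_def)
qed

end

section \<open>The patches at a vertex inside the faces of the tangent cone\<close>

locale surface_resolution = surface_patches +
 fixes Z :: resolution
 assumes res: "resolution_of_unity S Z"
begin

lemma res_vertex:
 assumes n: "n < num_vertices S"
 shows "!!x. x : bd S ==> 0 <= phi Z n x" "(%x. complex_of_real (phi Z n x)) : C_pw S"
  "openin (top_of_set (bd S)) (outer_nbhd Z n)" "vertex S n : outer_nbhd Z n" "outer_nbhd Z n <= bd S"
  "!!x. x : bd S - outer_nbhd Z n ==> phi Z n x = 0"
proof -
 have "\<forall>n<num_vertices S.
    (\<forall>x\<in>bd S. 0 <= phi Z n x) & (%x. complex_of_real (phi Z n x)) : C_pw S &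
    openin (top_of_set (bd S)) (inner_nbhd Z n) & openin (top_of_set (bd S)) (outer_nbhd Z n) &
    vertex S n : inner_nbhd Z n & inner_nbhd Z n \<subset> outer_nbhd Z n & outer_nbhd Z n \<subset> bd S &
    (\<forall>x\<in>inner_nbhd Z n. phi Z n x = 1) & (\<forall>x\<in>bd S - outer_nbhd Z n. phi Z n x = 0)"
  using res unfolding resolution_of_unity_def by (elim conjE) assumption
 note a = this[rule_format, OF n]
 show "!!x. x : bd S ==> 0 <= phi Z n x" "(%x. complex_of_real (phi Z n x)) : C_pw S"
  "openin (top_of_set (bd S)) (outer_nbhd Z n)" "vertex S n : outer_nbhd Z n" "outer_nbhd Z n <= bd S"
  "!!x. x : bd S - outer_nbhd Z n ==> phi Z n x = 0"
  using a by (metis, metis, metis, metis psubsetD, metis psubset_imp_subset, metis)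
qed

lemma res_sum: "x : bd S ==> (\<Sum>n<num_vertices S. phi Z n x) = 1"
 using res unfolding resolution_of_unity_def by blast

lemma res_dist:
 obtains C1 where "C1 > 0"
  "!!n l. n < num_vertices S ==> l < np ==> vertex S n ~: G l ==>
     ennreal C1 <= dist_along (bd S) (outer_nbhd Z n) (patch S l)"
  "!!n t. n < num_vertices S ==> t < num_faces S n ==>
     ennreal C1 <= dist_along (affine hull face S n t)
      (outer_nbhd Z n \<inter> face S n t) (patch S (patch_of_face S n t) - face S n t)"
proof -
 have "\<exists>C1>0. \<forall>n<num_vertices S.
    (\<forall>l<np. vertex S n ~: closure (patch S l) -->
     ennreal C1 <= dist_along (bd S) (outer_nbhd Z n) (patch S l)) &
    (\<forall>t<num_faces S n.
     ennreal C1 <= dist_along (affine hull face S n t)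
      (outer_nbhd Z n \<inter> face S n t) (patch S (patch_of_face S n t) - face S n t))"
  using res unfolding resolution_of_unity_def by (elim conjE) assumption
 thus ?thesis using that by metis
qed

text \<open>If x belonged to \<open>outer_nbhd Z n\<close>, the constant path at x would make a
  distance zero that the resolution of unity bounds from below.\<close>

lemma phi_zero:
 assumes n: "n < num_vertices S" and l: "l < np" "vertex S n ~: G l" and x: "x : patch S l"
 shows "phi Z n x = 0"
proof -
 have xb: "x : bd S" using x patch_G G_bd[OF l(1)] by blast
 have "x ~: outer_nbhd Z n"
 proof
  assume o: "x : outer_nbhd Z n"
  obtain C1 where "C1 > 0" "ennreal C1 <= dist_along (bd S) (outer_nbhd Z n) (patch S l)"
   using res_dist n l by metis
  moreover have "dist_along (bd S) (outer_nbhd Z n) (patch S l) <= ennreal (dist x x)"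
   by (rule dist_along_le[OF o x]) (simp add: xb)
  ultimately have "ennreal C1 <= ennreal 0" by (metis dist_self order_trans)
  thus False using \<open>C1 > 0\<close> by simp
 qed
 thus ?thesis using res_vertex(6)[OF n] xb by blast
qed

text \<open>Near the vertex an open piece of the patch lies in one closed face, and the distance
  condition of the resolution of unity then keeps the whole patch near the vertex in this face. By
  convexity every point can be shrunk towards the vertex without leaving the closed patch, so all of
  the patch lies in the sector. In the last inequality the right-hand side is the arc length to the
  nearer side of the sector.\<close>

lemma patch_in_face:
 assumes n: "n < num_vertices S" and i: "i < np" and v: "vertex S n : G i"
 shows "\<exists>t T. t < num_faces S n & linear T & (\<forall>x. norm (T x) = norm x) &
  (\<forall>x\<in>closure (sector (opening_angle S n t)). face_chart S n t x = vertex S n + T x) &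
  (\<forall>x\<in>patch S i. \<exists>r \<phi>. 0 < r & 0 < \<phi> & \<phi> < opening_angle S n t & x = vertex S n + T (polar (r, \<phi>)) &
   infdist x (K i) <= min \<phi> (opening_angle S n t - \<phi>) * r)"
proof -
 let ?v = "vertex S n"
 obtain C1 where C1: "C1 > 0"
  "!!t. t < num_faces S n ==> ennreal C1 <= dist_along (affine hull face S n t)
      (outer_nbhd Z n \<inter> face S n t) (patch S (patch_of_face S n t) - face S n t)"
  using res_dist n by metis
 obtain e1 where e1: "e1 > 0" "!!x. x : ball ?v e1 ==> x : bd S ==> x : frontier (tangent_cone (Omega S) ?v)"
  using frontier_tangent_cone[OF n] by blast
 obtain e2 where e2: "e2 > 0" "!!x. x : ball ?v e2 ==> x : bd S ==> x : outer_nbhd Z n"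
 proof -
  obtain U where U: "open U" "outer_nbhd Z n = bd S \<inter> U" using res_vertex(3)[OF n] unfolding openin_open by blast
  hence "?v : U" using res_vertex(4)[OF n] by blast
  then obtain e where "e > 0" "ball ?v e <= U" using U(1) open_contains_ball by blast
  thus ?thesis using that[of e] U(2) by blast
 qed
 \<comment> \<open>Two points in this ball are closer than \<open>C1\<close>, which contradicts the
   distance condition once one of them lies in the face and the other outside of it.\<close>
 define e where "e = min (min e1 e2) (C1 / 4)"
 have e: "e > 0" "e <= e1" "e <= e2" "e <= C1 / 4" using e1 e2 C1 by (auto simp: e_def)
 define X where "X = patch S i \<inter> ball ?v e"
 have Xop: "openin (top_of_set (A i)) X"
  unfolding X_def using patch_openin[OF i] by (simp add: openin_Int_open)
 have Xne: "X ~= {}"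
 proof -
  obtain y where "y : patch S i" "dist y ?v < e" using v e(1) unfolding closure_approachable by blast
  hence "y : X" by (simp add: X_def dist_commute)
  thus ?thesis by blast
 qed
 have patch_bd: "patch S i <= bd S" using patch_G G_bd[OF i] by blast
 have Xc: "X <= (\<Union>t\<in>{..<num_faces S n}. closure (face S n t))"
  unfolding vertex_data(5)[OF n, symmetric] X_def using e1(2) e(2) patch_bd by auto
 obtain t Y where tY: "t < num_faces S n" "openin (top_of_set (A i)) Y" "Y ~= {}" "Y <= X" "Y <= closure (face S n t)"
  using finite_closed_cover_open[OF _ _ Xop Xne Xc] by auto
 note t = tY(1)
 let ?w = "opening_angle S n t"
 have w: "0 < ?w" "?w < 2 * pi" using vertex_data(1)[OF n t] by auto
 obtain T where T: "linear T" "!!x. norm (T x) = norm x"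
  "!!x. x : closure (sector ?w) ==> face_chart S n t x = ?v + T x"
  using face_chart_linear[OF n t] by blast
 define FE where "FE x = ?v + T x" for x
 have FEd: "dist (FE x) (FE y) = dist x y" for x y
  using T(2)[of "x - y"] by (simp add: FE_def dist_norm linear_diff[OF T(1)])
 have FEc: "continuous_on UNIV FE" by (rule continuous_on_iff[THEN iffD2]) (auto simp: FEd)
 have FE_inj: "FE x = FE y ==> x = y" for x y using FEd[of x y] by simp
 have face: "face S n t = FE ` sector ?w"
  unfolding face_def FE_def by (rule image_cong[OF refl T(3)]) (use closure_subset in blast)
 have cl: "closure (face S n t) <= FE ` closure (sector ?w)"
 proof (rule closure_minimal)
  show "face S n t <= FE ` closure (sector ?w)" unfolding face using closure_subset by blast
  have "inj T" unfolding linear_injective_0[OF T(1)] using T(2) by (metis norm_eq_zero)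
  hence "closed (T ` closure (sector ?w))" by (rule closed_injective_linear_image[OF closed_closure T(1)])
  hence "closed ((+) ?v ` T ` closure (sector ?w))" by (rule closed_translation)
  thus "closed (FE ` closure (sector ?w))" by (simp add: image_image FE_def)
 qed
 have Req: "A i = range FE"
 proof (rule affine_eq_of_open_subset[OF A_affine[OF i] _ tY(2,3)])
  show "affine (range FE)" "aff_dim (A i) = aff_dim (range FE)"
   using isometry_range_affine[of FE] FEd A_dim[OF i] by simp_all
  show "Y <= range FE" using tY(5) cl by blast
 qed
 have face_A: "face S n t <= A i" unfolding face Req by blast
 obtain U where U: "open U" "Y = A i \<inter> U" using tY(2) unfolding openin_open by blast
 have "U \<inter> closure (face S n t) ~= {}" using tY U by blast
 hence "U \<inter> face S n t ~= {}" using open_Int_closure_eq_empty[OF U(1)] by blast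
 then obtain a where a: "a : face S n t" "a : Y" using face_A U by blast
 hence aX: "a : patch S i" "a : ball ?v e" using tY(4) by (auto simp: X_def)
 have pof: "patch_of_face S n t = i"
  unfolding patch_of_face_def
  by (rule the1_equality[OF vertex_data(4)[OF n t]]) (use i v a aX in blast)
 have Xface: "X <= face S n t"
 proof (rule ccontr)
  assume "\<not> X <= face S n t"
  then obtain x where "x : X" and xf: "x ~: face S n t" by blast
  hence x: "x : patch S i" "x : ball ?v e" "x ~: face S n t" unfolding X_def by blast+
  have "a : outer_nbhd Z n" using e2(2) aX e(3) patch_bd by auto
  moreover have "A i <= affine hull face S n t"
  proof -
   have h: "affine hull A i = A i" using A_affine[OF i] by (simp add: affine_hull_eq)
   have "A i = affine hull Y" by (rule affine_hull_openin[of "A i" Y, unfolded h, OF tY(2,3), symmetric])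
   also have "... <= affine hull (closure (face S n t))" by (rule hull_mono[OF tY(5)])
   also have "... = affine hull (face S n t)" by simp
   finally show ?thesis .
  qed
  moreover have "closed_segment a x <= A i"
   using aX(1) x(1) patch_A[OF i] affine_imp_convex[OF A_affine[OF i]] by (simp add: closed_segment_subset subsetD)
  ultimately have "dist_along (affine hull face S n t) (outer_nbhd Z n \<inter> face S n t) (patch S i - face S n t) <= ennreal (dist a x)"
   using a(1) x by (intro dist_along_le) auto
  hence "ennreal C1 <= ennreal (dist a x)" using C1(2)[OF t] unfolding pof by (rule order_trans[rotated])
  hence "C1 <= dist a x" by (simp add: ennreal_le_iff)
  moreover have "dist a x < 2 * e" using aX(2) x(2) dist_triangle_less_add[of a ?v e x e] by (simp add: dist_commute)
  ultimately show False using e C1 by simp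
 qed
 have pc: "x : FE ` polar ` ({0..} \<times> {0..?w})" if x: "x : patch S i" for x
 proof -
  \<comment> \<open>Shrinking by \<open>g\<close> brings the point into the ball of radius e, and
    the closed sector is invariant under the inverse scaling.\<close>
  define g where "g = e / (2 * (norm (x - ?v) + e))"
  have ne: "norm (x - ?v) + e > 0" using e(1) by (simp add: add_nonneg_pos)
  have g: "0 < g" "g <= 1" "g * norm (x - ?v) < e"
  proof -
   show "0 < g" using e(1) ne by (simp add: g_def)
   have p: "0 < 2 * (norm (x - ?v) + e)" using ne by simp
   have "e <= 2 * (norm (x - ?v) + e)" using e(1) norm_ge_zero[of "x - ?v"] by simp
   thus "g <= 1" unfolding g_def divide_le_eq_1_pos[OF p] .
   have "g * norm (x - ?v) <= g * (norm (x - ?v) + e)" using \<open>0 < g\<close> e(1) by simp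
   also have "... = e / 2"
   proof -
    have "e / (2 * c) * c = e / 2" if "c > 0" for c :: real using that by simp
    thus ?thesis unfolding g_def using ne by blast
   qed
   finally show "g * norm (x - ?v) < e" using e(1) by simp
  qed
  let ?p = "?v + g *\<^sub>R (x - ?v)"
  have "(1 - g) *\<^sub>R ?v + g *\<^sub>R x : G i"
   by (rule convexD_alt[OF convex_G[OF i] v]) (use x patch_G g in auto)
  hence "?p : G i" by (simp add: algebra_simps)
  moreover have "?p : ball ?v e" using g by (simp add: dist_norm)
  ultimately have "?p : closure (ball ?v e \<inter> patch S i)" using open_Int_closure_subset[OF open_ball] by blast
  hence "?p : closure (face S n t)" using closure_mono[OF Xface] by (auto simp: X_def Int_commute)
  hence "?p : FE ` polar ` ({0..} \<times> {0..?w})" using cl closure_sector[OF w(1)] by auto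
  then obtain r p where rp: "r >= 0" "p : {0..?w}" "?p = FE (polar (r, p))" by auto
  hence "g *\<^sub>R (x - ?v) = T (polar (r, p))" by (simp add: FE_def)
  hence "x - ?v = (1 / g) *\<^sub>R T (polar (r, p))" using g(1) by (metis divide_inverse mult_1 real_vector.scale_left_imp_eq real_vector.scale_one real_vector.scale_scale right_inverse less_irrefl)
  also have "... = T (polar ((1 / g) * r, p))" unfolding polar_scale using linear_scale[OF T(1)] by simp
  finally have "x = FE (polar ((1 / g) * r, p))" by (simp add: FE_def algebra_simps)
  moreover have "((1 / g) * r, p) : {0..} \<times> {0..?w}" using rp g(1) by simp
  ultimately show ?thesis by blast
 qed
 have main: "\<exists>r \<phi>. 0 < r & 0 < \<phi> & \<phi> < ?w & x = ?v + T (polar (r, \<phi>)) & infdist x (K i) <= min \<phi> (?w - \<phi>) * r"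
  if x: "x : patch S i" for x
 proof -
  obtain r p where rp: "r >= 0" "0 <= p" "p <= ?w" "x = FE (polar (r, p))" using pc[OF x] by auto
  have "r ~= 0"
  proof
   assume "r = 0"
   hence "x = ?v" using rp(4) linear_0[OF T(1)] by (simp add: FE_def polar_def zero_prod_def[symmetric])
   thus False using vertex_facts(3)[OF n i] x by simp
  qed
  hence r: "r > 0" using rp by simp
  define d where "d = infdist x (K i)"
  have d: "d > 0" unfolding d_def by (rule infdist_K_pos[OF i x])
  \<comment> \<open>Turning \<open>x\<close> along an arc shorter than its distance to
    \<open>K i\<close> does not leave the patch, so the new angle agrees modulo 2 pi with an angle
    of the closed sector.\<close>
  have stay: "\<exists>p'\<in>{0..?w}. \<exists>k::int. s = p' + 2 * pi * k" if s: "r * \<bar>p - s\<bar> < d" for s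
  proof -
   have "FE (polar (r, s)) : patch S i"
   proof (rule patch_ball[OF i x])
    show "FE (polar (r, s)) : A i" unfolding Req by simp
    show "dist x (FE (polar (r, s))) < infdist x (K i)"
     using dist_polar_le[OF rp(1), of p s] s unfolding rp(4) FEd d_def by linarith
   qed
   from pc[OF this] obtain r' p' where rp': "r' >= 0" "p' : {0..?w}" "FE (polar (r, s)) = FE (polar (r', p'))" by auto
   hence eq: "polar (r, s) = polar (r', p')" using FE_inj by blast
   hence "r = r'" using norm_polar[of r s] norm_polar[of r' p'] rp' rp by simp
   hence "sin s = sin p' & cos s = cos p'" using eq r by (simp add: polar_def)
   thus ?thesis using rp'(2) unfolding sin_cos_eq_iff by blast
  qed
  have rot: "\<exists>h. 0 < h & h < 2 * pi - ?w & r * (q + h) < d" if q: "r * q < d" for q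
   by (rule small_rotation[OF r q w(2)])
  have k0: "False" if "0 < 2 * pi * real_of_int k" "2 * pi * real_of_int k < 2 * pi" for k :: int
  proof -
   have "0 < real_of_int k" using that(1) pi_gt_zero by (simp add: zero_less_mult_iff)
   moreover have "real_of_int k < 1" using that(2) pi_gt_zero by simp
   ultimately show False by simp
  qed
  \<comment> \<open>Otherwise \<open>x\<close> could be turned past the side of angle zero to the
    angle -h, which is no angle of the sector modulo 2 pi because h is below 2 pi - w.\<close>
  have 1: "d <= r * p"
  proof (rule ccontr)
   assume "\<not> d <= r * p"
   then obtain h where h: "0 < h" "h < 2 * pi - ?w" "r * (p + h) < d" using rot[of p] by auto
   obtain p' k where pk: "p' : {0..?w}" "- h = p' + 2 * pi * real_of_int k"
    using stay[of "- h"] h rp by auto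
   hence "2 * pi * real_of_int (- k) = p' + h" by simp
   thus False using k0[of "- k"] pk(1) h by auto
  qed
  have 2: "d <= r * (?w - p)"
  proof (rule ccontr)
   assume "\<not> d <= r * (?w - p)"
   then obtain h where h: "0 < h" "h < 2 * pi - ?w" "r * (?w - p + h) < d" using rot[of "?w - p"] by auto
   have "\<bar>p - (?w + h)\<bar> = ?w - p + h" using rp h by simp
   then obtain p' k where pk: "p' : {0..?w}" "?w + h = p' + 2 * pi * real_of_int k"
    using stay[of "?w + h"] h by auto
   hence "2 * pi * real_of_int k = ?w + h - p'" by simp
   thus False using k0[of k] pk(1) h by auto
  qed
  have "0 < r * p" "0 < r * (?w - p)" using 1 2 d by linarith+
  hence "0 < p" "0 < ?w - p" using r by (simp_all only: zero_less_mult_pos[OF _ r])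
  hence "0 < p" "p < ?w" by auto
  moreover have "d <= min p (?w - p) * r" using 1 2 by (auto simp: min_def mult.commute)
  ultimately show ?thesis using r rp(4) unfolding d_def FE_def by blast
 qed
 show ?thesis by (intro exI[of _ t] exI[of _ T] conjI t T(1) allI T(2) ballI main T(3))
qed

end

section \<open>Surface measure and pull-back to the unit square\<close>

lemma abs_fst_le_norm: "\<bar>fst v\<bar> <= norm v" and abs_snd_le_norm: "\<bar>snd v\<bar> <= norm v" for v :: "real \<times> real"
 using norm_fst_le[of "fst v" "snd v"] norm_snd_le[of "snd v" "fst v"] by simp_all

lemma abs_jac_le: "\<bar>jac D\<bar> <= 2 * (norm (D (1, 0)) * norm (D (0, 1)))"
proof -
 have "\<bar>fst (D (1, 0)) * snd (D (0, 1))\<bar> <= norm (D (1, 0)) * norm (D (0, 1))"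
  "\<bar>snd (D (1, 0)) * fst (D (0, 1))\<bar> <= norm (D (1, 0)) * norm (D (0, 1))"
  unfolding abs_mult by (intro mult_mono abs_fst_le_norm abs_snd_le_norm; simp)+
 thus ?thesis unfolding jac_def by linarith
qed

lemma Ck_on_jac_continuous:
 assumes "Ck_on (Suc l) U g" "!!x. x : U ==> (g has_derivative g' x) (at x)"
 shows "continuous_on U (%x. jac (g' x))"
proof -
 obtain D where D: "\<forall>x\<in>U. (g has_derivative D x) (at x)" "\<forall>b\<in>Basis. Ck_on l U (%x. D x b)"
  using assms(1) by auto
 have e: "g' x = D x" if "x : U" for x using D(1) assms(2) that has_derivative_unique by blast
 have "continuous_on U (%x. jac (D x))" unfolding jac_def
  using D(2) by (intro continuous_intros Ck_on_continuous[of l]) (auto simp: Basis_plane)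
 thus ?thesis by (rule continuous_on_eq) (simp add: e)
qed

lemma Ck_on_derivative_bounded:
 fixes f :: "'a::euclidean_space => 'b::real_normed_vector"
 assumes f: "Ck_on (Suc l) U f" and C: "compact C" "C <= U"
 obtains B D where "B > 0" "!!y. y : U ==> (f has_derivative D y) (at y)" "!!y v. y : C ==> norm (D y v) <= B * norm v"
proof -
 obtain D where D: "\<forall>x\<in>U. (f has_derivative D x) (at x)" "\<forall>b\<in>Basis. Ck_on l U (%x. D x b)"
  using f by auto
 have "\<forall>b\<in>Basis. \<exists>B. \<forall>y\<in>C. norm (D y b) <= B"
 proof
  fix b :: 'a assume "b : Basis"
  hence "continuous_on C (%x. D x b)" using D(2) Ck_on_continuous continuous_on_subset C(2) by blast
  hence "bounded ((%x. D x b) ` C)" using compact_continuous_image C(1) compact_imp_bounded by blast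
  thus "\<exists>B. \<forall>y\<in>C. norm (D y b) <= B" by (auto simp: bounded_iff)
 qed
 from bchoice[OF this] obtain B where B: "!!b y. b : Basis ==> y : C ==> norm (D y b) <= B b" by blast
 define B' where "B' = (\<Sum>b\<in>(Basis :: 'a set). \<bar>B b\<bar>) + 1"
 have "norm (D y v) <= B' * norm v" if y: "y : C" for y v
 proof -
  have lin: "linear (D y)" using D(1) y C(2) has_derivative_linear by blast
  have "D y v = (\<Sum>b\<in>Basis. (v \<bullet> b) *\<^sub>R D y b)"
   by (subst euclidean_representation[of v, symmetric]) (simp add: linear_sum[OF lin] linear_scale[OF lin])
  also have "norm ... <= (\<Sum>b\<in>Basis. norm v * \<bar>B b\<bar>)"
  proof (rule sum_norm_le)
   fix b :: 'a assume b: "b : Basis"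
   have "\<bar>v \<bullet> b\<bar> <= norm v" by (rule Basis_le_norm[OF b])
   moreover have "norm (D y b) <= \<bar>B b\<bar>" using B[OF b y] by linarith
   ultimately show "norm ((v \<bullet> b) *\<^sub>R D y b) <= norm v * \<bar>B b\<bar>"
    unfolding norm_scaleR real_norm_def by (intro mult_mono) auto
  qed
  also have "... <= B' * norm v" by (simp add: B'_def sum_distrib_left[symmetric] mult.commute distrib_left)
  finally show ?thesis .
 qed
 moreover have "B' > 0" unfolding B'_def by (rule add_nonneg_pos) (auto intro: sum_nonneg)
 ultimately show ?thesis using that D(1) by blast
qed

lemma Ck_on_lipschitz:
 fixes f :: "'a::euclidean_space => 'b::real_normed_vector"
 assumes f: "Ck_on (Suc l) U f" and C: "compact C" "convex C" "C <= U"
 obtains B where "B > 0" "!!x y. x : C ==> y : C ==> dist (f x) (f y) <= B * dist x y"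
proof -
 obtain B D where B: "B > 0" "!!y. y : U ==> (f has_derivative D y) (at y)" "!!y v. y : C ==> norm (D y v) <= B * norm v"
  by (rule Ck_on_derivative_bounded[OF f C(1,3)], rule that)
 have "norm (f x - f y) <= B * norm (x - y)" if "x : C" "y : C" for x y
 proof (rule differentiable_bound[where f' = D, OF C(2) _ _ that])
  show "(f has_derivative D z) (at z within C)" if "z : C" for z
   using B(2) C(3) that has_derivative_at_withinI by blast
  show "onorm (D z) <= B" if "z : C" for z by (rule onorm_le) (rule B(3)[OF that])
 qed
 thus ?thesis using that B(1) by (simp add: dist_norm)
qed

context surface_patches
begin

abbreviation "M \<equiv> surface_measure S"
definition "D i = E i -` patch S i"
definition "kinv i = inv_into unit_square (kappa S i)"

lemma E_continuous: "i < np ==> continuous_on X (E i)"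
 by (rule continuous_on_iff[THEN iffD2]) (auto simp: E_dist)

lemma D_open:
 assumes i: "i < np"
 shows "open (D i)"
proof -
 obtain U where U: "open U" "patch S i = A i \<inter> U" using patch_openin[OF i] unfolding openin_open by blast
 have "D i = E i -` U" unfolding D_def using U by auto
 thus ?thesis using open_vimage[OF U(1) E_continuous[OF i]] by simp
qed

lemma E_D: "i < np ==> E i ` D i = patch S i"
 unfolding D_def using patch_A by blast

lemma bd_closed: "closed (bd S)" using compact_bd compact_imp_closed by blast

lemma patch_bd: "i < np ==> patch S i <= bd S" using patch_G G_bd by blast

lemma patch_borel: "i < np ==> patch S i : sets borel"
proof -
 assume i: "i < np"
 have "patch S i = G i - K i" using patch_G by (auto simp: K_def)
 thus ?thesis using sets.Diff[OF borel_closed[OF compact_imp_closed[OF compact_G[OF i]]] borel_closed[OF compact_imp_closed[OF K_compact[OF i]]]]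
  by (simp only:)
qed

lemma E_measurable: "i < np ==> E i : borel_measurable borel"
 by (rule borel_measurable_continuous_onI) (rule E_continuous)

text \<open>\<open>measure_of\<close> takes the prescribed values because the set function is
  countably additive, as can be seen patch by patch.\<close>

lemma surface_measure_facts:
 shows space_M: "space M = bd S" and sets_M: "sets M = {X. X : sets borel & X <= bd S}"
  and emeasure_M: "X : sets borel ==> X <= bd S ==>
   emeasure M X = (\<Sum>i<np. emeasure lborel (E i -` (X \<inter> patch S i)))"
proof -
 let ?S = "{X. X : sets borel & X <= bd S}"
 let ?f = "%X. \<Sum>i<np. emeasure lborel (E i -` (X \<inter> patch S i))"
 have b: "bd S : sets borel" using bd_closed by simp
 have "?S = sets (restrict_space borel (bd S))"
  unfolding sets_restrict_space using b by (auto intro: image_eqI)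
 hence sa: "sigma_algebra (bd S) ?S"
  using sets.sigma_algebra_axioms[of "restrict_space borel (bd S)"] by (simp add: space_restrict_space)
 interpret sigma_algebra "bd S" ?S by (rule sa)
 show "space M = bd S" unfolding surface_measure_def by (rule space_measure_of) (rule space_closed)
 show "sets M = ?S" unfolding surface_measure_def
  using sets_measure_of[OF space_closed] sigma_sets_eq by simp
 have meas: "E i -` (X \<inter> patch S i) : sets lborel" if "i < np" "X : sets borel" for i X
  using measurable_sets[OF E_measurable[OF that(1)], of "X \<inter> patch S i"] patch_borel[OF that(1)] that(2) by simp
 show "emeasure M X = ?f X" if "X : sets borel" "X <= bd S"
  unfolding surface_measure_def
 proof (rule emeasure_measure_of_sigma[OF sa])
  show "positive ?S ?f" by (simp add: positive_def)
  show "countably_additive ?S ?f"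
   unfolding countably_additive_def
  proof (intro allI impI)
   fix X :: "nat => point set" assume X: "range X <= ?S" "disjoint_family X" "\<Union> (range X) : ?S"
   have "(\<Sum>n. ?f (X n)) = (\<Sum>i<np. \<Sum>n. emeasure lborel (E i -` (X n \<inter> patch S i)))"
    by (rule suminf_sum) simp
   also have "... = ?f (\<Union> (range X))"
   proof (rule sum.cong[OF refl])
    fix i assume "i : {..<np}"
    hence i: "i < np" by simp
    have "(\<Sum>n. emeasure lborel (E i -` (X n \<inter> patch S i))) = emeasure lborel (\<Union>n. E i -` (X n \<inter> patch S i))"
    proof (rule suminf_emeasure)
     show "range (%n. E i -` (X n \<inter> patch S i)) <= sets lborel" using meas[OF i] X(1) by blast
     show "disjoint_family (%n. E i -` (X n \<inter> patch S i))"
      using X(2) unfolding disjoint_family_on_def by blast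
    qed
    also have "(\<Union>n. E i -` (X n \<inter> patch S i)) = E i -` (\<Union> (range X) \<inter> patch S i)" by blast
    finally show "(\<Sum>n. emeasure lborel (E i -` (X n \<inter> patch S i))) = emeasure lborel (E i -` (\<Union> (range X) \<inter> patch S i))" .
   qed
   finally show "(\<Sum>n. ?f (X n)) = ?f (\<Union> (range X))" .
  qed
 qed (use that in simp)
qed

lemma sets_M_restrict: "sets M = sets (restrict_space borel (bd S))"
 unfolding sets_M sets_restrict_space using bd_closed by (auto intro: image_eqI)

text \<open>The image of planar measure under the chart of one patch is dominated by the surface
  measure, which sums over all patches.\<close>

lemma nn_integral_M_ge:
 assumes i: "i < np" and f: "f : borel_measurable M"
 shows "(NN y. f (E i y) * indicator (D i) y) <= (\<integral>\<^sup>+x. f x \<partial>M)"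
proof -
 have Dm: "D i : sets lborel" using D_open[OF i] by simp
 have Em: "E i : measurable (restrict_space lborel (D i)) M"
 proof (rule measurableI)
  show "E i x : space M" if "x : space (restrict_space lborel (D i))" for x
   using that patch_bd[OF i] by (auto simp: space_M space_restrict_space D_def)
  fix X assume "X : sets M"
  hence X: "X : sets borel" by (simp add: sets_M)
  have "E i -` X \<inter> D i : sets lborel" using measurable_sets[OF E_measurable[OF i] X] Dm by simp
  thus "E i -` X \<inter> space (restrict_space lborel (D i)) : sets (restrict_space lborel (D i))"
   by (auto simp: space_restrict_space sets_restrict_space intro!: image_eqI[of _ _ "E i -` X \<inter> D i"])
 qed
 define N where "N = distr (restrict_space lborel (D i)) M (E i)"
 have sN: "sets N = sets M" by (simp add: N_def)
 have "N <= M"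
 proof (subst le_measure[OF sN], rule ballI)
  fix X assume XN: "X : sets N"
  hence X: "X : sets borel" "X <= bd S" by (auto simp: sN sets_M)
  have "emeasure N X = emeasure (restrict_space lborel (D i)) (E i -` X \<inter> space (restrict_space lborel (D i)))"
   unfolding N_def by (rule emeasure_distr[OF Em]) (use XN sN in simp)
  also have "... = emeasure lborel (E i -` X \<inter> D i)"
   by (subst emeasure_restrict_space) (use Dm in \<open>auto simp: space_restrict_space\<close>)
  also have "E i -` X \<inter> D i = E i -` (X \<inter> patch S i)" by (auto simp: D_def)
  also have "emeasure lborel (E i -` (X \<inter> patch S i)) <= (\<Sum>i<np. emeasure lborel (E i -` (X \<inter> patch S i)))"
   by (rule member_le_sum) (use i in auto)
  finally show "emeasure N X <= emeasure M X" using emeasure_M[OF X] by simp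
 qed
 hence "(\<integral>\<^sup>+x. f x \<partial>N) <= (\<integral>\<^sup>+x. f x \<partial>M)" by (rule nn_integral_mono_measure[OF sN])
 moreover have "(\<integral>\<^sup>+x. f x \<partial>N) = (\<integral>\<^sup>+y. f (E i y) \<partial>restrict_space lborel (D i))"
  unfolding N_def by (rule nn_integral_distr[OF Em]) (use f in simp)
 moreover have "... = (NN y. f (E i y) * indicator (D i) y)"
  by (rule nn_integral_restrict_space) (use Dm in simp)
 ultimately show ?thesis by simp
qed

lemma kinv_facts:
 assumes i: "i < np"
 shows "y : G i ==> kinv i y : unit_square" "y : G i ==> kappa S i (kinv i y) = y"
  "z : unit_square ==> kinv i (kappa S i z) = z" "z : unit_square ==> kappa S i z : G i"
proof -
 have bij: "bij_betw (kappa S i) unit_square (G i)" using diffeo[OF i] unfolding Ck_diffeo_def by auto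
 show "y : G i ==> kinv i y : unit_square" "y : G i ==> kappa S i (kinv i y) = y"
  "z : unit_square ==> kinv i (kappa S i z) = z" "z : unit_square ==> kappa S i z : G i"
  unfolding kinv_def using bij
  by (metis bij_betw_imp_surj_on inv_into_into, metis bij_betw_inv_into_right, metis bij_betw_inv_into_left, metis bij_betwE)
qed

lemma kinv_ext:
 assumes i: "i < np"
 obtains U g where "open U" "G i <= U" "Ck_on m U g" "!!y. y : G i ==> g y = kinv i y"
 using diffeo[OF i] unfolding Ck_diffeo_def Ck_up_to_def kinv_def by blast

lemma kap_ext:
 assumes i: "i < np"
 obtains U g where "open U" "unit_square <= U" "Ck_on m U g" "!!y. y : unit_square ==> g y = kappa S i y"
 using diffeo[OF i] unfolding Ck_diffeo_def Ck_up_to_def by blast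

text \<open>The mean value inequality needs a convex domain; for the inverse this is supplied by
  \<open>convex_G\<close>.\<close>

lemma lipschitz_kappa:
 assumes i: "i < np"
 obtains L where "L > 0" "!!x y. x : unit_square ==> y : unit_square ==> dist (kappa S i x) (kappa S i y) <= L * dist x y"
  "!!x y. x : G i ==> y : G i ==> dist (kinv i x) (kinv i y) <= L * dist x y"
proof -
 obtain l where l: "m = Suc l" using m1 by (cases m) auto
 obtain U g where 1: "open U" "unit_square <= U" "Ck_on m U g" "!!y. y : unit_square ==> g y = kappa S i y"
  by (rule kap_ext[OF i], rule that)
 obtain U' g' where 2: "open U'" "G i <= U'" "Ck_on m U' g'" "!!y. y : G i ==> g' y = kinv i y"
  by (rule kinv_ext[OF i], rule that)
 have sq: "convex (unit_square :: (real \<times> real) set)" "compact (unit_square :: (real \<times> real) set)"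
  by (intro convex_Times convex_real_interval) (intro compact_Times compact_Icc)
 obtain B1 where B1: "B1 > 0" "!!x y. x : unit_square ==> y : unit_square ==> dist (g x) (g y) <= B1 * dist x y"
  by (rule Ck_on_lipschitz[OF 1(3)[unfolded l] sq(2,1) 1(2)], rule that)
 obtain B2 where B2: "B2 > 0" "!!x y. x : G i ==> y : G i ==> dist (g' x) (g' y) <= B2 * dist x y"
  by (rule Ck_on_lipschitz[OF 2(3)[unfolded l] compact_G[OF i] convex_G[OF i] 2(2)], rule that)
 show ?thesis
 proof (rule that[of "B1 + B2"])
  show "dist (kappa S i x) (kappa S i y) <= (B1 + B2) * dist x y" if "x : unit_square" "y : unit_square" for x y
  proof -
   have "dist (kappa S i x) (kappa S i y) <= B1 * dist x y" using B1(2)[OF that] 1(4) that by simp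
   also have "... <= (B1 + B2) * dist x y" using B2(1) by (intro mult_right_mono) auto
   finally show ?thesis .
  qed
  show "dist (kinv i x) (kinv i y) <= (B1 + B2) * dist x y" if "x : G i" "y : G i" for x y
  proof -
   have "dist (kinv i x) (kinv i y) <= B2 * dist x y" using B2(2)[OF that] 2(4) that by simp
   also have "... <= (B1 + B2) * dist x y" using B1(1) by (intro mult_right_mono) auto
   finally show ?thesis .
  qed
 qed (use B1 B2 in simp)
qed

lemma V_eq_kinv: "i < np ==> V i = kinv i ` patch S i"
proof -
 assume i: "i < np"
 show ?thesis
 proof
  show "V i <= kinv i ` patch S i"
  proof
   fix z assume "z : V i"
   hence "z : unit_square" "kappa S i z : patch S i" by (auto simp: V_def)
   thus "z : kinv i ` patch S i" using kinv_facts(3)[OF i] by (intro image_eqI[of _ _ "kappa S i z"]) auto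
  qed
  show "kinv i ` patch S i <= V i"
  proof (rule image_subsetI)
   fix y assume y: "y : patch S i"
   hence "y : G i" using patch_G by blast
   thus "kinv i y : V i" using kinv_facts(1,2)[OF i, of y] y unfolding V_def by simp
  qed
 qed
qed

text \<open>One constant for all parametrizations \<open>h\<close> of the patch with derivatives
  bounded by 1 and \<open>J\<close>; it depends only on the inverse of \<open>kappa\<close>. It is
  used with the isometric chart, where \<open>J\<close> is 1, and with polar coordinates about a
  vertex, where \<open>J\<close> is the radius.\<close>

definition pull_const :: "nat => real => bool" where
 "pull_const i B \<longleftrightarrow> B > 0 & (\<forall>(X :: (real \<times> real) set) h Dh J f. open X --> Ck_on 1 X h --> h ` X = patch S i -->
  (\<forall>x\<in>X. (h has_derivative Dh x) (at x) & norm (Dh x (1, 0)) <= 1 & norm (Dh x (0, 1)) <= J x) -->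
  f : borel_measurable borel --> (\<forall>z. 0 <= f z) -->
  (NN z. ennreal (f z) * indicator (V i) z) <= (NN x. ennreal (B * J x * f (kinv i (h x))) * indicator X x))"

lemma pull_constD:
 fixes X :: "(real \<times> real) set"
 assumes "pull_const i B" "open X" "Ck_on 1 X h" "h ` X = patch S i"
  "!!x. x : X ==> (h has_derivative Dh x) (at x)"
  "!!x. x : X ==> norm (Dh x (1, 0)) <= 1" "!!x. x : X ==> norm (Dh x (0, 1)) <= J x"
  "f : borel_measurable borel" "!!z. 0 <= f z"
 shows "(NN z. ennreal (f z) * indicator (V i) z) <= (NN x. ennreal (B * J x * f (kinv i (h x))) * indicator X x)"
proof -
 have 1: "\<forall>x\<in>X. (h has_derivative Dh x) (at x) & norm (Dh x (1, 0)) <= 1 & norm (Dh x (0, 1)) <= J x"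
  using assms(5-7) by blast
 have 2: "\<forall>z. 0 <= f z" using assms(9) by blast
 show ?thesis
  by (rule assms(1)[unfolded pull_const_def, THEN conjunct2, THEN spec, THEN spec, THEN spec, THEN spec, THEN spec,
    THEN mp, THEN mp, THEN mp, THEN mp, THEN mp, THEN mp, OF assms(2-4) 1 assms(8) 2])
qed

lemma pull_const_ex:
 assumes i: "i < np"
 shows "\<exists>B. pull_const i B"
proof -
 obtain l where l: "m = Suc l" using m1 by (cases m) auto
 obtain U g where g: "open U" "G i <= U" "Ck_on m U g" "!!y. y : G i ==> g y = kinv i y"
  by (rule kinv_ext[OF i], rule that)
 obtain B Dg where B: "B > 0" "!!y. y : U ==> (g has_derivative Dg y) (at y)" "!!y v. y : G i ==> norm (Dg y v) <= B * norm v"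
  by (rule Ck_on_derivative_bounded[OF g(3)[unfolded l] compact_G[OF i] g(2)], rule that)
 show ?thesis
  unfolding pull_const_def
 \<comment> \<open>\<open>B\<close> bounds the derivative of the extended inverse of
   \<open>kappa\<close> and enters once for each column of the Jacobian; the factor 2 is that of
   \<open>abs_jac_le\<close>.\<close>
 proof (intro exI[of _ "2 * (B * B)"] conjI allI impI)
  show "0 < 2 * (B * B)" using B(1) by simp
  fix X :: "(real \<times> real) set" and h Dh J and f :: "real \<times> real => real"
  assume X: "open X" "Ck_on 1 X h" "h ` X = patch S i"
   and Dh0: "\<forall>x\<in>X. (h has_derivative Dh x) (at x) & norm (Dh x (1, 0)) <= 1 & norm (Dh x (0, 1)) <= J x"
   and f: "f : borel_measurable borel" and f0: "\<forall>z. 0 <= f z"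
  have f: "f : borel_measurable borel" "!!z. 0 <= f z" using f f0 by auto
  have Dh: "!!x. x : X ==> (h has_derivative Dh x) (at x)" "!!x. x : X ==> norm (Dh x (1, 0)) <= 1" "!!x. x : X ==> norm (Dh x (0, 1)) <= J x"
   using Dh0 by blast+
  have hG: "h x : G i" if "x : X" for x using X(3) that patch_G by blast
  have hU: "h x : U" if "x : X" for x using hG[OF that] g(2) by blast
  have im: "(%x. g (h x)) ` X = V i"
  proof -
   have "(%x. g (h x)) ` X = kinv i ` (h ` X)" unfolding image_image by (rule image_cong[OF refl]) (simp add: g(4) hG)
   thus ?thesis using X(3) V_eq_kinv[OF i] by simp
  qed
  have der: "((%x. g (h x)) has_derivative (%v. Dg (h x) (Dh x v))) (at x)" if "x : X" for x
   by (rule has_derivative_compose[OF Dh(1)[OF that] B(2)[OF hU[OF that]]])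
  have "Ck_on (Suc 0) X (%x. g (h x))"
   by (rule Ck_on_compose[OF X(1) Ck_on_le[OF g(3)]]) (use X(2) hU l in auto)
  hence jc: "continuous_on X (%x. jac (%v. Dg (h x) (Dh x v)))" by (rule Ck_on_jac_continuous[OF _ der])
  have "(NN z. ennreal (f z) * indicator (V i) z)
   <= (NN x. ennreal (\<bar>jac (%v. Dg (h x) (Dh x v))\<bar> * f (g (h x))) * indicator X x)"
   unfolding im[symmetric]
   by (rule nn_integral_image_le[OF X(1) der jc f]) (use im V_open[OF i] in auto)
  also have "... <= (NN x. ennreal (2 * (B * B) * J x * f (kinv i (h x))) * indicator X x)"
  proof (rule nn_integral_mono)
   fix x show "ennreal (\<bar>jac (%v. Dg (h x) (Dh x v))\<bar> * f (g (h x))) * indicator X x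
    <= ennreal (2 * (B * B) * J x * f (kinv i (h x))) * indicator X x"
   proof (cases "x : X")
    case True
    have n1: "norm (Dg (h x) (Dh x (1, 0))) <= B * 1"
     using B(3)[OF hG[OF True]] Dh(2)[OF True] B(1) by (meson mult_left_mono less_imp_le order_trans)
    have n2: "norm (Dg (h x) (Dh x (0, 1))) <= B * J x"
     using B(3)[OF hG[OF True]] Dh(3)[OF True] B(1) by (meson mult_left_mono less_imp_le order_trans)
    have "\<bar>jac (%v. Dg (h x) (Dh x v))\<bar> <= 2 * (norm (Dg (h x) (Dh x (1, 0))) * norm (Dg (h x) (Dh x (0, 1))))"
     by (rule abs_jac_le)
    also have "... <= 2 * ((B * 1) * (B * J x))"
     by (intro mult_left_mono mult_mono n1 n2) (use B(1) in auto)
    finally have "\<bar>jac (%v. Dg (h x) (Dh x v))\<bar> <= 2 * (B * B) * J x" by (simp add: mult_ac)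
    hence "\<bar>jac (%v. Dg (h x) (Dh x v))\<bar> * f (g (h x)) <= 2 * (B * B) * J x * f (g (h x))"
     by (rule mult_right_mono) (rule f(2))
    thus ?thesis using True g(4)[OF hG[OF True]] by (simp add: ennreal_leI)
   qed simp
  qed
  finally show "(NN z. ennreal (f z) * indicator (V i) z) <= (NN x. ennreal (2 * (B * B) * J x * f (kinv i (h x))) * indicator X x)" .
 qed
qed

lemma E_linear:
 assumes i: "i < np"
 obtains T where "linear T" "!!x. norm (T x) = norm x" "!!x. E i x = E i 0 + T x"
 using isometry_range_affine(4)[of "E i"] E_dist[OF i] by blast

lemma measurable_kappa:
 assumes i: "i < np" and u: "u : borel_measurable M"
 shows "(%z. indicator unit_square z *\<^sub>R (u (kappa S i z) :: complex)) : borel_measurable borel"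
proof -
 have sq: "(unit_square :: (real \<times> real) set) : sets borel" by (intro borel_closed closed_Times closed_atLeastAtMost)
 have k0: "kappa S i : measurable (restrict_space borel unit_square) borel"
  by (rule borel_measurable_continuous_on_restrict[OF kappa_continuous[OF i]])
 have "kappa S i : measurable (restrict_space borel unit_square) (restrict_space borel (bd S))"
  by (rule measurable_restrict_space2[OF _ k0])
   (use kinv_facts(4)[OF i] G_bd[OF i] in \<open>auto simp: space_restrict_space\<close>)
 hence k: "kappa S i : measurable (restrict_space borel unit_square) M"
  unfolding measurable_cong_sets[OF refl sets_M_restrict] .
 have "(%z. u (kappa S i z)) : borel_measurable (restrict_space borel unit_square)"
  by (rule measurable_compose[OF k u])
 thus ?thesis using sq borel_measurable_restrict_space_iff[of unit_square borel "%z. u (kappa S i z)"] by simp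
qed

text \<open>Up to a null set the square is \<open>V i\<close>, so \<open>pull_const\<close> applies
  with the isometric chart of the patch.\<close>

lemma L2_pull_back:
 assumes i: "i < np"
 obtains B where "B > 0" "!!u. u : borel_measurable M ==>
  (NN z. ennreal ((cmod (u (kappa S i z)))\<^sup>2) * indicator unit_square z) <= ennreal B * (\<integral>\<^sup>+x. ennreal ((cmod (u x))\<^sup>2) \<partial>M)"
proof -
 obtain B where B: "pull_const i B" using pull_const_ex[OF i] by blast
 hence B0: "B > 0" by (simp add: pull_const_def)
 obtain T where T: "linear T" "!!x. norm (T x) = norm x" "!!x. E i x = E i 0 + T x" by (rule E_linear[OF i], rule that)
 have Ed: "(E i has_derivative T) (at x)" for x
 proof -
  have "((%x. E i 0 + T x) has_derivative T) (at x)"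
   using linear_imp_has_derivative[OF T(1)] by (auto intro!: derivative_eq_intros)
  thus ?thesis using T(3) by (metis (no_types, lifting) ext)
 qed
 have EC: "Ck_on 1 (D i) (E i)"
  unfolding One_nat_def by (rule Ck_on_SucI[where D = "%x. T"]) (auto simp: Ed)
 have n1: "norm ((1, 0) :: real \<times> real) = 1" "norm ((0, 1) :: real \<times> real) = 1" by (simp_all add: norm_Pair)
 obtain L where L: "L > 0" "!!x y. x : G i ==> y : G i ==> dist (kinv i x) (kinv i y) <= L * dist x y"
  by (rule lipschitz_kappa[OF i], rule that)
 \<comment> \<open>These parameters belong to points of the four edges, so they lie on
   differentiable images of intervals in the plane.\<close>
 have null: "negligible (unit_square - V i)"
 proof -
  obtain l where l: "m = Suc l" using m1 by (cases m) auto
  obtain U g where g: "open U" "G i <= U" "Ck_on m U g" "!!y. y : G i ==> g y = kinv i y"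
   by (rule kinv_ext[OF i], rule that)
  have "unit_square - V i <= (\<Union>a<4::nat. (%t. g (linepath (corner S i a) (corner S i (Suc a mod 4)) t)) ` {0..1})"
  proof
   fix z assume z: "z : unit_square - V i"
   hence "kappa S i z : K i" using kinv_facts(4)[OF i, of z] by (auto simp: V_def K_def)
   then obtain a where a: "a < 4" "kappa S i z : edge (corner S i) a" unfolding K_edges[OF i] by blast
   then obtain t where t: "t : {0..1}" "kappa S i z = linepath (corner S i a) (corner S i (Suc a mod 4)) t"
    unfolding edge_def linepath_image_01[symmetric] by blast
   have "z = g (kappa S i z)" using g(4) kinv_facts(3,4)[OF i, of z] z by simp
   hence "z : (%t. g (linepath (corner S i a) (corner S i (Suc a mod 4)) t)) ` {0..1}"
    unfolding t(2) using t(1) by (rule image_eqI)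
   thus "z : (\<Union>a<4::nat. (%t. g (linepath (corner S i a) (corner S i (Suc a mod 4)) t)) ` {0..1})"
    by (rule UN_I[rotated]) (use a(1) in simp)
  qed
  moreover have "negligible (\<Union>a<4::nat. (%t. g (linepath (corner S i a) (corner S i (Suc a mod 4)) t)) ` {0..1})"
  proof (rule negligible_Union[OF finite_imageI])
   fix N assume "N : (%a::nat. (%t. g (linepath (corner S i a) (corner S i (Suc a mod 4)) t)) ` {0..1}) ` {..<4}"
   then obtain a where a: "a < 4" and N: "N = (%t. g (linepath (corner S i a) (corner S i (Suc a mod 4)) t)) ` {0..1}" by blast
   have "(%t. g (linepath (corner S i a) (corner S i (Suc a mod 4)) t)) differentiable_on {0..1}"
    unfolding differentiable_on_def
   proof
    fix t :: real assume t: "t : {0..1}"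
    let ?p = "corner S i a" and ?q = "corner S i (Suc a mod 4)"
    have lp: "(linepath ?p ?q has_derivative (%h. h *\<^sub>R (?q - ?p))) (at t within {0..1})"
     unfolding linepath_def[abs_def] by (auto intro!: derivative_eq_intros simp: algebra_simps)
    have "linepath ?p ?q t : edge (corner S i) a" using t by (auto simp: edge_def linepath_image_01[symmetric])
    hence "linepath ?p ?q t : K i" unfolding K_edges[OF i] using a by (intro UN_I[of a]) auto
    hence "linepath ?p ?q t : U" using K_G g(2) by blast
    then obtain Dg where "(g has_derivative Dg) (at (linepath ?p ?q t))" using Ck_on_deriv_ex[OF g(3)] by blast
    from has_derivative_compose[OF lp this]
    show "(%t. g (linepath ?p ?q t)) differentiable (at t within {0..1})" unfolding differentiable_def by blast
   qed
   thus "negligible N" unfolding N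
    by (rule negligible_differentiable_image_lowdim[rotated]) simp
  qed simp
  ultimately show ?thesis by (rule negligible_subset[rotated])
 qed
 show ?thesis
 proof (rule that[OF B0])
  fix u :: "point => complex" assume u: "u : borel_measurable M"
  define f where "f z = (cmod (indicator unit_square z *\<^sub>R u (kappa S i z)))\<^sup>2" for z
  have fm: "f : borel_measurable borel" unfolding f_def using measurable_kappa[OF i u] by measurable
  have f0: "0 <= f z" for z by (simp add: f_def)
  have ae: "AE z in lborel. z ~: unit_square - V i"
  proof (rule AE_I')
   have "unit_square - V i : sets borel"
    by (rule sets.Diff[OF borel_closed[OF closed_Times[OF closed_atLeastAtMost closed_atLeastAtMost]] borel_open[OF V_open[OF i]]])
   hence "unit_square - V i : sets lborel" by simp
   thus "unit_square - V i : null_sets lborel"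
    using null unfolding negligible_iff_null_sets by (simp only: null_sets_completion_iff)
  qed auto
  have "(NN z. ennreal ((cmod (u (kappa S i z)))\<^sup>2) * indicator unit_square z) = (NN z. ennreal (f z) * indicator (V i) z)"
   by (rule nn_integral_cong_AE, rule AE_mp[OF ae], rule AE_I2) (auto simp: f_def V_def indicator_def)
  also have "... <= (NN x. ennreal (B * 1 * f (kinv i (E i x))) * indicator (D i) x)"
   by (rule pull_constD[OF B D_open[OF i] EC E_D[OF i] Ed]) (auto simp: T(2) n1 fm f0)
  also have "... = (NN x. ennreal B * (ennreal ((cmod (u (E i x)))\<^sup>2) * indicator (D i) x))"
  proof (rule nn_integral_cong)
   fix x show "ennreal (B * 1 * f (kinv i (E i x))) * indicator (D i) x = ennreal B * (ennreal ((cmod (u (E i x)))\<^sup>2) * indicator (D i) x)"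
   proof (cases "x : D i")
    case True
    hence "E i x : G i" using patch_G by (auto simp: D_def)
    from kinv_facts(1,2)[OF i this] have "f (kinv i (E i x)) = (cmod (u (E i x)))\<^sup>2" by (simp add: f_def)
    thus ?thesis using True B0 by (simp add: ennreal_mult)
   qed simp
  qed
  also have "... = ennreal B * (NN x. ennreal ((cmod (u (E i x)))\<^sup>2) * indicator (D i) x)"
  proof (rule nn_integral_cmult)
   have "continuous_on (D i) (E i)" by (rule E_continuous[OF i])
   have "(%x. u (E i x)) : borel_measurable (restrict_space lborel (D i))"
   proof (rule measurable_compose[OF _ u], rule measurableI)
    show "E i x : space M" if "x : space (restrict_space lborel (D i))" for x
     using that patch_bd[OF i] by (auto simp: space_M space_restrict_space D_def)
    fix X assume "X : sets M"
    hence X: "X : sets borel" by (simp add: sets_M)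
    have "E i -` X \<inter> D i : sets lborel" using measurable_sets[OF E_measurable[OF i] X] D_open[OF i] by simp
    thus "E i -` X \<inter> space (restrict_space lborel (D i)) : sets (restrict_space lborel (D i))"
     by (auto simp: space_restrict_space sets_restrict_space intro!: image_eqI[of _ _ "E i -` X \<inter> D i"])
   qed
   hence "(%x. ennreal ((cmod (u (E i x)))\<^sup>2)) : borel_measurable (restrict_space lborel (D i))" by measurable
   thus "(%x. ennreal ((cmod (u (E i x)))\<^sup>2) * indicator (D i) x) : borel_measurable lborel"
    by (rule borel_measurable_restrict_space_iff_ennreal[of "D i" lborel, THEN iffD1, rotated]) (use D_open[OF i] in simp)
  qed
  also have "... <= ennreal B * (\<integral>\<^sup>+x. ennreal ((cmod (u x))\<^sup>2) \<partial>M)"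
   by (intro mult_left_mono nn_integral_M_ge[OF i]) (use u in measurable)
  finally show "(NN z. ennreal ((cmod (u (kappa S i z)))\<^sup>2) * indicator unit_square z) <= ennreal B * (\<integral>\<^sup>+x. ennreal ((cmod (u x))\<^sup>2) \<partial>M)" .
 qed
qed

lemma emeasure_ball_le:
 assumes X: "X : sets borel" "X <= bd S" "X <= cball p R" and R: "R >= 0"
 shows "emeasure M X <= ennreal (real (np) * (16 * R\<^sup>2))"
proof -
 have "emeasure lborel (E i -` (X \<inter> patch S i)) <= ennreal (16 * R\<^sup>2)" if i: "i < np" for i
 proof (cases "E i -` (X \<inter> patch S i) = {}")
  case False
  then obtain y where y: "E i y : X" by blast
  \<comment> \<open>Any point of the set serves as centre: all others lie within 2 R of it, hence in
    a square of side 4 R.\<close>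
  have "E i -` (X \<inter> patch S i) <= cbox (y - (2 * R, 2 * R)) (y + (2 * R, 2 * R))"
  proof
   fix x assume x: "x : E i -` (X \<inter> patch S i)"
   hence "E i x : cball p R" "E i y : cball p R" using X(3) y by blast+
   hence "dist (E i x) (E i y) <= 2 * R"
    using dist_triangle3[of "E i x" "E i y" p] by simp
   hence d: "norm (x - y) <= 2 * R" using E_dist[OF i] by (simp add: dist_norm)
   have "\<bar>fst x - fst y\<bar> <= 2 * R" "\<bar>snd x - snd y\<bar> <= 2 * R"
    using abs_fst_le_norm[of "x - y"] abs_snd_le_norm[of "x - y"] d by auto
   thus "x : cbox (y - (2 * R, 2 * R)) (y + (2 * R, 2 * R))"
    by (cases x, cases y) (auto simp: cbox_Pair_eq)
  qed
  hence "emeasure lborel (E i -` (X \<inter> patch S i)) <= emeasure lborel (cbox (y - (2 * R, 2 * R)) (y + (2 * R, 2 * R)))"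
   by (rule emeasure_mono) simp
  also have "... = ennreal (16 * R\<^sup>2)"
   by (subst emeasure_lborel_cbox) (use R in \<open>auto simp: Basis_plane inner_prod_def power2_eq_square\<close>)
  finally show ?thesis .
 qed simp
 hence "(\<Sum>i<np. emeasure lborel (E i -` (X \<inter> patch S i))) <= (\<Sum>i<np. ennreal (16 * R\<^sup>2))"
  by (intro sum_mono) auto
 also have "... = ennreal (real (np) * (16 * R\<^sup>2))"
  by (simp add: ennreal_mult ennreal_of_nat_eq_real_of_nat)
 finally show ?thesis using emeasure_M[OF X(1,2)] by simp
qed

lemma emeasure_M_finite: "emeasure M (bd S) < \<infinity>"
proof -
 obtain p R where "bd S <= cball p R" using compact_imp_bounded[OF compact_bd] unfolding bounded_subset_cball by blast
 hence "bd S <= cball p \<bar>R\<bar>" by (meson cball_subset_cball_iff abs_ge_self order_trans subset_cball)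
 from emeasure_ball_le[OF _ order_refl this] bd_closed show ?thesis
  by (metis abs_ge_zero borel_closed ennreal_less_top le_less_trans infinity_ennreal_def)
qed

text \<open>The strip of width eta about the edges is covered by about 1/eta balls with radius
  comparable to eta, each of area comparable to eta^2.\<close>

lemma emeasure_strip:
 obtains C where "C > 0" "!!eta. 0 < eta ==> eta <= 1 ==>
  emeasure M {x : bd S. infdist x (skeleton S) <= eta} <= ennreal (C * eta)"
proof -
 define Ls where "Ls = (\<Sum>i<np. \<Sum>a<4. dist (corner S i a) (corner S i (Suc a mod 4))) + 1"
 have sk: "skeleton S = (\<Union>(i, a)\<in>{..<np} \<times> {..<4}. edge (corner S i) a)"
  unfolding skeleton_def using K_edges unfolding K_def by auto
 define C where "C = real (np) * 4 * 2 * (real (np) * (16 * (Ls + 2)\<^sup>2)) + 1"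
 have L0: "Ls >= 1" unfolding Ls_def by (simp add: sum_nonneg)
 have Ld: "dist (corner S i a) (corner S i (Suc a mod 4)) <= Ls" if "i < np" "a < 4" for i a
 proof -
  have "dist (corner S i a) (corner S i (Suc a mod 4)) <= (\<Sum>a<4. dist (corner S i a) (corner S i (Suc a mod 4)))"
   by (rule member_le_sum) (use that in auto)
  also have "... <= (\<Sum>i<np. \<Sum>a<4. dist (corner S i a) (corner S i (Suc a mod 4)))"
   by (rule member_le_sum[of i "{..<np}" "%i. \<Sum>a<4. dist (corner S i a) (corner S i (Suc a mod 4))"])
    (use that in \<open>auto intro: sum_nonneg\<close>)
  finally show ?thesis by (simp add: Ls_def)
 qed
 show ?thesis
 proof (rule that[of C])
  show "C > 0" unfolding C_def by (intro add_nonneg_pos mult_nonneg_nonneg) auto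
  fix eta :: real assume eta: "0 < eta" "eta <= 1"
  \<comment> \<open>The number of mesh points per edge; eta <= 1 gives the upper bound 2 /
    eta.\<close>
  define N where "N = nat \<lceil>1 / eta\<rceil>"
  have N: "1 / eta <= real N" "real N <= 2 / eta"
  proof -
   show "1 / eta <= real N" unfolding N_def by linarith
   have "real N <= 1 / eta + 1" unfolding N_def using eta by (simp add: of_nat_nat)
   also have "... <= 1 / eta + 1 / eta" using eta by (intro add_left_mono) simp
   also have "... = 2 / eta" by (simp add: add_divide_distrib[symmetric])
   finally show "real N <= 2 / eta" .
  qed
  have Np: "N > 0" using N(1) eta by (metis divide_pos_pos gr0I less_le_trans not_less of_nat_0 zero_less_one order_refl)
  define pt where "pt i a j = corner S i a + (real j / real N) *\<^sub>R (corner S i (Suc a mod 4) - corner S i a)" for i a j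
  \<comment> \<open>Covers the width eta of the strip and the mesh size, which is at most eta times
    the bound \<open>Ls\<close> for the edge lengths.\<close>
  define R where "R = (Ls + 2) * eta"
  define Bl where "Bl = (%(i, a, j). cball (pt i a j) R \<inter> bd S)"
  define Ix where "Ix = {..<np} \<times> {..<4::nat} \<times> {..<N}"
  have cover: "{x : bd S. infdist x (skeleton S) <= eta} <= (\<Union>q\<in>Ix. Bl q)"
  proof
   fix x assume "x : {x : bd S. infdist x (skeleton S) <= eta}"
   hence x: "x : bd S" "infdist x (skeleton S) <= eta" by auto
   have np: "np > 0"
   proof (rule ccontr)
    assume "\<not> np > 0"
    hence "bd S = {}" using bd_eq by simp
    thus False using x(1) by simp
   qed
   have ske: "skeleton S ~= {}" using K_ne[OF np] np unfolding skeleton_def K_def by blast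
   have "compact (skeleton S)" unfolding skeleton_def using K_compact unfolding K_def by (intro compact_UN) auto
   then obtain y where y: "y : skeleton S" "infdist x (skeleton S) = dist x y"
    using infdist_attains_inf[OF compact_imp_closed ske] by blast
   then obtain i a where ia: "i < np" "a < 4" "y : edge (corner S i) a" unfolding sk by auto
   then obtain t where t: "0 <= t" "t <= 1" "y = corner S i a + t *\<^sub>R (corner S i (Suc a mod 4) - corner S i a)"
    unfolding edge_def by (auto simp: in_segment algebra_simps)
   define j where "j = (if t = 1 then N - 1 else nat \<lfloor>t * real N\<rfloor>)"
   have j: "j < N" "real j <= t * real N" "t * real N <= real (Suc j)"
   proof -
    show "j < N" using t Np unfolding j_def by (auto simp: nat_less_iff floor_less_iff)
    show "real j <= t * real N" using t Np unfolding j_def by auto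
    show "t * real N <= real (Suc j)" using t Np unfolding j_def
     by (auto simp: of_nat_diff) linarith
   qed
   have "y - pt i a j = (t - real j / real N) *\<^sub>R (corner S i (Suc a mod 4) - corner S i a)"
    unfolding t(3) pt_def by (simp add: algebra_simps)
   hence "dist y (pt i a j) = \<bar>t - real j / real N\<bar> * dist (corner S i a) (corner S i (Suc a mod 4))"
    by (simp add: dist_norm norm_minus_commute)
   also have "... <= eta * Ls"
   proof (rule mult_mono)
    have t1: "t <= real (Suc j) / real N" using j(3) Np by (simp add: pos_le_divide_eq)
    have t2: "real (Suc j) / real N = real j / real N + 1 / real N" by (simp add: add_divide_distrib)
    have "real j / real N <= t" using j(2) Np by (simp add: pos_divide_le_eq)
    hence "0 <= t - real j / real N" "t - real j / real N <= 1 / real N"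
     using t1 unfolding t2 by linarith+
    moreover have "1 / real N <= eta" using N(1) eta(1) Np by (simp add: field_simps)
    ultimately show "\<bar>t - real j / real N\<bar> <= eta" by simp
   qed (use Ld ia eta in auto)
   finally have "dist x (pt i a j) <= eta + eta * Ls"
    using dist_triangle[of x "pt i a j" y] x(2) y(2) by linarith
   also have "... <= R" using eta by (simp add: R_def algebra_simps)
   finally have "x : Bl (i, a, j)" using x(1) by (simp add: Bl_def dist_commute)
   moreover have "(i, a, j) : Ix" using ia j by (simp add: Ix_def)
   ultimately show "x : (\<Union>q\<in>Ix. Bl q)" by blast
  qed
  have Blm: "Bl q : sets M" for q
   using bd_closed by (auto simp: sets_M Bl_def split: prod.splits intro!: sets.Int)
  have R0: "R >= 0" using L0 eta by (simp add: R_def)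
  have "emeasure M {x : bd S. infdist x (skeleton S) <= eta} <= emeasure M (\<Union>q\<in>Ix. Bl q)"
   by (rule emeasure_mono[OF cover]) (use Blm in \<open>auto simp: Ix_def intro!: sets.finite_UN\<close>)
  also have "... <= (\<Sum>q\<in>Ix. emeasure M (Bl q))"
   by (rule emeasure_subadditive_finite) (use Blm in \<open>auto simp: Ix_def\<close>)
  also have "... <= (\<Sum>q\<in>Ix. ennreal (real (np) * (16 * R\<^sup>2)))"
  proof (rule sum_mono)
   fix q :: "nat \<times> nat \<times> nat"
   obtain i a j where q: "q = (i, a, j)" by (metis prod_cases3)
   show "emeasure M (Bl q) <= ennreal (real (np) * (16 * R\<^sup>2))"
    by (rule emeasure_ball_le[of _ "pt i a j", OF _ _ _ R0]) (use Blm[of q] in \<open>auto simp: sets_M q Bl_def\<close>)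
  qed
  also have "... = ennreal (real (card Ix) * (real (np) * (16 * R\<^sup>2)))"
   by (simp add: ennreal_mult ennreal_of_nat_eq_real_of_nat)
  also have "... <= ennreal (C * eta)"
  proof (rule ennreal_leI)
   have "real (card Ix) = real (np) * 4 * real N" by (simp add: Ix_def)
   also have "... <= real (np) * 4 * (2 / eta)" by (rule mult_left_mono[OF N(2)]) simp
   finally have "real (card Ix) * (real (np) * (16 * R\<^sup>2)) <= real (np) * 4 * (2 / eta) * (real (np) * (16 * R\<^sup>2))"
    by (rule mult_right_mono) simp
   also have "... = (C - 1) * eta" using eta by (simp add: C_def R_def power2_eq_square field_simps)
   also have "... <= C * eta" using eta by (simp add: algebra_simps)
   finally show "real (card Ix) * (real (np) * (16 * R\<^sup>2)) <= C * eta" .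
  qed
  finally show "emeasure M {x : bd S. infdist x (skeleton S) <= eta} <= ennreal (C * eta)" .
 qed
qed

end

section \<open>Weighted derivatives on a patch\<close>

lemma polar_unique:
 assumes "polar (r, a) = polar (s, b)" "r > 0" "s > 0" "a : {0<..<w}" "b : {0<..<w}" "w < 2 * pi"
 shows "r = s" "a = b"
proof -
 show rs: "r = s" using norm_polar[of r a] norm_polar[of s b] assms by simp
 have "sin a = sin b & cos a = cos b" using assms(1,2) rs by (simp add: polar_def)
 then obtain k :: int where k: "a = b + 2 * pi * real_of_int k" unfolding sin_cos_eq_iff by blast
 have "\<bar>a - b\<bar> < 2 * pi" using assms by auto
 hence "2 * pi * \<bar>real_of_int k\<bar> < 2 * pi * 1" using k by (simp add: abs_mult)
 hence "\<bar>real_of_int k\<bar> < 1" using pi_gt_zero by simp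
 hence "k = 0" by linarith
 thus "a = b" using k by simp
qed

lemma epowr_half_power2: "(epowr x (1 / 2))\<^sup>2 = x"
proof (cases x)
 case (real r)
 hence "(epowr x (1 / 2))\<^sup>2 = ennreal ((r powr (1 / 2))\<^sup>2)" by (simp add: epowr_def ennreal_power)
 also have "(r powr (1 / 2))\<^sup>2 = r" using real by (simp add: powr_half_sqrt)
 finally show ?thesis using real by simp
qed (simp add: epowr_def power2_eq_square ennreal_mult_top)

text \<open>After d is replaced by q r, the powers are distributed as q^(k-rho) = q^(k-p-s) q^p
  q^(s-rho) and r^(k-rho-l) = r^(k-l) r^(-rho). The factors q^p r^p, q^(s-rho) and r^(-rho) belong
  to the weight; the two remaining exponents are nonnegative, so these powers are bounded by powers
  of \<open>Q\<close> and \<open>R\<close>.\<close>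

lemma weight_ratio:
 fixes r q rho :: real
 assumes r: "0 < r" "r <= R" and q: "0 < q" "q <= Q" and RQ: "1 <= R" "1 <= Q" and rho: "0 < rho"
  and d: "0 <= d" "d <= q * r" and k: "rho < real k" "p + s <= k" "l <= k"
 shows "d powr (real k - rho) * (r ^ p / r ^ l) <= Q ^ k * R ^ k * (r powr (- rho) * (1 + r) powr rho * (q * r) ^ p * q powr (real s - rho))"
proof -
 have "d powr (real k - rho) <= (q * r) powr (real k - rho)" using d k by (intro powr_mono2) auto
 also have "... = q powr (real k - rho) * r powr (real k - rho)" using r q by (simp add: powr_mult)
 finally have "d powr (real k - rho) * (r ^ p / r ^ l) <= q powr (real k - rho) * r powr (real k - rho) * (r ^ p / r ^ l)"
  using r by (intro mult_right_mono) auto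
 also have "... = (q powr real (k - (p + s)) * r powr real (k - l)) * (r powr (- rho) * (q * r) ^ p * q powr (real s - rho))"
 proof -
  have 1: "q powr (real k - rho) = q powr real (k - (p + s)) * q ^ p * q powr (real s - rho)"
  proof -
   have "q powr real (k - (p + s)) * q ^ p * q powr (real s - rho) = q powr (real (k - (p + s)) + real p + (real s - rho))"
    using q by (simp add: powr_add powr_realpow)
   also have "real (k - (p + s)) + real p + (real s - rho) = real k - rho" using k by (simp add: of_nat_diff)
   finally show ?thesis ..
  qed
  have 2: "r powr (real k - rho) * (1 / r ^ l) = r powr real (k - l) * r powr (- rho)"
  proof -
   have "r powr (real k - rho) = r powr (real (k - l) + (- rho) + real l)" using k by (simp add: of_nat_diff)
   also have "... = r powr real (k - l) * r powr (- rho) * r ^ l" using r by (simp only: powr_add powr_realpow)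
   finally show ?thesis using r by simp
  qed
  have "q powr (real k - rho) * r powr (real k - rho) * (r ^ p / r ^ l) = q powr (real k - rho) * (r powr (real k - rho) * (1 / r ^ l)) * r ^ p"
   by simp
  also have "... = q powr real (k - (p + s)) * q ^ p * q powr (real s - rho) * (r powr real (k - l) * r powr (- rho)) * r ^ p"
   by (simp only: 1 2)
  finally show ?thesis by (simp add: power_mult_distrib mult_ac)
 qed
 also have "... <= (Q ^ k * R ^ k) * (r powr (- rho) * (1 + r) powr rho * (q * r) ^ p * q powr (real s - rho))"
 proof (intro mult_mono)
  have "q powr real (k - (p + s)) <= Q powr real (k - (p + s))" using q by (intro powr_mono2) auto
  also have "... = Q ^ (k - (p + s))" using RQ by (simp add: powr_realpow)
  also have "... <= Q ^ k" using RQ by (intro power_increasing) auto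
  finally show "q powr real (k - (p + s)) <= Q ^ k" .
  have "r powr real (k - l) <= R powr real (k - l)" using r by (intro powr_mono2) auto
  also have "... = R ^ (k - l)" using RQ by (simp add: powr_realpow)
  also have "... <= R ^ k" using RQ by (intro power_increasing) auto
  finally show "r powr real (k - l) <= R ^ k" .
  have "1 <= (1 + r) powr rho" using r rho by (intro ge_one_powr_ge_zero) auto
  thus "r powr (- rho) <= r powr (- rho) * (1 + r) powr rho" by (simp add: mult_le_cancel_left1)
 qed (use r q RQ in auto)
 finally show ?thesis .
qed

lemma norm_sum_list_le: "norm (\<Sum>x\<leftarrow>L. f x) <= (\<Sum>x\<leftarrow>L. norm (f x))"
 for f :: "_ => 'a::real_normed_vector"
 by (induction L) (auto intro: order_trans[OF norm_triangle_ineq])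

lemma sum_list_le_const:
 fixes f :: "_ => real"
 assumes "!!x. x : set L ==> f x <= B"
 shows "(\<Sum>x\<leftarrow>L. f x) <= real (length L) * B"
 using assms by (induction L) (auto simp: algebra_simps add_mono)

lemma C_pw_mult:
 assumes "u : C_pw S" "v : C_pw S"
 shows "(%x. u x * v x) : C_pw S"
proof -
 have "smooth_up_to (closure (patch S i)) (%x. u x * v x)" if i: "i < num_patches S" for i
 proof -
  obtain U g where 1: "open U" "closure (patch S i) <= U" "\<forall>m. Ck_on m U g" "\<forall>x\<in>closure (patch S i). g x = u x"
   using assms(1) i unfolding C_pw_def smooth_up_to_def by blast
  obtain U' g' where 2: "open U'" "closure (patch S i) <= U'" "\<forall>m. Ck_on m U' g'" "\<forall>x\<in>closure (patch S i). g' x = v x"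
   using assms(2) i unfolding C_pw_def smooth_up_to_def by blast
  have "Ck_on m (U \<inter> U') (%x. g x * g' x)" for m
   by (rule Ck_on_mult[OF Ck_on_subset[OF 1(3)[rule_format] Int_lower1] Ck_on_subset[OF 2(3)[rule_format] Int_lower2]])
  thus ?thesis unfolding smooth_up_to_def using 1 2
   by (intro exI[of _ "U \<inter> U'"] exI[of _ "%x. g x * g' x"]) (auto intro: open_Int)
 qed
 moreover have "continuous_on (bd S) (%x. u x * v x)" using assms unfolding C_pw_def by (auto intro: continuous_on_mult)
 ultimately show ?thesis unfolding C_pw_def by blast
qed

lemma C_pw_diff:
 assumes "u : C_pw S" "v : C_pw S"
 shows "(%x. u x - v x) : C_pw S"
proof -
 have "smooth_up_to (closure (patch S i)) (%x. u x - v x)" if i: "i < num_patches S" for i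
 proof -
  obtain U g where 1: "open U" "closure (patch S i) <= U" "\<forall>m. Ck_on m U g" "\<forall>x\<in>closure (patch S i). g x = u x"
   using assms(1) i unfolding C_pw_def smooth_up_to_def by blast
  obtain U' g' where 2: "open U'" "closure (patch S i) <= U'" "\<forall>m. Ck_on m U' g'" "\<forall>x\<in>closure (patch S i). g' x = v x"
   using assms(2) i unfolding C_pw_def smooth_up_to_def by blast
  have "Ck_on m (U \<inter> U') (%x. g x - g' x)" for m
   by (rule Ck_on_diff[OF Ck_on_subset[OF 1(3)[rule_format] Int_lower1] Ck_on_subset[OF 2(3)[rule_format] Int_lower2]])
  thus ?thesis unfolding smooth_up_to_def using 1 2
   by (intro exI[of _ "U \<inter> U'"] exI[of _ "%x. g x - g' x"]) (auto intro: open_Int)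
 qed
 moreover have "continuous_on (bd S) (%x. u x - v x)" using assms unfolding C_pw_def by (auto intro: continuous_on_diff)
 ultimately show ?thesis unfolding C_pw_def by blast
qed

context surface_patches
begin

abbreviation "dk i k a f z \<equiv> partials a (k - a) (%z. f (kappa S i z)) z"

text \<open>The meeting point of both halves of the proof: the norm on the tangent cone bounds the
  integral of this density of weighted derivatives of order \<open>k\<close> in the parameters of
  the patch, and that integral bounds the wavelet coefficients.\<close>

definition H :: "nat => nat => real => nat => (point => complex) => real \<times> real => real" where
 "H i k rho a f z = indicator (V i) z *\<^sub>R (infdist (kappa S i z) (K i) powr (real k - rho) * cmod (dk i k a f z))\<^sup>2"

lemma V_square: "V i <= unit_square" by (auto simp: V_def)

lemma V_infdist_pos: "i < np ==> z : V i ==> 0 < infdist (kappa S i z) (K i)"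
 using infdist_K_pos by (auto simp: V_def)

text \<open>The function is smooth on the closed patch, but the parametrization is of class
  \<open>m\<close> only; this is where \<open>k \<le> m\<close> enters.\<close>

lemma C_pw_Ck_on:
 assumes i: "i < np" and f: "f : C_pw S" and k: "k <= m"
 shows "Ck_on k (V i) (%z. f (kappa S i z))"
proof -
 obtain U g where g: "open U" "G i <= U" "\<forall>m. Ck_on m U g" "\<forall>x\<in>G i. g x = f x"
  using f i unfolding C_pw_def smooth_up_to_def by blast
 obtain W \<kappa> where \<kappa>: "open W" "unit_square <= W" "Ck_on m W \<kappa>" "!!y. y : unit_square ==> \<kappa> y = kappa S i y"
  by (rule kap_ext[OF i], rule that)
 have kV: "\<kappa> z = kappa S i z & kappa S i z : G i" if "z : V i" for z
  using \<kappa>(4) V_square that kinv_facts(4)[OF i] by blast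
 have "Ck_on k (V i) (%z. g (\<kappa> z))"
 proof (rule Ck_on_compose[where V = U and g = g and f = \<kappa>, OF V_open[OF i]])
  show "Ck_on k U g" using g(3) by blast
  show "Ck_on k (V i) \<kappa>" using Ck_on_subset[OF Ck_on_le[OF \<kappa>(3) k]] V_square \<kappa>(2) by blast
  show "\<kappa> ` V i <= U" using kV g(2) by auto
 qed
 thus ?thesis by (rule Ck_on_cong[OF V_open[OF i], rotated]) (use kV g(4) in auto)
qed

lemma H_measurable:
 assumes i: "i < np" and f: "f : C_pw S" and k: "k <= m" and a: "a <= k"
 shows "H i k rho a f : borel_measurable borel"
proof -
 have c1: "continuous_on (V i) (partials a (k - a) (%z. f (kappa S i z)))"
 proof (rule Ck_on_continuous[of 0], rule Ck_on_partials[OF V_open[OF i]])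
  show "Ck_on (a + (k - a) + 0) (V i) (%z. f (kappa S i z))"
   using C_pw_Ck_on[OF i f k] a by (simp del: Ck_on.simps)
 qed
 have c2: "continuous_on (V i) (%z. infdist (kappa S i z) (K i))"
  by (intro continuous_on_infdist continuous_on_subset[OF kappa_continuous[OF i] V_square])
 have "continuous_on (V i) (%z. (infdist (kappa S i z) (K i) powr (real k - rho) * cmod (dk i k a f z))\<^sup>2)"
  by (intro continuous_on_power continuous_on_mult continuous_on_norm c1 continuous_on_powr c2 continuous_on_const)
   (use V_infdist_pos[OF i] in force)
 from borel_measurable_continuous_on_indicator[OF _ this] show ?thesis
  unfolding H_def[abs_def] using V_open[OF i] by simp
qed

end

section \<open>The weighted norm on the tangent cone controls derivatives in the parameters of a
  patch\<close>

context surface_resolution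
begin

text \<open>Two changes of coordinates lead from the parameters of the patch to polar coordinates
  about the vertex: \<open>partials_compose\<close> to Cartesian coordinates in the plane of the
  face, then \<open>partials_polar\<close>. By \<open>weight_ratio\<close> every resulting term
  carries an admissible weight, because the distance to \<open>K i\<close> is at most q r.
  \<open>pull_const\<close> transforms the integral with the factor r that the weighted norm
  contains.\<close>

lemma H_le_weighted:
 assumes n: "n < num_vertices S" and i: "i < np" and v: "vertex S n : G i"
  and k: "1 <= k" "k <= m" and rho: "0 < rho" "rho < real k"
 shows "\<exists>C>0. \<forall>v\<in>C_pw S. \<forall>a\<le>k. (NN z. ennreal (H i k rho a (%x. complex_of_real (phi Z n x) * v x) z))
  <= ennreal C * (X_cone_norm S n k rho (%x. if x : bd S then complex_of_real (phi Z n x) * v x else 0))\<^sup>2"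
proof -
 let ?v = "vertex S n"
 obtain t T where t: "t < num_faces S n" and T: "linear T" "!!x. norm (T x) = norm x"
  and fc: "!!x. x : closure (sector (opening_angle S n t)) ==> face_chart S n t x = ?v + T x"
  and pf: "!!x. x : patch S i ==> \<exists>r \<phi>. 0 < r & 0 < \<phi> & \<phi> < opening_angle S n t & x = ?v + T (polar (r, \<phi>)) &
   infdist x (K i) <= min \<phi> (opening_angle S n t - \<phi>) * r"
  using patch_in_face[OF n i v] by blast
 let ?w = "opening_angle S n t"
 have w: "0 < ?w" "?w < 2 * pi" using vertex_data(1)[OF n t] by auto
 have bT: "bounded_linear T" using T(1) linear_conv_bounded_linear by blast
 define h where "h x = ?v + T (polar x)" for x
 have Tinj: "T x = T y ==> x = y" for x y
  using T(2)[of "x - y"] linear_diff[OF T(1), of x y] by simp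
 have Td: "dist (?v + T x) (?v + T y) = dist x y" for x y
  using T(2)[of "x - y"] by (simp add: dist_norm linear_diff[OF T(1)])
 have Req: "A i = range (%x. ?v + T x)"
 proof (rule affine_eq_of_open_subset[OF A_affine[OF i] _ patch_openin[OF i] patch_ne[OF i]])
  show "affine (range (%x. ?v + T x))" "aff_dim (A i) = aff_dim (range (%x. ?v + T x))"
   using isometry_range_affine[of "%x. ?v + T x"] Td A_dim[OF i] by simp_all
  show "patch S i <= range (%x. ?v + T x)" using pf by blast
 qed
 define O' where "O' = {x : {0<..} \<times> {0<..<?w}. h x : patch S i}"
 have hC: "Ck_on l X h" for l X
  unfolding h_def[abs_def] by (rule Ck_on_add[OF Ck_on_const bounded_linear.Ck_on_compose_linear[OF bT Ck_on_polar]])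
 have TA: "?v + T y : A i" for y unfolding Req by blast
 have hA: "h x : A i" for x unfolding h_def by (rule TA)
 have opO: "open O'"
 proof -
  obtain U where U: "open U" "patch S i = A i \<inter> U" using patch_openin[OF i] unfolding openin_open by blast
  have "h x : patch S i \<longleftrightarrow> h x : U" for x using hA[of x] U(2) by blast
  hence "O' = ({0<..} \<times> {0<..<?w}) \<inter> h -` U" unfolding O'_def by auto
  moreover have "open (h -` U)" by (rule open_vimage[OF U(1) Ck_on_continuous[OF hC[of 0]]])
  ultimately show ?thesis by (auto intro!: open_Int open_Times)
 qed
 have O'D: "0 < r" "0 < p" "p < ?w" "h (r, p) : patch S i" if "(r, p) : O'" for r p
  using that by (auto simp: O'_def)
 have him: "h ` O' = patch S i"
 proof
  show "h ` O' <= patch S i" by (auto simp: O'_def)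
  show "patch S i <= h ` O'"
  proof
   fix x assume x: "x : patch S i"
   obtain r p where rp: "0 < r" "0 < p" "p < ?w" "x = ?v + T (polar (r, p))" using pf[OF x] by blast
   thus "x : h ` O'" using x by (intro image_eqI[of _ _ "(r, p)"]) (auto simp: O'_def h_def)
  qed
 qed
 have inf: "infdist (h (r, p)) (K i) <= min p (?w - p) * r" if mem: "(r, p) : O'" for r p
 proof -
  obtain r' p' where rp: "0 < r'" "0 < p'" "p' < ?w" "h (r, p) = ?v + T (polar (r', p'))"
   "infdist (h (r, p)) (K i) <= min p' (?w - p') * r'" using pf[OF O'D(4)[OF mem]] by blast
  have "polar (r, p) = polar (r', p')" using rp(4) Tinj by (simp add: h_def)
  from polar_unique[OF this, of ?w] O'D[OF mem] rp w have "r = r'" "p = p'" by auto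
  thus ?thesis using rp(5) by simp
 qed
 obtain Rm where Rm: "1 <= Rm" "!!r p. (r, p) : O' ==> r <= Rm"
 proof -
  obtain B where B: "!!x. x : patch S i ==> norm x <= B" using patch_bdd[OF i] unfolding bounded_iff by blast
  have "r <= max 1 (B + norm ?v)" if rp: "(r, p) : O'" for r p
  proof -
   have "r = norm (T (polar (r, p)))" using norm_polar[of r p] T(2) O'D(1)[OF rp] by simp
   also have "... = norm (h (r, p) - ?v)" by (simp add: h_def)
   also have "... <= norm (h (r, p)) + norm ?v" by (rule norm_triangle_ineq4)
   also have "... <= B + norm ?v" using B[OF O'D(4)[OF rp]] by simp
   finally show ?thesis by simp
  qed
  thus ?thesis using that[of "max 1 (B + norm ?v)"] by simp
 qed
 define Qm where "Qm = 2 * pi + 1"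
 have Qm: "1 <= Qm" "!!p. p : {0<..<?w} ==> min p (?w - p) <= Qm" using w by (auto simp: Qm_def)
 obtain WW \<kappa> where \<kappa>: "open WW" "unit_square <= WW" "Ck_on m WW \<kappa>" "!!y. y : unit_square ==> \<kappa> y = kappa S i y"
  by (rule kap_ext[OF i], rule that)
 \<comment> \<open>The adjoint of the isometry \<open>T\<close> and thus its left inverse. With it
   \<open>Lam\<close> gives the planar coordinates of a point of the patch, as a function of class
   \<open>k\<close> on a neighbourhood of the closed square.\<close>
 define Ts where "Ts x = (x \<bullet> T (1, 0), x \<bullet> T (0, 1))" for x
 have Tip: "T x \<bullet> T y = x \<bullet> y" for x y
 proof -
  have "(norm (T (x + y)))\<^sup>2 = (norm (x + y))\<^sup>2" by (simp add: T(2))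
  moreover have "(norm (T x))\<^sup>2 = (norm x)\<^sup>2" "(norm (T y))\<^sup>2 = (norm y)\<^sup>2" by (simp_all add: T(2))
  ultimately show ?thesis unfolding power2_norm_eq_inner linear_add[OF T(1)]
   by (simp add: inner_add_left inner_add_right inner_commute)
 qed
 have TsT: "Ts (T y) = y" for y by (cases y) (simp add: Ts_def Tip inner_prod_def)
 define Lam where "Lam z = Ts (\<kappa> z - ?v)" for z
 have kv: "Ck_on k WW (%z. \<kappa> z - ?v)"
  by (rule Ck_on_diff[OF Ck_on_le[OF \<kappa>(3) k(2)] Ck_on_const])
 have LamC: "Ck_on k WW Lam"
  unfolding Lam_def[abs_def] Ts_def
  by (rule Ck_on_Pair[OF bounded_linear.Ck_on_compose_linear[OF bounded_linear_inner_left kv]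
    bounded_linear.Ck_on_compose_linear[OF bounded_linear_inner_left kv]])
 have Lamz: "Lam (kinv i (h x)) = polar x & kinv i (h x) : V i & kappa S i (kinv i (h x)) = h x" if "x : O'" for x
 proof -
  have hx: "h x : patch S i" using that by (auto simp: O'_def)
  hence hG: "h x : G i" using patch_G by blast
  have "Lam (kinv i (h x)) = Ts (h x - ?v)"
   unfolding Lam_def using \<kappa>(4)[OF kinv_facts(1)[OF i hG]] kinv_facts(2)[OF i hG] by simp
  thus ?thesis using TsT[of "polar x"] kinv_facts(1,2)[OF i hG] hx by (simp add: h_def V_def)
 qed
 have VO: "\<exists>x\<in>O'. z = kinv i (h x)" if "z : V i" for z
 proof -
  have "kappa S i z : patch S i" "z : unit_square" using that by (auto simp: V_def)
  then obtain x where "x : O'" "kappa S i z = h x" using him by (metis imageE)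
  thus ?thesis using kinv_facts(3)[OF i \<open>z \<in> unit_square\<close>] by metis
 qed
 have sq: "compact (unit_square :: (real \<times> real) set)" by (intro compact_Times compact_Icc)
 define OD where "OD = Lam ` V i"
 text \<open>The image of the patch in the plane of the face is open, so that it can serve as the domain for
  the two changes of coordinates.\<close>
 have OD: "OD = {y. ?v + T y : patch S i}"
 proof
  show "OD <= {y. ?v + T y : patch S i}"
   unfolding OD_def using VO Lamz by (force simp: O'_def h_def)
  show "{y. ?v + T y : patch S i} <= OD"
  proof
   fix y assume "y : {y. ?v + T y : patch S i}"
   then obtain x where x: "x : O'" "?v + T y = h x" using him by (metis imageE mem_Collect_eq)
   hence "y = polar x" using Tinj by (simp add: h_def)
   thus "y : OD" unfolding OD_def using Lamz[OF x(1)] by (metis imageI)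
  qed
 qed
 have opD: "open OD"
 proof -
  obtain U where U: "open U" "patch S i = A i \<inter> U" using patch_openin[OF i] unfolding openin_open by blast
  have "?v + T y : patch S i \<longleftrightarrow> ?v + T y : U" for y using TA[of y] U(2) by blast
  hence "OD = (%y. ?v + T y) -` U" unfolding OD by auto
  moreover have "continuous_on UNIV (%y. ?v + T y)"
   by (intro continuous_intros linear_continuous_on bT)
  ultimately show ?thesis using open_vimage[OF U(1)] by simp
 qed
 have VW: "V i <= WW" using V_square \<kappa>(2) by blast
 have "\<forall>a\<in>{..k}. \<exists>L :: ((real \<times> real => complex) \<times> nat \<times> nat) list.
  (\<forall>(c, p, q)\<in>set L. Ck_on (k - (a + (k - a))) WW c & 1 <= p + q & p + q <= a + (k - a)) &
  (\<forall>f. Ck_on k OD f --> (\<forall>z\<in>V i. partials a (k - a) (%z. f (Lam z)) z = (\<Sum>(c, p, q)\<leftarrow>L. c z * partials p q f (Lam z))))"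
  by (intro ballI partials_compose[OF V_open[OF i] opD \<kappa>(1) VW LamC]) (use k in \<open>auto simp: OD_def\<close>)
 from bchoice[OF this] obtain L where L0: "\<forall>a\<in>{..k}. (\<forall>(c, p, q)\<in>set (L a). Ck_on (k - (a + (k - a))) WW c & 1 <= p + q & p + q <= a + (k - a)) &
  (\<forall>f. Ck_on k OD f --> (\<forall>z\<in>V i. partials a (k - a) (%z. f (Lam z)) z = (\<Sum>(c, p, q)\<leftarrow>L a. c z * partials p q f (Lam z))))" ..
 have L1: "continuous_on WW c & 1 <= p + q & p + q <= k" if "a <= k" "(c, p, q) : set (L a)" for a c p q
  using bspec[OF L0, of a] that by auto
 have L2: "partials a (k - a) (%z. f (Lam z)) z = (\<Sum>(c, p, q)\<leftarrow>L a. c z * partials p q f (Lam z))"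
  if "a <= k" "Ck_on k OD f" "z : V i" for a f z
  using bspec[OF L0, of a] that by blast
 have "\<forall>pq\<in>{(p, q). 1 <= p + q & p + q <= k}. \<exists>P :: ((real => real) \<times> nat \<times> nat) list.
  (\<forall>(C, p', q')\<in>set P. trig C & 1 <= p' + q' & p' + q' <= fst pq + snd pq) &
  (\<forall>f r t. Ck_on (fst pq + snd pq) OD f --> 0 < r --> polar (r, t) : OD -->
   partials (fst pq) (snd pq) f (polar (r, t)) =
    (\<Sum>(C, p', q')\<leftarrow>P. of_real (C t * r ^ p' / r ^ (fst pq + snd pq)) * partials p' q' (%z. f (polar z)) (r, t)))"
  by (intro ballI partials_polar[OF opD]) auto
 from bchoice[OF this] obtain P where P0: "\<forall>pq\<in>{(p, q). 1 <= p + q & p + q <= k}.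
  (\<forall>(C, p', q')\<in>set (P pq). trig C & 1 <= p' + q' & p' + q' <= fst pq + snd pq) &
  (\<forall>f r t. Ck_on (fst pq + snd pq) OD f --> 0 < r --> polar (r, t) : OD -->
   partials (fst pq) (snd pq) f (polar (r, t)) =
    (\<Sum>(C, p', q')\<leftarrow>P pq. of_real (C t * r ^ p' / r ^ (fst pq + snd pq)) * partials p' q' (%z. f (polar z)) (r, t)))" ..
 have P1: "trig C & 1 <= p' + q' & p' + q' <= p + q" if "1 <= p + q" "p + q <= k" "(C, p', q') : set (P (p, q))" for p q C p' q'
  using bspec[OF P0, of "(p, q)"] that by auto
 have P2: "partials p q f (polar (r, t)) = (\<Sum>(C, p', q')\<leftarrow>P (p, q). of_real (C t * r ^ p' / r ^ (p + q)) * partials p' q' (%z. f (polar z)) (r, t))"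
  if "1 <= p + q" "p + q <= k" "Ck_on (p + q) OD f" "0 < r" "polar (r, t) : OD" for p q f r t
  using bspec[OF P0, of "(p, q)"] that by simp
 \<comment> \<open>The coefficients are continuous on \<open>WW\<close>, which contains the compact
   square; on the open set \<open>V i\<close> alone they might be unbounded.\<close>
 have "\<exists>B. \<forall>a\<le>k. \<forall>(c, p, q)\<in>set (L a). \<forall>z\<in>unit_square. cmod (c z) <= B"
 proof -
  have fin: "finite (\<Union>a\<in>{..k}. set (L a))" by simp
  have "\<forall>l\<in>(\<Union>a\<in>{..k}. set (L a)). \<exists>B. \<forall>z\<in>unit_square. cmod (fst l z) <= B"
  proof
   fix l assume "l : (\<Union>a\<in>{..k}. set (L a))"
   then obtain a where a: "a <= k" "l : set (L a)" by blast
   have "continuous_on unit_square (fst l)"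
    using L1[OF a(1), of "fst l" "fst (snd l)" "snd (snd l)"] a(2) \<kappa>(2) continuous_on_subset by auto
   hence "bounded (fst l ` unit_square)" using compact_continuous_image sq compact_imp_bounded by blast
   thus "\<exists>B. \<forall>z\<in>unit_square. cmod (fst l z) <= B" unfolding bounded_iff by blast
  qed
  from bchoice[OF this] obtain B where B: "\<forall>l\<in>(\<Union>a\<in>{..k}. set (L a)). \<forall>z\<in>unit_square. cmod (fst l z) <= B l" ..
  have "cmod (c z) <= (\<Sum>l\<in>(\<Union>a\<in>{..k}. set (L a)). \<bar>B l\<bar>)" if "a <= k" "(c, p, q) : set (L a)" "z : unit_square" for a c p q z
  proof -
   have l: "(c, p, q) : (\<Union>a\<in>{..k}. set (L a))" using that by blast
   have "cmod (c z) <= B (c, p, q)" using bspec[OF bspec[OF B l] that(3)] by (simp only: fst_conv)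
   also have "... <= \<bar>B (c, p, q)\<bar>" by simp
   also have "... <= (\<Sum>l\<in>(\<Union>a\<in>{..k}. set (L a)). \<bar>B l\<bar>)" by (rule member_le_sum[OF l _ fin]) simp
   finally show ?thesis .
  qed
  thus ?thesis by blast
 qed
 then obtain B1 where B1: "!!a c p q z. a <= k ==> (c, p, q) : set (L a) ==> z : unit_square ==> cmod (c z) <= B1" by blast
 define I where "I = {(p, q :: nat). 1 <= p + q & p + q <= k}"
 have finI: "finite I" by (rule finite_subset[of _ "{..k} \<times> {..k}"]) (auto simp: I_def)
 have "\<exists>B. \<forall>pq\<in>I. \<forall>(C, p', q')\<in>set (P pq). \<forall>t. \<bar>C t\<bar> <= B"
 proof -
  have fin: "finite (\<Union>pq\<in>I. set (P pq))" using finI by simp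
  have "\<forall>l\<in>(\<Union>pq\<in>I. set (P pq)). \<exists>B. \<forall>t. \<bar>fst l t\<bar> <= B"
  proof
   fix l assume "l : (\<Union>pq\<in>I. set (P pq))"
   then obtain p q where "(p, q) : I" "l : set (P (p, q))" by auto
   hence "trig (fst l)" using P1[of p q "fst l" "fst (snd l)" "snd (snd l)"] by (auto simp: I_def)
   thus "\<exists>B. \<forall>t. \<bar>fst l t\<bar> <= B" by (rule trig_bounded)
  qed
  from bchoice[OF this] obtain B where B: "\<forall>l\<in>(\<Union>pq\<in>I. set (P pq)). \<forall>t. \<bar>fst l t\<bar> <= B l" ..
  have "\<bar>C t\<bar> <= (\<Sum>l\<in>(\<Union>pq\<in>I. set (P pq)). \<bar>B l\<bar>)" if "pq : I" "(C, p', q') : set (P pq)" for pq C p' q' t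
  proof -
   have l: "(C, p', q') : (\<Union>pq\<in>I. set (P pq))" using that by blast
   have "\<bar>C t\<bar> <= B (C, p', q')" using bspec[OF B l] by simp
   also have "... <= \<bar>B (C, p', q')\<bar>" by simp
   also have "... <= (\<Sum>l\<in>(\<Union>pq\<in>I. set (P pq)). \<bar>B l\<bar>)" by (rule member_le_sum[OF l _ fin]) simp
   finally show ?thesis .
  qed
  thus ?thesis by blast
 qed
 then obtain B2 where B2: "!!p q C p' q' t. (p, q) : I ==> (C, p', q') : set (P (p, q)) ==> \<bar>C t\<bar> <= B2" by blast
 define Len where "Len = (\<Sum>a\<le>k. real (length (L a)))"
 define Len' where "Len' = (\<Sum>pq\<in>I. real (length (P pq)))"
 define C3 where "C3 = Len * (\<bar>B1\<bar> * (Len' * (\<bar>B2\<bar> * (Qm ^ k * Rm ^ k))))"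
 \<comment> \<open>The weight of the term with index \<open>pq\<close> in the norm of the tangent
   cone.\<close>
 define wt where "wt r p pq = r powr (- rho) * (1 + r) powr rho * (min p (?w - p) * r) ^ fst pq * min p (?w - p) powr (real (snd pq) - rho)"
  for r p and pq :: "nat \<times> nat"
 obtain Bp where Bp: "pull_const i Bp" using pull_const_ex[OF i] by blast
 hence Bp0: "Bp > 0" by (simp add: pull_const_def)
 \<comment> \<open>The first \<open>card I\<close> comes from squaring a sum over \<open>I\<close>,
   the second from adding the common bound over \<open>I\<close>; the 1 keeps the constant
   positive.\<close>
 define C where "C = Bp * (C3\<^sup>2 * real (card I)) * real (card I) + 1"
 have C0: "C > 0" unfolding C_def by (intro add_nonneg_pos mult_nonneg_nonneg) (use Bp0 in auto)
 have C30: "0 <= C3" unfolding C3_def Len_def Len'_def using Qm Rm by (intro mult_nonneg_nonneg sum_nonneg) auto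
 show ?thesis
 proof (intro exI[of _ C] conjI C0 ballI allI impI)
  fix v a assume v: "v : C_pw S" and a: "a <= k"
  define f where "f x = complex_of_real (phi Z n x) * v x" for x
  define fn where "fn x = (if x : bd S then complex_of_real (phi Z n x) * v x else 0)" for x
  define F where "F = (%(r, \<phi>). (fn \<circ> face_chart S n t) (r * cos \<phi>, r * sin \<phi>))"
  have f: "f : C_pw S" unfolding f_def[abs_def] by (rule C_pw_mult[OF res_vertex(2)[OF n] v])
  obtain U g where g: "open U" "G i <= U" "\<forall>m. Ck_on m U g" "\<forall>x\<in>G i. g x = f x"
   using f i unfolding C_pw_def smooth_up_to_def by blast
  define ft where "ft y = g (?v + T y)" for y
  have ftC: "Ck_on l OD ft" for l
   unfolding ft_def[abs_def]
  proof (rule Ck_on_compose[where V = U and g = g and f = "%y. ?v + T y", OF opD])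
   show "Ck_on l U g" using g(3) by blast
   show "Ck_on l OD (%y. ?v + T y)"
    by (rule Ck_on_add[OF Ck_on_const bounded_linear.Ck_on_compose_linear[OF bT Ck_on_ident]])
   show "(%y. ?v + T y) ` OD <= U" unfolding OD using patch_G g(2) by blast
  qed
  have polO: "polar x : OD" if "x : O'" for x using that by (auto simp: OD O'_def h_def)
  have FO: "F x = ft (polar x)" if xO: "x : O'" for x
  proof -
   obtain r p where x: "x = (r, p)" by fastforce
   have "polar x : sector ?w" using O'D[of r p] xO unfolding x sector_polar by (intro imageI) auto
   from fc[OF subsetD[OF closure_subset this]] have "face_chart S n t (polar x) = h x" by (simp only: h_def)
   moreover have "h x : patch S i" using xO by (simp add: O'_def)
   hence "h x : G i" "h x : bd S" using patch_G patch_bd[OF i] by blast+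
   ultimately show ?thesis using g(4) by (simp add: F_def x polar_Pair[symmetric] fn_def f_def[symmetric] ft_def h_def)
  qed
  have FC: "Ck_on l O' F" for l
   by (rule Ck_on_cong[OF opO FO[symmetric] Ck_on_compose[OF opO ftC Ck_on_polar]]) (use polO in auto)
  have wpart: "dk i k a f z = (\<Sum>(c, p, q)\<leftarrow>L a. c z * partials p q ft (Lam z))"
   if z: "z : V i" for z
  proof -
   have "f (kappa S i z) = ft (Lam z)" if z: "z : V i" for z
   proof -
    obtain x where x: "x : O'" "z = kinv i (h x)" using VO[OF z] by blast
    have "kappa S i z = h x" "Lam z = polar x" using Lamz[OF x(1)] x(2) by auto
    moreover have "h x : G i" using x(1) patch_G by (auto simp: O'_def)
    ultimately show ?thesis using g(4) by (simp add: ft_def h_def)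
   qed
   hence "dk i k a f z = partials a (k - a) (%z. ft (Lam z)) z"
    by (rule partials_cong[OF V_open[OF i] z])
   thus ?thesis using L2[OF a ftC z] by simp
  qed
  define S1 where "S1 x = (\<Sum>pq\<in>I. (wt (fst x) (snd x) pq * cmod (partials (fst pq) (snd pq) F x)))" for x
  have pw: "infdist (h x) (K i) powr (real k - rho) * cmod (partials a (k - a) (%z. f (kappa S i z)) (kinv i (h x))) <= C3 * S1 x"
   if xO: "x : O'" for x
  proof -
   obtain r t' where x: "x = (r, t')" by fastforce
   note xO' = xO[unfolded x]
   define z where "z = kinv i (h x)"
   have z: "Lam z = polar x" "z : V i" using Lamz[OF xO] by (auto simp: z_def)
   have zs: "z : unit_square" using z V_square by blast
   let ?d = "infdist (h x) (K i)" and ?q = "min t' (?w - t')"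
   have r: "0 < r" "r <= Rm" and q: "0 < ?q" "?q <= Qm" and d: "0 <= ?d" "?d <= ?q * r"
    using O'D[OF xO'] Rm(2)[OF xO'] Qm(2)[of t'] inf[OF xO'] infdist_nonneg by (auto simp: x)
   have S10: "0 <= wt r t' pq * cmod (partials (fst pq) (snd pq) F x)" for pq
    unfolding wt_def using r q by (intro mult_nonneg_nonneg) auto
   have S1n: "0 <= S1 x" unfolding S1_def x fst_conv snd_conv by (intro sum_nonneg S10[unfolded x])
   have in1: "?d powr (real k - rho) * cmod (partials p q' ft (polar x)) <= Len' * (\<bar>B2\<bar> * (Qm ^ k * Rm ^ k) * S1 x)"
    if pq: "1 <= p + q'" "p + q' <= k" for p q'
   proof -
    have e: "partials p q' ft (polar x) = (\<Sum>(C, p', q'')\<leftarrow>P (p, q'). of_real (C t' * r ^ p' / r ^ (p + q')) * partials p' q'' (%z. ft (polar z)) (r, t'))"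
     unfolding x by (rule P2[OF pq ftC r(1) polO[OF xO']])
    have "?d powr (real k - rho) * cmod (partials p q' ft (polar x)) <= ?d powr (real k - rho) *
     (\<Sum>l\<leftarrow>P (p, q'). cmod (case l of (C, p', q'') => of_real (C t' * r ^ p' / r ^ (p + q')) * partials p' q'' (%z. ft (polar z)) (r, t')))"
     unfolding e by (intro mult_left_mono norm_sum_list_le) simp
    also have "... = (\<Sum>l\<leftarrow>P (p, q'). ?d powr (real k - rho) * cmod (case l of (C, p', q'') => of_real (C t' * r ^ p' / r ^ (p + q')) * partials p' q'' (%z. ft (polar z)) (r, t')))"
     by (simp add: sum_list_const_mult)
    also have "... <= real (length (P (p, q'))) * (\<bar>B2\<bar> * (Qm ^ k * Rm ^ k) * S1 x)"
    proof (rule sum_list_le_const)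
     fix l assume l: "l : set (P (p, q'))"
     obtain C p' q'' where lC: "l = (C, p', q'')" by (metis prod_cases3)
     have pI: "(p, q') : I" using pq by (simp add: I_def)
     have tC: "1 <= p' + q''" "p' + q'' <= p + q'" using P1[OF pq] l lC by auto
     have I': "(p', q'') : I" using tC pq by (simp add: I_def)
     have pe: "partials p' q'' (%z. ft (polar z)) (r, t') = partials p' q'' F x"
      unfolding x by (rule partials_cong[OF opO xO']) (simp add: FO)
     have "?d powr (real k - rho) * (r ^ p' / r ^ (p + q')) <= Qm ^ k * Rm ^ k * wt r t' (p', q'')"
      unfolding wt_def fst_conv snd_conv
      by (rule weight_ratio[OF r q Rm(1) Qm(1) rho(1) d rho(2)]) (use tC pq in auto)
     hence w1: "(?d powr (real k - rho) * (r ^ p' / r ^ (p + q'))) * cmod (partials p' q'' F x) <= Qm ^ k * Rm ^ k * wt r t' (p', q'') * cmod (partials p' q'' F x)"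
      by (rule mult_right_mono) simp
     have w2: "wt r t' (p', q'') * cmod (partials p' q'' F x) <= S1 x"
      unfolding S1_def x fst_conv snd_conv
      using member_le_sum[OF I', of "%pq. wt r t' pq * cmod (partials (fst pq) (snd pq) F (r, t'))"] S10 finI by (simp add: x)
     have "?d powr (real k - rho) * cmod (case l of (C, p', q'') => of_real (C t' * r ^ p' / r ^ (p + q')) * partials p' q'' (%z. ft (polar z)) (r, t'))
      = \<bar>C t'\<bar> * ((?d powr (real k - rho) * (r ^ p' / r ^ (p + q'))) * cmod (partials p' q'' F x))"
      unfolding lC prod.case pe norm_mult norm_of_real using r by (simp add: abs_mult)
     also have "... <= \<bar>B2\<bar> * (Qm ^ k * Rm ^ k * S1 x)"
     proof (rule mult_mono)
      show "\<bar>C t'\<bar> <= \<bar>B2\<bar>" using B2[OF pI] l lC by (meson abs_ge_self order_trans)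
      have "Qm ^ k * Rm ^ k * (wt r t' (p', q'') * cmod (partials p' q'' F x)) <= Qm ^ k * Rm ^ k * S1 x"
       using w2 Qm Rm by (intro mult_left_mono) auto
      thus "(?d powr (real k - rho) * (r ^ p' / r ^ (p + q'))) * cmod (partials p' q'' F x) <= Qm ^ k * Rm ^ k * S1 x"
       using w1 by (simp add: mult.assoc)
     qed (use r in auto)
     finally show "?d powr (real k - rho) * cmod (case l of (C, p', q'') => of_real (C t' * r ^ p' / r ^ (p + q')) * partials p' q'' (%z. ft (polar z)) (r, t'))
      <= \<bar>B2\<bar> * (Qm ^ k * Rm ^ k) * S1 x" by (simp add: mult.assoc)
    qed
    also have "... <= Len' * (\<bar>B2\<bar> * (Qm ^ k * Rm ^ k) * S1 x)"
    proof (rule mult_right_mono)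
     show "real (length (P (p, q'))) <= Len'" unfolding Len'_def
      by (rule member_le_sum[of "(p, q')" I "%pq. real (length (P pq))"]) (use pq finI in \<open>auto simp: I_def\<close>)
     show "0 <= \<bar>B2\<bar> * (Qm ^ k * Rm ^ k) * S1 x" using Qm Rm S1n by simp
    qed
    finally show ?thesis .
   qed
   have "?d powr (real k - rho) * cmod (dk i k a f z) <= ?d powr (real k - rho) *
    (\<Sum>l\<leftarrow>L a. cmod (case l of (c, p, q) => c z * partials p q ft (polar x)))"
    unfolding wpart[OF z(2)] z(1) by (intro mult_left_mono norm_sum_list_le) simp
   also have "... = (\<Sum>l\<leftarrow>L a. ?d powr (real k - rho) * cmod (case l of (c, p, q) => c z * partials p q ft (polar x)))"
    by (simp add: sum_list_const_mult)
   also have "... <= real (length (L a)) * (\<bar>B1\<bar> * (Len' * (\<bar>B2\<bar> * (Qm ^ k * Rm ^ k) * S1 x)))"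
   proof (rule sum_list_le_const)
    fix l assume l: "l : set (L a)"
    obtain c p q' where lc: "l = (c, p, q')" by (metis prod_cases3)
    have pq: "1 <= p + q'" "p + q' <= k" using L1[OF a] l lc by auto
    have "?d powr (real k - rho) * cmod (case l of (c, p, q) => c z * partials p q ft (polar x)) = cmod (c z) * (?d powr (real k - rho) * cmod (partials p q' ft (polar x)))"
     by (simp add: lc norm_mult)
    also have "... <= \<bar>B1\<bar> * (Len' * (\<bar>B2\<bar> * (Qm ^ k * Rm ^ k) * S1 x))"
    proof (rule mult_mono[OF _ in1[OF pq]])
     show "cmod (c z) <= \<bar>B1\<bar>" using B1[OF a _ zs] l lc by (meson abs_ge_self order_trans)
    qed auto
    finally show "?d powr (real k - rho) * cmod (case l of (c, p, q) => c z * partials p q ft (polar x)) <= \<bar>B1\<bar> * (Len' * (\<bar>B2\<bar> * (Qm ^ k * Rm ^ k) * S1 x))" .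
   qed
   also have "... <= Len * (\<bar>B1\<bar> * (Len' * (\<bar>B2\<bar> * (Qm ^ k * Rm ^ k) * S1 x)))"
   proof (rule mult_right_mono)
    show "real (length (L a)) <= Len" unfolding Len_def
     by (rule member_le_sum[of a "{..k}" "%a. real (length (L a))"]) (use a in auto)
    show "0 <= \<bar>B1\<bar> * (Len' * (\<bar>B2\<bar> * (Qm ^ k * Rm ^ k) * S1 x))"
     using S1n Qm Rm unfolding Len'_def by (intro mult_nonneg_nonneg sum_nonneg) auto
   qed
   finally show ?thesis unfolding z_def C3_def by (simp add: mult.assoc)
  qed
  define J where "J x = fst x" for x :: "real \<times> real"
  have "(NN z. ennreal (H i k rho a f z)) = (NN z. ennreal (H i k rho a f z) * indicator (V i) z)"
   by (intro nn_integral_cong) (auto simp: H_def indicator_def)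
  also have "... <= (NN x. ennreal (Bp * J x * H i k rho a f (kinv i (h x))) * indicator O' x)"
  proof (rule pull_constD[OF Bp opO hC him])
   have pd: "(polar has_derivative (%h. (fst h * cos (snd x) - fst x * sin (snd x) * snd h,
    fst h * sin (snd x) + fst x * cos (snd x) * snd h))) (at x)" for x by (rule polar_derivative)
   show "(h has_derivative (%u. T (fst u * cos (snd x) - fst x * sin (snd x) * snd u, fst u * sin (snd x) + fst x * cos (snd x) * snd u))) (at x)" for x
   proof -
    have "((%x. T (polar x)) has_derivative (%u. T (fst u * cos (snd x) - fst x * sin (snd x) * snd u, fst u * sin (snd x) + fst x * cos (snd x) * snd u))) (at x)"
     by (rule bounded_linear.has_derivative[OF bT pd])
    from has_derivative_add[OF has_derivative_const this, of ?v] show ?thesis unfolding h_def[abs_def] by simp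
   qed
   show "norm (T (fst (1, 0) * cos (snd x) - fst x * sin (snd x) * snd (1, 0), fst (1, 0) * sin (snd x) + fst x * cos (snd x) * snd (1, 0))) <= 1" for x :: "real \<times> real"
    using norm_polar[of 1 "snd x"] by (simp add: T(2) polar_def)
   show "norm (T (fst (0, 1) * cos (snd x) - fst x * sin (snd x) * snd (0, 1), fst (0, 1) * sin (snd x) + fst x * cos (snd x) * snd (0, 1))) <= J x" if "x : O'" for x
   proof -
    have "norm (- (fst x * sin (snd x)), fst x * cos (snd x)) = norm (polar (fst x, snd x))"
     by (simp add: polar_def norm_Pair add.commute)
    thus ?thesis using that norm_polar[of "fst x" "snd x"] by (auto simp: T(2) J_def O'_def)
   qed
   show "H i k rho a f : borel_measurable borel" by (rule H_measurable[OF i f k(2) a])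
   show "0 <= H i k rho a f z" for z by (simp add: H_def)
  qed
  also have "... <= (NN x. (\<Sum>pq\<in>I. ennreal (Bp * (C3\<^sup>2 * real (card I))) * (ennreal ((wt (fst x) (snd x) pq * cmod (partials (fst pq) (snd pq) F x))\<^sup>2 * fst x) * indicator O' x)))"
  proof (rule nn_integral_mono)
   fix x
   show "ennreal (Bp * J x * H i k rho a f (kinv i (h x))) * indicator O' x
    <= (\<Sum>pq\<in>I. ennreal (Bp * (C3\<^sup>2 * real (card I))) * (ennreal ((wt (fst x) (snd x) pq * cmod (partials (fst pq) (snd pq) F x))\<^sup>2 * fst x) * indicator O' x))"
   proof (cases "x : O'")
    case True
    have x0: "0 < fst x" using True by (auto simp: O'_def)
    have "H i k rho a f (kinv i (h x)) = (infdist (h x) (K i) powr (real k - rho) * cmod (partials a (k - a) (%z. f (kappa S i z)) (kinv i (h x))))\<^sup>2"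
     using Lamz[OF True] by (simp add: H_def)
    also have "... <= (C3 * S1 x)\<^sup>2" by (rule power_mono[OF pw[OF True]]) simp
    also have "... <= C3\<^sup>2 * ((\<Sum>pq\<in>I. (wt (fst x) (snd x) pq * cmod (partials (fst pq) (snd pq) F x))\<^sup>2) * real (card I))"
     unfolding power_mult_distrib[of C3] S1_def by (rule mult_left_mono[OF sum_squared_le_sum_of_squares]) simp
    finally have "Bp * J x * H i k rho a f (kinv i (h x)) <= Bp * J x * (C3\<^sup>2 * ((\<Sum>pq\<in>I. (wt (fst x) (snd x) pq * cmod (partials (fst pq) (snd pq) F x))\<^sup>2) * real (card I)))"
     using Bp0 x0 by (intro mult_left_mono) (auto simp: J_def)
    also have "... = (\<Sum>pq\<in>I. (Bp * (C3\<^sup>2 * real (card I))) * ((wt (fst x) (snd x) pq * cmod (partials (fst pq) (snd pq) F x))\<^sup>2 * fst x))"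
     by (simp add: sum_distrib_left sum_distrib_right J_def mult_ac)
    finally have "ennreal (Bp * J x * H i k rho a f (kinv i (h x))) <= ennreal ..." by (rule ennreal_leI)
    also have "... = (\<Sum>pq\<in>I. ennreal ((Bp * (C3\<^sup>2 * real (card I))) * ((wt (fst x) (snd x) pq * cmod (partials (fst pq) (snd pq) F x))\<^sup>2 * fst x)))"
     by (rule sum_ennreal[symmetric]) (use Bp0 x0 in auto)
    also have "... = (\<Sum>pq\<in>I. ennreal (Bp * (C3\<^sup>2 * real (card I))) * ennreal ((wt (fst x) (snd x) pq * cmod (partials (fst pq) (snd pq) F x))\<^sup>2 * fst x))"
     by (intro sum.cong refl ennreal_mult) (use Bp0 x0 in auto)
    finally show ?thesis using True by simp
   qed simp
  qed
  also have "... = (\<Sum>pq\<in>I. ennreal (Bp * (C3\<^sup>2 * real (card I))) * (NN x. ennreal ((wt (fst x) (snd x) pq * cmod (partials (fst pq) (snd pq) F x))\<^sup>2 * fst x) * indicator O' x))"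
  proof -
   have me: "(%x. ennreal ((wt (fst x) (snd x) pq * cmod (partials (fst pq) (snd pq) F x))\<^sup>2 * fst x) * indicator O' x) : borel_measurable lborel" for pq
   proof -
    have c: "continuous_on O' (partials (fst pq) (snd pq) F)"
     by (rule Ck_on_continuous[of 0], rule Ck_on_partials[OF opO FC])
    have pos: "0 < fst x" "0 < min (snd x) (?w - snd x)" if "x : O'" for x using that by (auto simp: O'_def)
    have "continuous_on O' (%x. (wt (fst x) (snd x) pq * cmod (partials (fst pq) (snd pq) F x))\<^sup>2 * fst x)"
     unfolding wt_def
     by (intro continuous_on_mult continuous_on_power continuous_on_norm c continuous_on_powr continuous_on_min
       continuous_on_fst continuous_on_snd continuous_on_id continuous_on_const continuous_on_add continuous_on_diff)
      (use pos in force)+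
    from borel_measurable_continuous_on_indicator[OF _ this] opO
    have "(%x. ennreal (indicator O' x *\<^sub>R ((wt (fst x) (snd x) pq * cmod (partials (fst pq) (snd pq) F x))\<^sup>2 * fst x))) : borel_measurable borel"
     by measurable
    moreover have "(%x. ennreal (indicator O' x *\<^sub>R ((wt (fst x) (snd x) pq * cmod (partials (fst pq) (snd pq) F x))\<^sup>2 * fst x)))
     = (%x. ennreal ((wt (fst x) (snd x) pq * cmod (partials (fst pq) (snd pq) F x))\<^sup>2 * fst x) * indicator O' x)"
     by (auto simp: indicator_def)
    ultimately show ?thesis by simp
   qed
   show ?thesis by (subst nn_integral_sum) (use me in \<open>auto simp: nn_integral_cmult\<close>)
  qed
  also have "... <= (\<Sum>pq\<in>I. ennreal (Bp * (C3\<^sup>2 * real (card I))) * (X_cone_norm S n k rho fn)\<^sup>2)"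
  proof (intro sum_mono mult_left_mono)
   fix pq assume pq: "pq : I"
   have "(NN x. ennreal ((wt (fst x) (snd x) pq * cmod (partials (fst pq) (snd pq) F x))\<^sup>2 * fst x) * indicator O' x)
    <= (weighted_term ?w rho (fst pq) (snd pq) (fn \<circ> face_chart S n t))\<^sup>2"
    unfolding weighted_term_def Let_def epowr_half_power2
   proof (rule nn_integral_mono)
    fix x
    show "ennreal ((wt (fst x) (snd x) pq * cmod (partials (fst pq) (snd pq) F x))\<^sup>2 * fst x) * indicator O' x
     <= (case x of (r, \<phi>) => ennreal ((r powr - rho * (1 + r) powr rho * (min \<phi> (?w - \<phi>) * r) ^ fst pq * min \<phi> (?w - \<phi>) powr (real (snd pq) - rho)
      * cmod ((radial_derivative ^^ fst pq) ((angular_derivative ^^ snd pq) (%(r, \<phi>). (fn \<circ> face_chart S n t) (r * cos \<phi>, r * sin \<phi>))) (r, \<phi>)))\<^sup>2 * r)) * indicator ({0<..} \<times> {0<..<?w}) x"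
    proof (cases "x : O'")
     case True
     hence "x : {0<..} \<times> {0<..<?w}" by (simp add: O'_def)
     thus ?thesis using True by (cases x) (simp add: wt_def partials_def F_def)
    qed simp
   qed
   also have "... <= (X_cone_norm S n k rho fn)\<^sup>2"
   proof (rule power_mono)
    have "weighted_term ?w rho (fst pq) (snd pq) (fn \<circ> face_chart S n t) <= (\<Sum>(a, b)\<in>I. weighted_term ?w rho a b (fn \<circ> face_chart S n t))"
     using member_le_sum[OF pq, of "%(a, b). weighted_term ?w rho a b (fn \<circ> face_chart S n t)"] finI by (simp add: case_prod_unfold)
    also have "... <= (\<Sum>t<num_faces S n. \<Sum>(a, b)\<in>I. weighted_term (opening_angle S n t) rho a b (fn \<circ> face_chart S n t))"
     using member_le_sum[of t "{..<num_faces S n}" "%t. \<Sum>(a, b)\<in>I. weighted_term (opening_angle S n t) rho a b (fn \<circ> face_chart S n t)"] t by simp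
    also have "... <= X_cone_norm S n k rho fn" unfolding X_cone_norm_def I_def by simp
    finally show "weighted_term ?w rho (fst pq) (snd pq) (fn \<circ> face_chart S n t) <= X_cone_norm S n k rho fn" .
   qed simp
   finally show "(NN x. ennreal ((wt (fst x) (snd x) pq * cmod (partials (fst pq) (snd pq) F x))\<^sup>2 * fst x) * indicator O' x) <= (X_cone_norm S n k rho fn)\<^sup>2" .
  qed simp
  also have "... = ennreal (Bp * (C3\<^sup>2 * real (card I)) * real (card I)) * (X_cone_norm S n k rho fn)\<^sup>2"
   using Bp0 by (simp add: ennreal_mult ennreal_of_nat_eq_real_of_nat mult_ac)
  also have "... <= ennreal C * (X_cone_norm S n k rho fn)\<^sup>2"
   by (intro mult_right_mono ennreal_leI) (auto simp: C_def)
  finally show "(NN z. ennreal (H i k rho a (%x. complex_of_real (phi Z n x) * v x) z))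
   <= ennreal C * (X_cone_norm S n k rho (%x. if x : bd S then complex_of_real (phi Z n x) * v x else 0))\<^sup>2"
   unfolding f_def fn_def .
 qed
qed

end

section \<open>Wavelet coefficients\<close>

lemma cmod_powr2: "cmod z powr 2 = (cmod z)\<^sup>2"
 by (cases "z = 0") auto

lemma epowr_mono: "x <= y ==> 0 <= a ==> epowr x a <= epowr y a"
 by (cases x; cases y) (auto simp: epowr_def top_unique intro!: ennreal_leI powr_mono2)

lemma epowr_half_ennreal: "0 <= r ==> epowr (ennreal (r\<^sup>2)) (1 / 2) = ennreal r"
 by (simp add: epowr_def powr_half_sqrt)

lemma epowr_less_top: "epowr x a < \<infinity> \<longleftrightarrow> x < \<infinity>"
 by (auto simp: epowr_def less_top)

lemma Lp_norm_2: "Lp_norm N 2 u = epowr (\<integral>\<^sup>+x. ennreal ((cmod (u x))\<^sup>2) \<partial>N) (1 / 2)"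
 unfolding Lp_norm_def cmod_powr2 ..

lemma Lp_norm_2_power2: "(Lp_norm N 2 u)\<^sup>2 = (\<integral>\<^sup>+x. ennreal ((cmod (u x))\<^sup>2) \<partial>N)" for u :: "_ => complex"
 unfolding Lp_norm_2 epowr_half_power2 ..

lemma partials_zero: "partials a b (%z. 0) z = 0"
proof -
 have 1: "D1 (%z. 0 :: complex) = (%z. 0)" "D2 (%z. 0 :: complex) = (%z. 0)" by (auto intro!: ext)
 have "(D2 ^^ b) (%z. 0 :: complex) = (%z. 0)" by (induction b) (simp_all add: 1)
 moreover have "(D1 ^^ a) (%z. 0 :: complex) = (%z. 0)" by (induction a) (simp_all add: 1)
 ultimately show ?thesis by (simp add: partials_def)
qed

section \<open>Square integrable functions and the inner product on the surface\<close>

context surface_patches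
begin

lemma L2_iff: "u : L2_surface S \<longleftrightarrow> u : borel_measurable M & (\<integral>\<^sup>+x. ennreal ((cmod (u x))\<^sup>2) \<partial>M) < \<infinity>"
 unfolding L2_surface_def Lp_norm_2 epowr_less_top by simp

lemma L2_add:
 assumes u: "u : L2_surface S" and v: "v : L2_surface S"
 shows "(%x. u x + c * v x) : L2_surface S"
 unfolding L2_iff
proof
 have m [measurable]: "u : borel_measurable M" "v : borel_measurable M" using u v by (auto simp: L2_iff)
 show "(%x. u x + c * v x) : borel_measurable M" by measurable
 have "(\<integral>\<^sup>+x. ennreal ((cmod (u x + c * v x))\<^sup>2) \<partial>M) <= (\<integral>\<^sup>+x. ennreal 2 * ennreal ((cmod (u x))\<^sup>2) + ennreal (2 * (cmod c)\<^sup>2) * ennreal ((cmod (v x))\<^sup>2) \<partial>M)"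
 proof (rule nn_integral_mono)
  fix x
  have "(cmod (u x + c * v x))\<^sup>2 <= (cmod (u x) + cmod c * cmod (v x))\<^sup>2"
   by (intro power_mono order_trans[OF norm_triangle_ineq]) (auto simp: norm_mult)
  also have "... <= 2 * (cmod (u x))\<^sup>2 + 2 * (cmod c * cmod (v x))\<^sup>2"
   using sum_squares_bound[of "cmod (u x)" "cmod c * cmod (v x)"] by (simp add: power2_sum)
  finally have "ennreal ((cmod (u x + c * v x))\<^sup>2) <= ennreal (2 * (cmod (u x))\<^sup>2 + 2 * (cmod c)\<^sup>2 * (cmod (v x))\<^sup>2)"
   by (intro ennreal_leI) (simp add: power_mult_distrib mult.assoc)
  also have "... = ennreal 2 * ennreal ((cmod (u x))\<^sup>2) + ennreal (2 * (cmod c)\<^sup>2) * ennreal ((cmod (v x))\<^sup>2)"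
   by (simp add: ennreal_mult[symmetric] ennreal_plus[symmetric] del: ennreal_numeral ennreal_plus)
  finally show "ennreal ((cmod (u x + c * v x))\<^sup>2) <= ennreal 2 * ennreal ((cmod (u x))\<^sup>2) + ennreal (2 * (cmod c)\<^sup>2) * ennreal ((cmod (v x))\<^sup>2)" .
 qed
 also have "... = ennreal 2 * (\<integral>\<^sup>+x. ennreal ((cmod (u x))\<^sup>2) \<partial>M) + ennreal (2 * (cmod c)\<^sup>2) * (\<integral>\<^sup>+x. ennreal ((cmod (v x))\<^sup>2) \<partial>M)"
  by (subst nn_integral_add) (auto simp: nn_integral_cmult)
 also have "... < \<infinity>" using u v by (simp add: L2_iff ennreal_mult_less_top del: ennreal_numeral)
 finally show "(\<integral>\<^sup>+x. ennreal ((cmod (u x + c * v x))\<^sup>2) \<partial>M) < \<infinity>" .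
qed

lemma L2_zero: "(%x. 0) : L2_surface S" by (simp add: L2_iff)

lemma L2_diff: "u : L2_surface S ==> v : L2_surface S ==> (%x. u x - v x) : L2_surface S"
 using L2_add[of u v "- 1"] by simp

lemma L2_sum: "finite X ==> (!!a. a : X ==> f a : L2_surface S) ==> (%x. \<Sum>a\<in>X. c a * f a x) : L2_surface S"
proof (induction X rule: finite_induct)
 case (insert a X)
 have "(%x. (\<Sum>a\<in>X. c a * f a x) + c a * f a x) : L2_surface S"
  by (rule L2_add[OF insert.IH insert.prems]) (use insert.prems in auto)
 thus ?case using insert.hyps by (simp add: add.commute)
qed (simp add: L2_zero)

text \<open>Pull-backs of square integrable functions are square integrable, and the product is
  bounded by the sum of the squares.\<close>

lemma integrable_pull:
 assumes i: "i < np" and u: "u : L2_surface S" and v: "v : L2_surface S"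
 shows "integrable lborel (%z. indicator unit_square z *\<^sub>R (u (kappa S i z) * cnj (v (kappa S i z))))"
proof (rule integrableI_bounded)
 obtain B where B: "B > 0" "!!u. u : borel_measurable M ==>
  (NN z. ennreal ((cmod (u (kappa S i z)))\<^sup>2) * indicator unit_square z) <= ennreal B * (\<integral>\<^sup>+x. ennreal ((cmod (u x))\<^sup>2) \<partial>M)"
  by (rule L2_pull_back[OF i], rule that)
 have um: "u : borel_measurable M" "v : borel_measurable M" using u v by (auto simp: L2_iff)
 define f where "f w z = indicator unit_square z *\<^sub>R (w (kappa S i z) :: complex)" for w z
 have fm [measurable]: "f u : borel_measurable borel" "f v : borel_measurable borel"
  unfolding f_def[abs_def] by (rule measurable_kappa[OF i um(1)], rule measurable_kappa[OF i um(2)])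
 have eq: "indicator unit_square z *\<^sub>R (u (kappa S i z) * cnj (v (kappa S i z))) = f u z * cnj (f v z)" for z
  by (auto simp: f_def indicator_def)
 show "(%z. indicator unit_square z *\<^sub>R (u (kappa S i z) * cnj (v (kappa S i z)))) : borel_measurable lborel"
  unfolding eq by (rule borel_measurable_times) (use fm in \<open>auto intro!: borel_measurable_continuous_on[of cnj] continuous_intros\<close>)
 have fin: "(NN z. ennreal ((cmod (f w z))\<^sup>2)) < \<infinity>" if w: "w : L2_surface S" for w
 proof -
  have "(NN z. ennreal ((cmod (f w z))\<^sup>2)) = (NN z. ennreal ((cmod (w (kappa S i z)))\<^sup>2) * indicator unit_square z)"
   by (intro nn_integral_cong) (auto simp: f_def indicator_def)
  also have "... <= ennreal B * (\<integral>\<^sup>+x. ennreal ((cmod (w x))\<^sup>2) \<partial>M)" using w by (intro B(2)) (simp add: L2_iff)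
  also have "... < \<infinity>" using w by (simp add: L2_iff ennreal_mult_less_top)
  finally show ?thesis .
 qed
 have "(NN z. ennreal (norm (f u z * cnj (f v z)))) <= (NN z. ennreal ((cmod (f u z))\<^sup>2) + ennreal ((cmod (f v z))\<^sup>2))"
 proof (rule nn_integral_mono)
  fix z
  have "norm (f u z * cnj (f v z)) <= (cmod (f u z))\<^sup>2 + (cmod (f v z))\<^sup>2"
  proof -
   have "2 * (cmod (f u z) * cmod (f v z)) <= (cmod (f u z))\<^sup>2 + (cmod (f v z))\<^sup>2"
    using sum_squares_bound[of "cmod (f u z)" "cmod (f v z)"] by (simp only: mult.assoc)
   moreover have "0 <= cmod (f u z) * cmod (f v z)" by simp
   ultimately have "cmod (f u z) * cmod (f v z) <= (cmod (f u z))\<^sup>2 + (cmod (f v z))\<^sup>2" by linarith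
   thus ?thesis by (simp add: norm_mult)
  qed
  thus "ennreal (norm (f u z * cnj (f v z))) <= ennreal ((cmod (f u z))\<^sup>2) + ennreal ((cmod (f v z))\<^sup>2)"
   by (simp add: ennreal_plus[symmetric] ennreal_leI del: ennreal_plus)
 qed
 also have "... = (NN z. ennreal ((cmod (f u z))\<^sup>2)) + (NN z. ennreal ((cmod (f v z))\<^sup>2))"
  by (rule nn_integral_add) (use fm in auto)
 also have "... < \<infinity>" using fin[OF u] fin[OF v] by simp
 finally show "(NN z. ennreal (norm (indicator unit_square z *\<^sub>R (u (kappa S i z) * cnj (v (kappa S i z)))))) < \<infinity>"
  unfolding eq .
qed

lemma inner_linear:
 assumes u: "u : L2_surface S" and v: "v : L2_surface S" and w: "w : L2_surface S"
 shows "inner_surface S (%x. u x + c * v x) w = inner_surface S u w + c * inner_surface S v w"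
proof -
 have "inner_square ((%x. u x + c * v x) \<circ> kappa S i) (w \<circ> kappa S i)
  = inner_square (u \<circ> kappa S i) (w \<circ> kappa S i) + c * inner_square (v \<circ> kappa S i) (w \<circ> kappa S i)" if i: "i < np" for i
 proof -
  have "(%z. indicator unit_square z *\<^sub>R ((u (kappa S i z) + c * v (kappa S i z)) * cnj (w (kappa S i z))))
   = (%z. indicator unit_square z *\<^sub>R (u (kappa S i z) * cnj (w (kappa S i z))) + c * (indicator unit_square z *\<^sub>R (v (kappa S i z) * cnj (w (kappa S i z)))))"
   by (auto simp: fun_eq_iff indicator_def algebra_simps)
  note eq = this
  note i1 = integrable_pull[OF i u w]
  have i2: "integrable lborel (%z. c * (indicator unit_square z *\<^sub>R (v (kappa S i z) * cnj (w (kappa S i z)))))"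
   by (rule integrable_mult_right) (rule integrable_pull[OF i v w])
  show ?thesis
   unfolding inner_square_def set_lebesgue_integral_def o_def eq Bochner_Integration.integral_add[OF i1 i2] integral_mult_right_zero
   by (rule refl)
 qed
 thus ?thesis unfolding inner_surface_def by (simp add: sum.distrib sum_distrib_left)
qed

lemma inner_zero: "inner_surface S (%x. 0) w = 0"
 by (simp add: inner_surface_def inner_square_def set_lebesgue_integral_def)

lemma inner_sum:
 assumes w: "w : L2_surface S"
 shows "finite X ==> (!!a. a : X ==> f a : L2_surface S) ==>
  inner_surface S (%x. \<Sum>a\<in>X. c a * f a x) w = (\<Sum>a\<in>X. c a * inner_surface S (f a) w)"
proof (induction X rule: finite_induct)
 case (insert a X)
 have "inner_surface S (%x. (\<Sum>a\<in>X. c a * f a x) + c a * f a x) w = inner_surface S (%x. \<Sum>a\<in>X. c a * f a x) w + c a * inner_surface S (f a) w"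
  by (rule inner_linear[OF L2_sum _ w]) (use insert in auto)
 thus ?case using insert by (simp add: add.commute)
qed (simp add: inner_zero)

lemma inner_cong:
 assumes "!!x. x : bd S ==> u x = v x"
 shows "inner_surface S u w = inner_surface S v w"
 unfolding inner_surface_def inner_square_def
proof (intro sum.cong refl set_lebesgue_integral_cong allI impI)
 fix i z assume "i : {..<np}" and z: "z : unit_square"
 hence "kappa S i z : bd S" using kinv_facts(4)[of i z] G_bd[of i] by auto
 thus "(u \<circ> kappa S i) z * cnj ((w \<circ> kappa S i) z) = (v \<circ> kappa S i) z * cnj ((w \<circ> kappa S i) z)" using assms by simp
qed (simp add: borel_Times)

lemma C_pw_L2:
 assumes u: "u : C_pw S"
 shows "u : L2_surface S"
 unfolding L2_iff
proof
 have c: "continuous_on (bd S) u" using u by (simp add: C_pw_def)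
 show "u : borel_measurable M"
  using borel_measurable_continuous_on_restrict[OF c] measurable_cong_sets[OF sets_M_restrict refl, of borel] by blast
 obtain B where B: "!!x. x : bd S ==> cmod (u x) <= B"
  using compact_imp_bounded[OF compact_continuous_image[OF c compact_bd]] unfolding bounded_iff by blast
 have "(\<integral>\<^sup>+x. ennreal ((cmod (u x))\<^sup>2) \<partial>M) <= (\<integral>\<^sup>+x. ennreal (B\<^sup>2) \<partial>M)"
  by (intro nn_integral_mono ennreal_leI power_mono B) (auto simp: space_M)
 also have "... < \<infinity>" using emeasure_M_finite by (simp add: space_M ennreal_mult_less_top)
 finally show "(\<integral>\<^sup>+x. ennreal ((cmod (u x))\<^sup>2) \<partial>M) < \<infinity>" .
qed

lemma uniform_lipschitz:
 obtains L where "L > 0" "!!i x y. i < np ==> x : unit_square ==> y : unit_square ==> dist (kappa S i x) (kappa S i y) <= L * dist x y"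
  "!!i x y. i < np ==> x : G i ==> y : G i ==> dist (kinv i x) (kinv i y) <= L * dist x y"
proof -
 have "\<forall>i\<in>{..<np}. \<exists>L>0. (\<forall>x\<in>unit_square. \<forall>y\<in>unit_square. dist (kappa S i x) (kappa S i y) <= L * dist x y) &
  (\<forall>x\<in>G i. \<forall>y\<in>G i. dist (kinv i x) (kinv i y) <= L * dist x y)"
 proof
  fix i assume "i : {..<np}"
  hence i: "i < np" by simp
  obtain L where "L > 0" "!!x y. x : unit_square ==> y : unit_square ==> dist (kappa S i x) (kappa S i y) <= L * dist x y"
   "!!x y. x : G i ==> y : G i ==> dist (kinv i x) (kinv i y) <= L * dist x y"
   by (rule lipschitz_kappa[OF i], rule that)
  thus "\<exists>L>0. (\<forall>x\<in>unit_square. \<forall>y\<in>unit_square. dist (kappa S i x) (kappa S i y) <= L * dist x y) &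
   (\<forall>x\<in>G i. \<forall>y\<in>G i. dist (kinv i x) (kinv i y) <= L * dist x y)" by blast
 qed
 from bchoice[OF this] obtain l where l: "\<forall>i\<in>{..<np}. l i > 0 & (\<forall>x\<in>unit_square. \<forall>y\<in>unit_square. dist (kappa S i x) (kappa S i y) <= l i * dist x y) &
  (\<forall>x\<in>G i. \<forall>y\<in>G i. dist (kinv i x) (kinv i y) <= l i * dist x y)" ..
 define L where "L = 1 + (\<Sum>i<np. l i)"
 have pos: "0 <= l i" if "i : {..<np}" for i using bspec[OF l that] by (elim conjE) (rule less_imp_le)
 have lL: "l i <= L" if "i < np" for i
  using member_le_sum[of i "{..<np}" l, OF _ pos] that by (simp add: L_def)
 have L0: "L > 0" unfolding L_def by (intro add_pos_nonneg sum_nonneg pos) simp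
 show ?thesis
 proof (rule that[OF L0])
  show "dist (kappa S i x) (kappa S i y) <= L * dist x y" if i: "i < np" "x : unit_square" "y : unit_square" for i x y
  proof -
   have "dist (kappa S i x) (kappa S i y) <= l i * dist x y" using l i by blast
   also have "... <= L * dist x y" by (rule mult_right_mono[OF lL[OF i(1)]]) simp
   finally show ?thesis .
  qed
  show "dist (kinv i x) (kinv i y) <= L * dist x y" if i: "i < np" "x : G i" "y : G i" for i x y
  proof -
   have "dist (kinv i x) (kinv i y) <= l i * dist x y" using l i by blast
   also have "... <= L * dist x y" by (rule mult_right_mono[OF lL[OF i(1)]]) simp
   finally show ?thesis .
  qed
 qed
qed

lemma uniform_pull_back:
 obtains B where "B > 0" "!!i u. i < np ==> u : borel_measurable M ==>
  (NN z. ennreal ((cmod (u (kappa S i z)))\<^sup>2) * indicator unit_square z) <= ennreal B * (\<integral>\<^sup>+x. ennreal ((cmod (u x))\<^sup>2) \<partial>M)"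
proof -
 have "\<forall>i\<in>{..<np}. \<exists>B>0. \<forall>u\<in>borel_measurable M.
  (NN z. ennreal ((cmod (u (kappa S i z)))\<^sup>2) * indicator unit_square z) <= ennreal B * (\<integral>\<^sup>+x. ennreal ((cmod (u x))\<^sup>2) \<partial>M)"
 proof
  fix i assume "i : {..<np}"
  hence i: "i < np" by simp
  obtain B where "B > 0" "!!u. u : borel_measurable M ==>
   (NN z. ennreal ((cmod (u (kappa S i z)))\<^sup>2) * indicator unit_square z) <= ennreal B * (\<integral>\<^sup>+x. ennreal ((cmod (u x))\<^sup>2) \<partial>M)"
   by (rule L2_pull_back[OF i], rule that)
  thus "\<exists>B>0. \<forall>u\<in>borel_measurable M.
   (NN z. ennreal ((cmod (u (kappa S i z)))\<^sup>2) * indicator unit_square z) <= ennreal B * (\<integral>\<^sup>+x. ennreal ((cmod (u x))\<^sup>2) \<partial>M)" by blast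
 qed
 from bchoice[OF this] obtain b where b: "\<forall>i\<in>{..<np}. b i > 0 & (\<forall>u\<in>borel_measurable M.
  (NN z. ennreal ((cmod (u (kappa S i z)))\<^sup>2) * indicator unit_square z) <= ennreal (b i) * (\<integral>\<^sup>+x. ennreal ((cmod (u x))\<^sup>2) \<partial>M))" ..
 define B where "B = 1 + (\<Sum>i<np. b i)"
 have pos: "0 <= b i" if "i : {..<np}" for i using bspec[OF b that] by (elim conjE) (rule less_imp_le)
 have bB: "b i <= B" if "i < np" for i
  using member_le_sum[of i "{..<np}" b, OF _ pos] that by (simp add: B_def)
 have B0: "B > 0" unfolding B_def by (intro add_pos_nonneg sum_nonneg pos) simp
 show ?thesis
 proof (rule that[OF B0])
  fix i and u :: "point => complex" assume i: "i < np" and u: "u : borel_measurable M"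
  have "(NN z. ennreal ((cmod (u (kappa S i z)))\<^sup>2) * indicator unit_square z) <= ennreal (b i) * (\<integral>\<^sup>+x. ennreal ((cmod (u x))\<^sup>2) \<partial>M)"
   using b i u by blast
  also have "... <= ennreal B * (\<integral>\<^sup>+x. ennreal ((cmod (u x))\<^sup>2) \<partial>M)"
   by (intro mult_right_mono ennreal_leI bB[OF i]) simp
  finally show "(NN z. ennreal ((cmod (u (kappa S i z)))\<^sup>2) * indicator unit_square z) <= ennreal B * (\<integral>\<^sup>+x. ennreal ((cmod (u x))\<^sup>2) \<partial>M)" .
 qed
qed

end

section \<open>Continuity of the coefficients, position and number of the wavelets\<close>

locale wavelet_surface = surface_resolution +
 fixes W :: wavelet_system and d :: nat and sS :: real
 assumes wb: "wavelet_basis S W d sS"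
begin

abbreviation "cf \<equiv> coeff_at S W"
abbreviation "N j \<equiv> nabla S W j"
abbreviation "supp j xi \<equiv> supp_dual S W j xi"
abbreviation "j0 \<equiv> coarsest W"
abbreviation "del xi \<equiv> infdist xi (skeleton S)"

lemma basis_facts:
 "1 <= d" "1 <= sS" "biorthogonal_system S W" "wavelet_grids S W" "wavelets_normalized S W"
 "wavelet_supports S W" "vanishing_moments S W d" "finite_overlap S W" "sobolev_equivalence S W sS"
 using wb unfolding wavelet_basis_def by blast+

lemma N_facts: "j >= j0 ==> finite (N j)" "j >= j0 ==> xi : N j ==> \<exists>i<np. xi : G i"
proof -
 have *: "finite (grid W j i) & grid W j i <= G i" if "j >= j0" "i < np" for j i
  using basis_facts(4) that unfolding wavelet_grids_def by blast
 show "j >= j0 ==> finite (N j)" unfolding nabla_def using * by blast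
 show "j >= j0 ==> xi : N j ==> \<exists>i<np. xi : G i" unfolding nabla_def using * by blast
qed

lemma windices_L2: "eta : windices S W ==> primal W eta : L2_surface S & dual W eta : L2_surface S"
 using basis_facts(3)[unfolded biorthogonal_system_def riesz_basis_def, THEN conjunct1, THEN conjunct1, THEN bspec]
  basis_facts(3)[unfolded biorthogonal_system_def riesz_basis_def, THEN conjunct2, THEN conjunct1, THEN conjunct1, THEN bspec]
 by (intro conjI)

lemma Wavelet_windex: "j >= j0 ==> xi : N j ==> Wavelet j xi : windices S W"
 by (auto simp: windices_def)

lemma coeff_diff:
 assumes "j >= j0" "xi : N j" "u : L2_surface S" "v : L2_surface S"
 shows "cf (%x. u x - v x) j xi = cf u j xi - cf v j xi"
 unfolding coeff_at_def
 using inner_linear[OF assms(3,4), of "dual W (Wavelet j xi)" "- 1"] windices_L2[OF Wavelet_windex[OF assms(1,2)]] by simp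

text \<open>The norm equivalence of order zero bounds every single coefficient, with one constant
  for all levels.\<close>

lemma coeff_le_L2:
 obtains C where "C > 0" "!!u j xi. u : L2_surface S ==> j >= j0 ==> xi : N j ==> ennreal (C * cmod (cf u j xi)) <= Lp_norm M 2 u"
proof -
 have "\<exists>C1>0. \<exists>C2>0. \<forall>u\<in>L2_surface S. ennreal C1 * wavelet_sobolev_norm S W 0 u <= sobolev_norm S 0 u &
   sobolev_norm S 0 u <= ennreal C2 * wavelet_sobolev_norm S W 0 u"
  using basis_facts(2,9) unfolding sobolev_equivalence_def by (elim allE[of _ 0]) simp
 then obtain C where C: "C > 0" "!!u. u : L2_surface S ==> ennreal C * wavelet_sobolev_norm S W 0 u <= sobolev_norm S 0 u" by blast
 show ?thesis
 proof (rule that[OF C(1)])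
  fix u j xi assume u: "u : L2_surface S" and j: "j >= j0" and x: "xi : N j"
  let ?f = "%i. let j = j0 + i in ennreal (\<Sum>xi\<in>N j. 2 powr (2 * 0 * real j) * (cmod (cf u j xi))\<^sup>2)"
  have "ennreal ((cmod (cf u j xi))\<^sup>2) <= ?f (j - j0)"
   using j member_le_sum[OF x, of "%xi. (cmod (cf u j xi))\<^sup>2"] N_facts(1)[OF j] by (simp add: ennreal_leI)
  also have "... <= (\<Sum>i. ?f i)" using sum_le_suminf[of ?f "{j - j0}"] by (simp add: summableI)
  finally have "epowr (ennreal ((cmod (cf u j xi))\<^sup>2)) (1 / 2) <= epowr (\<Sum>i. ?f i) (1 / 2)" by (intro epowr_mono) auto
  also have "... <= wavelet_sobolev_norm S W 0 u" unfolding wavelet_sobolev_norm_def by (simp add: add_increasing)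
  finally have "ennreal (cmod (cf u j xi)) <= wavelet_sobolev_norm S W 0 u" by (simp add: epowr_half_ennreal)
  hence "ennreal C * ennreal (cmod (cf u j xi)) <= ennreal C * wavelet_sobolev_norm S W 0 u" by (rule mult_left_mono) simp
  also have "... <= sobolev_norm S 0 u" by (rule C(2)[OF u])
  also have "... = Lp_norm M 2 u" by (simp add: sobolev_norm_def sobolev_norm_nonneg_def)
  finally show "ennreal (C * cmod (cf u j xi)) <= Lp_norm M 2 u" using C(1) by (simp add: ennreal_mult)
 qed
qed

text \<open>Continuity in \<open>L2_surface\<close>, which transfers bounds for smooth functions to
  their limits.\<close>

lemma coeff_tendsto:
 assumes j: "j >= j0" "xi : N j" and u: "u : L2_surface S" and v: "!!l. v l : L2_surface S"
  and lim: "(%l :: nat. Lp_norm M 2 (%x. u x - v l x)) \<longlonglongrightarrow> 0"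
 shows "(%l. cf (v l) j xi) \<longlonglongrightarrow> cf u j xi"
proof -
 obtain C where C: "C > 0" "!!u j xi. u : L2_surface S ==> j >= j0 ==> xi : N j ==> ennreal (C * cmod (cf u j xi)) <= Lp_norm M 2 u"
  by (rule coeff_le_L2, rule that)
 have le: "ennreal (C * cmod (cf u j xi - cf (v l) j xi)) <= Lp_norm M 2 (%x. u x - v l x)" for l
  using C(2)[OF L2_diff[OF u v[of l]] j] unfolding coeff_diff[OF j u v[of l]] .
 have "(%l. ennreal (C * cmod (cf u j xi - cf (v l) j xi))) \<longlonglongrightarrow> 0"
  by (rule tendsto_sandwich[OF _ _ tendsto_const lim]) (auto simp: le)
 hence "(%l. C * cmod (cf u j xi - cf (v l) j xi)) \<longlonglongrightarrow> 0"
  by (subst (asm) ennreal_tendsto_0_iff) (use C(1) in auto)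
 from tendsto_mult_left[OF this, of "1 / C"] C(1) have "(%l. cmod (cf u j xi - cf (v l) j xi)) \<longlonglongrightarrow> 0" by simp
 hence "(%l. cf u j xi - cf (v l) j xi) \<longlonglongrightarrow> 0" by (rule tendsto_norm_zero_cancel)
 from tendsto_diff[OF tendsto_const[of "cf u j xi"] this] show ?thesis by simp
qed

lemma supp_facts:
 obtains c1 c2 where "c1 > 0" "c2 > 0" "!!j xi. j >= j0 ==> xi : N j ==> closed (supp j xi) & supp j xi <= bd S & xi : supp j xi &
  supp j xi <= cball xi (c2 / 2 ^ j) & ennreal (c1 / 4 ^ j) <= emeasure M (supp j xi)"
proof -
 obtain c1 c2 where c: "c1 > 0" "c2 > 0" "!!j xi. j >= j0 ==> xi : N j ==> compact (supp j xi) & xi : supp j xi &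
    ennreal (c1 / 2 ^ (2 * j)) <= emeasure M (supp j xi) & diameter (supp j xi) <= c2 / 2 ^ j"
  using basis_facts(6) unfolding wavelet_supports_def by blast
 show ?thesis
 proof (rule that[OF c(1,2)])
  fix j xi assume j: "j >= j0" "xi : N j"
  note * = c(3)[OF j]
  have "supp j xi <= bd S" unfolding supp_dual_def by (rule closure_minimal[OF _ bd_closed]) auto
  moreover have "supp j xi <= cball xi (c2 / 2 ^ j)"
  proof
   fix x assume "x : supp j xi"
   hence "dist xi x <= diameter (supp j xi)" using * by (intro diameter_bounded_bound compact_imp_bounded) auto
   thus "x : cball xi (c2 / 2 ^ j)" using * by simp
  qed
  moreover have "(2::real) ^ (2 * j) = 4 ^ j" by (simp add: power_mult)
  ultimately show "closed (supp j xi) & supp j xi <= bd S & xi : supp j xi &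
  supp j xi <= cball xi (c2 / 2 ^ j) & ennreal (c1 / 4 ^ j) <= emeasure M (supp j xi)"
   using * compact_imp_closed by auto
 qed
qed

text \<open>Every support has area at least a multiple of 4^(-j), and a point lies in at most
  \<open>C0\<close> of them, so their total area is at most \<open>C0\<close> times that of
  \<open>X\<close>.\<close>

lemma card_le_measure:
 obtains C where "C > 0" "!!j X Y. j >= j0 ==> X : sets borel ==> X <= bd S ==> Y <= N j ==> \<forall>xi\<in>Y. supp j xi <= X ==>
  ennreal (real (card Y)) <= ennreal (C * 4 ^ j) * emeasure M X"
proof -
 obtain c1 c2 where c: "c1 > 0" "c2 > 0" "!!j xi. j >= j0 ==> xi : N j ==> closed (supp j xi) & supp j xi <= bd S & xi : supp j xi &
  supp j xi <= cball xi (c2 / 2 ^ j) & ennreal (c1 / 4 ^ j) <= emeasure M (supp j xi)"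
  by (rule supp_facts, rule that)
 obtain C0 :: nat where C0: "!!j x. j >= j0 ==> x : bd S ==> card {xi : N j. x : supp j xi} <= C0"
  using basis_facts(8) unfolding finite_overlap_def by blast
 define C where "C = (real C0 + 1) / c1"
 have C: "C > 0" using c(1) by (simp add: C_def)
 show ?thesis
 proof (rule that[OF C])
  fix j X Y assume j: "j >= j0" and X: "X : sets borel" "X <= bd S" and Y: "Y <= N j" "\<forall>xi\<in>Y. supp j xi <= X"
  have finY: "finite Y" using finite_subset[OF Y(1) N_facts(1)[OF j]] .
  have sm: "supp j xi : sets M" if "xi : Y" for xi using c(3)[OF j] Y(1) that by (auto simp: sets_M)
  have Xm: "X : sets M" using X by (simp add: sets_M)
  have "of_nat (card Y) * ennreal (c1 / 4 ^ j) = (\<Sum>xi\<in>Y. ennreal (c1 / 4 ^ j))" by simp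
  also have "... <= (\<Sum>xi\<in>Y. emeasure M (supp j xi))" using c(3)[OF j] Y(1) by (intro sum_mono) blast
  also have "... = (\<Sum>xi\<in>Y. \<integral>\<^sup>+x. indicator (supp j xi) x \<partial>M)" using sm by simp
  also have "... = (\<integral>\<^sup>+x. (\<Sum>xi\<in>Y. indicator (supp j xi) x) \<partial>M)" using sm by (subst nn_integral_sum) auto
  also have "... <= (\<integral>\<^sup>+x. of_nat C0 * indicator X x \<partial>M)"
  proof (rule nn_integral_mono)
   fix x assume "x : space M"
   hence x: "x : bd S" by (simp add: space_M)
   show "(\<Sum>xi\<in>Y. indicator (supp j xi) x) <= (of_nat C0 * indicator X x :: ennreal)"
   proof (cases "x : X")
    case True
    have "(\<Sum>xi\<in>Y. indicator (supp j xi) x :: ennreal) = of_nat (card {xi : Y. x : supp j xi})"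
    proof -
     have "Y \<inter> {xi. x : supp j xi} = {xi : Y. x : supp j xi}" by auto
     thus ?thesis using finY by (simp add: indicator_def)
    qed
    also have "card {xi : Y. x : supp j xi} <= card {xi : N j. x : supp j xi}" using Y(1) N_facts(1)[OF j] by (intro card_mono) auto
    also have "... <= C0" by (rule C0[OF j x])
    finally show ?thesis using True by simp
   next
    case False
    hence "indicator (supp j xi) x = (0 :: ennreal)" if "xi : Y" for xi using bspec[OF Y(2) that] by (auto simp: indicator_def)
    thus ?thesis by simp
   qed
  qed
  also have "... = of_nat C0 * emeasure M X" using Xm by (simp add: nn_integral_cmult)
  finally have le: "of_nat (card Y) * ennreal (c1 / 4 ^ j) <= of_nat C0 * emeasure M X" .
  have "ennreal (real (card Y)) = ennreal (4 ^ j / c1) * (of_nat (card Y) * ennreal (c1 / 4 ^ j))"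
   using c(1) by (simp add: ennreal_of_nat_eq_real_of_nat ennreal_mult[symmetric])
  also have "... <= ennreal (4 ^ j / c1) * (of_nat C0 * emeasure M X)" by (rule mult_left_mono[OF le]) simp
  also have "... = ennreal (4 ^ j / c1 * real C0) * emeasure M X"
   unfolding ennreal_of_nat_eq_real_of_nat using c(1) by (subst ennreal_mult) (auto simp: mult.assoc)
  also have "... <= ennreal (C * 4 ^ j) * emeasure M X"
   using c(1) by (intro mult_right_mono ennreal_leI) (auto simp: C_def field_simps)
  finally show "ennreal (real (card Y)) <= ennreal (C * 4 ^ j) * emeasure M X" .
 qed
qed

text \<open>The supports of these wavelets lie in a strip about the edges whose width is eta plus
  the size of a support. The latter accounts for the term 1 / 2^j and for a number of order 2^j of
  wavelets at the edges.\<close>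

lemma card_strip:
 obtains C where "C > 0" "!!j eta. j >= j0 ==> 0 <= eta ==> real (card {xi : N j. del xi <= eta}) <= C * 4 ^ j * (eta + 1 / 2 ^ j)"
proof -
 obtain c1 c2 where c: "c1 > 0" "c2 > 0" "!!j xi. j >= j0 ==> xi : N j ==> closed (supp j xi) & supp j xi <= bd S & xi : supp j xi &
  supp j xi <= cball xi (c2 / 2 ^ j) & ennreal (c1 / 4 ^ j) <= emeasure M (supp j xi)"
  by (rule supp_facts, rule that)
 obtain C where C: "C > 0" "!!j X Y. j >= j0 ==> X : sets borel ==> X <= bd S ==> Y <= N j ==> \<forall>xi\<in>Y. supp j xi <= X ==>
  ennreal (real (card Y)) <= ennreal (C * 4 ^ j) * emeasure M X" by (rule card_le_measure, rule that)
 obtain Cs where Cs: "Cs > 0" "!!eta. 0 < eta ==> eta <= 1 ==> emeasure M {x : bd S. infdist x (skeleton S) <= eta} <= ennreal (Cs * eta)"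
  by (rule emeasure_strip, rule that)
 define mb where "mb = enn2real (emeasure M (bd S))"
 have mb: "emeasure M (bd S) = ennreal mb" "0 <= mb" using emeasure_M_finite by (auto simp: mb_def)
 have bdm: "bd S : sets M" using bd_closed by (simp add: sets_M)
 \<comment> \<open>For widths above one the total area of the surface serves as bound.\<close>
 have strip: "emeasure M {x : bd S. infdist x (skeleton S) <= eta} <= ennreal ((Cs + mb) * eta)" if eta: "0 < eta" for eta
 proof (cases "eta <= 1")
  case True
  have "Cs * eta <= (Cs + mb) * eta" using mb eta by (intro mult_right_mono) auto
  thus ?thesis using Cs(2)[OF eta True] by (meson ennreal_leI order_trans)
 next
  case False
  have "emeasure M {x : bd S. infdist x (skeleton S) <= eta} <= ennreal mb" unfolding mb(1)[symmetric] by (rule emeasure_mono[OF _ bdm]) auto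
  also have "... <= ennreal ((Cs + mb) * eta)"
  proof (rule ennreal_leI)
   have "mb * 1 <= mb * eta" using False mb by (intro mult_left_mono) auto
   thus "mb <= (Cs + mb) * eta" using Cs(1) eta by (simp add: distrib_right add_increasing)
  qed
  finally show ?thesis .
 qed
 define C' where "C' = C * (Cs + mb) * (1 + c2)"
 have C'0: "C' > 0" unfolding C'_def using C(1) Cs(1) mb c(2) by simp
 show ?thesis
 proof (rule that[OF C'0])
  fix j eta assume j: "j >= j0" and eta: "(0::real) <= eta"
  define e where "e = eta + c2 / 2 ^ j"
  have e: "e > 0" using eta c(2) by (simp add: e_def add_nonneg_pos)
  have cl: "closed {x : bd S. infdist x (skeleton S) <= e}"
   using closed_Int[OF bd_closed closed_Collect_le[OF continuous_on_infdist[OF continuous_on_id] continuous_on_const, of "skeleton S" e]]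
   by (simp add: Int_def)
  have "ennreal (real (card {xi : N j. del xi <= eta})) <= ennreal (C * 4 ^ j) * emeasure M {x : bd S. infdist x (skeleton S) <= e}"
  proof (rule C(2)[OF j _ _ _ ballI])
   fix xi assume xi: "xi : {xi : N j. del xi <= eta}"
   show "supp j xi <= {x : bd S. infdist x (skeleton S) <= e}"
   proof
    fix x assume x: "x : supp j xi"
    hence "x : bd S" "dist xi x <= c2 / 2 ^ j" using c(3)[OF j, of xi] xi by auto
    thus "x : {x : bd S. infdist x (skeleton S) <= e}"
     using infdist_triangle[of x "skeleton S" xi] xi by (simp add: e_def dist_commute)
   qed
  qed (use cl in auto)
  also have "... <= ennreal (C * 4 ^ j) * ennreal ((Cs + mb) * e)" by (rule mult_left_mono[OF strip[OF e]]) simp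
  also have "... = ennreal (C * 4 ^ j * ((Cs + mb) * e))" using C(1) Cs(1) mb e by (simp add: ennreal_mult[symmetric])
  finally have "real (card {xi : N j. del xi <= eta}) <= C * 4 ^ j * ((Cs + mb) * e)"
   using C(1) Cs(1) mb e by (subst (asm) ennreal_le_iff) auto
  also have "... <= C * 4 ^ j * ((Cs + mb) * ((1 + c2) * (eta + 1 / 2 ^ j)))"
  proof (intro mult_left_mono)
   show "e <= (1 + c2) * (eta + 1 / 2 ^ j)" using c(2) eta by (simp add: e_def algebra_simps add_divide_distrib)
  qed (use C(1) Cs(1) mb in auto)
  also have "... = C' * 4 ^ j * (eta + 1 / 2 ^ j)" by (simp add: C'_def mult_ac)
  finally show "real (card {xi : N j. del xi <= eta}) <= C' * 4 ^ j * (eta + 1 / 2 ^ j)" .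
 qed
qed

end

section \<open>Coefficients of piecewise smooth functions away from the edges\<close>

context wavelet_surface
begin

text \<open>The factor 2^(kj) undoes the gain from the vanishing moments, and the power of the
  distance to the edges is the weight of derivatives of order \<open>k\<close>.\<close>

abbreviation "wt k rho j xi \<equiv> 2 powr (real k * real j) * del xi powr (real k - rho)"

text \<open>The open patch \<open>i\<close> does not meet the other closed patches, so the dual
  wavelet vanishes on them.\<close>

lemma coeff_single:
 assumes i: "i < np" and s: "supp j xi <= patch S i"
 shows "cf f j xi = (LINT z|lborel. f (kappa S i z) * (indicator unit_square z *\<^sub>R cnj (dual W (Wavelet j xi) (kappa S i z))))"
proof -
 have z: "inner_square (f \<circ> kappa S l) (dual W (Wavelet j xi) \<circ> kappa S l) = 0" if l: "l < np" "l ~= i" for l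
 proof -
  have "dual W (Wavelet j xi) (kappa S l z) = 0" if z: "z : unit_square" for z
  proof (rule ccontr)
   assume ne: "dual W (Wavelet j xi) (kappa S l z) ~= 0"
   have g: "kappa S l z : G l" by (rule kinv_facts(4)[OF l(1) z])
   hence "kappa S l z : supp j xi" unfolding supp_dual_def using ne G_bd[OF l(1)] by (intro subsetD[OF closure_subset]) blast
   thus False using s g patch_disjoint[OF i l(1)] l(2) by blast
  qed
  hence "(%z. indicator unit_square z *\<^sub>R ((f \<circ> kappa S l) z * cnj ((dual W (Wavelet j xi) \<circ> kappa S l) z))) = (%z. 0)"
   by (auto simp: fun_eq_iff indicator_def)
  thus ?thesis unfolding inner_square_def set_lebesgue_integral_def by (simp only: integral_zero)
 qed
 have "cf f j xi = (\<Sum>l\<in>{i}. inner_square (f \<circ> kappa S l) (dual W (Wavelet j xi) \<circ> kappa S l))"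
  unfolding coeff_at_def inner_surface_def by (rule sum.mono_neutral_right) (use i z in auto)
 also have "... = (LINT z|lborel. f (kappa S i z) * (indicator unit_square z *\<^sub>R cnj (dual W (Wavelet j xi) (kappa S i z))))"
  unfolding inner_square_def set_lebesgue_integral_def by (simp add: o_def)
 finally show ?thesis .
qed

text \<open>The moment condition is stated with arbitrary polynomial coefficients; the family that
  is 1 at \<open>(a, b)\<close> and 0 elsewhere picks out the monomial.\<close>

lemma moments:
 assumes j: "j >= j0" "xi : N j" and i: "i < np" and s: "supp j xi <= patch S i" and ab: "a + b < d"
 shows "(LINT z|lborel. of_real (fst z ^ a * snd z ^ b) * (indicator unit_square z *\<^sub>R cnj (dual W (Wavelet j xi) (kappa S i z)))) = 0"
proof -
 let ?c = "%q. if q = (a, b) then 1 else 0 :: complex"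
 have fin: "finite {(a, b). a + b < d}" by (rule finite_subset[of _ "{..<d} \<times> {..<d}"]) auto
 have e: "(\<Sum>(a, b)\<in>{(a, b). a + b < d}. ?c (a, b) * complex_of_real (x ^ a * y ^ b)) = complex_of_real (x ^ a * y ^ b)" for x y
 proof -
  have "(\<Sum>(a, b)\<in>{(a, b). a + b < d}. ?c (a, b) * complex_of_real (x ^ a * y ^ b))
   = (\<Sum>q\<in>{(a, b). a + b < d}. if q = (a, b) then complex_of_real (x ^ fst q * y ^ snd q) else 0)"
   by (intro sum.cong refl) (auto split: prod.split if_splits)
  also have "... = complex_of_real (x ^ a * y ^ b)" using fin ab by (subst sum.delta) auto
  finally show ?thesis .
 qed
 have "inner_square (%(x, y). \<Sum>(a, b)\<in>{(a, b). a + b < d}. ?c (a, b) * complex_of_real (x ^ a * y ^ b)) (dual W (Wavelet j xi) \<circ> kappa S i) = 0"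
  using basis_facts(7)[unfolded vanishing_moments_def, rule_format, OF j i s] .
 moreover have "inner_square (%(x, y). \<Sum>(a, b)\<in>{(a, b). a + b < d}. ?c (a, b) * complex_of_real (x ^ a * y ^ b)) (dual W (Wavelet j xi) \<circ> kappa S i)
  = (LINT z|lborel. of_real (fst z ^ a * snd z ^ b) * (indicator unit_square z *\<^sub>R cnj (dual W (Wavelet j xi) (kappa S i z))))"
  unfolding inner_square_def set_lebesgue_integral_def e by (intro Bochner_Integration.integral_cong refl) (auto simp: indicator_def)
 ultimately show ?thesis by simp
qed

text \<open>A segment that leaves \<open>V i\<close> does so at a point that is still in the closed
  square and is mapped to \<open>K i\<close>; by the Lipschitz bound the image of \<open>z0\<close>
  would then be too close to \<open>K i\<close>.\<close>

lemma neighbourhood_in_patch: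
 assumes i: "i < np" and z0: "z0 : V i" and z: "dist z0 z <= h"
  and L: "0 < L" "!!x y. x : unit_square ==> y : unit_square ==> dist (kappa S i x) (kappa S i y) <= L * dist x y"
  and far: "2 * (L * h) <= \<epsilon>" "0 < \<epsilon>" "\<epsilon> <= infdist (kappa S i z0) (K i)"
 shows "z : V i" "\<epsilon> <= 2 * infdist (kappa S i z) (K i)"
proof -
 have zs: "z0 : unit_square" using z0 V_square by blast
 have Lh: "L * dist z0 w <= \<epsilon> / 2" if "dist z0 w <= h" for w
 proof -
  have "L * dist z0 w <= L * h" using that L(1) by simp
  thus ?thesis using far(1) by linarith
 qed
 show zV: "z : V i"
 proof (rule ccontr)
  assume "z ~: V i"
  hence "closed_segment z0 z \<inter> frontier (V i) ~= {}"
   using z0 by (intro connected_Int_frontier) auto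
  then obtain w where w: "w : closed_segment z0 z" "w : frontier (V i)" by blast
  have "w : closure (V i)" "w ~: V i" using w(2) V_open[OF i] by (auto simp: frontier_def interior_open)
  moreover have "closed (unit_square :: (real \<times> real) set)" by (intro closed_Times closed_atLeastAtMost)
  ultimately have ws: "w : unit_square" using closure_minimal[OF V_square] by blast
  have "kappa S i w : K i" using \<open>w \<notin> V i\<close> ws kinv_facts(4)[OF i ws] by (simp add: V_def K_def)
  hence "infdist (kappa S i z0) (K i) <= dist (kappa S i z0) (kappa S i w)" by (rule infdist_le)
  also have "... <= L * dist z0 w" by (rule L(2)[OF zs ws])
  also have "... <= \<epsilon> / 2" using w(1) z dist_in_closed_segment[of w z0 z] by (intro Lh) (simp add: dist_commute)
  finally show False using far by linarith
 qed
 have "infdist (kappa S i z0) (K i) <= infdist (kappa S i z) (K i) + dist (kappa S i z0) (kappa S i z)" by (rule infdist_triangle)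
 also have "dist (kappa S i z0) (kappa S i z) <= \<epsilon> / 2"
  using L(2)[OF zs subsetD[OF V_square zV]] Lh[OF z] by linarith
 finally show "\<epsilon> <= 2 * infdist (kappa S i z) (K i)" using far(3) by linarith
qed

text \<open>Far from the edges a support lies in one patch, and a square that contains its pull-back
  lies in \<open>V i\<close> at comparable distance from the edges. There
  \<open>vanishing_moment_bound\<close> estimates a single coefficient, and bounded overlap of the
  squares allows summation.\<close>

lemma good_coefficients:
 assumes k: "1 <= k" "k <= m" "k <= d" and rho: "0 < rho" "rho < real k"
 obtains R C where "1 <= R" "0 < C"
  "!!i j f. i < np ==> j >= j0 ==> f : C_pw S ==>
   (\<Sum>xi\<in>{xi : N j. xi : patch S i & R / 2 ^ j <= del xi}. ennreal ((wt k rho j xi * cmod (cf f j xi))\<^sup>2))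
   <= ennreal C * (\<Sum>a\<le>k. NN z. ennreal (H i k rho a f z))"
proof -
 obtain c1 c2 where c2: "c1 > 0" "c2 > 0" and supp: "!!j xi. j >= j0 ==> xi : N j ==> closed (supp j xi) & supp j xi <= bd S & xi : supp j xi &
  supp j xi <= cball xi (c2 / 2 ^ j) & ennreal (c1 / 4 ^ j) <= emeasure M (supp j xi)"
  by (rule supp_facts, rule that)
 obtain Cm where Cm: "Cm > 0" "!!j X Y. j >= j0 ==> X : sets borel ==> X <= bd S ==> Y <= N j ==> \<forall>xi\<in>Y. supp j xi <= X ==>
  ennreal (real (card Y)) <= ennreal (Cm * 4 ^ j) * emeasure M X" by (rule card_le_measure, rule that)
 obtain L where L: "L > 0" "!!i x y. i < np ==> x : unit_square ==> y : unit_square ==> dist (kappa S i x) (kappa S i y) <= L * dist x y"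
  "!!i x y. i < np ==> x : G i ==> y : G i ==> dist (kinv i x) (kinv i y) <= L * dist x y" by (rule uniform_lipschitz, rule that)
 obtain B where B: "B > 0" "!!i u. i < np ==> u : borel_measurable M ==>
  (NN z. ennreal ((cmod (u (kappa S i z)))\<^sup>2) * indicator unit_square z) <= ennreal B * (\<integral>\<^sup>+x. ennreal ((cmod (u x))\<^sup>2) \<partial>M)"
  by (rule uniform_pull_back, rule that)
 obtain c where c: "c > 0" "!!i x y. i < np ==> x : patch S i ==> y : bd S - patch S i ==> c * infdist x (K i) <= dist x y"
  using separation by blast
 obtain Cn where Cn: "Cn > 0" "!!j xi. j >= j0 ==> xi : N j ==> Lp_norm M 2 (dual W (Wavelet j xi)) <= ennreal Cn"
  using basis_facts(5) unfolding wavelets_normalized_def by blast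
 \<comment> \<open>The term with \<open>c\<close> keeps supports inside the patch by
   \<open>separation\<close>, the term with \<open>L\<close> keeps the squares of side h inside
   \<open>V i\<close>.\<close>
 define R where "R = 1 + 2 * c2 / c + 4 * (L * (L * c2))"
 \<comment> \<open>Collected from the norm of the pulled-back dual wavelet, from the factor
   \<open>(k + 1) * h ^ (2 * k)\<close> after cancellation of its 2^(-2kj) against the weight, and
   from comparing distances up to a factor 2, which gives 4^k.\<close>
 define C3 where "C3 = B * Cn\<^sup>2 * (real (k + 1) * (2 * L * c2) ^ (2 * k)) * 4 ^ k"
 \<comment> \<open>Bounds the number of squares through one point: the corresponding supports lie in
   a ball of radius (4 L L c2 + c2) / 2^j, and the powers of 4 cancel.\<close>
 define ov where "ov = Cm * (real (np) * (16 * (4 * L * L * c2 + c2)\<^sup>2))"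
 have R: "1 <= R" "c2 < c * R" "4 * (L * (L * c2)) <= R"
 proof -
  have p: "0 <= 2 * c2 / c" "0 <= 4 * (L * (L * c2))" using c c2 L by auto
  show "1 <= R" "4 * (L * (L * c2)) <= R" using p by (auto simp: R_def)
  have "c2 < c + 2 * c2 + c * (4 * (L * (L * c2)))" using c c2 L by (simp add: add_pos_pos)
  also have "... = c * R" using c by (simp add: R_def algebra_simps)
  finally show "c2 < c * R" .
 qed
 have C30: "0 < C3" using B Cn L c2 by (simp add: C3_def)
 have ov0: "0 <= ov" using Cm by (simp add: ov_def)
 show ?thesis
 proof (rule that[OF R(1), of "C3 * (ov + 1)"])
  show "0 < C3 * (ov + 1)" using C30 ov0 by simp
  fix i j f assume i: "i < np" and j: "j >= j0" and f: "f : C_pw S"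
  define Y where "Y = {xi : N j. xi : patch S i & R / 2 ^ j <= del xi}"
  have finY: "finite Y" using N_facts(1)[OF j] by (simp add: Y_def)
  define h where "h = 2 * L * c2 / 2 ^ j"
  have h: "h > 0" using L c2 by (simp add: h_def)
  \<comment> \<open>The support reaches at most c2 / 2^j from xi, hence at most L c2 / 2^j = h / 2
    in the parameters, and is contained in this square about the parameter of xi.\<close>
  define Q where "Q xi = {fst (kinv i xi) - h / 2..fst (kinv i xi) - h / 2 + h} \<times> {snd (kinv i xi) - h / 2..snd (kinv i xi) - h / 2 + h}" for xi
  have KS: "K i <= skeleton S" using i by (auto simp: K_def skeleton_def)
  have Y: "xi : N j" "xi : patch S i" "xi : G i" "kinv i xi : V i" "kappa S i (kinv i xi) = xi" "R / 2 ^ j <= del xi" "del xi <= infdist xi (K i)" "0 < del xi"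
   if "xi : Y" for xi
  proof -
   show 1: "xi : N j" "xi : patch S i" "R / 2 ^ j <= del xi" using that by (auto simp: Y_def)
   thus 2: "xi : G i" using patch_G by blast
   show "kappa S i (kinv i xi) = xi" by (rule kinv_facts(2)[OF i 2])
   thus "kinv i xi : V i" using 1 kinv_facts(1)[OF i 2] by (simp add: V_def)
   show "del xi <= infdist xi (K i)" by (rule infdist_mono[OF KS K_ne[OF i]])
   show "0 < del xi" by (rule less_le_trans[OF _ 1(3)]) (use R(1) in simp)
  qed
  have sp: "supp j xi <= patch S i" if y: "xi : Y" for xi
  proof (rule ccontr)
   assume "\<not> supp j xi <= patch S i"
   then obtain x where x: "x : supp j xi" "x ~: patch S i" by blast
   have xb: "x : bd S - patch S i" "dist xi x <= c2 / 2 ^ j" using x supp[OF j Y(1)[OF y]] by auto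
   have "c * (R / 2 ^ j) <= c * infdist xi (K i)" using Y(6,7)[OF y] c(1) by (intro mult_left_mono) auto
   also have "... <= dist xi x" by (rule c(2)[OF i Y(2)[OF y] xb(1)])
   also have "... <= c2 / 2 ^ j" by (rule xb(2))
   finally show False using R(2) by (simp add: field_simps)
  qed
  have Qd: "dist (kinv i xi) z <= h" if z: "z : Q xi" for z xi
  proof -
   obtain x y where xy: "z = (x, y)" by fastforce
   obtain a b where ab: "kinv i xi = (a, b)" by fastforce
   have "a - h / 2 <= x & x <= a - h / 2 + h & b - h / 2 <= y & y <= b - h / 2 + h" using z by (simp add: Q_def xy ab)
   hence 1: "\<bar>a - x\<bar> <= h / 2" "\<bar>b - y\<bar> <= h / 2" by linarith+
   have "dist (kinv i xi) z = norm (a - x, b - y)" by (simp add: xy ab dist_norm)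
   also have "... <= norm (a - x) + norm (b - y)" by (rule norm_Pair_le)
   also have "... <= h" using 1 by simp
   finally show ?thesis .
  qed
  have nb: "z : V i" "del xi <= 2 * infdist (kappa S i z) (K i)" if y: "xi : Y" and z: "z : Q xi" for xi z
  proof -
   have "2 * (L * h) = 4 * (L * (L * c2)) / 2 ^ j" by (simp add: h_def)
   also have "... <= R / 2 ^ j" by (rule divide_right_mono[OF R(3)]) simp
   also have "... <= del xi" by (rule Y(6)[OF y])
   finally have "2 * (L * h) <= del xi" .
   note * = neighbourhood_in_patch[OF i Y(4)[OF y] Qd[OF z] L(1) L(2)[OF i] this Y(8)[OF y], unfolded Y(5)[OF y], OF _ _ Y(7)[OF y]]
   show "z : V i" by (rule *(1))
   show "del xi <= 2 * infdist (kappa S i z) (K i)" by (rule *(2))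
  qed
  have single: "ennreal ((wt k rho j xi * cmod (cf f j xi))\<^sup>2) <= ennreal C3 * (\<Sum>a\<le>k. NN z. ennreal (H i k rho a f z) * indicator (Q xi) z)"
   if y: "xi : Y" for xi
  proof -
   define eta where "eta z = indicator unit_square z *\<^sub>R cnj (dual W (Wavelet j xi) (kappa S i z))" for z
   note jx = j Y(1)[OF y]
   have dL2: "dual W (Wavelet j xi) : L2_surface S" using windices_L2[OF Wavelet_windex[OF jx]] by blast
   hence dm: "dual W (Wavelet j xi) : borel_measurable M" by (simp add: L2_iff)
   have etacnj: "eta z = cnj (indicator unit_square z *\<^sub>R dual W (Wavelet j xi) (kappa S i z))" for z by (simp add: eta_def indicator_def)
   have etam: "eta : borel_measurable borel"
    unfolding etacnj[abs_def] by (rule borel_measurable_continuous_on[OF _ measurable_kappa[OF i dm], of cnj]) (intro continuous_intros)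
   have etan: "(NN z. ennreal ((norm (eta z))\<^sup>2)) <= ennreal (B * Cn\<^sup>2)"
   proof -
    have "(NN z. ennreal ((norm (eta z))\<^sup>2)) = (NN z. ennreal ((cmod (dual W (Wavelet j xi) (kappa S i z)))\<^sup>2) * indicator unit_square z)"
     by (intro nn_integral_cong) (auto simp: eta_def indicator_def)
    also have "... <= ennreal B * (\<integral>\<^sup>+x. ennreal ((cmod (dual W (Wavelet j xi) x))\<^sup>2) \<partial>M)" by (rule B(2)[OF i dm])
    also have "... = ennreal B * (Lp_norm M 2 (dual W (Wavelet j xi)))\<^sup>2" unfolding Lp_norm_2_power2 ..
    also have "... <= ennreal B * (ennreal Cn)\<^sup>2" by (intro mult_left_mono power_mono Cn(2)[OF jx]) auto
    also have "... = ennreal (B * Cn\<^sup>2)" using B Cn by (simp add: ennreal_mult ennreal_power)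
    finally show ?thesis .
   qed
   have eta0: "eta z = 0" if z: "z ~: Q xi" for z
   proof (rule ccontr)
    assume "eta z ~= 0"
    hence zs: "z : unit_square" and ne: "dual W (Wavelet j xi) (kappa S i z) ~= 0" by (auto simp: eta_def indicator_def split: if_splits)
    have g: "kappa S i z : G i" by (rule kinv_facts(4)[OF i zs])
    have "kappa S i z : supp j xi" unfolding supp_dual_def using ne g G_bd[OF i] by (intro subsetD[OF closure_subset]) blast
    hence ds: "dist xi (kappa S i z) <= c2 / 2 ^ j" using supp[OF jx] by auto
    have "dist (kinv i xi) z = dist (kinv i xi) (kinv i (kappa S i z))" by (simp only: kinv_facts(3)[OF i zs])
    also have "... <= L * dist xi (kappa S i z)" by (rule L(3)[OF i Y(3)[OF y] g])
    also have "... <= L * (c2 / 2 ^ j)" by (rule mult_left_mono[OF ds]) (use L(1) in simp)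
    also have "... = h / 2" by (simp add: h_def)
    finally have dz: "norm (kinv i xi - z) <= h / 2" by (simp add: dist_norm)
    have "\<bar>fst (kinv i xi) - fst z\<bar> <= h / 2" "\<bar>snd (kinv i xi) - snd z\<bar> <= h / 2"
     using abs_fst_le_norm[of "kinv i xi - z"] abs_snd_le_norm[of "kinv i xi - z"] dz by auto
    hence "fst z : {fst (kinv i xi) - h / 2..fst (kinv i xi) - h / 2 + h}" "snd z : {snd (kinv i xi) - h / 2..snd (kinv i xi) - h / 2 + h}"
     unfolding atLeastAtMost_iff by ((intro conjI; linarith)+)
    thus False using z unfolding Q_def by (metis mem_Times_iff)
   qed
   have co: "cf f j xi = (LINT z|lborel. f (kappa S i z) * eta z)" unfolding eta_def by (rule coeff_single[OF i sp[OF y]])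
   have bnd: "ennreal ((norm (LINT z|lborel. f (kappa S i z) * eta z))\<^sup>2) <= (NN z. ennreal ((norm (eta z))\<^sup>2)) * (ennreal (real (k + 1) * h ^ (2 * k)) *
    (\<Sum>a\<le>k. NN z. ennreal ((norm (dk i k a f z))\<^sup>2) * indicator (Q xi) z))"
   proof (rule vanishing_moment_bound[OF _ h Q_def V_open[OF i] _ C_pw_Ck_on[OF i f k(2)] etam eta0])
    show "Q xi <= V i" using nb(1)[OF y] by blast
    show "(NN z. ennreal ((norm (eta z))\<^sup>2)) < \<infinity>" using etan by (rule le_less_trans) simp
    show "(LINT z|lborel. of_real (fst z ^ a * snd z ^ b) * eta z) = 0" if "a + b < k" for a b
     unfolding eta_def by (rule moments[OF jx i sp[OF y]]) (use that k in simp)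
   qed (use k in auto)
   have wt0: "0 <= wt k rho j xi" by simp
   have "ennreal ((wt k rho j xi * cmod (cf f j xi))\<^sup>2) = ennreal ((wt k rho j xi)\<^sup>2) * ennreal ((norm (LINT z|lborel. f (kappa S i z) * eta z))\<^sup>2)"
    unfolding co power_mult_distrib by (rule ennreal_mult) auto
   also have "... <= ennreal ((wt k rho j xi)\<^sup>2) * (ennreal (B * Cn\<^sup>2) * (ennreal (real (k + 1) * h ^ (2 * k)) *
    (\<Sum>a\<le>k. NN z. ennreal ((norm (dk i k a f z))\<^sup>2) * indicator (Q xi) z)))"
    by (intro mult_left_mono order_trans[OF bnd] mult_right_mono etan) auto
   also have "... = ennreal (B * Cn\<^sup>2 * (real (k + 1) * h ^ (2 * k))) * (\<Sum>a\<le>k. ennreal ((wt k rho j xi)\<^sup>2) * (NN z. ennreal ((norm (dk i k a f z))\<^sup>2) * indicator (Q xi) z))"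
    unfolding sum_distrib_left[symmetric] using B(1) Cn(1) h by (subst ennreal_mult[of "B * Cn\<^sup>2"]) (auto simp: mult_ac)
   also have "... <= ennreal (B * Cn\<^sup>2 * (real (k + 1) * h ^ (2 * k))) * (\<Sum>a\<le>k. ennreal (4 ^ (k * j) * 4 ^ k) * (NN z. ennreal (H i k rho a f z) * indicator (Q xi) z))"
   proof (intro mult_left_mono sum_mono)
    fix a assume a: "a : {..k}"
    have ck: "continuous_on (V i) (partials a (k - a) (%z. f (kappa S i z)))"
    proof (rule Ck_on_continuous[of 0], rule Ck_on_partials[OF V_open[OF i]])
     show "Ck_on (a + (k - a) + 0) (V i) (%z. f (kappa S i z))" using C_pw_Ck_on[OF i f k(2)] a by (simp del: Ck_on.simps)
    qed
    have Qb: "Q xi : sets borel" unfolding Q_def by (intro borel_closed closed_Times closed_atLeastAtMost)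
    have pm: "(%z. ennreal ((norm (dk i k a f z))\<^sup>2) * indicator (Q xi) z) : borel_measurable lborel"
    proof -
     have "continuous_on (Q xi) (%z. (norm (dk i k a f z))\<^sup>2)"
      by (intro continuous_on_power continuous_on_norm continuous_on_subset[OF ck]) (use nb(1)[OF y] in blast)
     from borel_measurable_continuous_on_indicator[OF Qb this]
     have "(%z. ennreal (indicator (Q xi) z *\<^sub>R (norm (dk i k a f z))\<^sup>2)) : borel_measurable borel" by measurable
     also have "(%z. ennreal (indicator (Q xi) z *\<^sub>R (norm (dk i k a f z))\<^sup>2))
      = (%z. ennreal ((norm (dk i k a f z))\<^sup>2) * indicator (Q xi) z)" by (auto simp: fun_eq_iff indicator_def)
     finally show ?thesis by simp
    qed
    have Hm: "(%z. ennreal (H i k rho a f z) * indicator (Q xi) z) : borel_measurable lborel"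
     using H_measurable[OF i f k(2), of a] a Qb by simp
    have "ennreal ((wt k rho j xi)\<^sup>2) * (NN z. ennreal ((norm (dk i k a f z))\<^sup>2) * indicator (Q xi) z)
     = (NN z. ennreal ((wt k rho j xi)\<^sup>2) * (ennreal ((norm (dk i k a f z))\<^sup>2) * indicator (Q xi) z))"
     by (rule nn_integral_cmult[OF pm, symmetric])
    also have "... <= (NN z. ennreal (4 ^ (k * j) * 4 ^ k) * (ennreal (H i k rho a f z) * indicator (Q xi) z))"
    proof (rule nn_integral_mono)
     fix z
     show "ennreal ((wt k rho j xi)\<^sup>2) * (ennreal ((norm (dk i k a f z))\<^sup>2) * indicator (Q xi) z)
      <= ennreal (4 ^ (k * j) * 4 ^ k) * (ennreal (H i k rho a f z) * indicator (Q xi) z)"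
     proof (cases "z : Q xi")
      case True
      define I where "I = infdist (kappa S i z) (K i)"
      define P where "P = cmod (dk i k a f z)"
      have I0: "0 <= I" "del xi <= 2 * I" using nb(2)[OF y True] by (auto simp: I_def infdist_nonneg)
      have "del xi powr (real k - rho) <= (2 * I) powr (real k - rho)" using I0 rho by (intro powr_mono2 infdist_nonneg) auto
      also have "... = 2 powr (real k - rho) * I powr (real k - rho)" by (rule powr_mult)
      also have "... <= 2 powr real k * I powr (real k - rho)" using rho by (intro mult_right_mono powr_mono) auto
      finally have "wt k rho j xi * P <= 2 powr (real k * real j) * (2 powr real k * I powr (real k - rho)) * P"
       by (intro mult_right_mono mult_left_mono) (auto simp: P_def)
      also have "... = 2 ^ (k * j) * 2 ^ k * (I powr (real k - rho) * P)"
      proof -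
       have "2 powr (real k * real j) = (2::real) ^ (k * j)" "2 powr real k = (2::real) ^ k"
        by (simp_all add: powr_realpow flip: of_nat_mult)
       thus ?thesis by (simp add: mult_ac)
      qed
      finally have "(wt k rho j xi * P)\<^sup>2 <= (2 ^ (k * j) * 2 ^ k * (I powr (real k - rho) * P))\<^sup>2"
       by (rule power_mono) (simp add: P_def)
      also have "... = (2 ^ (k * j))\<^sup>2 * (2 ^ k)\<^sup>2 * (I powr (real k - rho) * P)\<^sup>2" by (simp only: power_mult_distrib)
      also have "((2::real) ^ (k * j))\<^sup>2 = 4 ^ (k * j)" by (simp add: power2_eq_square power_mult_distrib[symmetric])
      also have "((2::real) ^ k)\<^sup>2 = 4 ^ k" by (simp add: power2_eq_square power_mult_distrib[symmetric])
      finally have "(wt k rho j xi)\<^sup>2 * P\<^sup>2 <= 4 ^ (k * j) * 4 ^ k * (I powr (real k - rho) * P)\<^sup>2" by (simp only: power_mult_distrib)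
      also have "(I powr (real k - rho) * P)\<^sup>2 = H i k rho a f z" using nb(1)[OF y True] by (simp add: H_def I_def P_def)
      finally have "ennreal ((wt k rho j xi)\<^sup>2 * P\<^sup>2) <= ennreal (4 ^ (k * j) * 4 ^ k * H i k rho a f z)" by (rule ennreal_leI)
      moreover have "ennreal ((wt k rho j xi)\<^sup>2 * P\<^sup>2) = ennreal ((wt k rho j xi)\<^sup>2) * ennreal (P\<^sup>2)" by (rule ennreal_mult) auto
      moreover have "ennreal (4 ^ (k * j) * 4 ^ k * H i k rho a f z) = ennreal (4 ^ (k * j) * 4 ^ k) * ennreal (H i k rho a f z)"
       by (rule ennreal_mult) (auto simp: H_def)
      ultimately have "ennreal ((wt k rho j xi)\<^sup>2) * ennreal (P\<^sup>2) <= ennreal (4 ^ (k * j) * 4 ^ k) * ennreal (H i k rho a f z)" by (simp only:)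
      thus ?thesis using True unfolding P_def by (simp only: indicator_simps mult_1_right if_True)
     qed simp
    qed
    also have "... = ennreal (4 ^ (k * j) * 4 ^ k) * (NN z. ennreal (H i k rho a f z) * indicator (Q xi) z)"
     by (rule nn_integral_cmult[OF Hm])
    finally show "ennreal ((wt k rho j xi)\<^sup>2) * (NN z. ennreal ((norm (dk i k a f z))\<^sup>2) * indicator (Q xi) z)
     <= ennreal (4 ^ (k * j) * 4 ^ k) * (NN z. ennreal (H i k rho a f z) * indicator (Q xi) z)" .
   qed simp
   also have "... = ennreal (B * Cn\<^sup>2 * (real (k + 1) * h ^ (2 * k)) * (4 ^ (k * j) * 4 ^ k)) * (\<Sum>a\<le>k. NN z. ennreal (H i k rho a f z) * indicator (Q xi) z)"
    unfolding sum_distrib_left[symmetric] using B(1) Cn(1) h by (subst ennreal_mult[of "B * Cn\<^sup>2 * (real (k + 1) * h ^ (2 * k))"]) (auto simp: mult_ac)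
   also have "B * Cn\<^sup>2 * (real (k + 1) * h ^ (2 * k)) * (4 ^ (k * j) * 4 ^ k) = C3"
   proof -
    have "(4::real) ^ (k * j) = (2 ^ j) ^ (2 * k)" by (simp add: power_mult[symmetric] mult.commute[of j] mult.left_commute[of j] mult.assoc) (simp add: power_mult)
    hence "h ^ (2 * k) * 4 ^ (k * j) = (2 * L * c2) ^ (2 * k)" by (simp add: h_def power_divide)
    thus ?thesis by (simp add: C3_def mult_ac)
   qed
   finally show ?thesis .
  qed
  have overlap: "(\<Sum>xi\<in>Y. indicator (Q xi) z) <= ennreal ov" for z
  proof -
   define Yz where "Yz = {xi : Y. z : Q xi}"
   have "(\<Sum>xi\<in>Y. indicator (Q xi) z :: ennreal) = ennreal (real (card Yz))"
   proof -
    have "Y \<inter> {xi. z : Q xi} = Yz" by (auto simp: Yz_def)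
    thus ?thesis using finY by (simp add: indicator_def ennreal_of_nat_eq_real_of_nat)
   qed
   also have "... <= ennreal ov"
   proof (cases "Yz = {}")
    case True
    thus ?thesis by simp
   next
    case False
    then obtain xi0 where x0: "xi0 : Y" "z : Q xi0" by (auto simp: Yz_def)
    define r where "r = (4 * L * L * c2 + c2) / 2 ^ j"
    have r0: "0 <= r" using L c2 by (simp add: r_def)
    have "ennreal (real (card Yz)) <= ennreal (Cm * 4 ^ j) * emeasure M (bd S \<inter> cball xi0 r)"
    proof (rule Cm(2)[OF j _ _ _ ballI])
     fix xi assume "xi : Yz"
     hence x: "xi : Y" "z : Q xi" by (auto simp: Yz_def)
     have "dist xi0 xi = dist (kappa S i (kinv i xi0)) (kappa S i (kinv i xi))" by (simp only: Y(5)[OF x0(1)] Y(5)[OF x(1)])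
     also have "... <= L * dist (kinv i xi0) (kinv i xi)" using Y(4)[OF x0(1)] Y(4)[OF x(1)] V_square by (intro L(2)[OF i]) blast+
     also have "... <= L * (h + h)"
      using L(1) Qd[OF x0(2)] Qd[OF x(2)] dist_triangle2[of "kinv i xi0" "kinv i xi" z] by (intro mult_left_mono) auto
     finally have dx: "dist xi0 xi <= 4 * L * L * c2 / 2 ^ j" by (simp add: h_def mult_ac)
     show "supp j xi <= bd S \<inter> cball xi0 r"
     proof
      fix y assume "y : supp j xi"
      hence "y : bd S" "dist xi y <= c2 / 2 ^ j" using supp[OF j Y(1)[OF x(1)]] by auto
      thus "y : bd S \<inter> cball xi0 r" using dx dist_triangle[of xi0 y xi] by (simp add: r_def add_divide_distrib)
     qed
    qed (use bd_closed Y(1) in \<open>auto simp: Yz_def intro!: borel_closed closed_Int\<close>)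
    also have "... <= ennreal (Cm * 4 ^ j) * ennreal (real (np) * (16 * r\<^sup>2))"
     by (intro mult_left_mono emeasure_ball_le[of _ xi0, OF _ _ _ r0]) (use bd_closed in \<open>auto intro!: borel_closed closed_Int\<close>)
    also have "... = ennreal (Cm * 4 ^ j * (real (np) * (16 * r\<^sup>2)))" using Cm(1) by (simp add: ennreal_mult)
    also have "Cm * 4 ^ j * (real (np) * (16 * r\<^sup>2)) = ov"
    proof -
     have "(4::real) ^ j = (2 ^ j)\<^sup>2" by (simp add: power2_eq_square power_mult_distrib[symmetric])
     hence "4 ^ j * r\<^sup>2 = (4 * L * L * c2 + c2)\<^sup>2" by (simp add: r_def power_divide)
     thus ?thesis by (simp add: ov_def mult_ac)
    qed
    finally show ?thesis .
   qed
   finally show ?thesis .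
  qed
  have "(\<Sum>xi\<in>Y. ennreal ((wt k rho j xi * cmod (cf f j xi))\<^sup>2)) <= (\<Sum>xi\<in>Y. ennreal C3 * (\<Sum>a\<le>k. NN z. ennreal (H i k rho a f z) * indicator (Q xi) z))"
   by (rule sum_mono[OF single])
  also have "... = ennreal C3 * (\<Sum>a\<le>k. \<Sum>xi\<in>Y. NN z. ennreal (H i k rho a f z) * indicator (Q xi) z)"
   unfolding sum_distrib_left[symmetric] by (subst sum.swap) (rule refl)
  also have "... <= ennreal C3 * (\<Sum>a\<le>k. ennreal ov * (NN z. ennreal (H i k rho a f z)))"
  proof (intro mult_left_mono sum_mono)
   fix a assume "a : {..k}"
   hence Hm: "(%z. ennreal (H i k rho a f z)) : borel_measurable lborel" using H_measurable[OF i f k(2), of a] by simp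
   have Qb: "Q xi : sets lborel" for xi unfolding Q_def sets_lborel by (intro borel_closed closed_Times closed_atLeastAtMost)
   have "(\<Sum>xi\<in>Y. NN z. ennreal (H i k rho a f z) * indicator (Q xi) z) = (NN z. (\<Sum>xi\<in>Y. ennreal (H i k rho a f z) * indicator (Q xi) z))"
    by (rule nn_integral_sum[symmetric]) (use Hm Qb in \<open>auto intro!: borel_measurable_times_ennreal borel_measurable_indicator simp del: sets_lborel\<close>)
   also have "... <= (NN z. ennreal ov * ennreal (H i k rho a f z))"
   proof (rule nn_integral_mono)
    fix z
    show "(\<Sum>xi\<in>Y. ennreal (H i k rho a f z) * indicator (Q xi) z) <= ennreal ov * ennreal (H i k rho a f z)"
     unfolding sum_distrib_left[symmetric] using mult_left_mono[OF overlap[of z], of "ennreal (H i k rho a f z)"] by (simp add: mult.commute)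
   qed
   also have "... = ennreal ov * (NN z. ennreal (H i k rho a f z))" by (rule nn_integral_cmult[OF Hm])
   finally show "(\<Sum>xi\<in>Y. NN z. ennreal (H i k rho a f z) * indicator (Q xi) z) <= ennreal ov * (NN z. ennreal (H i k rho a f z))" .
  qed simp
  also have "... = ennreal (C3 * ov) * (\<Sum>a\<le>k. NN z. ennreal (H i k rho a f z))"
   unfolding sum_distrib_left[symmetric] using C30 ov0 by (simp add: ennreal_mult mult.assoc)
  also have "... <= ennreal (C3 * (ov + 1)) * (\<Sum>a\<le>k. NN z. ennreal (H i k rho a f z))"
   using C30 ov0 by (intro mult_right_mono ennreal_leI) (auto simp: algebra_simps)
  finally show "(\<Sum>xi\<in>{xi : N j. xi : patch S i & R / 2 ^ j <= del xi}. ennreal ((wt k rho j xi * cmod (cf f j xi))\<^sup>2))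
   <= ennreal (C3 * (ov + 1)) * (\<Sum>a\<le>k. NN z. ennreal (H i k rho a f z))" unfolding Y_def .
 qed
qed

end

section \<open>From piecewise smooth functions to the weighted space\<close>

context wavelet_surface
begin

text \<open>On a patch whose closure misses the vertex the localized function vanishes; the other
  patches are those of \<open>H_le_weighted\<close>.\<close>

lemma H_localized_le:
 assumes n: "n < num_vertices S" and i: "i < np"
  and k: "1 <= k" "k <= m" and rho: "0 < rho" "rho < real k"
 shows "\<exists>C>0. \<forall>v\<in>C_pw S. \<forall>a\<le>k. (NN z. ennreal (H i k rho a (%x. complex_of_real (phi Z n x) * v x) z))
  <= ennreal C * (X_cone_norm S n k rho (%x. if x : bd S then complex_of_real (phi Z n x) * v x else 0))\<^sup>2"
proof (cases "vertex S n : G i")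
 case True
 thus ?thesis by (rule H_le_weighted[OF n i _ k rho])
next
 case False
 have "H i k rho a (%x. complex_of_real (phi Z n x) * v x) z = 0" for a v z
 proof (cases "z : V i")
  case z: True
  have "partials a (k - a) (%z. complex_of_real (phi Z n (kappa S i z)) * v (kappa S i z)) z = partials a (k - a) (%z. 0) z"
   by (rule partials_cong[OF V_open[OF i] z]) (use phi_zero[OF n i False] in \<open>simp add: V_def\<close>)
  thus ?thesis by (simp add: H_def partials_zero)
 qed (simp add: H_def)
 thus ?thesis by (intro exI[of _ 1]) simp
qed

lemma coeff_localized:
 assumes j: "j >= j0" "xi : N j" and v: "v : C_pw S"
 shows "cf v j xi = (\<Sum>n<num_vertices S. cf (%x. complex_of_real (phi Z n x) * v x) j xi)"
proof -
 have d: "dual W (Wavelet j xi) : L2_surface S" using windices_L2[OF Wavelet_windex[OF j]] by blast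
 have "inner_surface S v (dual W (Wavelet j xi)) = inner_surface S (%x. \<Sum>n<num_vertices S. 1 * (complex_of_real (phi Z n x) * v x)) (dual W (Wavelet j xi))"
 proof (rule inner_cong)
  fix x assume "x : bd S"
  hence "(\<Sum>n<num_vertices S. complex_of_real (phi Z n x)) = 1" using res_sum[of x] by (simp flip: of_real_sum)
  thus "v x = (\<Sum>n<num_vertices S. 1 * (complex_of_real (phi Z n x) * v x))" by (simp flip: sum_distrib_right)
 qed
 also have "... = (\<Sum>n<num_vertices S. 1 * inner_surface S (%x. complex_of_real (phi Z n x) * v x) (dual W (Wavelet j xi)))"
  by (rule inner_sum[OF d]) (use v in \<open>auto intro!: C_pw_L2 C_pw_mult res_vertex(2)\<close>)
 finally show ?thesis by (simp add: coeff_at_def)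
qed

text \<open>The resolution of unity splits each coefficient into those of the localized functions.
  Cauchy-Schwarz over the vertices and summation over the patches yield a constant that depends on
  neither the level nor the function.\<close>

lemma good_coefficients_X:
 assumes k: "1 <= k" "k <= m" "k <= d" and rho: "0 < rho" "rho < real k"
 obtains R C where "1 <= R" "0 <= C"
  "!!j v. j >= j0 ==> v : C_pw S ==>
   (\<Sum>xi\<in>{xi : N j. R / 2 ^ j <= del xi}. ennreal ((wt k rho j xi * cmod (cf v j xi))\<^sup>2)) <= ennreal C * (X_norm S Z k rho v)\<^sup>2"
proof -
 obtain R C where RC: "1 <= R" "0 < C" and gc: "!!i j f. i < np ==> j >= j0 ==> f : C_pw S ==>
   (\<Sum>xi\<in>{xi : N j. xi : patch S i & R / 2 ^ j <= del xi}. ennreal ((wt k rho j xi * cmod (cf f j xi))\<^sup>2))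
   <= ennreal C * (\<Sum>a\<le>k. NN z. ennreal (H i k rho a f z))"
  by (rule good_coefficients[OF k rho], rule that)
 define Xc where "Xc n v = X_cone_norm S n k rho (%x. if x : bd S then complex_of_real (phi Z n x) * v x else 0)" for n v
 define fn where "fn n v x = complex_of_real (phi Z n x) * v x" for n v x
 have Xn: "Xc n v <= X_norm S Z k rho v" if "n < num_vertices S" for n v
  unfolding X_norm_def Xc_def
  by (rule member_le_sum[of n "{..<num_vertices S}" "%n. X_cone_norm S n k rho (%x. if x : bd S then complex_of_real (phi Z n x) * v x else 0)"])
   (use that in auto)
 have "\<forall>q\<in>{..<num_vertices S} \<times> {..<np}. \<exists>C>0. \<forall>v\<in>C_pw S. \<forall>a\<le>k.
  (NN z. ennreal (H (snd q) k rho a (fn (fst q) v) z)) <= ennreal C * (Xc (fst q) v)\<^sup>2"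
  unfolding Xc_def fn_def[abs_def] by (intro ballI H_localized_le k(1,2) rho) auto
 from bchoice[OF this] obtain c where c: "\<forall>q\<in>{..<num_vertices S} \<times> {..<np}. c q > 0 & (\<forall>v\<in>C_pw S. \<forall>a\<le>k.
  (NN z. ennreal (H (snd q) k rho a (fn (fst q) v) z)) <= ennreal (c q) * (Xc (fst q) v)\<^sup>2)" ..
 define C' where "C' = (\<Sum>q\<in>{..<num_vertices S} \<times> {..<np}. c q)"
 have c0: "0 <= c q" if "q : {..<num_vertices S} \<times> {..<np}" for q using bspec[OF c that] by (elim conjE) (rule less_imp_le)
 have C'0: "0 <= C'" unfolding C'_def by (rule sum_nonneg[OF c0])
 have HX: "(NN z. ennreal (H i k rho a (fn n v) z)) <= ennreal C' * (X_norm S Z k rho v)\<^sup>2"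
  if n: "n < num_vertices S" and i: "i < np" and v: "v : C_pw S" and a: "a <= k" for n i v a
 proof -
  have q: "(n, i) : {..<num_vertices S} \<times> {..<np}" using n i by simp
  have "(NN z. ennreal (H i k rho a (fn n v) z)) <= ennreal (c (n, i)) * (Xc n v)\<^sup>2"
   using bspec[OF c q] v a by simp
  also have "... <= ennreal C' * (X_norm S Z k rho v)\<^sup>2"
   unfolding C'_def by (intro mult_mono power_mono Xn[OF n] ennreal_leI member_le_sum[OF q]) (use c0 in auto)
  finally show ?thesis .
 qed
 let ?nv = "num_vertices S" and ?np = "np"
 define C'' where "C'' = C * (real (Suc k) * C')"
 have C''0: "0 <= C''" using RC C'0 by (simp add: C''_def)
 show ?thesis
 proof (rule that[OF RC(1), of "real ?np * (real ?nv * (real ?nv * C''))"])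
  show "0 <= real ?np * (real ?nv * (real ?nv * C''))" using C''0 by simp
  fix j v assume j: "j >= j0" and v: "v : C_pw S"
  let ?G = "{xi : N j. R / 2 ^ j <= del xi}"
  define g where "g xi = ennreal ((wt k rho j xi * cmod (cf v j xi))\<^sup>2)" for xi
  have finG: "finite ?G" using N_facts(1)[OF j] by simp
  have fv: "fn n v : C_pw S" if "n < ?nv" for n unfolding fn_def[abs_def] by (rule C_pw_mult[OF res_vertex(2)[OF that] v])
  \<comment> \<open>Positive distance to the skeleton puts xi into an open patch, so at least one of
    the summands over the patches is \<open>g xi\<close>.\<close>
  have "(\<Sum>xi\<in>?G. g xi) <= (\<Sum>xi\<in>?G. \<Sum>i<?np. if xi : patch S i then g xi else 0)"
  proof (rule sum_mono)
   fix xi assume x: "xi : ?G"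
   obtain i where i: "i < ?np" "xi : G i" using N_facts(2)[OF j, of xi] x by blast
   have d0: "0 < del xi" by (rule less_le_trans[of _ "R / 2 ^ j"]) (use x RC(1) in auto)
   have "xi : patch S i"
   proof (rule ccontr)
    assume "xi ~: patch S i"
    hence "xi : skeleton S" using i by (auto simp: skeleton_def)
    thus False using d0 by simp
   qed
   hence "g xi = (if xi : patch S i then g xi else 0)" by simp
   also have "... <= (\<Sum>i<?np. if xi : patch S i then g xi else 0)"
    by (rule member_le_sum[of i "{..<?np}" "%i. if xi : patch S i then g xi else 0"]) (use i in auto)
   finally show "g xi <= (\<Sum>i<?np. if xi : patch S i then g xi else 0)" .
  qed
  also have "... = (\<Sum>i<?np. \<Sum>xi\<in>?G. if xi : patch S i then g xi else 0)" by (rule sum.swap)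
  also have "... <= (\<Sum>i<?np. ennreal (real ?nv * (real ?nv * C'')) * (X_norm S Z k rho v)\<^sup>2)"
  proof (rule sum_mono)
   fix i assume "i : {..<?np}"
   hence i: "i < ?np" by simp
   let ?Y = "{xi : N j. xi : patch S i & R / 2 ^ j <= del xi}"
   have "{xi : ?G. xi : patch S i} = ?Y" by auto
   hence "(\<Sum>xi\<in>?G. if xi : patch S i then g xi else 0) = (\<Sum>xi\<in>?Y. g xi)"
    using sum.inter_filter[OF finG, of g "%xi. xi : patch S i"] by simp
   also have "... <= (\<Sum>xi\<in>?Y. \<Sum>n<?nv. ennreal (real ?nv) * ennreal ((wt k rho j xi * cmod (cf (fn n v) j xi))\<^sup>2))"
   proof (rule sum_mono)
    fix xi assume x: "xi : ?Y"
    have "(wt k rho j xi * cmod (cf v j xi))\<^sup>2 <= (\<Sum>n<?nv. wt k rho j xi * cmod (cf (fn n v) j xi))\<^sup>2"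
     using coeff_localized[OF j, of xi v] x v unfolding fn_def[abs_def] sum_distrib_left[symmetric]
     by (intro power_mono mult_left_mono) (auto intro: norm_sum)
    also have "... <= (\<Sum>n<?nv. (wt k rho j xi * cmod (cf (fn n v) j xi))\<^sup>2) * real (card {..<?nv})" by (rule sum_squared_le_sum_of_squares)
    also have "... = (\<Sum>n<?nv. real ?nv * (wt k rho j xi * cmod (cf (fn n v) j xi))\<^sup>2)" unfolding sum_distrib_right card_lessThan by (intro sum.cong refl mult.commute)
    finally have "g xi <= ennreal (\<Sum>n<?nv. real ?nv * (wt k rho j xi * cmod (cf (fn n v) j xi))\<^sup>2)" unfolding g_def by (rule ennreal_leI)
    also have "... = (\<Sum>n<?nv. ennreal (real ?nv * (wt k rho j xi * cmod (cf (fn n v) j xi))\<^sup>2))" by (rule sum_ennreal[symmetric]) simp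
    also have "... = (\<Sum>n<?nv. ennreal (real ?nv) * ennreal ((wt k rho j xi * cmod (cf (fn n v) j xi))\<^sup>2))"
     by (intro sum.cong refl ennreal_mult) auto
    finally show "g xi <= (\<Sum>n<?nv. ennreal (real ?nv) * ennreal ((wt k rho j xi * cmod (cf (fn n v) j xi))\<^sup>2))" .
   qed
   also have "... = (\<Sum>n<?nv. ennreal (real ?nv) * (\<Sum>xi\<in>?Y. ennreal ((wt k rho j xi * cmod (cf (fn n v) j xi))\<^sup>2)))"
    by (subst sum.swap) (simp only: sum_distrib_left)
   also have "... <= (\<Sum>n<?nv. ennreal (real ?nv) * (ennreal C'' * (X_norm S Z k rho v)\<^sup>2))"
   proof (intro sum_mono mult_left_mono)
    fix n assume "n : {..<?nv}"
    hence n: "n < ?nv" by simp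
    have "(\<Sum>xi\<in>?Y. ennreal ((wt k rho j xi * cmod (cf (fn n v) j xi))\<^sup>2)) <= ennreal C * (\<Sum>a\<le>k. NN z. ennreal (H i k rho a (fn n v) z))"
     by (rule gc[OF i j fv[OF n]])
    also have "... <= ennreal C * (\<Sum>a\<le>k. ennreal C' * (X_norm S Z k rho v)\<^sup>2)"
     by (intro mult_left_mono sum_mono HX[OF n i v]) auto
    also have "... = ennreal C'' * (X_norm S Z k rho v)\<^sup>2"
     using RC C'0 by (simp add: C''_def ennreal_mult ennreal_of_nat_eq_real_of_nat[symmetric] mult.assoc del: of_nat_Suc)
    finally show "(\<Sum>xi\<in>?Y. ennreal ((wt k rho j xi * cmod (cf (fn n v) j xi))\<^sup>2)) <= ennreal C'' * (X_norm S Z k rho v)\<^sup>2" .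
   qed simp
   also have "... = ennreal (real ?nv * (real ?nv * C'')) * (X_norm S Z k rho v)\<^sup>2"
    using C''0 by (simp add: ennreal_mult ennreal_of_nat_eq_real_of_nat[symmetric] mult.assoc)
   finally show "(\<Sum>xi\<in>?G. if xi : patch S i then g xi else 0) <= ennreal (real ?nv * (real ?nv * C'')) * (X_norm S Z k rho v)\<^sup>2" .
  qed
  also have "... = ennreal (real ?np * (real ?nv * (real ?nv * C''))) * (X_norm S Z k rho v)\<^sup>2"
   using C''0 by (simp add: ennreal_mult ennreal_of_nat_eq_real_of_nat[symmetric] mult.assoc)
  finally show "(\<Sum>xi\<in>?G. ennreal ((wt k rho j xi * cmod (cf v j xi))\<^sup>2)) <= ennreal (real ?np * (real ?nv * (real ?nv * C''))) * (X_norm S Z k rho v)\<^sup>2"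
   unfolding g_def .
 qed
qed

text \<open>The approximating smooth functions have bounded norms from some index \<open>q\<close>
  on, by the Cauchy property. Every level contains finitely many wavelets, so the bound passes to
  the limit coefficient by coefficient, without derivatives of \<open>u\<close> itself.\<close>

lemma X_space_coefficients:
 assumes k: "1 <= k" "k <= m" "k <= d" and rho: "0 < rho" "rho < real k" and u: "u : X_space S Z k rho"
 obtains R B where "1 <= R"
  "!!j. j >= j0 ==> (\<Sum>xi\<in>{xi : N j. R / 2 ^ j <= del xi}. (wt k rho j xi * cmod (cf u j xi))\<^sup>2) <= B"
proof -
 obtain R C where RC: "1 <= R" "0 <= C" and gc: "!!j v. j >= j0 ==> v : C_pw S ==>
   (\<Sum>xi\<in>{xi : N j. R / 2 ^ j <= del xi}. ennreal ((wt k rho j xi * cmod (cf v j xi))\<^sup>2)) <= ennreal C * (X_norm S Z k rho v)\<^sup>2"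
  by (rule good_coefficients_X[OF k rho], rule that)
 obtain v where uL: "u : L2_surface S" and v: "!!l. v l : C_pw S & X_norm S Z k rho (v l) < \<infinity>"
  and cau: "\<forall>\<epsilon>>0. \<exists>M. \<forall>m\<ge>M. \<forall>l\<ge>M. X_norm S Z k rho (%x. v m x - v l x) < \<epsilon>"
  and lim: "(%l :: nat. Lp_norm M 2 (%x. u x - v l x)) \<longlonglongrightarrow> 0"
  using u unfolding X_space_def by blast
 have vL: "v l : L2_surface S" for l using v[of l] C_pw_L2 by blast
 obtain q where q: "!!l. l >= q ==> X_norm S Z k rho (%x. v l x - v q x) < 1" using cau[rule_format, of 1] by (auto simp: zero_less_one)
 define x where "x = enn2real (X_norm S Z k rho (v q))"
 have x: "X_norm S Z k rho (v q) = ennreal x" "0 <= x" using v[of q] by (auto simp: x_def)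
 \<comment> \<open>The first part belongs to the difference to \<open>v q\<close>, whose norm is
   below 1, the second to \<open>v q\<close> itself.\<close>
 define B where "B = 2 * C + 2 * (C * x\<^sup>2)"
 have B0: "0 <= B" using RC by (simp add: B_def)
 show ?thesis
 proof (rule that[OF RC(1)])
  fix j assume j: "j >= j0"
  let ?G = "{xi : N j. R / 2 ^ j <= del xi}"
  have bnd: "(\<Sum>xi\<in>?G. (wt k rho j xi * cmod (cf (v l) j xi))\<^sup>2) <= B" if l: "l >= q" for l
  proof -
   define w where "w y = v l y - v q y" for y
   have w: "w : C_pw S" unfolding w_def[abs_def] using v by (intro C_pw_diff) auto
   have "(\<Sum>xi\<in>?G. ennreal ((wt k rho j xi * cmod (cf w j xi))\<^sup>2)) <= ennreal C * 1\<^sup>2"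
    by (rule order_trans[OF gc[OF j w]], intro mult_left_mono power_mono) (use q[OF l] in \<open>auto simp: w_def[abs_def]\<close>)
   hence 1: "(\<Sum>xi\<in>?G. (wt k rho j xi * cmod (cf w j xi))\<^sup>2) <= C"
    using RC by (subst (asm) sum_ennreal) auto
   have "(\<Sum>xi\<in>?G. ennreal ((wt k rho j xi * cmod (cf (v q) j xi))\<^sup>2)) <= ennreal (C * x\<^sup>2)"
    using gc[OF j, of "v q"] v[of q] RC x by (simp add: ennreal_mult ennreal_power)
   hence 2: "(\<Sum>xi\<in>?G. (wt k rho j xi * cmod (cf (v q) j xi))\<^sup>2) <= C * x\<^sup>2"
    using RC by (subst (asm) sum_ennreal) auto
   have "(\<Sum>xi\<in>?G. (wt k rho j xi * cmod (cf (v l) j xi))\<^sup>2)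
    <= (\<Sum>xi\<in>?G. 2 * (wt k rho j xi * cmod (cf w j xi))\<^sup>2 + 2 * (wt k rho j xi * cmod (cf (v q) j xi))\<^sup>2)"
   proof (rule sum_mono)
    fix xi assume "xi : ?G"
    hence xj: "xi : N j" by simp
    define a where "a = wt k rho j xi * cmod (cf w j xi)"
    define b where "b = wt k rho j xi * cmod (cf (v q) j xi)"
    have "cf (v l) j xi = cf w j xi + cf (v q) j xi"
     unfolding w_def[abs_def] coeff_diff[OF j xj vL vL] by simp
    hence "wt k rho j xi * cmod (cf (v l) j xi) <= a + b"
     unfolding a_def b_def distrib_left[symmetric] by (intro mult_left_mono) (auto intro: norm_triangle_ineq)
    hence "(wt k rho j xi * cmod (cf (v l) j xi))\<^sup>2 <= (a + b)\<^sup>2" by (rule power_mono) simp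
    also have "... <= 2 * a\<^sup>2 + 2 * b\<^sup>2" using sum_squares_bound[of a b] by (simp add: power2_sum)
    finally show "(wt k rho j xi * cmod (cf (v l) j xi))\<^sup>2 <= 2 * (wt k rho j xi * cmod (cf w j xi))\<^sup>2 + 2 * (wt k rho j xi * cmod (cf (v q) j xi))\<^sup>2"
     unfolding a_def b_def .
   qed
   also have "... = 2 * (\<Sum>xi\<in>?G. (wt k rho j xi * cmod (cf w j xi))\<^sup>2) + 2 * (\<Sum>xi\<in>?G. (wt k rho j xi * cmod (cf (v q) j xi))\<^sup>2)"
    by (simp only: sum.distrib sum_distrib_left)
   also have "... <= B" unfolding B_def using 1 2 by linarith
   finally show ?thesis .
  qed
  have "(%l. \<Sum>xi\<in>?G. (wt k rho j xi * cmod (cf (v l) j xi))\<^sup>2) \<longlonglongrightarrow> (\<Sum>xi\<in>?G. (wt k rho j xi * cmod (cf u j xi))\<^sup>2)"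
   by (intro tendsto_sum tendsto_power tendsto_mult tendsto_const tendsto_norm coeff_tendsto[OF j _ uL vL lim]) auto
  thus "(\<Sum>xi\<in>?G. (wt k rho j xi * cmod (cf u j xi))\<^sup>2) <= B"
   by (rule LIMSEQ_le_const2) (use bnd in blast)
 qed
qed

end

section \<open>Sequence spaces\<close>

text \<open>A weighted geometric mean is at most the maximum. This additive form takes the place of
  Hoelder's inequality: terms are bounded one by one and then summed.\<close>

lemma powr_young:
 fixes x y l :: real
 assumes "0 <= x" "0 <= y" "0 <= l" "l <= 1"
 shows "x powr l * y powr (1 - l) <= x + y"
proof -
 define z where "z = max x y"
 have "x powr l * y powr (1 - l) <= z powr l * z powr (1 - l)"
  using assms by (intro mult_mono powr_mono2) (auto simp: z_def)
 also have "... = z powr (l + (1 - l))" by (rule powr_add[symmetric])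
 also have "... = z" using assms by (simp add: z_def)
 also have "... <= x + y" using assms by (simp add: z_def)
 finally show ?thesis .
qed

text \<open>Layers between 2^l t and 2^(l+1) t: each contains at most c 2^(l+1) t points with terms
  at most (2^l t)^(-b), so the sums over the layers form a geometric series of ratio 2^(1-b), which
  converges because b > 1.\<close>

lemma sum_dyadic_layers:
 fixes \<delta> :: "'a => real"
 assumes Y: "finite Y" and t: "t > 0" "!!xi. xi : Y ==> t <= \<delta> xi" and b: "1 < b" and c: "0 <= c"
  and layer: "!!eta. t <= eta ==> real (card {xi : Y. \<delta> xi <= eta}) <= c * eta"
 shows "(\<Sum>xi\<in>Y. \<delta> xi powr (- b)) <= c * (2 / (1 - 2 powr (1 - b))) * t powr (1 - b)"
proof -
 have "\<exists>l. 2 ^ l * t <= \<delta> xi & \<delta> xi <= 2 ^ Suc l * t" if x: "xi : Y" for xi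
 proof -
  obtain N where "\<delta> xi / t < 2 ^ N" using real_arch_pow[of 2 "\<delta> xi / t"] by auto
  hence "\<delta> xi < 2 ^ N * t" using t(1) by (simp add: field_simps)
  also have "... <= 2 ^ Suc N * t" using t(1) by simp
  finally have ex: "\<exists>l. \<delta> xi <= 2 ^ Suc l * t" by (intro exI[of _ N]) simp
  define l where "l = (LEAST l. \<delta> xi <= 2 ^ Suc l * t)"
  have l: "\<delta> xi <= 2 ^ Suc l * t" unfolding l_def by (rule LeastI_ex[OF ex])
  have "2 ^ l * t <= \<delta> xi"
  proof (cases l)
   case (Suc l')
   hence "\<not> \<delta> xi <= 2 ^ Suc l' * t" unfolding l_def by (intro not_less_Least) simp
   thus ?thesis using Suc by simp
  qed (use t(2)[OF x] in simp)
  thus ?thesis using l by blast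
 qed
 then obtain l where l: "!!xi. xi : Y ==> 2 ^ l xi * t <= \<delta> xi & \<delta> xi <= 2 ^ Suc (l xi) * t" by metis
 \<comment> \<open>One more than the largest layer index; the inserted 0 provides for an empty
   set.\<close>
 define N where "N = Suc (Max (insert 0 (l ` Y)))"
 define q where "q = (2::real) powr (1 - b)"
 have q: "0 < q" "q < 1" using b by (auto simp: q_def powr_less_one)
 have lN: "l xi < N" if "xi : Y" for xi using that Y by (auto simp: N_def less_Suc_eq_le)
 have "(\<Sum>xi\<in>Y. \<delta> xi powr (- b)) <= (\<Sum>xi\<in>Y. \<Sum>n<N. if \<delta> xi <= 2 ^ Suc n * t then (2 ^ n * t) powr (- b) else 0)"
 proof (rule sum_mono)
  fix xi assume x: "xi : Y"
  have "\<delta> xi powr (- b) <= (2 ^ l xi * t) powr (- b)" using l[OF x] t(1) b by (intro powr_mono2') auto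
  also have "... = (if \<delta> xi <= 2 ^ Suc (l xi) * t then (2 ^ l xi * t) powr (- b) else 0)" using l[OF x] by simp
  also have "... <= (\<Sum>n<N. if \<delta> xi <= 2 ^ Suc n * t then (2 ^ n * t) powr (- b) else 0)"
   by (rule member_le_sum[of "l xi" "{..<N}" "%n. if \<delta> xi <= 2 ^ Suc n * t then (2 ^ n * t) powr (- b) else 0"])
    (use lN[OF x] in auto)
  finally show "\<delta> xi powr (- b) <= (\<Sum>n<N. if \<delta> xi <= 2 ^ Suc n * t then (2 ^ n * t) powr (- b) else 0)" .
 qed
 also have "... = (\<Sum>n<N. \<Sum>xi\<in>Y. if \<delta> xi <= 2 ^ Suc n * t then (2 ^ n * t) powr (- b) else 0)" by (rule sum.swap)
 also have "... = (\<Sum>n<N. real (card {xi : Y. \<delta> xi <= 2 ^ Suc n * t}) * (2 ^ n * t) powr (- b))"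
  using Y by (simp add: sum.inter_filter[symmetric])
 also have "... <= (\<Sum>n<N. c * (2 ^ Suc n * t) * (2 ^ n * t) powr (- b))"
 proof (intro sum_mono mult_right_mono layer)
  show "t <= 2 ^ Suc n * t" for n using t(1) one_le_power[of "2::real" "Suc n"] by (simp del: power_Suc)
 qed simp
 also have "... = (\<Sum>n<N. c * 2 * t powr (1 - b) * q ^ n)"
 proof (rule sum.cong[OF refl])
  fix n
  have "(2 ^ n * t) * (2 ^ n * t) powr (- b) = (2 ^ n * t) powr (1 - b)"
   using t(1) by (simp add: powr_diff powr_minus field_simps)
  also have "... = (2 ^ n) powr (1 - b) * t powr (1 - b)" using t(1) by (simp add: powr_mult)
  also have "(2 ^ n :: real) powr (1 - b) = q ^ n"
   unfolding q_def by (simp add: powr_realpow[symmetric] powr_powr mult.commute)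
  finally show "c * (2 ^ Suc n * t) * (2 ^ n * t) powr (- b) = c * 2 * t powr (1 - b) * q ^ n"
   by (simp add: mult_ac)
 qed
 also have "... = c * 2 * t powr (1 - b) * (\<Sum>n<N. q ^ n)" by (simp add: sum_distrib_left)
 also have "... <= c * 2 * t powr (1 - b) * (1 / (1 - q))"
 proof (rule mult_left_mono)
  have "(\<Sum>n<N. q ^ n) = (1 - q ^ N) / (1 - q)" using q by (simp add: sum_gp_strict)
  also have "... <= 1 / (1 - q)" using q by (intro divide_right_mono) auto
  finally show "(\<Sum>n<N. q ^ n) <= 1 / (1 - q)" .
 qed (use c in simp)
 finally show ?thesis by (simp add: q_def)
qed

text \<open>Young's inequality with a free weight x. The exponent t/(2-t) is forced: x has to cancel
  between a factor raised to t/2 and one raised to 1 - t/2.\<close>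

lemma powr_young_power:
 fixes a :: real
 assumes a: "0 <= a" "0 < x" and t: "0 < t" "t < 2"
 shows "a powr t <= x * a\<^sup>2 + x powr (- (t / (2 - t)))"
proof -
 have "a powr t = (x * a\<^sup>2) powr (t / 2) * (x powr (- (t / (2 - t)))) powr (1 - t / 2)"
 proof (cases "a = 0")
  case False
  hence a0: "a > 0" using a by simp
  have e: "- (t / (2 - t)) * (1 - t / 2) = - (t / 2)" using t by (simp add: field_simps)
  have "(x * a\<^sup>2) powr (t / 2) = x powr (t / 2) * a powr t"
  proof -
   have "a\<^sup>2 = a powr 2" using a0 by simp
   hence "(a\<^sup>2) powr (t / 2) = a powr t" by (simp only: powr_powr) simp
   thus ?thesis using a0 a by (simp add: powr_mult)
  qed
  moreover have "(x powr (- (t / (2 - t)))) powr (1 - t / 2) = x powr (- (t / 2))" unfolding powr_powr e ..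
  ultimately show ?thesis using a by (simp add: powr_minus field_simps)
 qed simp
 also have "... <= x * a\<^sup>2 + x powr (- (t / (2 - t)))"
  using a t by (intro powr_young) auto
 finally show ?thesis .
qed

text \<open>Meant for the coefficients at the edges: there are of order 2^j of them on level j, and
  even after multiplication by 2^j the last term decays like 2^(-ej).\<close>

lemma powr_le_besov_term:
 fixes p t s0 X P :: real
 assumes p: "0 < p" and t: "0 < t" and s0: "0 <= s0" "s0 > 1 / t - 1 / p" and P: "1 <= P"
 shows "\<exists>K\<ge>0. \<exists>e>0. \<forall>j a. 0 <= a --> (2 powr (s0 * real j) * a) powr p <= P -->
  a powr t <= K * (2 powr (s0 * real j) * a) powr p + 2 powr (- (1 + e) * real j)"
proof (cases "t < p")
 case True
 \<comment> \<open>Solves b (1 - t/p) = s0 t, so that the weight 2^(-bj) cancels the weight of the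
   Besov term; b > 1 is the assumption on \<open>s0\<close>.\<close>
 define b where "b = s0 / (1 / t - 1 / p)"
 have d: "0 < 1 / t - 1 / p" using True p t by (simp add: field_simps)
 have b: "b > 1" using s0 d by (simp add: b_def)
 show ?thesis
 proof (rule exI[of _ 1], rule conjI, simp, rule exI[of _ "b - 1"], intro conjI allI impI)
  fix j :: nat and a :: real assume a: "0 <= a"
  have e: "- b * real j * (1 - t / p) = - (s0 * real j * t)"
   unfolding b_def using d p t by (simp add: field_simps)
  have "a powr t = ((2 powr (s0 * real j) * a) powr p) powr (t / p) * (2 powr (- b * real j)) powr (1 - t / p)"
   unfolding powr_powr e using p a by (simp add: powr_mult powr_powr powr_minus field_simps)
  also have "... <= (2 powr (s0 * real j) * a) powr p + 2 powr (- b * real j)"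
   using True p t a by (intro powr_young) auto
  finally show "a powr t <= 1 * (2 powr (s0 * real j) * a) powr p + 2 powr (- (1 + (b - 1)) * real j)" by simp
 qed (use b in auto)
next
 case False
 show ?thesis
 \<comment> \<open>For t >= p the Besov term alone suffices: the bound \<open>P\<close> pays for the
   passage from exponent p to t, and any positive rate may stand in the last term.\<close>
 proof (rule exI[of _ "P powr ((t - p) / p)"], rule conjI, simp, rule exI[of _ 1], intro conjI allI impI)
  fix j :: nat and a :: real assume a: "0 <= a" and X: "(2 powr (s0 * real j) * a) powr p <= P"
  define X where "X = 2 powr (s0 * real j) * a"
  have aX: "0 <= X" "a <= X" using a s0 ge_one_powr_ge_zero[of 2 "s0 * real j"] by (auto simp: X_def mult_le_cancel_right1)
  have "a powr t <= X powr t" using aX a t by (intro powr_mono2) auto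
  also have "... = (X powr p) powr ((t - p) / p) * X powr p"
  proof (cases "X = 0")
   case False
   have "(X powr p) powr ((t - p) / p) * X powr p = X powr (t - p) * X powr p" using p by (simp add: powr_powr)
   also have "... = X powr (t - p + p)" by (rule powr_add[symmetric])
   finally show ?thesis by simp
  qed simp
  also have "... <= P powr ((t - p) / p) * X powr p"
   using X False p by (intro mult_right_mono powr_mono2) (auto simp: X_def)
  finally show "a powr t <= P powr ((t - p) / p) * (2 powr (s0 * real j) * a) powr p + 2 powr (- (1 + 1) * real j)"
   unfolding X_def by (simp add: add_increasing2)
 qed auto
qed

lemma summable_powr_scale: "e > 0 ==> summable (%i. 2 powr (- e * real (j0 + i)))"
proof -
 assume e: "e > 0"
 have "(%i. 2 powr (- e * real (j0 + i))) = (%i. 2 powr (- e * real j0) * (2 powr (- e)) ^ i)"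
  by (rule ext) (simp add: powr_realpow[symmetric] powr_powr powr_add[symmetric] algebra_simps)
 thus ?thesis using e by (simp add: summable_mult summable_geometric powr_less_one)
qed

text \<open>Each level is split at distance R / 2^j from the edges. Close to them
  \<open>powr_le_besov_term\<close> is summed over order 2^j points; farther away
  \<open>powr_young_power\<close> separates the bound \<open>good\<close> from a sum of powers of
  the distance, which \<open>sum_dyadic_layers\<close> evaluates.\<close>

lemma summable_Besov:
 fixes N :: "nat => 'a set" and a \<delta> :: "nat => 'a => real" and k :: real
 assumes N: "!!j. j >= j0 ==> finite (N j)" and a: "!!j xi. 0 <= a j xi"
  and count: "!!j eta. j >= j0 ==> 0 <= eta ==> real (card {xi : N j. \<delta> j xi <= eta}) <= C0 * 4 ^ j * (eta + 1 / 2 ^ j)"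
  and C0: "0 < C0" and R: "1 <= R"
  and good: "!!j. j >= j0 ==> (\<Sum>xi\<in>{xi : N j. R / 2 ^ j <= \<delta> j xi}. (2 powr (k * real j) * \<delta> j xi powr (k - rho) * a j xi)\<^sup>2) <= G2"
  and besov: "summable (%i. \<Sum>xi\<in>N (j0 + i). (2 powr (s0 * real (j0 + i)) * a (j0 + i) xi) powr p)"
  and p: "0 < p" and s0: "0 <= s0" "s0 > 1 / t - 1 / p"
  and t: "1 / t = \<alpha> / 2 + 1 / 2" and \<alpha>: "0 < \<alpha>" "\<alpha> < 2 * rho" "\<alpha> < 2 * (k - rho)"
 shows "summable (%i. \<Sum>xi\<in>N (j0 + i). a (j0 + i) xi powr t)"
proof -
 have t': "t = 2 / (\<alpha> + 1)"
 proof -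
  have "t ~= 0" using t \<alpha> by auto
  thus ?thesis using t \<alpha> by (simp add: field_simps)
 qed
 have t0: "0 < t" "t < 2" using \<alpha> by (auto simp: t' field_simps)
 have "2 - t = 2 * \<alpha> / (\<alpha> + 1)" using \<alpha> by (simp add: t' field_simps)
 hence "t / (2 - t) = (2 / (\<alpha> + 1)) / (2 * \<alpha> / (\<alpha> + 1))" by (simp only: t')
 also have "... = 1 / \<alpha>" using \<alpha> by (simp add: divide_simps)
 finally have tt: "t / (2 - t) = 1 / \<alpha>" .
 define X where "X j = (\<Sum>xi\<in>N j. (2 powr (s0 * real j) * a j xi) powr p)" for j
 have X0: "0 <= X j" for j by (auto simp: X_def intro!: sum_nonneg)
 define P where "P = 1 + (\<Sum>i. X (j0 + i))"
 have Xs: "summable (%i. X (j0 + i))" unfolding X_def by (rule besov)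
 have XP: "X j <= P" if "j >= j0" for j
  using sum_le_suminf[OF Xs, of "{j - j0}"] X0 that by (simp add: P_def)
 have P: "1 <= P" using suminf_nonneg[OF Xs] X0 by (simp add: P_def)
 obtain K e where K: "K >= 0" "e > 0" and Ke: "!!j a. 0 <= a ==> (2 powr (s0 * real j) * a) powr p <= P ==>
  a powr t <= K * (2 powr (s0 * real j) * a) powr p + 2 powr (- (1 + e) * real j)"
  using powr_le_besov_term[OF p t0(1) s0 P] by blast
 \<comment> \<open>Half of the gap between alpha and 2 rho: it gives the first part of the sum away
   from the edges a decay 2^(-\<epsilon> j) and leaves the exponent \<open>f\<close> of the second
   part positive.\<close>
 define \<epsilon> where "\<epsilon> = (2 * rho - \<alpha>) / 2"
 have \<epsilon>: "0 < \<epsilon>" "\<epsilon> < 2 * rho - \<alpha>" using \<alpha> by (auto simp: \<epsilon>_def)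
 \<comment> \<open>b > 1, as required by \<open>sum_dyadic_layers\<close>, is the condition alpha <
   2 (k - rho).\<close>
 define b where "b = 2 * (k - rho) / \<alpha>"
 have b: "1 < b" using \<alpha> by (simp add: b_def)
 define C1 where "C1 = 2 * C0 * (2 / (1 - 2 powr (1 - b))) * R powr (1 - b)"
 define f where "f = (2 * rho - \<alpha> - \<epsilon>) / \<alpha>"
 have f: "f > 0" using \<epsilon> \<alpha> by (simp add: f_def)
 have main: "(\<Sum>xi\<in>N j. a j xi powr t) <= (K * X j + C0 * (R + 1) * 2 powr (- e * real j)) + (G2 * 2 powr (- \<epsilon> * real j) + C1 * 2 powr (- f * real j))"
  if j: "j >= j0" for j
 proof -
  let ?G = "{xi : N j. R / 2 ^ j <= \<delta> j xi}" and ?B = "{xi : N j. \<delta> j xi < R / 2 ^ j}"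
  have pj: "(2::real) ^ j = 2 powr real j" by (simp add: powr_realpow)
  have p4: "(4::real) ^ j = 2 ^ j * 2 ^ j" by (simp add: power_mult_distrib[symmetric])
  have B: "(\<Sum>xi\<in>?B. a j xi powr t) <= K * X j + C0 * (R + 1) * 2 powr (- e * real j)"
  proof -
   have "(\<Sum>xi\<in>?B. a j xi powr t) <= (\<Sum>xi\<in>?B. K * (2 powr (s0 * real j) * a j xi) powr p + 2 powr (- (1 + e) * real j))"
   proof (intro sum_mono Ke a)
    fix xi assume "xi : ?B"
    hence "(2 powr (s0 * real j) * a j xi) powr p <= X j" unfolding X_def
     by (intro member_le_sum[of xi "N j" "%xi. (2 powr (s0 * real j) * a j xi) powr p"]) (auto simp: N[OF j])
    thus "(2 powr (s0 * real j) * a j xi) powr p <= P" using XP[OF j] by simp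
   qed
   also have "... = K * (\<Sum>xi\<in>?B. (2 powr (s0 * real j) * a j xi) powr p) + real (card ?B) * 2 powr (- (1 + e) * real j)"
    by (simp add: sum.distrib sum_distrib_left)
   also have "... <= K * X j + (C0 * (R + 1) * 2 ^ j) * 2 powr (- (1 + e) * real j)"
   proof (intro add_mono mult_left_mono mult_right_mono)
    show "(\<Sum>xi\<in>?B. (2 powr (s0 * real j) * a j xi) powr p) <= X j" unfolding X_def
     by (rule sum_mono2) (auto simp: N[OF j])
    have "card ?B <= card {xi : N j. \<delta> j xi <= R / 2 ^ j}" by (rule card_mono) (auto simp: N[OF j])
    hence "real (card ?B) <= C0 * 4 ^ j * (R / 2 ^ j + 1 / 2 ^ j)"
     using count[OF j, of "R / 2 ^ j"] R by simp
    also have "... = C0 * (R + 1) * 2 ^ j" by (simp add: p4 field_simps)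
    finally show "real (card ?B) <= C0 * (R + 1) * 2 ^ j" .
   qed (use K in auto)
   also have "C0 * (R + 1) * 2 ^ j * 2 powr (- (1 + e) * real j) = C0 * (R + 1) * 2 powr (- e * real j)"
    unfolding pj by (simp add: powr_add[symmetric] algebra_simps)
   finally show ?thesis .
  qed
  have G: "(\<Sum>xi\<in>?G. a j xi powr t) <= G2 * 2 powr (- \<epsilon> * real j) + C1 * 2 powr (- f * real j)"
  proof -
   \<comment> \<open>Young's weight: up to a decaying factor it reproduces the squares in
     \<open>good\<close>, and its power with exponent -1/alpha is a multiple of the distance to the
     power -b.\<close>
   define x where "x xi = 2 powr (- \<epsilon> * real j) * (2 powr (k * real j) * \<delta> j xi powr (k - rho))\<^sup>2" for xi
   have dpos: "0 < \<delta> j xi" if "xi : ?G" for xi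
    using that R by (auto intro: less_le_trans[of _ "R / 2 ^ j"])
   have "(\<Sum>xi\<in>?G. a j xi powr t) <= (\<Sum>xi\<in>?G. x xi * (a j xi)\<^sup>2 + x xi powr (- (1 / \<alpha>)))"
   proof (rule sum_mono)
    fix xi assume "xi : ?G"
    hence "0 < \<delta> j xi" by (rule dpos)
    hence "0 < 2 powr (k * real j) * \<delta> j xi powr (k - rho)" by simp
    hence "0 < x xi" unfolding x_def by (intro mult_pos_pos zero_less_power) auto
    thus "a j xi powr t <= x xi * (a j xi)\<^sup>2 + x xi powr (- (1 / \<alpha>))"
     using powr_young_power[OF a _ t0] tt by metis
   qed
   also have "... = 2 powr (- \<epsilon> * real j) * (\<Sum>xi\<in>?G. (2 powr (k * real j) * \<delta> j xi powr (k - rho) * a j xi)\<^sup>2) + (\<Sum>xi\<in>?G. x xi powr (- (1 / \<alpha>)))"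
    by (simp add: sum.distrib sum_distrib_left x_def power_mult_distrib mult_ac)
   also have "(\<Sum>xi\<in>?G. x xi powr (- (1 / \<alpha>))) = 2 powr ((\<epsilon> / \<alpha> - 2 * k / \<alpha>) * real j) * (\<Sum>xi\<in>?G. \<delta> j xi powr (- b))"
    unfolding sum_distrib_left
   proof (rule sum.cong[OF refl])
    fix xi assume "xi : ?G"
    hence d: "0 < \<delta> j xi" by (rule dpos)
    have "x xi = 2 powr (- \<epsilon> * real j) * ((2 powr (k * real j)) powr 2 * (\<delta> j xi powr (k - rho)) powr 2)"
     using d by (simp add: x_def power_mult_distrib powr_numeral)
    also have "... = 2 powr ((2 * k - \<epsilon>) * real j) * \<delta> j xi powr (2 * (k - rho))"
     unfolding powr_powr mult.assoc[symmetric] powr_add[symmetric] by (simp add: algebra_simps)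
    finally have "x xi powr (- (1 / \<alpha>)) = 2 powr ((2 * k - \<epsilon>) * real j * (- (1 / \<alpha>))) * \<delta> j xi powr (2 * (k - rho) * (- (1 / \<alpha>)))"
     using d by (simp add: powr_mult powr_powr)
    also have "(2 * k - \<epsilon>) * real j * (- (1 / \<alpha>)) = (\<epsilon> / \<alpha> - 2 * k / \<alpha>) * real j" using \<alpha> by (simp add: field_simps)
    also have "2 * (k - rho) * (- (1 / \<alpha>)) = - b" by (simp add: b_def)
    finally show "x xi powr (- (1 / \<alpha>)) = 2 powr ((\<epsilon> / \<alpha> - 2 * k / \<alpha>) * real j) * \<delta> j xi powr (- b)" .
   qed
   also have "(\<Sum>xi\<in>?G. \<delta> j xi powr (- b)) <= (2 * C0 * 4 ^ j) * (2 / (1 - 2 powr (1 - b))) * (R / 2 ^ j) powr (1 - b)"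
   proof (rule sum_dyadic_layers)
    show "real (card {xi : ?G. \<delta> j xi <= eta}) <= 2 * C0 * 4 ^ j * eta" if eta: "R / 2 ^ j <= eta" for eta
    proof -
     have eta1: "1 / 2 ^ j <= eta" by (rule order_trans[OF divide_right_mono[OF R] eta]) simp
     hence eta0: "0 <= eta" by (rule order_trans[rotated]) simp
     have "card {xi : ?G. \<delta> j xi <= eta} <= card {xi : N j. \<delta> j xi <= eta}" by (rule card_mono) (auto simp: N[OF j])
     hence "real (card {xi : ?G. \<delta> j xi <= eta}) <= C0 * 4 ^ j * (eta + 1 / 2 ^ j)" using count[OF j eta0] by simp
     also have "... <= C0 * 4 ^ j * (eta + eta)" using eta1 C0 by (intro mult_left_mono add_left_mono) auto
     finally show ?thesis by simp
    qed
   qed (use N[OF j] R b C0 in auto)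
   also have "(R / 2 ^ j) powr (1 - b) = R powr (1 - b) * 2 powr ((b - 1) * real j)"
   proof -
    have e: "(b - 1) * real j = - (real j * (1 - b))" by (simp add: algebra_simps)
    show ?thesis unfolding pj powr_divide powr_powr e powr_minus by (simp add: divide_inverse)
   qed
   also have "(2 * C0 * 4 ^ j) * (2 / (1 - 2 powr (1 - b))) * (R powr (1 - b) * 2 powr ((b - 1) * real j)) = C1 * (2 powr real j * 2 powr real j * 2 powr ((b - 1) * real j))"
    unfolding C1_def p4 pj by (simp add: mult_ac)
   also have "2 powr real j * 2 powr real j * 2 powr ((b - 1) * real j) = 2 powr ((1 + b) * real j)"
    unfolding powr_add[symmetric] by (simp add: algebra_simps)
   finally have "(\<Sum>xi\<in>?G. a j xi powr t) <= 2 powr (- \<epsilon> * real j) * (\<Sum>xi\<in>?G. (2 powr (k * real j) * \<delta> j xi powr (k - rho) * a j xi)\<^sup>2)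
    + 2 powr ((\<epsilon> / \<alpha> - 2 * k / \<alpha>) * real j) * (C1 * 2 powr ((1 + b) * real j))" by simp
   also have "2 powr ((\<epsilon> / \<alpha> - 2 * k / \<alpha>) * real j) * (C1 * 2 powr ((1 + b) * real j)) = C1 * 2 powr (- f * real j)"
   proof -
    have "(\<epsilon> / \<alpha> - 2 * k / \<alpha>) + (1 + b) = - f" unfolding b_def f_def using \<alpha> by (simp add: field_simps)
    hence "2 powr ((\<epsilon> / \<alpha> - 2 * k / \<alpha>) * real j) * 2 powr ((1 + b) * real j) = 2 powr (- f * real j)"
     unfolding powr_add[symmetric] distrib_right[symmetric] by simp
    thus ?thesis by (simp add: mult_ac)
   qed
   also have "2 powr (- \<epsilon> * real j) * (\<Sum>xi\<in>?G. (2 powr (k * real j) * \<delta> j xi powr (k - rho) * a j xi)\<^sup>2) <= 2 powr (- \<epsilon> * real j) * G2"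
    by (rule mult_left_mono[OF good[OF j]]) simp
   finally show ?thesis by (simp add: mult.commute)
  qed
  have "N j = ?B \<union> ?G" by auto
  hence "(\<Sum>xi\<in>N j. a j xi powr t) = (\<Sum>xi\<in>?B \<union> ?G. a j xi powr t)" by simp
  also have "... = (\<Sum>xi\<in>?B. a j xi powr t) + (\<Sum>xi\<in>?G. a j xi powr t)"
   by (rule sum.union_disjoint) (auto simp: N[OF j])
  finally show ?thesis using B G by simp
 qed
 show ?thesis
 proof (rule summable_comparison_test')
  show "norm (\<Sum>xi\<in>N (j0 + i). a (j0 + i) xi powr t) <= (K * X (j0 + i) + C0 * (R + 1) * 2 powr (- e * real (j0 + i)))
   + (G2 * 2 powr (- \<epsilon> * real (j0 + i)) + C1 * 2 powr (- f * real (j0 + i)))" if "i >= 0" for i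
   using main[of "j0 + i"] by (simp add: sum_nonneg)
 qed (intro summable_add summable_mult Xs summable_powr_scale K \<epsilon> f)
qed

text \<open>By the choice of \<open>t\<close> and \<open>s'\<close> the summand is a product of
  powers of the two given summands with exponents adding up to one; \<open>powr_young\<close> bounds
  it by their sum. For \<Theta> = 0 the claim is the second hypothesis.\<close>

lemma summable_interpolate:
 fixes N :: "nat => 'a set" and a :: "nat => 'a => real"
 assumes a: "!!j xi. 0 <= a j xi" and \<Theta>: "0 <= \<Theta>" "\<Theta> <= 1" and s': "s' = (1 - \<Theta>) * s0"
  and pos: "0 < \<tau>" "0 < p" and t: "0 < t" "1 / t = \<Theta> / \<tau> + (1 - \<Theta>) / p"
  and A: "\<Theta> > 0 ==> summable (%i. \<Sum>xi\<in>N (j0 + i). a (j0 + i) xi powr \<tau>)"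
  and B: "summable (%i. \<Sum>xi\<in>N (j0 + i). (2 powr (s0 * real (j0 + i)) * a (j0 + i) xi) powr p)"
 shows "summable (%i. \<Sum>xi\<in>N (j0 + i). (2 powr (s' * real (j0 + i)) * a (j0 + i) xi) powr t)"
proof (cases "\<Theta> = 0")
 case True
 hence "t = p" using t pos by simp
 thus ?thesis using B True s' by simp
next
 case False
 have l: "\<Theta> * t / \<tau> + (1 - \<Theta>) * t / p = 1"
 proof -
  have "\<Theta> * t / \<tau> + (1 - \<Theta>) * t / p = t * (\<Theta> / \<tau> + (1 - \<Theta>) / p)" by (simp add: algebra_simps)
  also have "... = 1" using t by (simp flip: t(2))
  finally show ?thesis .
 qed
 have pw: "(2 powr (s' * real j) * a j xi) powr t <= a j xi powr \<tau> + (2 powr (s0 * real j) * a j xi) powr p" for j xi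
 proof -
  have l0: "0 <= (1 - \<Theta>) * t / p" using \<Theta> t pos by (intro divide_nonneg_pos mult_nonneg_nonneg) auto
  have "(2 powr (s' * real j) * a j xi) powr t = (a j xi powr \<tau>) powr (\<Theta> * t / \<tau>) * ((2 powr (s0 * real j) * a j xi) powr p) powr (1 - \<Theta> * t / \<tau>)"
  proof (cases "a j xi = 0")
   case False
   have l': "1 - \<Theta> * t / \<tau> = (1 - \<Theta>) * t / p" using l by linarith
   have e1: "\<tau> * (\<Theta> * t / \<tau>) = \<Theta> * t" "p * ((1 - \<Theta>) * t / p) = (1 - \<Theta>) * t" using pos by auto
   have "a j xi powr (\<Theta> * t) * a j xi powr ((1 - \<Theta>) * t) = a j xi powr t"
    unfolding powr_add[symmetric] by (simp add: algebra_simps)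
   moreover have "(2 powr (s0 * real j)) powr ((1 - \<Theta>) * t) = (2 powr (s' * real j)) powr t"
    unfolding powr_powr s' by (simp add: mult_ac)
   moreover have "(2 powr (s0 * real j) * a j xi) powr ((1 - \<Theta>) * t) = (2 powr (s0 * real j)) powr ((1 - \<Theta>) * t) * a j xi powr ((1 - \<Theta>) * t)"
    "(2 powr (s' * real j) * a j xi) powr t = (2 powr (s' * real j)) powr t * a j xi powr t"
    using a[of j xi] by (simp_all only: powr_mult)
   moreover have "(a j xi powr \<tau>) powr (\<Theta> * t / \<tau>) = a j xi powr (\<Theta> * t)"
    "((2 powr (s0 * real j) * a j xi) powr p) powr ((1 - \<Theta>) * t / p) = (2 powr (s0 * real j) * a j xi) powr ((1 - \<Theta>) * t)"
    unfolding powr_powr e1 by simp_all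
   ultimately show ?thesis unfolding l' by simp
  qed (use False in simp)
  also have "... <= a j xi powr \<tau> + (2 powr (s0 * real j) * a j xi) powr p"
  proof (rule powr_young)
   show "\<Theta> * t / \<tau> <= 1" using l l0 by linarith
  qed (use a \<Theta> t pos in auto)
  finally show ?thesis .
 qed
 show ?thesis
 proof (rule summable_comparison_test')
  show "norm (\<Sum>xi\<in>N (j0 + i). (2 powr (s' * real (j0 + i)) * a (j0 + i) xi) powr t)
   <= (\<Sum>xi\<in>N (j0 + i). a (j0 + i) xi powr \<tau>) + (\<Sum>xi\<in>N (j0 + i). (2 powr (s0 * real (j0 + i)) * a (j0 + i) xi) powr p)" if "i >= 0" for i
   using sum_mono[of "N (j0 + i)", OF pw[of "j0 + i"]] by (simp only: sum.distrib real_norm_def abs_of_nonneg sum_nonneg powr_ge_zero)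
  show "summable (%i. (\<Sum>xi\<in>N (j0 + i). a (j0 + i) xi powr \<tau>) + (\<Sum>xi\<in>N (j0 + i). (2 powr (s0 * real (j0 + i)) * a (j0 + i) xi) powr p))"
   using A B False \<Theta> by (intro summable_add) auto
 qed
qed

text \<open>Keep the entries above (T/n)^(1/t). Adding up their t-th powers shows that there are
  fewer than n; for all others b^2 <= theta^(2-t) b^t with theta the threshold.\<close>

lemma threshold:
 fixes N :: "nat => 'a set" and b :: "nat => 'a => real"
 assumes N: "!!i. finite (N i)" and b: "!!i xi. 0 <= b i xi" and t: "0 < t" "t <= 2"
  and sm: "summable (%i. \<Sum>xi\<in>N i. b i xi powr t)"
 shows "\<exists>T>0. \<forall>n\<ge>1. \<exists>\<Lambda>. finite \<Lambda> & \<Lambda> <= Sigma UNIV N & card \<Lambda> < n &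
  (\<Sum>i. ennreal (\<Sum>xi\<in>N i. if (i, xi) : \<Lambda> then 0 else (b i xi)\<^sup>2)) <= ennreal (T * real n powr (- 2 * (1 / t - 1 / 2)))"
proof -
 \<comment> \<open>The added 1 makes \<open>T\<close> strictly larger than the sum, which turns the
   counting estimate into \<open>card \<Lambda> < n\<close>.\<close>
 define T where "T = 1 + (\<Sum>i. \<Sum>xi\<in>N i. b i xi powr t)"
 have s0: "0 <= (\<Sum>xi\<in>N i. b i xi powr t)" for i by (rule sum_nonneg) simp
 have T: "1 <= T" using suminf_nonneg[OF sm s0] by (simp add: T_def)
 show ?thesis
 proof (intro exI[of _ "T powr (2 / t)"] conjI allI impI)
  fix n :: nat assume n: "n >= 1"
  define \<theta> where "\<theta> = (T / real n) powr (1 / t)"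
  have \<theta>: "0 < \<theta>" "\<theta> powr t = T / real n" using T n t by (auto simp: \<theta>_def powr_powr)
  define \<Lambda> where "\<Lambda> = {x : Sigma UNIV N. \<theta> < b (fst x) (snd x)}"
  have "finite \<Lambda> & card \<Lambda> <= n - 1"
  \<comment> \<open>\<Lambda> could a priori meet infinitely many levels; a common bound for the
    cardinality of its finite subsets excludes this.\<close>
  proof (rule finite_if_finite_subsets_card_bdd)
   fix F assume F: "F <= \<Lambda>" "finite F"
   obtain m where m: "!!x. x : F ==> fst x < m"
    using finite_nat_set_iff_bounded[of "fst ` F"] F(2) by auto
   have Fm: "F <= Sigma {..<m} N" using F m by (auto simp: \<Lambda>_def)
   have "real (card F) * (T / real n) = (\<Sum>x\<in>F. \<theta> powr t)" by (simp add: \<theta>)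
   also have "... <= (\<Sum>x\<in>F. b (fst x) (snd x) powr t)"
    using F \<theta> t by (intro sum_mono powr_mono2) (auto simp: \<Lambda>_def)
   also have "... <= (\<Sum>x\<in>Sigma {..<m} N. b (fst x) (snd x) powr t)"
    by (rule sum_mono2) (use Fm N in auto)
   also have "... = (\<Sum>i<m. \<Sum>xi\<in>N i. b i xi powr t)"
    using sum.Sigma[of "{..<m}" N "%i xi. b i xi powr t"] N by (simp add: case_prod_unfold)
   also have "... <= (\<Sum>i. \<Sum>xi\<in>N i. b i xi powr t)" by (rule sum_le_suminf[OF sm]) (auto intro: sum_nonneg)
   also have "... < T" by (simp add: T_def)
   finally have "real (card F) * (T / real n) < T" .
   hence "real (card F) < real n" using T n by (simp add: field_simps)
   thus "card F <= n - 1" by simp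
  qed
  hence fin: "finite \<Lambda> & card \<Lambda> < n" using n by auto
  have th: "\<theta> powr (2 - t) * T = T powr (2 / t) * real n powr (- 2 * (1 / t - 1 / 2))"
  proof -
   have "\<theta> powr (2 - t) = (T / real n) powr ((2 - t) / t)" by (simp add: \<theta>_def powr_powr)
   also have "(2 - t) / t = 2 / t - 1" using t by (simp add: field_simps)
   also have "(T / real n) powr (2 / t - 1) = T powr (2 / t - 1) * real n powr (- (2 / t - 1))"
    unfolding powr_divide powr_minus by (simp add: divide_inverse)
   finally have "\<theta> powr (2 - t) * T = (T powr (2 / t - 1) * T) * real n powr (- (2 / t - 1))" by simp
   also have "T powr (2 / t - 1) * T = T powr (2 / t)" using T by (simp add: powr_diff)
   also have "- (2 / t - 1) = - 2 * (1 / t - 1 / 2)" by (simp add: field_simps)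
   finally show ?thesis .
  qed
  have "(\<Sum>i. ennreal (\<Sum>xi\<in>N i. if (i, xi) : \<Lambda> then 0 else (b i xi)\<^sup>2)) <= (\<Sum>i. ennreal (\<theta> powr (2 - t) * (\<Sum>xi\<in>N i. b i xi powr t)))"
  proof (intro suminf_le ennreal_leI)
   fix i
   have "(if (i, xi) : \<Lambda> then 0 else (b i xi)\<^sup>2) <= \<theta> powr (2 - t) * b i xi powr t" if "xi : N i" for xi
   proof (cases "(i, xi) : \<Lambda> \<or> b i xi = 0")
    case False
    hence bt: "b i xi <= \<theta>" "0 < b i xi" using that b[of i xi] by (auto simp: \<Lambda>_def)
    have "(b i xi)\<^sup>2 = b i xi powr ((2 - t) + t)" using bt by (simp add: powr_numeral)
    also have "... = b i xi powr (2 - t) * b i xi powr t" by (rule powr_add)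
    also have "... <= \<theta> powr (2 - t) * b i xi powr t" using bt t by (intro mult_right_mono powr_mono2) auto
    finally show ?thesis using False by simp
   qed auto
   thus "(\<Sum>xi\<in>N i. if (i, xi) : \<Lambda> then 0 else (b i xi)\<^sup>2) <= \<theta> powr (2 - t) * (\<Sum>xi\<in>N i. b i xi powr t)"
    unfolding sum_distrib_left by (rule sum_mono)
  qed auto
  also have "... = ennreal (\<Sum>i. \<theta> powr (2 - t) * (\<Sum>xi\<in>N i. b i xi powr t))"
   by (rule suminf_ennreal2) (use sm in \<open>auto intro!: mult_nonneg_nonneg sum_nonneg summable_mult\<close>)
  also have "... = ennreal (\<theta> powr (2 - t) * (\<Sum>i. \<Sum>xi\<in>N i. b i xi powr t))" by (simp add: suminf_mult[OF sm])
  also have "... <= ennreal (\<theta> powr (2 - t) * T)" by (intro ennreal_leI mult_left_mono) (auto simp: T_def)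
  finally show "\<exists>\<Lambda>. finite \<Lambda> & \<Lambda> <= Sigma UNIV N & card \<Lambda> < n &
   (\<Sum>i. ennreal (\<Sum>xi\<in>N i. if (i, xi) : \<Lambda> then 0 else (b i xi)\<^sup>2)) <= ennreal (T powr (2 / t) * real n powr (- 2 * (1 / t - 1 / 2)))"
   unfolding th using fin by (intro exI[of _ \<Lambda>]) (auto simp: \<Lambda>_def)
 qed (use T in auto)
qed

section \<open>Best n-term approximation\<close>

lemma suminf_ennreal_finite_summable:
 assumes "!!i. 0 <= f i" "(\<Sum>i. ennreal (f i)) < \<infinity>"
 shows "summable f"
proof (rule summable_suminf_not_top[OF assms(1)])
 show "(\<Sum>i. ennreal (f i)) ~= top" using assms(2) unfolding infinity_ennreal_def by (rule less_imp_neq)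
qed

lemma epowr_summand: "a + epowr x r < \<infinity> ==> x < \<infinity>"
 unfolding epowr_less_top[of x r, symmetric] by simp

text \<open>The error is defined with exactly n members of the dictionary; shorter sums are padded
  by \<mu>0 with coefficient zero.\<close>

lemma best_nterm_error_le:
 assumes L: "finite \<Lambda>" "\<Lambda> <= I" "card \<Lambda> <= n" and ne: "\<mu>0 : I"
 shows "best_nterm_error u (f ` I) nrm n <= nrm (%x. u x - (\<Sum>\<mu>\<in>\<Lambda>. c \<mu> * f \<mu> x))"
proof -
 obtain g where g: "bij_betw g {0..<card \<Lambda>} \<Lambda>" using ex_bij_betw_nat_finite[OF L(1)] by blast
 define b where "b l = f (if l < card \<Lambda> then g l else \<mu>0)" for l
 define e where "e l = (if l < card \<Lambda> then c (g l) else 0)" for l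
 have gL: "g l : \<Lambda>" if "l < card \<Lambda>" for l using bij_betwE[OF g] that by simp
 have eq: "(\<Sum>l<n. e l * b l x) = (\<Sum>\<mu>\<in>\<Lambda>. c \<mu> * f \<mu> x)" for x
 proof -
  have "(\<Sum>l<n. e l * b l x) = (\<Sum>l\<in>{0..<card \<Lambda>}. e l * b l x)"
   by (rule sum.mono_neutral_right) (use L(3) in \<open>auto simp: e_def\<close>)
  also have "... = (\<Sum>l\<in>{0..<card \<Lambda>}. c (g l) * f (g l) x)" by (rule sum.cong) (auto simp: e_def b_def)
  also have "... = (\<Sum>\<mu>\<in>\<Lambda>. c \<mu> * f \<mu> x)" by (rule sum.reindex_bij_betw[OF g])
  finally show ?thesis .
 qed
 show ?thesis unfolding best_nterm_error_def
 proof (rule INF_lower2[of b])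
  show "b : {b. \<forall>m<n. b m : f ` I}" using gL L(2) ne by (auto simp: b_def)
  show "(INF c. nrm (%x. u x - (\<Sum>m<n. c m * b m x))) <= nrm (%x. u x - (\<Sum>\<mu>\<in>\<Lambda>. c \<mu> * f \<mu> x))"
   by (rule INF_lower2[of e]) (auto simp: eq)
 qed
qed

section \<open>Besov spaces and approximation rates in terms of coefficients\<close>

context wavelet_surface
begin

text \<open>Supplies the element for the padding in \<open>best_nterm_error_le\<close>. A nonempty
  compact set has nonempty frontier, so there is a patch, and its grid on the coarsest level is
  nonempty.\<close>

lemma windices_ne: "windices S W ~= {}"
proof -
 have "bd S ~= {}"
 proof -
  have "bounded (Omega S)" using cOmega by (rule compact_imp_bounded)
  hence "Omega S ~= UNIV" using not_bounded_UNIV by auto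
  thus ?thesis using Omega_ne frontier_eq_empty[of "Omega S"] by simp
 qed
 then obtain i where i: "i < np" using bd_eq by blast
 from basis_facts(4)[unfolded wavelet_grids_def] obtain C1 C2 where C1: "C1 > 0" and
  grid: "\<forall>j\<ge>j0. \<forall>i<np. finite (grid W j i) & grid W j i <= G i &
   C1 * 2 ^ (2 * j) <= real (card (grid W j i)) & real (card (grid W j i)) <= C2 * 2 ^ (2 * j)"
  by (elim exE conjE) (rule that)
 note grid[rule_format, OF order_refl i, THEN conjunct2, THEN conjunct2, THEN conjunct1]
 moreover have "0 < C1 * 2 ^ (2 * j0)" using C1 by simp
 ultimately have "0 < real (card (grid W j0 i))" by (rule less_le_trans[rotated])
 hence "grid W j0 i ~= {}" by auto
 then obtain xi where "xi : N j0" using i unfolding nabla_def by blast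
 from Wavelet_windex[OF order_refl this] show ?thesis by blast
qed

lemma coarse_projection_L2: "coarse_projection S W u : L2_surface S"
 unfolding coarse_projection_def[abs_def]
 by (rule L2_sum) (use windices_L2 in \<open>auto simp: windices_def\<close>)

text \<open>The surface has finite measure, and |u|^t <= 1 + |u|^2.\<close>

lemma Lp_norm_finite:
 assumes u: "u : L2_surface S" and t: "0 < t" "t <= 2"
 shows "Lp_norm M t u < \<infinity>"
 unfolding Lp_norm_def epowr_less_top
proof -
 have m [measurable]: "u : borel_measurable M" using u by (simp add: L2_iff)
 have "(\<integral>\<^sup>+x. ennreal (cmod (u x) powr t) \<partial>M) <= (\<integral>\<^sup>+x. 1 + ennreal ((cmod (u x))\<^sup>2) \<partial>M)"
 proof (rule nn_integral_mono)
  fix x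
  have "cmod (u x) powr t <= 1 + (cmod (u x))\<^sup>2"
  proof (cases "cmod (u x) <= 1")
   case True
   hence "cmod (u x) powr t <= 1 powr t" using t by (intro powr_mono2) auto
   also have "... <= 1 + (cmod (u x))\<^sup>2" by simp
   finally show ?thesis .
  next
   case False
   hence "cmod (u x) powr t <= cmod (u x) powr 2" using t by (intro powr_mono) auto
   thus ?thesis by (simp add: cmod_powr2)
  qed
  hence "ennreal (cmod (u x) powr t) <= ennreal (1 + (cmod (u x))\<^sup>2)" by (rule ennreal_leI)
  thus "ennreal (cmod (u x) powr t) <= 1 + ennreal ((cmod (u x))\<^sup>2)" by simp
 qed
 also have "... = emeasure M (bd S) + (\<integral>\<^sup>+x. ennreal ((cmod (u x))\<^sup>2) \<partial>M)"
  by (subst nn_integral_add) (auto simp: space_M)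
 also have "... < \<infinity>" using emeasure_M_finite u by (simp add: L2_iff)
 finally show "(\<integral>\<^sup>+x. ennreal (cmod (u x) powr t) \<partial>M) < \<infinity>" .
qed

lemma summable_square_coefficients:
 assumes u: "u : L2_surface S"
 shows "summable (%i. \<Sum>xi\<in>N (j0 + i). (cmod (cf u (j0 + i) xi))\<^sup>2)"
proof -
 have "\<exists>C1>0. \<exists>C2>0. \<forall>u\<in>L2_surface S. ennreal C1 * wavelet_sobolev_norm S W 0 u <= sobolev_norm S 0 u &
   sobolev_norm S 0 u <= ennreal C2 * wavelet_sobolev_norm S W 0 u"
  using basis_facts(2,9) unfolding sobolev_equivalence_def by (elim allE[of _ 0]) simp
 then obtain C where C: "C > 0" "ennreal C * wavelet_sobolev_norm S W 0 u <= sobolev_norm S 0 u" using u by blast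
 note C(2)
 also have "sobolev_norm S 0 u = Lp_norm M 2 u" by (simp add: sobolev_norm_def sobolev_norm_nonneg_def)
 also have "... < \<infinity>" using u by (simp add: L2_surface_def)
 finally have fin: "wavelet_sobolev_norm S W 0 u < \<infinity>" using C(1) by (auto simp: ennreal_mult_less_top)
 have "(\<Sum>i. ennreal (\<Sum>xi\<in>N (j0 + i). (cmod (cf u (j0 + i) xi))\<^sup>2)) < \<infinity>"
 proof -
  have "wavelet_sobolev_norm S W 0 u = Lp_norm M 2 (coarse_projection S W u) + epowr (\<Sum>i. ennreal (\<Sum>xi\<in>N (j0 + i). (cmod (cf u (j0 + i) xi))\<^sup>2)) (1 / 2)"
   unfolding wavelet_sobolev_norm_def Let_def by simp
  thus ?thesis using fin by (simp only: epowr_summand)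
 qed
 thus ?thesis by (rule suminf_ennreal_finite_summable[rotated]) (simp add: sum_nonneg)
qed

text \<open>With equal inner and outer exponents the wavelet part of the Besov norm is a weighted
  sequence norm; the weight is moved inside the p-th power.\<close>

lemma besov_summable:
 assumes u: "u : besov_space S W s p (ereal p)" and p: "0 < p"
 shows "summable (%i. \<Sum>xi\<in>N (j0 + i). (2 powr ((s - 2 * (1 / p - 1 / 2)) * real (j0 + i)) * cmod (cf u (j0 + i) xi)) powr p)"
proof -
 let ?w = "%j. 2 powr (real j * (s + 2 * (1 / 2 - 1 / p)))"
 let ?A = "%j. \<Sum>xi\<in>N j. cmod (cf u j xi) powr p"
 have "(\<Sum>i. ennreal (?w (j0 + i) powr p * ?A (j0 + i) powr (p / p))) < \<infinity>"
 proof -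
  have "besov_norm S W s p (ereal p) u = Lp_norm M p (coarse_projection S W u) + epowr (\<Sum>i. ennreal (?w (j0 + i) powr p * ?A (j0 + i) powr (p / p))) (1 / p)"
  proof -
   have q: "(ereal p = \<infinity>) = False" "real_of_ereal (ereal p) = p" by simp_all
   show ?thesis unfolding besov_norm_def Let_def q if_False by (rule refl)
  qed
  moreover have "besov_norm S W s p (ereal p) u < \<infinity>" using u by (simp only: besov_space_def mem_Collect_eq)
  ultimately show ?thesis by (simp only: epowr_summand)
 qed
 hence "summable (%i. ?w (j0 + i) powr p * ?A (j0 + i) powr (p / p))" by (rule suminf_ennreal_finite_summable[rotated]) simp
 also have "(%i. ?w (j0 + i) powr p * ?A (j0 + i) powr (p / p))
  = (%i. \<Sum>xi\<in>N (j0 + i). (2 powr ((s - 2 * (1 / p - 1 / 2)) * real (j0 + i)) * cmod (cf u (j0 + i) xi)) powr p)"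
 proof
  fix i
  have A: "?A (j0 + i) powr (p / p) = ?A (j0 + i)" using p by (simp add: sum_nonneg)
  have w: "real (j0 + i) * (s + 2 * (1 / 2 - 1 / p)) = (s - 2 * (1 / p - 1 / 2)) * real (j0 + i)" by (simp add: algebra_simps)
  show "?w (j0 + i) powr p * ?A (j0 + i) powr (p / p) = (\<Sum>xi\<in>N (j0 + i). (2 powr ((s - 2 * (1 / p - 1 / 2)) * real (j0 + i)) * cmod (cf u (j0 + i) xi)) powr p)"
   unfolding A w sum_distrib_left powr_mult ..
 qed
 finally show ?thesis .
qed

text \<open>On this line of parameters the exponent alpha + 2(1/2 - 1/t) of the level weights
  vanishes, so apart from the coarse part the norm is an unweighted sequence norm.\<close>

lemma besov_memI:
 assumes u: "u : L2_surface S" and t: "1 / t = \<alpha> / 2 + 1 / 2" "0 <= \<alpha>"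
  and sm: "summable (%i. \<Sum>xi\<in>N (j0 + i). cmod (cf u (j0 + i) xi) powr t)"
 shows "u : besov_space S W \<alpha> t (ereal t)"
proof -
 have "0 < 1 / t" using t by simp
 hence t0: "0 < t" by simp
 have "1 / 2 <= 1 / t" using t by simp
 hence t2: "t <= 2" using t0 by (simp add: field_simps)
 have w: "\<alpha> + 2 * (1 / 2 - 1 / t) = 0" unfolding t(1) by simp
 have A: "(\<Sum>xi\<in>N j. cmod (cf u j xi) powr t) powr (t / t) = (\<Sum>xi\<in>N j. cmod (cf u j xi) powr t)" for j
  using t0 by (simp add: sum_nonneg)
 have o: "(2 powr (real j * 0)) powr t = 1" for j by simp
 have q: "(ereal t = \<infinity>) = False" "real_of_ereal (ereal t) = t" by simp_all
 have se: "(\<Sum>i. ennreal (\<Sum>xi\<in>N (j0 + i). cmod (cf u (j0 + i) xi) powr t)) = ennreal (\<Sum>i. \<Sum>xi\<in>N (j0 + i). cmod (cf u (j0 + i) xi) powr t)"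
  by (rule suminf_ennreal2[OF _ sm]) (simp add: sum_nonneg)
 have "besov_norm S W \<alpha> t (ereal t) u = Lp_norm M t (coarse_projection S W u) + epowr (ennreal (\<Sum>i. \<Sum>xi\<in>N (j0 + i). cmod (cf u (j0 + i) xi) powr t)) (1 / t)"
  unfolding besov_norm_def Let_def q if_False w A o mult_1_left se by (rule refl)
 also have "... < \<infinity>" using Lp_norm_finite[OF coarse_projection_L2[of u] t0 t2] by (simp add: epowr_def)
 finally show ?thesis using u by (simp add: besov_space_def)
qed

text \<open>Biorthogonality removes exactly the chosen coefficients, so that the norm equivalence
  reads off the approximation error from the others.\<close>

lemma residual:
 fixes u :: "point => complex"
 assumes u: "u : L2_surface S" and L: "finite \<Lambda>" "\<Lambda> <= windices S W"
 defines "e \<equiv> %x. u x - (\<Sum>\<mu>\<in>\<Lambda>. inner_surface S u (dual W \<mu>) * primal W \<mu> x)"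
 shows "e : L2_surface S"
  "eta : windices S W ==> inner_surface S e (dual W eta) = (if eta : \<Lambda> then 0 else inner_surface S u (dual W eta))"
proof -
 let ?q = "%x. \<Sum>\<mu>\<in>\<Lambda>. inner_surface S u (dual W \<mu>) * primal W \<mu> x"
 have p: "primal W \<mu> : L2_surface S" if "\<mu> : \<Lambda>" for \<mu> using windices_L2 L(2) that by blast
 have q: "?q : L2_surface S" by (rule L2_sum[OF L(1) p])
 show "e : L2_surface S" unfolding e_def by (rule L2_diff[OF u q])
 assume eta: "eta : windices S W"
 hence d: "dual W eta : L2_surface S" using windices_L2 by blast
 have bi: "inner_surface S (primal W \<mu>) (dual W eta) = (if \<mu> = eta then 1 else 0)" if "\<mu> : \<Lambda>" for \<mu>
  using basis_facts(3)[unfolded biorthogonal_system_def, THEN conjunct2, THEN conjunct2, THEN conjunct1] eta L(2) that by blast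
 have "inner_surface S ?q (dual W eta) = (\<Sum>\<mu>\<in>\<Lambda>. inner_surface S u (dual W \<mu>) * inner_surface S (primal W \<mu>) (dual W eta))"
  by (rule inner_sum[OF d L(1) p])
 also have "... = (\<Sum>\<mu>\<in>\<Lambda>. if eta = \<mu> then inner_surface S u (dual W \<mu>) else 0)" by (rule sum.cong) (auto simp: bi)
 also have "... = (if eta : \<Lambda> then inner_surface S u (dual W eta) else 0)" using L(1) by (simp add: sum.delta')
 finally show "inner_surface S e (dual W eta) = (if eta : \<Lambda> then 0 else inner_surface S u (dual W eta))"
  unfolding e_def using inner_linear[OF u q d, of "- 1"] by simp
qed

text \<open>All generators are kept if n is large, and the rest of the budget goes to the largest
  weighted wavelet coefficients found by \<open>threshold\<close>. The norm equivalence of order s'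
  converts the discarded coefficients into the error.\<close>

lemma best_nterm_rate:
 fixes u :: "point => complex"
 assumes u: "u : L2_surface S" and s': "0 <= s'" "s' < min (3 / 2) sS" and t: "0 < t" "t <= 2"
  and sm: "summable (%i. \<Sum>xi\<in>N (j0 + i). (2 powr (s' * real (j0 + i)) * cmod (cf u (j0 + i) xi)) powr t)"
 shows "\<exists>C>0. \<forall>n\<ge>1. best_nterm_error u (primal W ` windices S W) (sobolev_norm S s') n <= ennreal (C * real n powr (- (1 / t - 1 / 2)))"
proof -
 define b where "b i xi = 2 powr (s' * real (j0 + i)) * cmod (cf u (j0 + i) xi)" for i xi
 define ee where "ee = 1 / t - 1 / 2"
 have ee: "0 <= ee" using t by (simp add: ee_def field_simps)
 let ?N0 = "num_generators W"
 have b0: "0 <= b i xi" for i xi by (simp add: b_def)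
 obtain T where T: "T > 0" and th: "!!n. n >= 1 ==> \<exists>\<Lambda>. finite \<Lambda> & \<Lambda> <= Sigma UNIV (%i. N (j0 + i)) & card \<Lambda> < n &
  (\<Sum>i. ennreal (\<Sum>xi\<in>N (j0 + i). if (i, xi) : \<Lambda> then 0 else (b i xi)\<^sup>2)) <= ennreal (T * real n powr (- 2 * (1 / t - 1 / 2)))"
  using threshold[of "%i. N (j0 + i)" b t, OF N_facts(1) b0 t sm[folded b_def]] by auto
 have "\<exists>C1>0. \<exists>C2>0. \<forall>u\<in>L2_surface S. ennreal C1 * wavelet_sobolev_norm S W s' u <= sobolev_norm S s' u &
   sobolev_norm S s' u <= ennreal C2 * wavelet_sobolev_norm S W s' u"
  using basis_facts(9) s' unfolding sobolev_equivalence_def by (elim allE[of _ s']) simp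
 then obtain C2 where C2: "C2 > 0" "!!u. u : L2_surface S ==> sobolev_norm S s' u <= ennreal C2 * wavelet_sobolev_norm S W s' u" by blast
 obtain \<mu>0 where \<mu>0: "\<mu>0 : windices S W" using windices_ne by blast
 define W0 where "W0 = enn2real (Lp_norm M 2 (coarse_projection S W u))"
 have W0: "Lp_norm M 2 (coarse_projection S W u) = ennreal W0" "0 <= W0"
  using coarse_projection_L2[of u] by (auto simp: W0_def L2_surface_def)
 \<comment> \<open>For n below \<open>2 * ?N0 + 2\<close> the zero approximation is used, and the
   last factor compensates n^(-ee).\<close>
 define K1 where "K1 = (W0 + sqrt T) * real (2 * ?N0 + 2) powr ee"
 \<comment> \<open>The square root of the bound from \<open>threshold\<close>, with 2^ee because
   only half of the n terms are guaranteed to wavelets.\<close>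
 define K2 where "K2 = sqrt T * 2 powr ee"
 have KK: "0 <= K1" "0 < K2" using W0 T by (auto simp: K1_def K2_def)
 have approx: "best_nterm_error u (primal W ` windices S W) (sobolev_norm S s') n <= ennreal C2 * (Lp_norm M 2 cp + ennreal (sqrt (T * real l powr (- 2 * ee))))"
  if L: "finite \<Lambda>" "\<Lambda> <= windices S W" "card \<Lambda> <= n"
   and cp: "cp = (%x. \<Sum>l<?N0. (if Generator l : \<Lambda> then 0 else inner_surface S u (dual W (Generator l))) * primal W (Generator l) x)"
   and rest: "(\<Sum>i. ennreal (\<Sum>xi\<in>N (j0 + i). if Wavelet (j0 + i) xi : \<Lambda> then 0 else (b i xi)\<^sup>2)) <= ennreal (T * real l powr (- 2 * ee))"
  for \<Lambda> n cp and l :: nat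
 proof -
  define e where "e x = u x - (\<Sum>\<mu>\<in>\<Lambda>. inner_surface S u (dual W \<mu>) * primal W \<mu> x)" for x
  note r = residual[OF u L(1,2), folded e_def]
  have "best_nterm_error u (primal W ` windices S W) (sobolev_norm S s') n <= sobolev_norm S s' e"
   unfolding e_def[abs_def] by (rule best_nterm_error_le[OF L \<mu>0])
  also have "... <= ennreal C2 * wavelet_sobolev_norm S W s' e" by (rule C2(2)[OF r(1)])
  also have "wavelet_sobolev_norm S W s' e <= Lp_norm M 2 cp + ennreal (sqrt (T * real l powr (- 2 * ee)))"
   unfolding wavelet_sobolev_norm_def
  proof (rule add_mono)
   have "coarse_projection S W e = cp"
    unfolding coarse_projection_def cp by (intro ext sum.cong refl) (simp add: r(2) windices_def)
   thus "Lp_norm M 2 (coarse_projection S W e) <= Lp_norm M 2 cp" by simp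
   have "(\<Sum>i. let j = j0 + i in ennreal (\<Sum>xi\<in>N j. 2 powr (2 * s' * real j) * (cmod (cf e j xi))\<^sup>2))
    = (\<Sum>i. ennreal (\<Sum>xi\<in>N (j0 + i). if Wavelet (j0 + i) xi : \<Lambda> then 0 else (b i xi)\<^sup>2))"
   proof (rule suminf_cong)
    fix i
    have "2 powr (2 * s' * real (j0 + i)) * (cmod (cf e (j0 + i) xi))\<^sup>2 = (if Wavelet (j0 + i) xi : \<Lambda> then 0 else (b i xi)\<^sup>2)"
     if "xi : N (j0 + i)" for xi
    proof -
     have w: "Wavelet (j0 + i) xi : windices S W" by (rule Wavelet_windex) (use that in auto)
     have p: "2 powr (2 * s' * real (j0 + i)) = (2 powr (s' * real (j0 + i)))\<^sup>2"
      unfolding power2_eq_square powr_add[symmetric] by (simp add: algebra_simps)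
     show ?thesis unfolding p coeff_at_def r(2)[OF w] b_def by (simp add: power_mult_distrib coeff_at_def)
    qed
    thus "(let j = j0 + i in ennreal (\<Sum>xi\<in>N j. 2 powr (2 * s' * real j) * (cmod (cf e j xi))\<^sup>2))
     = ennreal (\<Sum>xi\<in>N (j0 + i). if Wavelet (j0 + i) xi : \<Lambda> then 0 else (b i xi)\<^sup>2)" by (simp only: Let_def cong: sum.cong)
   qed
   hence "epowr (\<Sum>i. let j = j0 + i in ennreal (\<Sum>xi\<in>N j. 2 powr (2 * s' * real j) * (cmod (cf e j xi))\<^sup>2)) (1 / 2)
    <= epowr (ennreal (T * real l powr (- 2 * ee))) (1 / 2)" using rest by (intro epowr_mono) auto
   also have "... = ennreal (sqrt (T * real l powr (- 2 * ee)))"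
    using epowr_half_ennreal[of "sqrt (T * real l powr (- 2 * ee))"] T by simp
   finally show "epowr (\<Sum>i. let j = j0 + i in ennreal (\<Sum>xi\<in>N j. 2 powr (2 * s' * real j) * (cmod (cf e j xi))\<^sup>2)) (1 / 2)
    <= ennreal (sqrt (T * real l powr (- 2 * ee)))" .
  qed
  finally show ?thesis by (simp add: mult_left_mono)
 qed
 show ?thesis
 proof (intro exI[of _ "C2 * (K1 + K2)"] conjI allI impI)
  show "0 < C2 * (K1 + K2)" using C2 KK by simp
  fix n :: nat assume n: "1 <= n"
  have "best_nterm_error u (primal W ` windices S W) (sobolev_norm S s') n <= ennreal C2 * ennreal ((K1 + K2) * real n powr (- ee))"
  proof (cases "n < 2 * ?N0 + 2")
   case True
   \<comment> \<open>With budget 1 the set of kept entries is empty, so this is a bound for the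
     whole coefficient sequence.\<close>
   obtain \<Lambda> :: "(nat \<times> point) set" where \<Lambda>: "finite \<Lambda>" "card \<Lambda> < 1"
    "(\<Sum>i. ennreal (\<Sum>xi\<in>N (j0 + i). if (i, xi) : \<Lambda> then 0 else (b i xi)\<^sup>2)) <= ennreal (T * real 1 powr (- 2 * (1 / t - 1 / 2)))"
    using th[of 1] by auto
   have "\<Lambda> = {}" using \<Lambda>(1,2) by simp
   hence rest: "(\<Sum>i. ennreal (\<Sum>xi\<in>N (j0 + i). if Wavelet (j0 + i) xi : {} then 0 else (b i xi)\<^sup>2)) <= ennreal (T * real 1 powr (- 2 * ee))"
    using \<Lambda>(3) by (simp add: ee_def)
   have "best_nterm_error u (primal W ` windices S W) (sobolev_norm S s') n
    <= ennreal C2 * (Lp_norm M 2 (coarse_projection S W u) + ennreal (sqrt (T * real 1 powr (- 2 * ee))))"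
    by (rule approx[OF _ _ _ _ rest]) (auto simp: coarse_projection_def)
   also have "... = ennreal C2 * ennreal (W0 + sqrt T)" unfolding W0(1) using W0(2) T by (simp add: ennreal_plus[symmetric] del: ennreal_plus)
   also have "... <= ennreal C2 * ennreal ((K1 + K2) * real n powr (- ee))"
   proof (intro mult_left_mono ennreal_leI)
    have "1 = (real n powr ee) * real n powr (- ee)" using n by (simp flip: powr_add)
    also have "... <= real (2 * ?N0 + 2) powr ee * real n powr (- ee)"
     using True ee by (intro mult_right_mono powr_mono2) auto
    finally have "(W0 + sqrt T) * 1 <= (W0 + sqrt T) * (real (2 * ?N0 + 2) powr ee * real n powr (- ee))"
     using W0 T by (intro mult_left_mono) auto
    also have "... = K1 * real n powr (- ee)" by (simp add: K1_def)
    also have "... <= (K1 + K2) * real n powr (- ee)" using KK by (intro mult_right_mono) auto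
    finally show "W0 + sqrt T <= (K1 + K2) * real n powr (- ee)" by simp
   qed simp
   finally show ?thesis .
  next
   case False
   \<comment> \<open>From \<open>2 * ?N0 + 2\<close> on at least half of the budget remains after
     the generators.\<close>
   define l where "l = n - ?N0"
   have l: "l >= 1" "n = ?N0 + l" "real n / 2 <= real l" using False by (auto simp: l_def)
   obtain \<Lambda> where \<Lambda>: "finite \<Lambda>" "\<Lambda> <= Sigma UNIV (%i. N (j0 + i))" "card \<Lambda> < l"
    "(\<Sum>i. ennreal (\<Sum>xi\<in>N (j0 + i). if (i, xi) : \<Lambda> then 0 else (b i xi)\<^sup>2)) <= ennreal (T * real l powr (- 2 * ee))"
    using th[OF l(1)] unfolding ee_def by blast
   define \<Lambda>' where "\<Lambda>' = Generator ` {..<?N0} \<union> (%(i, xi). Wavelet (j0 + i) xi) ` \<Lambda>"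
   have mem: "Wavelet (j0 + i) xi : \<Lambda>' \<longleftrightarrow> (i, xi) : \<Lambda>" for i xi by (force simp: \<Lambda>'_def)
   have "best_nterm_error u (primal W ` windices S W) (sobolev_norm S s') n
    <= ennreal C2 * (Lp_norm M 2 (%x. 0 :: complex) + ennreal (sqrt (T * real l powr (- 2 * ee))))"
   proof (rule approx[of \<Lambda>'])
    show "finite \<Lambda>'" using \<Lambda>(1) by (simp add: \<Lambda>'_def)
    show "\<Lambda>' <= windices S W" using \<Lambda>(2) by (auto simp: \<Lambda>'_def windices_def)
    have "card \<Lambda>' <= card (Generator ` {..<?N0}) + card ((%(i, xi). Wavelet (j0 + i) xi) ` \<Lambda>)" unfolding \<Lambda>'_def by (rule card_Un_le)
    also have "... <= card {..<?N0} + card \<Lambda>" by (intro add_mono card_image_le \<Lambda>(1) finite_lessThan)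
    also have "... <= n" using \<Lambda>(3) l(2) by simp
    finally show "card \<Lambda>' <= n" .
    show "(%x. 0) = (%x. \<Sum>l<?N0. (if Generator l : \<Lambda>' then 0 else inner_surface S u (dual W (Generator l))) * primal W (Generator l) x)"
     by (auto simp: \<Lambda>'_def fun_eq_iff intro!: sum.neutral[symmetric])
    show "(\<Sum>i. ennreal (\<Sum>xi\<in>N (j0 + i). if Wavelet (j0 + i) xi : \<Lambda>' then 0 else (b i xi)\<^sup>2)) <= ennreal (T * real l powr (- 2 * ee))"
     unfolding mem by (rule \<Lambda>(4))
   qed
   also have "Lp_norm M 2 (%x. 0 :: complex) = 0" by (simp add: Lp_norm_2 epowr_def)
   also have "ennreal C2 * (0 + ennreal (sqrt (T * real l powr (- 2 * ee)))) <= ennreal C2 * ennreal ((K1 + K2) * real n powr (- ee))"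
    unfolding add_0_left
   proof (intro mult_left_mono ennreal_leI)
    have "real l powr (- 2 * ee) = (real l powr (- ee))\<^sup>2" unfolding power2_eq_square powr_add[symmetric] by simp
    hence "sqrt (T * real l powr (- 2 * ee)) = sqrt T * real l powr (- ee)" using T by (simp add: real_sqrt_mult)
    also have "... <= sqrt T * (real n / 2) powr (- ee)" using T l n ee by (intro mult_left_mono powr_mono2') auto
    also have "... = K2 * real n powr (- ee)" unfolding K2_def powr_divide by (simp add: powr_minus divide_inverse)
    also have "... <= (K1 + K2) * real n powr (- ee)" using KK by (intro mult_right_mono) auto
    finally show "sqrt (T * real l powr (- 2 * ee)) <= (K1 + K2) * real n powr (- ee)" .
   qed simp
   finally show ?thesis .
  qed
  also have "... = ennreal (C2 * (K1 + K2) * real n powr (- (1 / t - 1 / 2)))"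
   using C2(1) KK by (simp add: ennreal_mult[symmetric] ee_def mult.assoc)
  finally show "best_nterm_error u (primal W ` windices S W) (sobolev_norm S s') n <= ennreal (C2 * (K1 + K2) * real n powr (- (1 / t - 1 / 2)))" .
 qed
qed

text \<open>For alpha = 0 the exponent is 2 and square summability holds in
  \<open>L2_surface\<close>; otherwise the bounds for the coefficients meet the hypotheses of
  \<open>summable_Besov\<close>.\<close>

lemma coefficients_summable:
 assumes k: "1 <= k" "k <= m" "k <= d" and rho: "0 < rho" "rho < real k" and uX: "u : X_space S Z k rho"
  and uB: "u : besov_space S W s p (ereal p)" and p: "0 < p" "0 <= s - 2 * (1 / p - 1 / 2)"
  and t: "1 / t = \<alpha> / 2 + 1 / 2" and \<alpha>: "0 <= \<alpha>" "\<alpha> < 2 * min rho (min (real k - rho) (s - (1 / p - 1 / 2)))"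
 shows "summable (%i. \<Sum>xi\<in>N (j0 + i). cmod (cf u (j0 + i) xi) powr t)"
proof (cases "\<alpha> = 0")
 case True
 hence "t = 2" using t by (simp add: field_simps split: if_splits)
 moreover have "u : L2_surface S" using uX by (simp add: X_space_def)
 ultimately show ?thesis using summable_square_coefficients by (simp add: cmod_powr2)
next
 case False
 obtain R B where RB: "1 <= R" "!!j. j >= j0 ==> (\<Sum>xi\<in>{xi : N j. R / 2 ^ j <= del xi}. (wt k rho j xi * cmod (cf u j xi))\<^sup>2) <= B"
  by (rule X_space_coefficients[OF k rho uX], rule that)
 obtain C where C: "C > 0" "!!j eta. j >= j0 ==> 0 <= eta ==> real (card {xi : N j. del xi <= eta}) <= C * 4 ^ j * (eta + 1 / 2 ^ j)"
  by (rule card_strip, rule that)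
 show ?thesis
 proof (rule summable_Besov[where \<delta> = "%j xi. del xi" and N = "nabla S W" and a = "%j xi. cmod (cf u j xi)" and k = "real k" and rho = rho, OF N_facts(1) norm_ge_zero C(2) C(1) RB besov_summable[OF uB p(1)] p(1,2) _ t])
  \<comment> \<open>Equivalent to alpha < 2(s - (1/p - 1/2)), the condition from the third term of
    the minimum.\<close>
  show "1 / t - 1 / p < s - 2 * (1 / p - 1 / 2)" unfolding t using \<alpha> by (simp add: min_def split: if_splits)
 qed (use \<alpha> False in \<open>auto simp: min_def split: if_splits\<close>)
qed

end

theorem theorem5p6:
  fixes S :: surface and m :: nat and Z :: resolution
    and W :: wavelet_system and d :: nat and sS :: real
    and k :: nat and \<rho> s p \<alpha>star :: real
    and Op :: "(real ^ 3 \<Rightarrow> complex) \<Rightarrow> (real ^ 3 \<Rightarrow> complex)"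
    and g u :: "real ^ 3 \<Rightarrow> complex"
  assumes "polyhedral_surface m S"
    and "resolution_of_unity S Z"
    and "wavelet_basis S W d sS"
    and "1 \<le> k" and "k \<le> d" and "k \<le> m"
    and "0 < \<rho>" and "\<rho> < real k"
    and "admissible s p (ereal p)" and "0 < s"
    and "\<forall>x\<in>bd S. Op u x = g x"
    and "u \<in> besov_space S W s p (ereal p) \<inter> X_space S Z k \<rho>"
    and "\<alpha>star = min \<rho> (min (real k - \<rho>) (s - (1 / p - 1 / 2)))"
  shows "(\<forall>\<alpha> \<tau>. 1 / \<tau> = \<alpha> / 2 + 1 / 2 \<and> 0 \<le> \<alpha> \<and> \<alpha> < 2 * \<alpha>star \<longrightarrow>
            u \<in> besov_space S W \<alpha> \<tau> (ereal \<tau>)) \<and>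
         (\<forall>s'. 0 \<le> s' \<and> s' < min (3 / 2) sS \<and> s - s' \<ge> 2 * (1 / p - 1 / 2) \<longrightarrow>
            (let \<Theta> = 1 - s' / (s - 2 * (1 / p - 1 / 2));
                 \<gamma>star = s - s' + \<Theta> * (2 * \<alpha>star - s)
             in 0 \<le> \<Theta> \<and> \<Theta> \<le> 1 \<and> 0 \<le> \<gamma>star \<and>
                (\<forall>\<gamma><\<gamma>star. \<exists>C>0. \<forall>n\<ge>1.
                   best_nterm_error u (primal W ` windices S W) (sobolev_norm S s') n
                     \<le> ennreal (C * real n powr (- \<gamma> / 2)))))"
proof -
 interpret wavelet_surface m S Z W d sS by unfold_locales (use assms in auto)
 have uB: "u : besov_space S W s p (ereal p)" and uX: "u : X_space S Z k \<rho>" using assms(12) by auto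
 have uL: "u : L2_surface S" using uX by (simp add: X_space_def)
 have ip: "1 / 2 <= 1 / p" "1 / p <= s / 2 + 1 / 2" using assms(9) by (auto simp: admissible_def)
 have "0 < 1 / p" using ip by linarith
 hence p: "0 < p" by simp
 define s0 where "s0 = s - 2 * (1 / p - 1 / 2)"
 have s0: "0 <= s0" "s0 <= s" using ip by (auto simp: s0_def field_simps)
 have as: "0 < \<alpha>star" using assms(7,8,10) ip unfolding assms(13) by (auto simp: min_def field_simps)
 have cs: "summable (%i. \<Sum>xi\<in>N (j0 + i). cmod (cf u (j0 + i) xi) powr \<tau>)"
  if "1 / \<tau> = \<alpha> / 2 + 1 / 2" "0 <= \<alpha>" "\<alpha> < 2 * \<alpha>star" for \<alpha> \<tau>
  by (rule coefficients_summable[OF assms(4,6,5,7,8) uX uB p s0(1)[unfolded s0_def] that(1,2) that(3)[unfolded assms(13)]])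
 show ?thesis
 proof (intro conjI allI impI)
  fix \<alpha> \<tau> assume t: "1 / \<tau> = \<alpha> / 2 + 1 / 2 & 0 <= \<alpha> & \<alpha> < 2 * \<alpha>star"
  thus "u : besov_space S W \<alpha> \<tau> (ereal \<tau>)" by (intro besov_memI[OF uL] cs) auto
 next
  fix s' assume s': "0 <= s' & s' < min (3 / 2) sS & 2 * (1 / p - 1 / 2) <= s - s'"
  \<comment> \<open>If \<open>s0\<close> is 0 then so is \<open>s'\<close>, and 0 / 0 = 0 makes
    \<Theta> equal to 1.\<close>
  define \<Theta> where "\<Theta> = 1 - s' / s0"
  define \<gamma>s where "\<gamma>s = s - s' + \<Theta> * (2 * \<alpha>star - s)"
  have ss: "s' <= s0" using s' by (simp add: s0_def)
  have \<Theta>: "0 <= \<Theta>" "\<Theta> <= 1" using s' s0 ss by (auto simp: \<Theta>_def divide_le_eq_1)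
  have s'eq: "s' = (1 - \<Theta>) * s0" using s' ss by (auto simp: \<Theta>_def)
  \<comment> \<open>A convex combination of \<open>2 * \<alpha>star\<close> and
    \<open>2 / p - 1\<close>, the rates at the two ends of the interpolation; both are
    nonnegative.\<close>
  have \<gamma>s: "\<gamma>s = 2 * (\<Theta> * \<alpha>star) + (1 - \<Theta>) * (2 / p - 1)"
   unfolding \<gamma>s_def s'eq s0_def by (simp add: algebra_simps)
  have ip2: "0 <= 2 / p - 1" using ip by simp
  have \<gamma>0: "0 <= \<gamma>s" unfolding \<gamma>s using \<Theta> as ip2 by (intro add_nonneg_nonneg mult_nonneg_nonneg) auto
  have rate: "\<exists>C>0. \<forall>n\<ge>1. best_nterm_error u (primal W ` windices S W) (sobolev_norm S s') n <= ennreal (C * real n powr (- \<gamma> / 2))"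
   if \<gamma>: "\<gamma> < \<gamma>s" for \<gamma>
  proof -
   \<comment> \<open>Slightly below \<open>2 * \<alpha>star\<close>, so that the loss is at most the
     gap between \<gamma> and its bound; the maximum keeps \<alpha> nonnegative when \<gamma> is
     small.\<close>
   define \<alpha> where "\<alpha> = max 0 (2 * \<alpha>star - (\<gamma>s - \<gamma>))"
   have \<alpha>: "0 <= \<alpha>" "\<alpha> < 2 * \<alpha>star" "2 * \<alpha>star - \<alpha> <= \<gamma>s - \<gamma>" using \<gamma> as by (auto simp: \<alpha>_def)
   define \<tau> where "\<tau> = 2 / (\<alpha> + 1)"
   have \<tau>: "1 / \<tau> = \<alpha> / 2 + 1 / 2" "0 < \<tau>" using \<alpha> by (auto simp: \<tau>_def field_simps)
   \<comment> \<open>The exponent between \<tau> and \<open>p\<close> that belongs to the smoothness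
     \<open>s' = (1 - \<Theta>) * s0\<close> between 0 and \<open>s0\<close>.\<close>
   define t where "t = 1 / (\<Theta> / \<tau> + (1 - \<Theta>) / p)"
   have "\<Theta> / \<tau> + (1 - \<Theta>) / p = \<Theta> * (1 / \<tau>) + (1 - \<Theta>) * (1 / p)" by simp
   also have "... = 1 / 2 + \<Theta> * \<alpha> / 2 + (1 - \<Theta>) * (2 / p - 1) / 2" unfolding \<tau>(1) by (simp add: field_simps)
   finally have it: "1 / t = 1 / 2 + \<Theta> * \<alpha> / 2 + (1 - \<Theta>) * (2 / p - 1) / 2" by (simp add: t_def)
   have nn: "0 <= \<Theta> * \<alpha>" "0 <= (1 - \<Theta>) * (2 / p - 1)" using \<Theta> \<alpha> ip2 by (auto intro!: mult_nonneg_nonneg)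
   have "1 / 2 <= 1 / t" unfolding it by (intro add_increasing2 divide_nonneg_pos nn order_refl) auto
   hence t: "0 < t" "t <= 2"
   proof -
    have "0 < 1 / t" using \<open>1 / 2 \<le> 1 / t\<close> by linarith
    thus "0 < t" by simp
    thus "t <= 2" using \<open>1 / 2 \<le> 1 / t\<close> by (simp add: field_simps)
   qed
   have sm: "summable (%i. \<Sum>xi\<in>N (j0 + i). (2 powr (s' * real (j0 + i)) * cmod (cf u (j0 + i) xi)) powr t)"
    by (rule summable_interpolate[OF norm_ge_zero \<Theta> s'eq \<tau>(2) p t(1) _ cs[OF \<tau>(1) \<alpha>(1,2)] besov_summable[OF uB p, folded s0_def]])
     (simp add: t_def)
   obtain C where C: "C > 0" "!!n. n >= 1 ==> best_nterm_error u (primal W ` windices S W) (sobolev_norm S s') n <= ennreal (C * real n powr (- (1 / t - 1 / 2)))"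
    using best_nterm_rate[OF uL _ _ t sm] s' by auto
   have "\<Theta> * (2 * \<alpha>star - \<alpha>) <= 1 * (2 * \<alpha>star - \<alpha>)" using \<Theta> \<alpha> by (intro mult_right_mono) auto
   hence 1: "2 * (\<Theta> * \<alpha>star) - \<Theta> * \<alpha> <= \<gamma>s - \<gamma>" using \<alpha>(3) by (simp add: right_diff_distrib mult.left_commute)
   have 2: "g / 2 <= I - 1 / 2" if "2 * A - X <= G - g" "G = 2 * A + Y" "I = 1 / 2 + X / 2 + Y / 2" for A X Y G I g :: real
    using that by linarith
   from 2[OF 1 \<gamma>s it] have "\<gamma> / 2 <= 1 / t - 1 / 2" .
   hence "C * real n powr (- (1 / t - 1 / 2)) <= C * real n powr (- \<gamma> / 2)" if "n >= 1" for n
    using C(1) that by (intro mult_left_mono powr_mono) auto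
   thus ?thesis using C by (intro exI[of _ C]) (meson ennreal_leI order_trans)
  qed
  show "let \<Theta> = 1 - s' / (s - 2 * (1 / p - 1 / 2)); \<gamma>star = s - s' + \<Theta> * (2 * \<alpha>star - s)
   in 0 <= \<Theta> & \<Theta> <= 1 & 0 <= \<gamma>star &
     (\<forall>\<gamma><\<gamma>star. \<exists>C>0. \<forall>n\<ge>1. best_nterm_error u (primal W ` windices S W) (sobolev_norm S s') n <= ennreal (C * real n powr (- \<gamma> / 2)))"
   unfolding Let_def s0_def[symmetric] \<Theta>_def[symmetric] \<gamma>s_def[symmetric] using \<Theta> \<gamma>0 rate by blast
 qed
qed

end
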